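(* Let $K$ be an algebraically closed field of characteristic $0$. Then the two-sorted structure $(K,\operatorname{Fin}(K))$ and the poset $\operatorname{Var}(K)$ are bi-interpretable (with parameters).
   Context: $(K,\operatorname{Fin}(K))$ is the two-sorted first-order structure consisting of the field $K$ (in the language of rings), a second sort $\operatorname{Fin}(K)$ whose elements are the finite subsets of $K$, and the membership relation $\in$ between $K$ and $\operatorname{Fin}(K)$. $\operatorname{Var}(K)$ is the poset, ordered by inclusion, of all irreducible Zariski closed proper subsets of the projective plane $\mathbb P^2(K)$, i.e. points and irreducible curves. "Definable" means first-order definable with parameters. For a structure $\mathcal A$, $\mathcal A^{eq}$ is Shelah's expansion of $\mathcal A$, which has a new sort $X/E$, with its projection map $X\to X/E$, for each $\emptyset$-definable equivalence relation $E$ on a finite product $X$ of sorts. A structure $\mathcal B$ (possibly in another language) is interpretable in $\mathcal A$ if $\mathcal B$ is isomorphic to a structure definable in $\mathcal A^{eq}$. If $\mathcal A$ and $\mathcal B$ are interpretable in each other, composing the interpretations gives a structure $\mathcal A'\cong\mathcal A$ definable in $\mathcal A^{eq}$ and a structure $\mathcal B'\cong\mathcal B$ definable in $\mathcal B^{eq}$. $\mathcal A$ and $\mathcal B$ are bi-interpretable if the mutual interpretations can be chosen so that the isomorphism $\mathcal A'\cong\mathcal A$ is definable in $\mathcal A^{eq}$ and the isomorphism $\mathcal B'\cong\mathcal B$ is definable in $\mathcal B^{eq}$. *)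

theory Defs
  imports "HOL-Analysis.Analysis" "HOL-Computational_Algebra.Polynomial"
begin

section \<open>Many-sorted first-order structures\<close>

text \<open>
  The language (sorts, function symbols, relation symbols and their types) is part of the record.
  Carriers of different sorts may overlap as sets; only well-sorted formulas are ever considered,
  so this is harmless.
\<close>

record ('s, 'f, 'r, 'a) fo_structure =
  sorts   :: "'s set"
  funs    :: "'f set"
  fdom    :: "'f \<Rightarrow> 's list"
  fcod    :: "'f \<Rightarrow> 's"
  rels    :: "'r set"
  rdom    :: "'r \<Rightarrow> 's list"
  carrier :: "'s \<Rightarrow> 'a set"
  funI    :: "'f \<Rightarrow> 'a list \<Rightarrow> 'a"
  relI    :: "'r \<Rightarrow> 'a list set"

definition tuples :: "('s, 'f, 'r, 'a) fo_structure \<Rightarrow> 's list \<Rightarrow> 'a list set" where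
  "tuples A ss = {xs. list_all2 (\<lambda>x s. x \<in> carrier A s) xs ss}"

definition wf_structure :: "('s, 'f, 'r, 'a) fo_structure \<Rightarrow> bool" where
  "wf_structure A \<longleftrightarrow>
     (\<forall>f \<in> funs A. set (fdom A f) \<subseteq> sorts A \<and> fcod A f \<in> sorts A \<and>
        (\<forall>xs \<in> tuples A (fdom A f). funI A f xs \<in> carrier A (fcod A f))) \<and>
     (\<forall>r \<in> rels A. set (rdom A r) \<subseteq> sorts A \<and> relI A r \<subseteq> tuples A (rdom A r))"

definition fo_iso ::
  "('s \<Rightarrow> 'a \<Rightarrow> 'b) \<Rightarrow> ('s, 'f, 'r, 'a) fo_structure \<Rightarrow> ('s, 'f, 'r, 'b) fo_structure \<Rightarrow> bool" where
  "fo_iso h A B \<longleftrightarrow>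
     sorts A = sorts B \<and> funs A = funs B \<and> rels A = rels B \<and>
     (\<forall>f \<in> funs A. fdom A f = fdom B f \<and> fcod A f = fcod B f) \<and>
     (\<forall>r \<in> rels A. rdom A r = rdom B r) \<and>
     (\<forall>s \<in> sorts A. bij_betw (h s) (carrier A s) (carrier B s)) \<and>
     (\<forall>f \<in> funs A. \<forall>xs \<in> tuples A (fdom A f).
        h (fcod A f) (funI A f xs) = funI B f (map2 h (fdom A f) xs)) \<and>
     (\<forall>r \<in> rels A. \<forall>xs \<in> tuples A (rdom A r).
        xs \<in> relI A r \<longleftrightarrow> map2 h (rdom A r) xs \<in> relI B r)"


section \<open>Formulas and definable sets\<close>

datatype ('s, 'f) fo_term = Var 's nat | App 'f "('s, 'f) fo_term list"

datatype ('s, 'f, 'r) fo_formula =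
    Fls
  | Equal "('s, 'f) fo_term" "('s, 'f) fo_term"
  | Rel 'r "('s, 'f) fo_term list"
  | Neg "('s, 'f, 'r) fo_formula"
  | Conj "('s, 'f, 'r) fo_formula" "('s, 'f, 'r) fo_formula"
  | Exi 's nat "('s, 'f, 'r) fo_formula"

fun term_sort :: "('s, 'f, 'r, 'a) fo_structure \<Rightarrow> ('s, 'f) fo_term \<Rightarrow> 's" where
  "term_sort A (Var s i) = s"
| "term_sort A (App f ts) = fcod A f"

fun wf_term :: "('s, 'f, 'r, 'a) fo_structure \<Rightarrow> ('s, 'f) fo_term \<Rightarrow> bool" where
  "wf_term A (Var s i) \<longleftrightarrow> s \<in> sorts A"
| "wf_term A (App f ts) \<longleftrightarrow>
     f \<in> funs A \<and> (\<forall>t \<in> set ts. wf_term A t) \<and> map (term_sort A) ts = fdom A f"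

fun wf_formula :: "('s, 'f, 'r, 'a) fo_structure \<Rightarrow> ('s, 'f, 'r) fo_formula \<Rightarrow> bool" where
  "wf_formula A Fls \<longleftrightarrow> True"
| "wf_formula A (Equal t u) \<longleftrightarrow> wf_term A t \<and> wf_term A u \<and> term_sort A t = term_sort A u"
| "wf_formula A (Rel r ts) \<longleftrightarrow>
     r \<in> rels A \<and> (\<forall>t \<in> set ts. wf_term A t) \<and> map (term_sort A) ts = rdom A r"
| "wf_formula A (Neg p) \<longleftrightarrow> wf_formula A p"
| "wf_formula A (Conj p q) \<longleftrightarrow> wf_formula A p \<and> wf_formula A q"
| "wf_formula A (Exi s i p) \<longleftrightarrow> s \<in> sorts A \<and> wf_formula A p"

fun term_vars :: "('s, 'f) fo_term \<Rightarrow> ('s \<times> nat) set" where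
  "term_vars (Var s i) = {(s, i)}"
| "term_vars (App f ts) = (\<Union>t \<in> set ts. term_vars t)"

fun free_vars :: "('s, 'f, 'r) fo_formula \<Rightarrow> ('s \<times> nat) set" where
  "free_vars Fls = {}"
| "free_vars (Equal t u) = term_vars t \<union> term_vars u"
| "free_vars (Rel r ts) = (\<Union>t \<in> set ts. term_vars t)"
| "free_vars (Neg p) = free_vars p"
| "free_vars (Conj p q) = free_vars p \<union> free_vars q"
| "free_vars (Exi s i p) = free_vars p - {(s, i)}"

fun term_val :: "('s, 'f, 'r, 'a) fo_structure \<Rightarrow> ('s \<times> nat \<Rightarrow> 'a) \<Rightarrow> ('s, 'f) fo_term \<Rightarrow> 'a" where
  "term_val A e (Var s i) = e (s, i)"
| "term_val A e (App f ts) = funI A f (map (term_val A e) ts)"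

fun sat :: "('s, 'f, 'r, 'a) fo_structure \<Rightarrow> ('s \<times> nat \<Rightarrow> 'a) \<Rightarrow> ('s, 'f, 'r) fo_formula \<Rightarrow> bool" where
  "sat A e Fls \<longleftrightarrow> False"
| "sat A e (Equal t u) \<longleftrightarrow> term_val A e t = term_val A e u"
| "sat A e (Rel r ts) \<longleftrightarrow> map (term_val A e) ts \<in> relI A r"
| "sat A e (Neg p) \<longleftrightarrow> \<not> sat A e p"
| "sat A e (Conj p q) \<longleftrightarrow> sat A e p \<and> sat A e q"
| "sat A e (Exi s i p) \<longleftrightarrow> (\<exists>x \<in> carrier A s. sat A (e((s, i) := x)) p)"

text \<open>
  In a formula defining a set of tuples of type \<open>ss\<close>, the variables \<open>(ss ! i, i)\<close> with
  \<open>i < length ss\<close> stand for the coordinates; all other free variables stand for parameters,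
  whose values are given by the assignment \<open>e\<close> and have to lie in \<open>P\<close>.
\<close>

definition coord_vars :: "'s list \<Rightarrow> ('s \<times> nat) set" where
  "coord_vars ss = {(ss ! i, i) | i. i < length ss}"

definition definable_over ::
  "('s, 'f, 'r, 'a) fo_structure \<Rightarrow> ('s \<Rightarrow> 'a set) \<Rightarrow> 's list \<Rightarrow> 'a list set \<Rightarrow> bool" where
  "definable_over A P ss D \<longleftrightarrow> set ss \<subseteq> sorts A \<and>
     (\<exists>\<phi> e. wf_formula A \<phi> \<and>
        (\<forall>(s, i) \<in> free_vars \<phi> - coord_vars ss. e (s, i) \<in> carrier A s \<inter> P s) \<and>
        D = {xs \<in> tuples A ss.
               sat A (\<lambda>(s, i). if (s, i) \<in> coord_vars ss then xs ! i else e (s, i)) \<phi>})"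

abbreviation definable :: "('s, 'f, 'r, 'a) fo_structure \<Rightarrow> 's list \<Rightarrow> 'a list set \<Rightarrow> bool" where
  "definable A \<equiv> definable_over A (carrier A)"

abbreviation zero_definable :: "('s, 'f, 'r, 'a) fo_structure \<Rightarrow> 's list \<Rightarrow> 'a list set \<Rightarrow> bool" where
  "zero_definable A \<equiv> definable_over A (\<lambda>_. {})"


section \<open>Shelah's expansion by imaginaries\<close>

datatype ('s, 'a) eq_sort = Home 's | Quot "'s list" "('a list \<times> 'a list) set"
datatype ('s, 'f, 'a) eq_fun = Old 'f | Proj "'s list" "('a list \<times> 'a list) set"
datatype 'a eq_elem = Elem (the_Elem: 'a) | Class "'a list set"

definition zero_def_equiv ::
  "('s, 'f, 'r, 'a) fo_structure \<Rightarrow> 's list \<Rightarrow> ('a list \<times> 'a list) set \<Rightarrow> bool" where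
  "zero_def_equiv A ss E \<longleftrightarrow> set ss \<subseteq> sorts A \<and> equiv (tuples A ss) E \<and>
     zero_definable A (ss @ ss) {xs @ ys | xs ys. (xs, ys) \<in> E}"

definition eq_structure ::
  "('s, 'f, 'r, 'a) fo_structure \<Rightarrow> (('s, 'a) eq_sort, ('s, 'f, 'a) eq_fun, 'r, 'a eq_elem) fo_structure" where
  "eq_structure A = \<lparr>
     sorts = Home ` sorts A \<union> {Quot ss E | ss E. zero_def_equiv A ss E},
     funs = Old ` funs A \<union> {Proj ss E | ss E. zero_def_equiv A ss E},
     fdom = (\<lambda>F. case F of Old f \<Rightarrow> map Home (fdom A f) | Proj ss E \<Rightarrow> map Home ss),
     fcod = (\<lambda>F. case F of Old f \<Rightarrow> Home (fcod A f) | Proj ss E \<Rightarrow> Quot ss E),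
     rels = rels A,
     rdom = (\<lambda>r. map Home (rdom A r)),
     carrier = (\<lambda>S. case S of Home s \<Rightarrow> Elem ` carrier A s
                  | Quot ss E \<Rightarrow> Class ` (tuples A ss // E)),
     funI = (\<lambda>F xs. case F of Old f \<Rightarrow> Elem (funI A f (map the_Elem xs))
                  | Proj ss E \<Rightarrow> Class (E `` {map the_Elem xs})),
     relI = (\<lambda>r. map Elem ` relI A r) \<rparr>"


section \<open>Interpretations and bi-interpretability\<close>

text \<open>
  \<open>C\<close> is a structure definable in \<open>A\<close>: the sort \<open>s\<close> of \<open>C\<close> is a definable
  set of tuples of type \<open>\<alpha> s\<close>. Tuples of such tuples are concatenated; this is injective,
  the lengths being determined by \<open>\<alpha>\<close>.
\<close>

definition definable_structure ::
  "('s, 'f, 'r, 'a) fo_structure \<Rightarrow> ('t \<Rightarrow> 's list) \<Rightarrow> ('t, 'g, 'q, 'a list) fo_structure \<Rightarrow> bool" where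
  "definable_structure A \<alpha> C \<longleftrightarrow> wf_structure C \<and>
     (\<forall>s \<in> sorts C. definable A (\<alpha> s) (carrier C s)) \<and>
     (\<forall>f \<in> funs C. definable A (concat (map \<alpha> (fdom C f)) @ \<alpha> (fcod C f))
                      {concat xs @ funI C f xs | xs. xs \<in> tuples C (fdom C f)}) \<and>
     (\<forall>r \<in> rels C. definable A (concat (map \<alpha> (rdom C r))) (concat ` relI C r))"

text \<open>
  \<open>(\<alpha>, C, g)\<close> is an interpretation of \<open>B\<close> in \<open>A\<close>; such a triple
  exists iff \<open>B\<close> is interpretable in \<open>A\<close>.
\<close>

definition interprets ::
  "('s, 'f, 'r, 'a) fo_structure \<Rightarrow> ('t, 'g, 'q, 'b) fo_structure \<Rightarrow> ('t \<Rightarrow> ('s, 'a) eq_sort list) \<Rightarrow>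
   ('t, 'g, 'q, 'a eq_elem list) fo_structure \<Rightarrow> ('t \<Rightarrow> 'b \<Rightarrow> 'a eq_elem list) \<Rightarrow> bool" where
  "interprets A B \<alpha> C g \<longleftrightarrow> definable_structure (eq_structure A) \<alpha> C \<and> fo_iso g B C"

text \<open>
  An interpretation \<open>(\<alpha>, C, g)\<close> of \<open>B\<close> in \<open>A\<close> extends to an interpretation of
  \<open>eq_structure B\<close> in \<open>A\<close>. The extension is needed to compose interpretations, and it is
  unique up to isomorphisms definable (sort by sort) in \<open>eq_structure A\<close>, because it
  interprets the projection maps.
\<close>

definition extends_interp ::
  "('t, 'g, 'q, 'b) fo_structure \<Rightarrow>
   (('t, 'b) eq_sort \<Rightarrow> 'u list) \<Rightarrow> (('t, 'b) eq_sort \<Rightarrow> 'b eq_elem \<Rightarrow> 'x list) \<Rightarrow>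
   ('t \<Rightarrow> 'u list) \<Rightarrow> ('t \<Rightarrow> 'b \<Rightarrow> 'x list) \<Rightarrow> bool" where
  "extends_interp B \<alpha>' g' \<alpha> g \<longleftrightarrow>
     (\<forall>s \<in> sorts B. \<alpha>' (Home s) = \<alpha> s \<and> (\<forall>b \<in> carrier B s. g' (Home s) (Elem b) = g s b))"

text \<open>
  Let \<open>(\<beta>, D, f)\<close> interpret \<open>A\<close> in \<open>B\<close>, and let \<open>(\<alpha>', C', g')\<close>
  interpret \<open>eq_structure B\<close> in \<open>A\<close>. The composed interpretation of \<open>A\<close> in itself
  sends \<open>a\<close> of sort \<open>s\<close> to the tuple obtained by applying \<open>g'\<close> to every coordinate of
  the tuple \<open>f s a\<close>.
\<close>

definition comp_type :: "('u \<Rightarrow> 'v list) \<Rightarrow> ('s \<Rightarrow> 'u list) \<Rightarrow> 's \<Rightarrow> 'v list" where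
  "comp_type \<alpha>' \<beta> s = concat (map \<alpha>' (\<beta> s))"

definition comp_map ::
  "('u \<Rightarrow> 'x \<Rightarrow> 'y list) \<Rightarrow> ('s \<Rightarrow> 'u list) \<Rightarrow> ('s \<Rightarrow> 'a \<Rightarrow> 'x list) \<Rightarrow> 's \<Rightarrow> 'a \<Rightarrow> 'y list" where
  "comp_map g' \<beta> f s a = concat (map2 g' (\<beta> s) (f s a))"

definition definable_self_iso ::
  "('s, 'f, 'r, 'a) fo_structure \<Rightarrow> ('s \<Rightarrow> ('s, 'a) eq_sort list) \<Rightarrow> ('s \<Rightarrow> 'a \<Rightarrow> 'a eq_elem list) \<Rightarrow> bool" where
  "definable_self_iso A \<gamma> h \<longleftrightarrow>
     (\<forall>s \<in> sorts A. definable (eq_structure A) (Home s # \<gamma> s) {Elem a # h s a | a. a \<in> carrier A s})"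

definition bi_interpretable ::
  "('s, 'f, 'r, 'a) fo_structure \<Rightarrow> ('t, 'g, 'q, 'b) fo_structure \<Rightarrow> bool" where
  "bi_interpretable A B \<longleftrightarrow>
     (\<exists>\<alpha> C g \<beta> D f \<alpha>' C' g' \<beta>' D' f' A' B'.
        interprets A B \<alpha> C g \<and> interprets B A \<beta> D f \<and>
        interprets A (eq_structure B) \<alpha>' C' g' \<and> extends_interp B \<alpha>' g' \<alpha> g \<and>
        interprets B (eq_structure A) \<beta>' D' f' \<and> extends_interp A \<beta>' f' \<beta> f \<and>
        interprets A A (comp_type \<alpha>' \<beta>) A' (comp_map g' \<beta> f) \<and>
        definable_self_iso A (comp_type \<alpha>' \<beta>) (comp_map g' \<beta> f) \<and>
        interprets B B (comp_type \<beta>' \<alpha>) B' (comp_map f' \<alpha> g) \<and>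
        definable_self_iso B (comp_type \<beta>' \<alpha>) (comp_map f' \<alpha> g))"


section \<open>The field with its finite subsets\<close>

datatype fin_sort = Field_Sort | Fin_Sort
datatype ring_fun = Zero | One | Plus | Minus | Times
datatype fin_rel = Member
datatype 'k fin_elem = Scalar (the_Scalar: 'k) | FinSet (the_FinSet: "'k set")

fun ring_fun_val :: "ring_fun \<Rightarrow> 'k::field list \<Rightarrow> 'k" where
  "ring_fun_val Zero [] = 0"
| "ring_fun_val One [] = 1"
| "ring_fun_val Plus [x, y] = x + y"
| "ring_fun_val Minus [x] = - x"
| "ring_fun_val Times [x, y] = x * y"
| "ring_fun_val _ _ = undefined"

definition Fin_structure ::
  "'k::field itself \<Rightarrow> (fin_sort, ring_fun, fin_rel, 'k fin_elem) fo_structure" where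
  "Fin_structure _ = \<lparr>
     sorts = UNIV,
     funs = UNIV,
     fdom = (\<lambda>F. case F of Zero \<Rightarrow> [] | One \<Rightarrow> [] | Plus \<Rightarrow> [Field_Sort, Field_Sort]
               | Minus \<Rightarrow> [Field_Sort] | Times \<Rightarrow> [Field_Sort, Field_Sort]),
     fcod = (\<lambda>_. Field_Sort),
     rels = UNIV,
     rdom = (\<lambda>_. [Field_Sort, Fin_Sort]),
     carrier = (\<lambda>s. case s of Field_Sort \<Rightarrow> range Scalar | Fin_Sort \<Rightarrow> {FinSet X | X. finite X}),
     funI = (\<lambda>F xs. Scalar (ring_fun_val F (map the_Scalar xs))),
     relI = (\<lambda>_. {[Scalar x, FinSet X] | x X. finite X \<and> x \<in> X}) \<rparr>"


section \<open>The poset of proper irreducible closed subsets of the projective plane\<close>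

definition proportional :: "(('k::field ^ 3) \<times> ('k ^ 3)) set" where
  "proportional = {(u, v). u \<noteq> 0 \<and> v \<noteq> 0 \<and> (\<exists>c. v = c *s u)}"

definition proj_plane :: "('k::field ^ 3) set set" where
  "proj_plane = (UNIV - {0}) // proportional"

text \<open>The ternary form of degree \<open>d\<close> with \<open>c i j\<close> the coefficient of
  \<open>X\<^sup>i Y\<^sup>j Z\<^bsup>d-i-j\<^esup>\<close>.\<close>

definition form_val :: "nat \<Rightarrow> (nat \<Rightarrow> nat \<Rightarrow> 'k) \<Rightarrow> 'k::field ^ 3 \<Rightarrow> 'k" where
  "form_val d c v = (\<Sum>(i, j) \<in> {(i, j). i + j \<le> d}. c i j * (v $ 1) ^ i * (v $ 2) ^ j * (v $ 3) ^ (d - i - j))"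

definition zariski_closed :: "('k::field ^ 3) set set \<Rightarrow> bool" where
  "zariski_closed Z \<longleftrightarrow>
     (\<exists>S. Z = {p \<in> proj_plane. \<forall>(d, c) \<in> S. \<forall>v \<in> p. form_val d c v = 0})"

definition irreducible_closed :: "('k::field ^ 3) set set \<Rightarrow> bool" where
  "irreducible_closed Z \<longleftrightarrow> zariski_closed Z \<and> Z \<noteq> {} \<and>
     (\<forall>V W. zariski_closed V \<and> zariski_closed W \<and> Z = V \<union> W \<longrightarrow> V = Z \<or> W = Z)"

datatype poset_rel = Leq

definition Var_structure ::
  "'k::field itself \<Rightarrow> (unit, unit, poset_rel, ('k ^ 3) set set) fo_structure" where
  "Var_structure _ = (let V = {Z. irreducible_closed Z \<and> Z \<noteq> proj_plane} in \<lparr>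
     sorts = UNIV,
     funs = {},
     fdom = (\<lambda>_. []),
     fcod = (\<lambda>_. ()),
     rels = UNIV,
     rdom = (\<lambda>_. [(), ()]),
     carrier = (\<lambda>_. V),
     funI = (\<lambda>_ _. undefined),
     relI = (\<lambda>_. {[Z, W] | Z W. Z \<in> V \<and> W \<in> V \<and> Z \<subseteq> W}) \<rparr>)"

end

theory Submission
  imports Defs
begin

text \<open>
  A line other than the line \<open>L\<close> at infinity is recognised in the poset as a curve \<open>D\<close> with a single
  point on \<open>L\<close> such that each point of \<open>D\<close> off \<open>L\<close> is all of the intersection of \<open>D\<close> with each of two
  curves that meet \<open>L\<close> in one further point each, and these points differ. The equations of the two curves then
  have the same single zero on \<open>D\<close>, so modulo the equation of \<open>D\<close> they are proportional (after raising them to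
  a common degree), and comparing leading forms shows that \<open>D\<close> has degree one. Lines give the field structure on
  an axis by the usual incidence constructions, and a finite subset of the axis is its intersection with an
  irreducible curve.

  Conversely, a generic linear combination of the coordinates codes finite relations on \<open>K\<close> by finite subsets of
  \<open>K\<close>, and a finite relation can be read as a program that evaluates polynomials, a run being again a finite
  relation. The zero sets of programs are closed and include all curves, so irreducibility is
  expressible by quantifying over codes. Since the quotient of a definable set by a definable equivalence relation
  with parameters embeds in an imaginary sort, it suffices to work with definable surjections from tuples onto the sorts.
\<close>

section \<open>Definable predicates\<close>

text \<open>Inclusion shows neither degrees nor multiplicities, so the test for lines has to force
  degree one by set-theoretic incidence alone. The two different points at infinity of the auxiliary
  curves supply the contradiction: if the leading form of D is X^e, the proportionality modulo D
  makes a constant multiple of (1 - b1 X)^N agree with one of (1 - b2 X)^N modulo X^e, and for e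
  \<ge> 2 the constant and linear terms give b1 = b2; characteristic 0 enters through the factor N.
  The test is demanded at all affine points of D because the order singles out no good one; it is
  applied where the projection to y is unramified, so that y - c is a local parameter. In the other
  direction the degrees are unbounded, so no fixed tuple of coefficients codes all curves; this is
  why finite sets have to carry whole programs. A formal obstacle remains: the definition of
  bi-interpretability composes injections into imaginary sorts, whereas the natural maps are
  surjections from tuples. The criterion \<open>bi_interpretableI\<close> reduces it to the
  definability of the graphs of the two composed surjections.\<close>

definition wt :: "('s, 'f, 'r, 'a) fo_structure => 's list => (nat => 'a) => bool" where
  "wt A \<Gamma> e \<longleftrightarrow> (\<forall>i<length \<Gamma>. e i \<in> carrier A (\<Gamma> ! i))"

text \<open>Contexts are de Bruijn: the quantifier rule prepends a sort, and \<open>e (Suc n)\<close> is the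
  old variable \<open>n\<close>.\<close>

inductive dfn :: "('s, 'f, 'r, 'a) fo_structure => ('s => 'a set) => 's list => ((nat => 'a) => bool) => bool"
  for A P where
  dfn_False: "dfn A P \<Gamma> (\<lambda>e. False)"
| dfn_eq: "i < length \<Gamma> ==> j < length \<Gamma> ==> \<Gamma> ! i = \<Gamma> ! j ==> dfn A P \<Gamma> (\<lambda>e. e i = e j)"
| dfn_const: "i < length \<Gamma> ==> c \<in> carrier A (\<Gamma> ! i) ==> c \<in> P (\<Gamma> ! i) ==> dfn A P \<Gamma> (\<lambda>e. e i = c)"
| dfn_rel: "r \<in> rels A ==> \<forall>i\<in>set is. i < length \<Gamma> ==> map ((!) \<Gamma>) is = rdom A r ==>
    dfn A P \<Gamma> (\<lambda>e. map e is \<in> relI A r)"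
| dfn_fun: "f \<in> funs A ==> \<forall>i\<in>set is. i < length \<Gamma> ==> map ((!) \<Gamma>) is = fdom A f ==>
    j < length \<Gamma> ==> \<Gamma> ! j = fcod A f ==> dfn A P \<Gamma> (\<lambda>e. e j = funI A f (map e is))"
| dfn_neg: "dfn A P \<Gamma> Q ==> dfn A P \<Gamma> (\<lambda>e. \<not> Q e)"
| dfn_conj: "dfn A P \<Gamma> Q ==> dfn A P \<Gamma> R ==> dfn A P \<Gamma> (\<lambda>e. Q e \<and> R e)"
| dfn_ex0: "s \<in> sorts A ==> dfn A P (s # \<Gamma>) Q ==> dfn A P \<Gamma> (\<lambda>e. \<exists>x\<in>carrier A s. Q (case_nat x e))"
| dfn_cong: "dfn A P \<Gamma> Q ==> (\<And>e. wt A \<Gamma> e ==> Q e \<longleftrightarrow> R e) ==> dfn A P \<Gamma> R"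

lemma wt_Cons: "wt A (s # \<Gamma>) (case_nat x e) \<longleftrightarrow> x \<in> carrier A s \<and> wt A \<Gamma> e"
  unfolding wt_def by (auto simp: less_Suc_eq_0_disj)

lemma dfn_True: "dfn A P \<Gamma> (\<lambda>e. True)"
  using dfn_neg[OF dfn_False] by simp

lemma dfn_disj:
  assumes "dfn A P \<Gamma> Q" "dfn A P \<Gamma> R"
  shows "dfn A P \<Gamma> (\<lambda>e. Q e \<or> R e)"
proof -
  have "dfn A P \<Gamma> (\<lambda>e. \<not> (\<not> Q e \<and> \<not> R e))"
    by (intro dfn_neg dfn_conj assms)
  then show ?thesis by simp
qed

lemma dfn_imp:
  assumes "dfn A P \<Gamma> Q" "dfn A P \<Gamma> R"
  shows "dfn A P \<Gamma> (\<lambda>e. Q e --> R e)"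
proof -
  have "dfn A P \<Gamma> (\<lambda>e. \<not> Q e \<or> R e)"
    by (intro dfn_neg dfn_disj assms)
  then show ?thesis by (rule dfn_cong) blast
qed

lemma dfn_iff:
  assumes "dfn A P \<Gamma> Q" "dfn A P \<Gamma> R"
  shows "dfn A P \<Gamma> (\<lambda>e. Q e \<longleftrightarrow> R e)"
proof -
  have "dfn A P \<Gamma> (\<lambda>e. (Q e --> R e) \<and> (R e --> Q e))"
    by (intro dfn_conj dfn_imp assms)
  then show ?thesis by (rule dfn_cong) blast
qed

lemma dfn_ex:
  assumes "s \<in> sorts A" "dfn A P (s # \<Gamma>) (\<lambda>e. Q (\<lambda>n. e (Suc n)) (e 0))"
  shows "dfn A P \<Gamma> (\<lambda>e. \<exists>x\<in>carrier A s. Q e x)"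
  using dfn_ex0[OF assms] by simp

lemma dfn_all:
  assumes "s \<in> sorts A" "dfn A P (s # \<Gamma>) (\<lambda>e. Q (\<lambda>n. e (Suc n)) (e 0))"
  shows "dfn A P \<Gamma> (\<lambda>e. \<forall>x\<in>carrier A s. Q e x)"
proof -
  have "dfn A P \<Gamma> (\<lambda>e. \<not> (\<exists>x\<in>carrier A s. \<not> Q e x))"
    by (intro dfn_neg dfn_ex assms)
  then show ?thesis by simp
qed

lemma dfn_All_less: "(\<And>k. k < n ==> dfn A P \<Gamma> (Q k)) ==> dfn A P \<Gamma> (\<lambda>e. \<forall>k<n. Q k e)"
  for n :: nat
proof (induction n)
  case 0
  then show ?case using dfn_True by simp
next
  case (Suc n)
  have "dfn A P \<Gamma> (\<lambda>e. (\<forall>k<n. Q k e) \<and> Q n e)"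
    by (intro dfn_conj Suc) auto
  then show ?case by (rule dfn_cong) (auto simp: less_Suc_eq)
qed

text \<open>The map \<sigma> may be any sort-preserving one, so weakening, permutation and
  identification of variables are covered at once. Under a quantifier \<sigma> is lifted to fix the
  new variable 0.\<close>

lemma dfn_reindex:
  assumes "dfn A P \<Gamma> Q" "\<And>i. i < length \<Gamma> ==> \<sigma> i < length \<Gamma>' \<and> \<Gamma>' ! \<sigma> i = \<Gamma> ! i"
  shows "dfn A P \<Gamma>' (\<lambda>e. Q (\<lambda>i. e (\<sigma> i)))"
  using assms
proof (induction arbitrary: \<Gamma>' \<sigma>)
  case (dfn_rel r "is" \<Gamma>)
  have *: "map (\<lambda>i. e (\<sigma> i)) is = map e (map \<sigma> is)" for e :: "nat => 'd" by simp
  have "dfn A P \<Gamma>' (\<lambda>e. map e (map \<sigma> is) \<in> relI A r)"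
    using dfn_rel by (intro dfn.dfn_rel) (auto simp flip: dfn_rel.hyps(3))
  then show ?case unfolding * .
next
  case (dfn_fun f "is" \<Gamma> j)
  have *: "map (\<lambda>i. e (\<sigma> i)) is = map e (map \<sigma> is)" for e :: "nat => 'd" by simp
  have "dfn A P \<Gamma>' (\<lambda>e. e (\<sigma> j) = funI A f (map e (map \<sigma> is)))"
    using dfn_fun by (intro dfn.dfn_fun) (auto simp flip: dfn_fun.hyps(3))
  then show ?case unfolding * .
next
  case (dfn_ex0 s \<Gamma> Q)
  define \<sigma>' where "\<sigma>' = (\<lambda>i. case i of 0 => 0 | Suc n => Suc (\<sigma> n))"
  have *: "(\<lambda>i. case_nat x e (\<sigma>' i)) = case_nat x (\<lambda>i. e (\<sigma> i))" for x :: 'd and e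
    by (auto simp: \<sigma>'_def fun_eq_iff split: nat.split)
  have "dfn A P (s # \<Gamma>') (\<lambda>e. Q (\<lambda>i. e (\<sigma>' i)))"
    using dfn_ex0.prems by (intro dfn_ex0.IH) (auto simp: \<sigma>'_def split: nat.split)
  from dfn.dfn_ex0[OF dfn_ex0.hyps(1) this] show ?case by (simp add: *)
next
  case (dfn_cong \<Gamma> Q R)
  have "dfn A P \<Gamma>' (\<lambda>e. Q (\<lambda>i. e (\<sigma> i)))" using dfn_cong by blast
  then show ?case
  proof (rule dfn.dfn_cong)
    fix e assume "wt A \<Gamma>' e"
    then have "wt A \<Gamma> (\<lambda>i. e (\<sigma> i))" using dfn_cong.prems unfolding wt_def by metis
    then show "Q (\<lambda>i. e (\<sigma> i)) = R (\<lambda>i. e (\<sigma> i))" by (rule dfn_cong.hyps)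
  qed
next
  case (dfn_const i \<Gamma> c)
  then show ?case by (intro dfn.dfn_const) auto
qed (auto intro: dfn.intros)

text \<open>Environments are infinite and \<open>dfn_cong\<close> controls predicates on well-typed
  ones only, so dependence on the context alone is a fact to be proved, for well-typed
  environments.\<close>

lemma dfn_local:
  assumes "dfn A P \<Gamma> Q" "wt A \<Gamma> e" "\<And>i. i < length \<Gamma> ==> e i = e' i"
  shows "Q e \<longleftrightarrow> Q e'"
  using assms
proof (induction arbitrary: e e')
  case (dfn_rel r "is" \<Gamma>)
  have "map e is = map e' is" using dfn_rel by (intro map_cong) auto
  then show ?case by (simp only:)
next
  case (dfn_fun f "is" \<Gamma> j)
  have "map e is = map e' is" using dfn_fun by (intro map_cong) auto
  moreover have "e j = e' j" using dfn_fun by simp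
  ultimately show ?case by (simp only:)
next
  case (dfn_ex0 s \<Gamma> Q)
  have "Q (case_nat x e) = Q (case_nat x e')" if "x \<in> carrier A s" for x
    using that dfn_ex0 by (intro dfn_ex0.IH) (auto simp: wt_Cons less_Suc_eq_0_disj)
  then show ?case by auto
next
  case (dfn_neg \<Gamma> Q)
  then show ?case by blast
next
  case (dfn_conj \<Gamma> Q R)
  then show ?case by blast
next
  case (dfn_cong \<Gamma> Q R)
  have "wt A \<Gamma> e'" using dfn_cong.prems unfolding wt_def by auto
  then show ?case using dfn_cong by blast
qed auto

section \<open>Tuples, blocks of variables and block quantifiers\<close>

lemma tuples_iff: "xs \<in> tuples A ss \<longleftrightarrow> length xs = length ss \<and> (\<forall>i<length ss. xs ! i \<in> carrier A (ss ! i))"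
  unfolding tuples_def list_all2_conv_all_nth by auto

lemma tuples_length: "xs \<in> tuples A ss ==> length xs = length ss"
  by (simp add: tuples_iff)

lemma tuples_Nil [simp]: "tuples A [] = {[]}"
  unfolding tuples_def by auto

lemma tuples_Cons: "x # xs \<in> tuples A (s # ss) \<longleftrightarrow> x \<in> carrier A s \<and> xs \<in> tuples A ss"
  unfolding tuples_def by auto

lemma tuples_ConsE:
  assumes "ys \<in> tuples A (s # ss)"
  obtains x xs where "ys = x # xs" "x \<in> carrier A s" "xs \<in> tuples A ss"
  using assms unfolding tuples_def by (auto simp: list_all2_Cons2)

lemma tuples_append: "length xs = length ss ==>
    xs @ ys \<in> tuples A (ss @ ts) \<longleftrightarrow> xs \<in> tuples A ss \<and> ys \<in> tuples A ts"
  unfolding tuples_def by (auto simp: list_all2_append)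

lemma tuples_appendE:
  assumes "zs \<in> tuples A (ss @ ts)"
  obtains xs ys where "zs = xs @ ys" "xs \<in> tuples A ss" "ys \<in> tuples A ts"
  using assms unfolding tuples_def by (auto simp: list_all2_append2)

definition cat :: "'a list => (nat => 'a) => nat => 'a" where
  "cat xs e i = (if i < length xs then xs ! i else e (i - length xs))"

lemma cat_Nil [simp]: "cat [] e = e"
  by (auto simp: cat_def)

lemma cat_Cons [simp]: "cat (x # xs) e = case_nat x (cat xs e)"
  by (auto simp: cat_def fun_eq_iff split: nat.split)

lemma map_cat1 [simp]: "map (cat xs e) [0..<length xs] = xs"
  by (rule nth_equalityI) (auto simp: cat_def)

lemma map_cat_prefix: "length xs = n ==> map (cat xs e) [0..<n] = xs"
  by auto

lemma cat_shift [simp]: "cat xs e (length xs + i) = e i" "cat xs e (i + length xs) = e i"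
  by (auto simp: cat_def)

lemma cat_cat: "cat (xs @ ys) e = cat xs (cat ys e)"
  by (auto simp: cat_def fun_eq_iff nth_append)

lemma wt_cat: "length xs = length ss ==> wt A (ss @ \<Gamma>) (cat xs e) \<longleftrightarrow> xs \<in> tuples A ss \<and> wt A \<Gamma> e"
proof (induction xs ss rule: list_induct2)
  case (Cons x xs s ss)
  then show ?case by (simp add: wt_Cons tuples_Cons)
qed simp

text \<open>The head of \<open>ss\<close> is bound innermost, so that variable k of the block is
  entry k of the tuple.\<close>

lemma dfn_block_ex0:
  assumes "set ss \<subseteq> sorts A" "dfn A P (ss @ \<Gamma>) Q"
  shows "dfn A P \<Gamma> (\<lambda>e. \<exists>xs\<in>tuples A ss. Q (cat xs e))"
  using assms
proof (induction ss arbitrary: Q)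
  case Nil
  then show ?case by simp
next
  case (Cons s ss)
  have "dfn A P (ss @ \<Gamma>) (\<lambda>e. \<exists>x\<in>carrier A s. Q (case_nat x e))"
    using Cons.prems by (intro dfn_ex0) auto
  then have "dfn A P \<Gamma> (\<lambda>e. \<exists>xs\<in>tuples A ss. \<exists>x\<in>carrier A s. Q (case_nat x (cat xs e)))"
    using Cons.IH Cons.prems by fastforce
  then show ?case
  proof (rule dfn_cong)
    fix e
    show "(\<exists>xs\<in>tuples A ss. \<exists>x\<in>carrier A s. Q (case_nat x (cat xs e))) =
      (\<exists>xs\<in>tuples A (s # ss). Q (cat xs e))"
    proof
      assume "\<exists>xs\<in>tuples A ss. \<exists>x\<in>carrier A s. Q (case_nat x (cat xs e))"
      then obtain xs x where "xs \<in> tuples A ss" "x \<in> carrier A s" "Q (case_nat x (cat xs e))" by blast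
      then show "\<exists>xs\<in>tuples A (s # ss). Q (cat xs e)"
        by (intro bexI[of _ "x # xs"]) (auto simp: tuples_Cons)
    next
      assume "\<exists>xs\<in>tuples A (s # ss). Q (cat xs e)"
      then obtain ys where "ys \<in> tuples A (s # ss)" "Q (cat ys e)" by blast
      then show "\<exists>xs\<in>tuples A ss. \<exists>x\<in>carrier A s. Q (case_nat x (cat xs e))"
        by (elim tuples_ConsE) auto
    qed
  qed
qed

lemma dfn_block_ex:
  assumes "set ss \<subseteq> sorts A"
    and "dfn A P (ss @ \<Gamma>) (\<lambda>e. Q (\<lambda>n. e (length ss + n)) (map e [0..<length ss]))"
  shows "dfn A P \<Gamma> (\<lambda>e. \<exists>xs\<in>tuples A ss. Q e xs)"
  using dfn_block_ex0[OF assms]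
proof (rule dfn_cong)
  fix e
  have "(\<lambda>n. cat xs e (length ss + n)) = e" "map (cat xs e) [0..<length ss] = xs"
    if "xs \<in> tuples A ss" for xs
    using tuples_length[OF that] by (auto simp: fun_eq_iff cat_def intro: nth_equalityI)
  then show "(\<exists>xs\<in>tuples A ss. Q (\<lambda>n. cat xs e (length ss + n)) (map (cat xs e) [0..<length ss])) =
       (\<exists>xs\<in>tuples A ss. Q e xs)" by auto
qed

lemma dfn_block_all:
  assumes "set ss \<subseteq> sorts A"
    and "dfn A P (ss @ \<Gamma>) (\<lambda>e. Q (\<lambda>n. e (length ss + n)) (map e [0..<length ss]))"
  shows "dfn A P \<Gamma> (\<lambda>e. \<forall>xs\<in>tuples A ss. Q e xs)"
proof -
  have "dfn A P \<Gamma> (\<lambda>e. \<not> (\<exists>xs\<in>tuples A ss. \<not> Q e xs))"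
    by (intro dfn_neg dfn_block_ex assms)
  then show ?thesis by simp
qed

lemma map_nth_const: "length xs = length is ==>
    map e is = xs \<longleftrightarrow> (\<forall>k<length is. e (is ! k) = xs ! k)"
  by (auto simp: list_eq_iff_nth_eq)

text \<open>Moves a definable set of tuples to an arbitrary list of variables of the right sorts,
  repetitions allowed.\<close>

lemma dfn_at:
  assumes "dfn A P ss (\<lambda>e. R (map e [0..<length ss]))"
    and "\<forall>i\<in>set is. i < length \<Gamma>" "map ((!) \<Gamma>) is = ss"
  shows "dfn A P \<Gamma> (\<lambda>e. R (map e is))"
proof -
  have len: "length is = length ss" using assms(3) by auto
  have "dfn A P \<Gamma> (\<lambda>e. R (map (\<lambda>i. e (is ! i)) [0..<length ss]))"
  proof (rule dfn_reindex[OF assms(1)])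
    fix i assume "i < length ss"
    then show "is ! i < length \<Gamma> \<and> \<Gamma> ! (is ! i) = ss ! i"
      using assms(2) len nth_map[of i "is" "(!) \<Gamma>"] nth_mem[of i "is"] by (simp add: assms(3))
  qed
  moreover have "map (\<lambda>i. e (is ! i)) [0..<length ss] = map e is" for e :: "nat => 'd"
    using len by (auto intro: nth_equalityI)
  ultimately show ?thesis by simp
qed

subsection \<open>Elimination of parameters\<close>

text \<open>Imaginary sorts exist only for relations definable without parameters, so a relation
  with parameters must be exhibited as a fibre of a parameter-free one. Each constant becomes a
  fresh variable at the end of the context.\<close>

lemma dfn_params:
  assumes "dfn A P \<Gamma> Q" "set \<Gamma> \<subseteq> sorts A"
  obtains \<Delta> b Q0 where "set \<Delta> \<subseteq> sorts A" "b \<in> tuples A \<Delta>" "dfn A (\<lambda>_. {}) (\<Gamma> @ \<Delta>) Q0"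
    "\<And>xs e. xs \<in> tuples A \<Gamma> ==> Q (cat xs e) \<longleftrightarrow> Q0 (cat xs (cat b e))"
proof -
  have "\<exists>\<Delta> b Q0. set \<Delta> \<subseteq> sorts A \<and> b \<in> tuples A \<Delta> \<and> dfn A (\<lambda>_. {}) (\<Gamma> @ \<Delta>) Q0 \<and>
    (\<forall>xs\<in>tuples A \<Gamma>. \<forall>e. Q (cat xs e) \<longleftrightarrow> Q0 (cat xs (cat b e)))"
    using assms
  proof induction
    case (dfn_False \<Gamma>)
    then show ?case by (intro exI[of _ "[]"] exI[of _ "\<lambda>_. False"]) (auto intro: dfn.intros)
  next
    case (dfn_eq i \<Gamma> j)
    then show ?case
      by (intro exI[of _ "[]"] exI[of _ "\<lambda>e. e i = e j"]) (auto intro: dfn.intros)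
  next
    case (dfn_rel r "is" \<Gamma>)
    then show ?case
      by (intro exI[of _ "[]"] exI[of _ "\<lambda>e. map e is \<in> relI A r"]) (auto intro: dfn.intros)
  next
    case (dfn_fun f "is" \<Gamma> j)
    then show ?case
      by (intro exI[of _ "[]"] exI[of _ "\<lambda>e. e j = funI A f (map e is)"]) (auto intro: dfn.intros)
  next
    case (dfn_const i \<Gamma> c)
    have "dfn A (\<lambda>_. {}) (\<Gamma> @ [\<Gamma> ! i]) (\<lambda>e. e i = e (length \<Gamma>))"
      using dfn_const by (intro dfn.dfn_eq) (auto simp: nth_append)
    then show ?case using dfn_const
      by (intro exI[of _ "[\<Gamma> ! i]"] exI[of _ "[c]"] exI[of _ "\<lambda>e. e i = e (length \<Gamma>)"])
         (auto simp: tuples_Cons cat_def dest: tuples_length)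
  next
    case (dfn_neg \<Gamma> Q)
    then obtain \<Delta> b Q0 where "set \<Delta> \<subseteq> sorts A" "b \<in> tuples A \<Delta>" "dfn A (\<lambda>_. {}) (\<Gamma> @ \<Delta>) Q0"
      "\<forall>xs\<in>tuples A \<Gamma>. \<forall>e. Q (cat xs e) \<longleftrightarrow> Q0 (cat xs (cat b e))" by blast
    then show ?case
      by (intro exI[of _ \<Delta>] exI[of _ b] exI[of _ "\<lambda>e. \<not> Q0 e"]) (auto intro: dfn.dfn_neg)
  next
    case (dfn_conj \<Gamma> Q R)
    then obtain \<Delta>1 b1 Q1 \<Delta>2 b2 Q2 where
      1: "set \<Delta>1 \<subseteq> sorts A" "b1 \<in> tuples A \<Delta>1" "dfn A (\<lambda>_. {}) (\<Gamma> @ \<Delta>1) Q1"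
      "\<forall>xs\<in>tuples A \<Gamma>. \<forall>e. Q (cat xs e) \<longleftrightarrow> Q1 (cat xs (cat b1 e))" and
      2: "set \<Delta>2 \<subseteq> sorts A" "b2 \<in> tuples A \<Delta>2" "dfn A (\<lambda>_. {}) (\<Gamma> @ \<Delta>2) Q2"
      "\<forall>xs\<in>tuples A \<Gamma>. \<forall>e. R (cat xs e) \<longleftrightarrow> Q2 (cat xs (cat b2 e))" by metis
    \<comment> \<open>The parameters of the second conjunct are placed behind those of the first;
      the variables of \<Gamma> stay.\<close>
    define \<sigma> where "\<sigma> i = (if i < length \<Gamma> then i else i + length \<Delta>1)" for i
    have len: "length b1 = length \<Delta>1" using 1 tuples_length by blast
    have d1: "dfn A (\<lambda>_. {}) (\<Gamma> @ \<Delta>1 @ \<Delta>2) Q1"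
      by (rule dfn_reindex[OF 1(3), of "\<lambda>i. i" "\<Gamma> @ \<Delta>1 @ \<Delta>2"]) (auto simp: nth_append)
    have d2: "dfn A (\<lambda>_. {}) (\<Gamma> @ \<Delta>1 @ \<Delta>2) (\<lambda>e. Q2 (\<lambda>i. e (\<sigma> i)))"
      by (rule dfn_reindex[OF 2(3), of \<sigma>]) (auto simp: nth_append \<sigma>_def)
    have e1: "Q (cat xs e) \<longleftrightarrow> Q1 (cat xs (cat (b1 @ b2) e))" if "xs \<in> tuples A \<Gamma>" for xs e
    proof -
      have "Q (cat xs e) \<longleftrightarrow> Q1 (cat xs (cat b1 e))" using 1 that by blast
      also have "\<dots> \<longleftrightarrow> Q1 (cat xs (cat (b1 @ b2) e))"
      proof (rule dfn_local[OF 1(3)])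
        show "wt A (\<Gamma> @ \<Delta>1) (cat xs (cat b1 e))"
          using 1(2) that len tuples_length[OF that] wt_cat[of xs \<Gamma> A \<Delta>1] wt_cat[of b1 \<Delta>1 A "[]" e]
          by (auto simp: wt_def)
        fix i assume "i < length (\<Gamma> @ \<Delta>1)"
        then show "cat xs (cat b1 e) i = cat xs (cat (b1 @ b2) e) i"
          using len tuples_length[OF that] by (auto simp: cat_def nth_append)
      qed
      finally show ?thesis .
    qed
    have e2: "(\<lambda>i. cat xs (cat (b1 @ b2) e) (\<sigma> i)) = cat xs (cat b2 e)" if "xs \<in> tuples A \<Gamma>" for xs e
      using len tuples_length[OF that] by (auto simp: cat_def fun_eq_iff \<sigma>_def nth_append)
    show ?case
    proof (intro exI conjI)
      show "set (\<Delta>1 @ \<Delta>2) \<subseteq> sorts A" "b1 @ b2 \<in> tuples A (\<Delta>1 @ \<Delta>2)"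
        using 1 2 len by (auto simp: tuples_append)
      show "dfn A (\<lambda>_. {}) (\<Gamma> @ \<Delta>1 @ \<Delta>2) (\<lambda>e. Q1 e \<and> Q2 (\<lambda>i. e (\<sigma> i)))"
        by (intro dfn.dfn_conj d1 d2)
      show "\<forall>xs\<in>tuples A \<Gamma>. \<forall>e. (Q (cat xs e) \<and> R (cat xs e)) =
        (Q1 (cat xs (cat (b1 @ b2) e)) \<and> Q2 (\<lambda>i. cat xs (cat (b1 @ b2) e) (\<sigma> i)))"
        using e1 2(4) by (simp add: e2)
    qed
  next
    case (dfn_ex0 s \<Gamma> Q)
    have "set (s # \<Gamma>) \<subseteq> sorts A" using dfn_ex0.hyps dfn_ex0.prems by simp
    from dfn_ex0.IH[OF this] obtain \<Delta> b Q0 where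
      1: "set \<Delta> \<subseteq> sorts A" "b \<in> tuples A \<Delta>" "dfn A (\<lambda>_. {}) (s # \<Gamma> @ \<Delta>) Q0"
      "\<forall>xs\<in>tuples A (s # \<Gamma>). \<forall>e. Q (cat xs e) \<longleftrightarrow> Q0 (cat xs (cat b e))"
      unfolding append_Cons by blast
    have 2: "dfn A (\<lambda>_. {}) (\<Gamma> @ \<Delta>) (\<lambda>e. \<exists>x\<in>carrier A s. Q0 (case_nat x e))"
      by (rule dfn.dfn_ex0[OF dfn_ex0.hyps(1) 1(3)])
    have 3: "Q (case_nat x (cat xs e)) \<longleftrightarrow> Q0 (case_nat x (cat xs (cat b e)))"
      if "x \<in> carrier A s" "xs \<in> tuples A \<Gamma>" for x xs e
      using 1(4)[rule_format, of "x # xs" e] that by (simp add: tuples_Cons)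
    have "\<forall>xs\<in>tuples A \<Gamma>. \<forall>e. (\<exists>x\<in>carrier A s. Q (case_nat x (cat xs e))) \<longleftrightarrow>
      (\<exists>x\<in>carrier A s. Q0 (case_nat x (cat xs (cat b e))))"
      using 3 by blast
    with 1(1,2) 2 show ?case by blast
  next
    case (dfn_cong \<Gamma> Q R)
    then obtain \<Delta> b Q0 where 1: "set \<Delta> \<subseteq> sorts A" "b \<in> tuples A \<Delta>" "dfn A (\<lambda>_. {}) (\<Gamma> @ \<Delta>) Q0"
      "\<forall>xs\<in>tuples A \<Gamma>. \<forall>e. Q (cat xs e) \<longleftrightarrow> Q0 (cat xs (cat b e))" by blast
    have "Q (cat xs e) \<longleftrightarrow> R (cat xs e)" if "xs \<in> tuples A \<Gamma>" for xs e
    proof (rule dfn_cong.hyps)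
      show "wt A \<Gamma> (cat xs e)"
        using wt_cat[OF tuples_length[OF that], of A "[]" e] that by (simp add: wt_def[of A "[]"])
    qed
    then have "\<forall>xs\<in>tuples A \<Gamma>. \<forall>e. R (cat xs e) \<longleftrightarrow> Q0 (cat xs (cat b e))" using 1(4) by simp
    then show ?case using 1 by blast
  qed
  then obtain \<Delta> b Q0 where "set \<Delta> \<subseteq> sorts A" "b \<in> tuples A \<Delta>" "dfn A (\<lambda>_. {}) (\<Gamma> @ \<Delta>) Q0"
    "\<forall>xs\<in>tuples A \<Gamma>. \<forall>e. Q (cat xs e) \<longleftrightarrow> Q0 (cat xs (cat b e))" by blast
  then show ?thesis using that[of \<Delta> b Q0] by blast
qed

subsection \<open>Definable predicates and formulas\<close>

lemma wf_fun:
  assumes "wf_structure A" "f \<in> funs A"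
  shows "set (fdom A f) \<subseteq> sorts A" "fcod A f \<in> sorts A"
    "xs \<in> tuples A (fdom A f) ==> funI A f xs \<in> carrier A (fcod A f)"
  using assms unfolding wf_structure_def by blast+

lemma wf_rel:
  assumes "wf_structure A" "r \<in> rels A"
  shows "set (rdom A r) \<subseteq> sorts A" "relI A r \<subseteq> tuples A (rdom A r)"
  using assms unfolding wf_structure_def by blast+

lemma term_sort_in: "wf_structure A ==> wf_term A t ==> term_sort A t \<in> sorts A"
  by (cases t) (auto dest: wf_fun(2))

primrec ren_term :: "(nat => nat) => ('s, 'f) fo_term => ('s, 'f) fo_term" where
  "ren_term \<rho> (Var s i) = Var s (\<rho> i)"
| "ren_term \<rho> (App f ts) = App f (map (ren_term \<rho>) ts)"

primrec ren :: "(nat => nat) => ('s, 'f, 'r) fo_formula => ('s, 'f, 'r) fo_formula" where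
  "ren \<rho> Fls = Fls"
| "ren \<rho> (Equal t u) = Equal (ren_term \<rho> t) (ren_term \<rho> u)"
| "ren \<rho> (Rel r ts) = Rel r (map (ren_term \<rho>) ts)"
| "ren \<rho> (Neg p) = Neg (ren \<rho> p)"
| "ren \<rho> (Conj p q) = Conj (ren \<rho> p) (ren \<rho> q)"
| "ren \<rho> (Exi s i p) = Exi s (\<rho> i) (ren \<rho> p)"

lemma term_vars_ren: "term_vars (ren_term \<rho> t) = map_prod id \<rho> ` term_vars t"
  by (induction t) auto

lemma free_vars_ren: "inj \<rho> ==> free_vars (ren \<rho> \<phi>) = map_prod id \<rho> ` free_vars \<phi>"
proof (induction \<phi>)
  case (Exi s i p)
  then show ?case by (auto simp: inj_eq)
qed (auto simp: term_vars_ren)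

lemma term_sort_ren [simp]: "term_sort A (ren_term \<rho> t) = term_sort A t"
  by (cases t) auto

lemma wf_term_ren [simp]: "wf_term A (ren_term \<rho> t) = wf_term A t"
  by (induction t) (auto simp: comp_def)

lemma wf_ren [simp]: "wf_formula A (ren \<rho> \<phi>) = wf_formula A \<phi>"
  by (induction \<phi>) (auto simp: comp_def)

lemma term_val_ren: "term_val A e (ren_term \<rho> t) = term_val A (\<lambda>(s, i). e (s, \<rho> i)) t"
  by (induction t) (auto simp: comp_def cong: map_cong)

lemma sat_ren: "inj \<rho> ==> sat A e (ren \<rho> \<phi>) \<longleftrightarrow> sat A (\<lambda>(s, i). e (s, \<rho> i)) \<phi>"
proof (induction \<phi> arbitrary: e)
  case (Exi s i p)
  have "(\<lambda>(s', j). (e((s, \<rho> i) := x)) (s', \<rho> j)) = (\<lambda>(s, i). e (s, \<rho> i))((s, i) := x)" for x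
    using Exi.prems by (auto simp: fun_eq_iff inj_eq)
  then show ?case using Exi by simp
qed (auto simp: term_val_ren comp_def cong: map_cong)

lemma term_val_cong: "(\<And>v. v \<in> term_vars t ==> e v = e' v) ==> term_val A e t = term_val A e' t"
proof (induction t)
  case (App f ts)
  then have "map (term_val A e) ts = map (term_val A e') ts" by (intro map_cong) auto
  then show ?case by (simp only: term_val.simps)
qed auto

lemma sat_cong: "(\<And>v. v \<in> free_vars \<phi> ==> e v = e' v) ==> sat A e \<phi> \<longleftrightarrow> sat A e' \<phi>"
proof (induction \<phi> arbitrary: e e')
  case (Equal t u)
  have "term_val A e t = term_val A e' t" "term_val A e u = term_val A e' u"
    using Equal.prems by (intro term_val_cong; simp)+
  then show ?case by simp
next
  case (Rel r ts)
  have "map (term_val A e) ts = map (term_val A e') ts"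
    using Rel by (intro map_cong refl term_val_cong) auto
  then show ?case by (simp only: sat.simps)
next
  case (Conj p q)
  have "sat A e p = sat A e' p" "sat A e q = sat A e' q"
    using Conj.prems by (intro Conj.IH; simp)+
  then show ?case by simp
next
  case (Exi s i p)
  have "sat A (e((s, i) := x)) p = sat A (e'((s, i) := x)) p" for x
    using Exi.prems by (intro Exi.IH) auto
  then show ?case by simp
next
  case (Neg p)
  have "sat A e p = sat A e' p" using Neg.prems by (intro Neg.IH) simp
  then show ?case by simp
qed auto

text \<open>Even variables stand for the context, odd ones for parameters; bound variables are arbitrary.\<close>

definition even_odd :: "(nat => 'a) => ('s \<times> nat => 'a) => 's \<times> nat => 'a" where
  "even_odd e p = (\<lambda>(s, n). if even n then e (n div 2) else p (s, n div 2))"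

definition expresses where
  "expresses A P \<Gamma> Q \<phi> p \<longleftrightarrow> wf_formula A \<phi> \<and>
    (\<forall>(s, n)\<in>free_vars \<phi>. if even n then n div 2 < length \<Gamma> \<and> s = \<Gamma> ! (n div 2)
        else p (s, n div 2) \<in> carrier A s \<inter> P s) \<and>
    (\<forall>e. wt A \<Gamma> e --> (Q e \<longleftrightarrow> sat A (even_odd e p) \<phi>))"

lemma dfn_expressible:
  assumes "dfn A P \<Gamma> Q" "set \<Gamma> \<subseteq> sorts A"
  shows "\<exists>\<phi> p. expresses A P \<Gamma> Q \<phi> p"
  using assms
proof induction
  case (dfn_False \<Gamma>)
  then show ?case unfolding expresses_def by (intro exI[of _ Fls]) auto
next
  case (dfn_eq i \<Gamma> j)
  then show ?case unfolding expresses_def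
    by (intro exI[of _ "Equal (Var (\<Gamma> ! i) (2 * i)) (Var (\<Gamma> ! j) (2 * j))"]) (auto simp: even_odd_def)
next
  case (dfn_const i \<Gamma> c)
  then show ?case unfolding expresses_def
    by (intro exI[of _ "Equal (Var (\<Gamma> ! i) (2 * i)) (Var (\<Gamma> ! i) 1)"] exI[of _ "\<lambda>_. c"])
      (auto simp: even_odd_def)
next
  case (dfn_rel r "is" \<Gamma>)
  then show ?case unfolding expresses_def
    by (intro exI[of _ "Rel r (map (\<lambda>i. Var (\<Gamma> ! i) (2 * i)) is)"])
      (auto simp: even_odd_def comp_def subset_iff)
next
  case (dfn_fun f "is" \<Gamma> j)
  have "\<Gamma> ! j \<in> sorts A" using dfn_fun.hyps(4) dfn_fun.prems nth_mem by blast
  with dfn_fun show ?case unfolding expresses_def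
    by (intro exI[of _ "Equal (Var (\<Gamma> ! j) (2 * j)) (App f (map (\<lambda>i. Var (\<Gamma> ! i) (2 * i)) is))"])
      (auto simp: even_odd_def comp_def subset_iff)
next
  case (dfn_neg \<Gamma> Q)
  then obtain \<phi> p where "expresses A P \<Gamma> Q \<phi> p" by blast
  then show ?case unfolding expresses_def by (intro exI[of _ "Neg \<phi>"] exI[of _ p]) auto
next
  case (dfn_conj \<Gamma> Q R)
  then obtain \<phi> p \<psi> q where 1: "expresses A P \<Gamma> Q \<phi> p" "expresses A P \<Gamma> R \<psi> q" by blast
  \<comment> \<open>The two formulas must not share parameter variables: parameter m of the first
    becomes parameter 2m (a = 1), that of the second parameter 2m + 1 (a = 3). The even variables,
    which stand for the context, stay.\<close>
  define \<rho> where "\<rho> a n = (if even n then n else 4 * (n div 2) + a)" for a n :: nat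
  have inj: "inj (\<rho> a)" if "odd a" for a
  proof (rule injI)
    fix x y assume xy: "\<rho> a x = \<rho> a y"
    have "even (\<rho> a n) \<longleftrightarrow> even n" for n using that by (auto simp: \<rho>_def)
    then have "even x \<longleftrightarrow> even y" using xy by metis
    then show "x = y" using xy by (cases "even x") (auto simp: \<rho>_def elim!: oddE)
  qed
  define r where "r = (\<lambda>(s, n). if even n then p (s, n div 2) else q (s, n div 2))"
  have d: "Suc (4 * n) div 2 = 2 * n" "(4 * n + 3) div 2 = 2 * n + 1" for n :: nat by auto
  have *: "even_odd e r (s, \<rho> 1 n) = even_odd e p (s, n)" for e s n
    by (cases "even n") (auto simp: even_odd_def \<rho>_def r_def d elim!: oddE)
  have **: "even_odd e r (s, \<rho> 3 n) = even_odd e q (s, n)" for e s n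
    by (cases "even n") (auto simp: even_odd_def \<rho>_def r_def d elim!: oddE)
  define ok where "ok \<pi> v \<longleftrightarrow> (case v of (s, n) => if even n then n div 2 < length \<Gamma> \<and> s = \<Gamma> ! (n div 2)
        else \<pi> (s, n div 2) \<in> carrier A s \<inter> P s)" for \<pi> and v :: "'a \<times> nat"
  have k: "ok r (s, \<rho> 1 n)" if "ok p (s, n)" for s n
    using that by (cases "even n") (auto simp: ok_def \<rho>_def r_def d elim!: oddE)
  have kk: "ok r (s, \<rho> 3 n)" if "ok q (s, n)" for s n
    using that by (cases "even n") (auto simp: ok_def \<rho>_def r_def d elim!: oddE)
  have "expresses A P \<Gamma> (\<lambda>e. Q e \<and> R e) (Conj (ren (\<rho> 1) \<phi>) (ren (\<rho> 3) \<psi>)) r"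
    unfolding expresses_def ok_def[symmetric]
  proof (intro conjI ballI allI impI)
    show "wf_formula A (Conj (ren (\<rho> 1) \<phi>) (ren (\<rho> 3) \<psi>))" using 1 by (simp add: expresses_def)
  next
    fix v assume "v \<in> free_vars (Conj (ren (\<rho> 1) \<phi>) (ren (\<rho> 3) \<psi>))"
    then consider s n where "v = (s, \<rho> 1 n)" "(s, n) \<in> free_vars \<phi>"
      | s n where "v = (s, \<rho> 3 n)" "(s, n) \<in> free_vars \<psi>"
      by (auto simp: free_vars_ren inj)
    then show "ok r v" using 1 k kk unfolding expresses_def ok_def[symmetric] by cases auto
  next
    fix e assume "wt A \<Gamma> e"
    then show "(Q e \<and> R e) \<longleftrightarrow> sat A (even_odd e r) (Conj (ren (\<rho> 1) \<phi>) (ren (\<rho> 3) \<psi>))"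
      using 1 by (simp add: expresses_def sat_ren inj *[unfolded One_nat_def] **)
  qed
  then show ?case by blast
next
  case (dfn_ex0 s \<Gamma> Q)
  then obtain \<phi> p where 1: "expresses A P (s # \<Gamma>) Q \<phi> p" by auto
  \<comment> \<open>The bound variable, number 0 of the longer context, becomes the odd variable 1.
    The other context variables move down one place, and the parameters move up one place to free
    it.\<close>
  define \<rho> where "\<rho> n = (if n = 0 then 1 else if even n then n - 2 else n + 2)" for n :: nat
  have inj: "inj \<rho>"
    by (rule injI) (simp add: \<rho>_def split: if_splits; presburger)
  have dd: "(2 * b - 2) div 2 = b - Suc 0" for b :: nat by (cases b) auto
  define r where "r = (\<lambda>(t, n). p (t, n - Suc 0))"
  have *: "sat A ((even_odd e r)((s, 1) := x)) (ren \<rho> \<phi>) \<longleftrightarrow> Q (case_nat x e)"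
    if "x \<in> carrier A s" "wt A \<Gamma> e" for x e
  proof -
    have "Q (case_nat x e) \<longleftrightarrow> sat A (even_odd (case_nat x e) p) \<phi>"
      using 1 that by (auto simp: expresses_def wt_Cons)
    also have "\<dots> \<longleftrightarrow> sat A (\<lambda>(t, n). ((even_odd e r)((s, 1) := x)) (t, \<rho> n)) \<phi>"
    proof (rule sat_cong)
      fix v assume v: "v \<in> free_vars \<phi>"
      obtain t n where tn: "v = (t, n)" by (cases v)
      have "n = 0 ==> t = s" using v tn 1 by (auto simp: expresses_def)
      then show "even_odd (case_nat x e) p v = (\<lambda>(t, n). ((even_odd e r)((s, 1) := x)) (t, \<rho> n)) v"
        unfolding tn by (auto simp: even_odd_def \<rho>_def r_def elim!: evenE oddE split: nat.splits)
    qed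
    also have "\<dots> \<longleftrightarrow> sat A ((even_odd e r)((s, 1) := x)) (ren \<rho> \<phi>)"
      by (simp add: sat_ren[OF inj])
    finally show ?thesis by simp
  qed
  have "expresses A P \<Gamma> (\<lambda>e. \<exists>x\<in>carrier A s. Q (case_nat x e)) (Exi s 1 (ren \<rho> \<phi>)) r"
    unfolding expresses_def
  proof (intro conjI allI impI ballI)
    show "wf_formula A (Exi s 1 (ren \<rho> \<phi>))" using 1 dfn_ex0.hyps by (auto simp: expresses_def)
  next
    fix v assume "v \<in> free_vars (Exi s 1 (ren \<rho> \<phi>))"
    then have *: "v \<in> map_prod id \<rho> ` free_vars \<phi>" "v ~= (s, 1)"
      by (simp_all add: free_vars_ren[OF inj])
    from *(1) obtain t m where v: "v = (t, \<rho> m)" "(t, m) \<in> free_vars \<phi>" by auto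
    have "if even m then m div 2 < length (s # \<Gamma>) \<and> t = (s # \<Gamma>) ! (m div 2)
        else p (t, m div 2) \<in> carrier A t \<inter> P t" using 1 v(2) by (auto simp: expresses_def)
    moreover have "m ~= 0"
    proof
      assume "m = 0"
      then show False using *(2) v(1) calculation by (simp add: \<rho>_def)
    qed
    ultimately show "case v of (t, n) => if even n then n div 2 < length \<Gamma> \<and> t = \<Gamma> ! (n div 2)
          else r (t, n div 2) \<in> carrier A t \<inter> P t"
      unfolding v using dd
      by (auto simp: \<rho>_def r_def nth_Cons elim!: evenE oddE split: if_splits nat.splits)
  next
    fix e assume "wt A \<Gamma> e"
    then show "(\<exists>x\<in>carrier A s. Q (case_nat x e)) \<longleftrightarrow> sat A (even_odd e r) (Exi s 1 (ren \<rho> \<phi>))"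
      using * by simp
  qed
  then show ?case by blast
next
  case (dfn_cong \<Gamma> Q R)
  then obtain \<phi> p where "expresses A P \<Gamma> Q \<phi> p" by blast
  then have "expresses A P \<Gamma> R \<phi> p" using dfn_cong.hyps by (auto simp: expresses_def)
  then show ?case by blast
qed

lemma coord_vars_iff: "(s, i) \<in> coord_vars ss \<longleftrightarrow> i < length ss \<and> s = ss ! i"
  unfolding coord_vars_def by auto

text \<open>Together with \<open>definable_over_dfn\<close> this identifies the inductive predicate
  with definability by formulas in well-formed structures, so later arguments need only the closure
  rules.\<close>

lemma definable_overI:
  assumes ss: "set ss \<subseteq> sorts A" and D: "D \<subseteq> tuples A ss"
    and "dfn A P ss (\<lambda>e. map e [0..<length ss] \<in> D)"
  shows "definable_over A P ss D"
proof -
  define N where "N = length ss"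
  obtain \<phi> p where 1: "expresses A P ss (\<lambda>e. map e [0..<length ss] \<in> D) \<phi> p"
    using dfn_expressible assms by blast
  \<comment> \<open>Passes from the even and odd numbering to that of \<open>definable_over\<close>:
    coordinate i is variable i, and all other variables, bound ones included, are moved to N or
    beyond.\<close>
  define \<rho> where "\<rho> n = (if even n \<and> n div 2 < N then n div 2 else N + n)" for n :: nat
  have inj: "inj \<rho>" unfolding inj_def \<rho>_def by (auto split: if_splits elim!: evenE)
  define r where "r = (\<lambda>(t, n). p (t, (n - N) div 2))"
  have "sat A (\<lambda>(s, i). if (s, i) \<in> coord_vars ss then xs ! i else r (s, i)) (ren \<rho> \<phi>) \<longleftrightarrow> xs \<in> D"
    if xs: "xs \<in> tuples A ss" for xs
  proof -
    define e where "e = cat xs (\<lambda>_. undefined)"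
    have len: "length xs = N" using tuples_length[OF xs] by (simp add: N_def)
    have "wt A ss e" using wt_cat[of xs ss A "[]"] xs len by (auto simp: e_def wt_def N_def)
    then have "xs \<in> D \<longleftrightarrow> sat A (even_odd e p) \<phi>"
      using 1 len by (auto simp: expresses_def e_def N_def map_cat_prefix)
    also have "\<dots> \<longleftrightarrow> sat A (\<lambda>(s, n). (\<lambda>(s, i). if (s, i) \<in> coord_vars ss then xs ! i else r (s, i)) (s, \<rho> n)) \<phi>"
    proof (rule sat_cong)
      fix v assume "v \<in> free_vars \<phi>"
      moreover obtain t n where tn: "v = (t, n)" by (cases v)
      ultimately have "if even n then n div 2 < N \<and> t = ss ! (n div 2)
        else p (t, n div 2) \<in> carrier A t \<inter> P t" using 1 by (auto simp: expresses_def N_def)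
      then show "even_odd e p v =
         (\<lambda>(s, n). (\<lambda>(s, i). if (s, i) \<in> coord_vars ss then xs ! i else r (s, i)) (s, \<rho> n)) v"
        unfolding tn e_def using len
        by (auto simp: even_odd_def \<rho>_def r_def cat_def coord_vars_iff N_def split: if_splits)
    qed
    finally show ?thesis by (simp add: sat_ren[OF inj])
  qed
  then have "D = {xs \<in> tuples A ss.
               sat A (\<lambda>(s, i). if (s, i) \<in> coord_vars ss then xs ! i else r (s, i)) (ren \<rho> \<phi>)}"
    using D by auto
  moreover have "\<forall>(s, i) \<in> free_vars (ren \<rho> \<phi>) - coord_vars ss. r (s, i) \<in> carrier A s \<inter> P s"
  proof clarify
    fix t m assume *: "(t, m) \<in> free_vars (ren \<rho> \<phi>)" "(t, m) \<notin> coord_vars ss"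
    then obtain n where n: "m = \<rho> n" "(t, n) \<in> free_vars \<phi>" by (auto simp: free_vars_ren[OF inj])
    then have "if even n then n div 2 < N \<and> t = ss ! (n div 2)
        else p (t, n div 2) \<in> carrier A t \<inter> P t" using 1 by (auto simp: expresses_def N_def)
    then show "r (t, m) \<in> carrier A t \<inter> P t" using *(2) n(1)
      by (auto simp: \<rho>_def r_def coord_vars_iff N_def split: if_splits)
  qed
  ultimately show ?thesis unfolding definable_over_def using ss 1
    by (auto simp: expresses_def intro!: exI[of _ "ren \<rho> \<phi>"] exI[of _ r])
qed

section \<open>From formulas back to definable predicates\<close>

definition val :: "('v => nat option) => ('v => 'a) => (nat => 'a) => 'v => 'a" where
  "val \<kappa> p e v = (case \<kappa> v of Some i => e i | None => p v)"

definition okval where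
  "okval A P \<Gamma> \<kappa> p v \<longleftrightarrow> (case \<kappa> v of Some i => i < length \<Gamma> \<and> \<Gamma> ! i = fst v
     | None => p v \<in> carrier A (fst v) \<inter> P (fst v))"

lemma term_val_in:
  assumes "wf_structure A"
  shows "wf_term A t ==> wt A \<Gamma> e ==> \<forall>v\<in>term_vars t. okval A P \<Gamma> \<kappa> p v ==>
    term_val A (val \<kappa> p e) t \<in> carrier A (term_sort A t)"
proof (induction t)
  case (Var s i)
  then have ok: "okval A P \<Gamma> \<kappa> p (s, i)" by simp
  show ?case
  proof (cases "\<kappa> (s, i)")
    case None
    then show ?thesis using ok by (simp add: val_def okval_def)
  next
    case (Some k)
    then have "k < length \<Gamma>" "\<Gamma> ! k = s" using ok by (simp_all add: okval_def)
    then show ?thesis using Some Var(2) unfolding wt_def by (simp add: val_def) metis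
  qed
next
  case (App f ts)
  have "map (term_val A (val \<kappa> p e)) ts \<in> tuples A (fdom A f)"
  proof -
    have h: "fdom A f = map (term_sort A) ts" using App.prems by simp
    have "term_val A (val \<kappa> p e) t \<in> carrier A (term_sort A t)" if "t \<in> set ts" for t
    proof (rule App.IH[OF that])
      show "wf_term A t" "wt A \<Gamma> e" "\<forall>v\<in>term_vars t. okval A P \<Gamma> \<kappa> p v"
        using App.prems that by auto
    qed
    then show ?thesis unfolding tuples_iff h by simp
  qed
  then show ?case using wf_fun(3)[OF assms] App.prems by simp
qed

text \<open>The rules admit function symbols on variables only, so a nested term is flattened by
  quantifying over the values of its arguments; \<open>term_val_in\<close> guarantees that these
  values lie in the carriers.\<close>

lemma dfn_term:
  assumes wf: "wf_structure A"
  shows "wf_term A t ==> \<forall>v\<in>term_vars t. okval A P \<Gamma> \<kappa> p v ==> j < length \<Gamma> ==>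
    \<Gamma> ! j = term_sort A t ==> dfn A P \<Gamma> (\<lambda>e. e j = term_val A (val \<kappa> p e) t)"
proof (induction t arbitrary: \<Gamma> \<kappa> j)
  case (Var s i)
  show ?case
  proof (cases "\<kappa> (s, i)")
    case None
    then have "dfn A P \<Gamma> (\<lambda>e. e j = p (s, i))"
      using Var by (intro dfn_const) (auto simp: okval_def)
    then show ?thesis using None by (simp add: val_def)
  next
    case (Some k)
    then have "dfn A P \<Gamma> (\<lambda>e. e j = e k)"
      using Var by (intro dfn_eq) (auto simp: okval_def)
    then show ?thesis using Some by (simp add: val_def)
  qed
next
  case (App f ts)
  define ss where "ss = fdom A f"
  have ss: "map (term_sort A) ts = ss" "f \<in> funs A" using App.prems by (auto simp: ss_def)
  moreover have "set ss \<subseteq> sorts A" using wf_fun(1)[OF wf ss(2)] by (simp add: ss_def)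
  moreover have "length ss = length ts" using ss(1) by (metis length_map)
  ultimately have ss: "set ss \<subseteq> sorts A" "map (term_sort A) ts = ss" "length ss = length ts" "f \<in> funs A"
    by simp_all
  define \<kappa>' where "\<kappa>' = map_option ((+) (length ss)) \<circ> \<kappa>"
  have v: "val \<kappa>' p e = val \<kappa> p (\<lambda>n. e (length ss + n))" for e
    by (auto simp: val_def \<kappa>'_def fun_eq_iff split: option.split)
  have "dfn A P (ss @ \<Gamma>) (\<lambda>e. e k = term_val A (val \<kappa>' p e) (ts ! k))" if "k < length ts" for k
  proof (rule App.IH)
    show "ts ! k \<in> set ts" "wf_term A (ts ! k)" "k < length (ss @ \<Gamma>)"
      using that App.prems ss by auto
    show "(ss @ \<Gamma>) ! k = term_sort A (ts ! k)" using that ss by (auto simp: nth_append)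
    show "\<forall>v\<in>term_vars (ts ! k). okval A P (ss @ \<Gamma>) \<kappa>' p v"
    proof
      fix v assume "v \<in> term_vars (ts ! k)"
      then have "okval A P \<Gamma> \<kappa> p v" using App.prems that by auto
      then show "okval A P (ss @ \<Gamma>) \<kappa>' p v"
        by (auto simp: okval_def \<kappa>'_def split: option.splits)
    qed
  qed
  then have "dfn A P (ss @ \<Gamma>) (\<lambda>e. \<forall>k<length ts. e k = term_val A (val \<kappa>' p e) (ts ! k))"
    by (rule dfn_All_less)
  moreover have "dfn A P (ss @ \<Gamma>) (\<lambda>e. e (length ss + j) = funI A f (map e [0..<length ss]))"
    using App.prems ss by (intro dfn_fun) (auto simp: nth_append ss_def intro!: nth_equalityI)
  ultimately have "dfn A P (ss @ \<Gamma>) (\<lambda>e. (\<forall>k<length ts. map e [0..<length ss] ! k =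
      term_val A (val \<kappa> p (\<lambda>n. e (length ss + n))) (ts ! k)) \<and>
      e (length ss + j) = funI A f (map e [0..<length ss]))"
    unfolding v by (rule dfn_cong[OF dfn_conj]) (use ss in auto)
  then have "dfn A P \<Gamma> (\<lambda>e. \<exists>xs\<in>tuples A ss. (\<forall>k<length ts. xs ! k =
      term_val A (val \<kappa> p e) (ts ! k)) \<and> e j = funI A f xs)"
    using dfn_block_ex[OF ss(1), where Q = "\<lambda>e xs. (\<forall>k<length ts. xs ! k =
      term_val A (val \<kappa> p e) (ts ! k)) \<and> e j = funI A f xs"] by simp
  then show ?case
  proof (rule dfn_cong)
    fix e assume e: "wt A \<Gamma> e"
    define ys where "ys = map (term_val A (val \<kappa> p e)) ts"
    have "term_val A (val \<kappa> p e) t \<in> carrier A (term_sort A t)" if "t \<in> set ts" for t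
      using that App.prems by (intro term_val_in[OF wf _ e]) auto
    then have y: "ys \<in> tuples A ss"
      by (simp add: tuples_iff ys_def flip: ss(2))
    have n: "\<forall>k<length ts. ys ! k = term_val A (val \<kappa> p e) (ts ! k)" by (simp add: ys_def)
    have u: "xs = ys" if "xs \<in> tuples A ss" "\<forall>k<length ts. xs ! k = term_val A (val \<kappa> p e) (ts ! k)" for xs
      using that tuples_length[OF that(1)] ss(3) by (intro nth_equalityI) (simp_all add: ys_def)
    have t: "term_val A (val \<kappa> p e) (App f ts) = funI A f ys" by (simp add: ys_def)
    show "(\<exists>xs\<in>tuples A ss. (\<forall>k<length ts. xs ! k =
      term_val A (val \<kappa> p e) (ts ! k)) \<and> e j = funI A f xs) \<longleftrightarrow> e j = term_val A (val \<kappa> p e) (App f ts)"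
      unfolding t using y n u by blast
  qed
qed

lemma dfn_sat:
  assumes wf: "wf_structure A"
  shows "wf_formula A \<phi> ==> \<forall>v\<in>free_vars \<phi>. okval A P \<Gamma> \<kappa> p v ==>
    dfn A P \<Gamma> (\<lambda>e. sat A (val \<kappa> p e) \<phi>)"
proof (induction \<phi> arbitrary: \<Gamma> \<kappa>)
  case Fls
  then show ?case using dfn_False by simp
next
  case (Equal t u)
  define \<kappa>' where "\<kappa>' = map_option Suc \<circ> \<kappa>"
  have v: "val \<kappa>' p e = val \<kappa> p (\<lambda>n. e (Suc n))" for e
    by (auto simp: val_def \<kappa>'_def fun_eq_iff split: option.split)
  have ok: "okval A P (s # \<Gamma>) \<kappa>' p v" if "okval A P \<Gamma> \<kappa> p v" for v s
    using that by (auto simp: okval_def \<kappa>'_def split: option.splits)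
  have s: "term_sort A t \<in> sorts A" using term_sort_in[OF wf] Equal.prems by simp
  have "dfn A P (term_sort A t # \<Gamma>) (\<lambda>e. e 0 = term_val A (val \<kappa>' p e) t \<and> e 0 = term_val A (val \<kappa>' p e) u)"
    using Equal.prems ok by (intro dfn_conj dfn_term wf) auto
  then have "dfn A P \<Gamma> (\<lambda>e. \<exists>x\<in>carrier A (term_sort A t). x = term_val A (val \<kappa> p e) t \<and> x = term_val A (val \<kappa> p e) u)"
    unfolding v by (intro dfn_ex s)
  then show ?case
  proof (rule dfn_cong)
    fix e assume e: "wt A \<Gamma> e"
    have "term_val A (val \<kappa> p e) t \<in> carrier A (term_sort A t)"
      using Equal.prems by (intro term_val_in[OF wf _ e]) auto
    then show "(\<exists>x\<in>carrier A (term_sort A t). x = term_val A (val \<kappa> p e) t \<and> x = term_val A (val \<kappa> p e) u)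
      \<longleftrightarrow> sat A (val \<kappa> p e) (Equal t u)" by auto
  qed
next
  case (Rel r ts)
  define ss where "ss = rdom A r"
  have ss: "map (term_sort A) ts = ss" "r \<in> rels A" using Rel.prems by (auto simp: ss_def)
  moreover have "set ss \<subseteq> sorts A" using wf_rel(1)[OF wf ss(2)] by (simp add: ss_def)
  moreover have "length ss = length ts" using ss(1) by (metis length_map)
  ultimately have ss: "set ss \<subseteq> sorts A" "map (term_sort A) ts = ss" "length ss = length ts" "r \<in> rels A"
    by simp_all
  define \<kappa>' where "\<kappa>' = map_option ((+) (length ss)) \<circ> \<kappa>"
  have v: "val \<kappa>' p e = val \<kappa> p (\<lambda>n. e (length ss + n))" for e
    by (auto simp: val_def \<kappa>'_def fun_eq_iff split: option.split)
  have "dfn A P (ss @ \<Gamma>) (\<lambda>e. e k = term_val A (val \<kappa>' p e) (ts ! k))" if "k < length ts" for k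
  proof (rule dfn_term[OF wf])
    show "wf_term A (ts ! k)" "k < length (ss @ \<Gamma>)"
      using that Rel.prems ss by auto
    show "(ss @ \<Gamma>) ! k = term_sort A (ts ! k)" using that ss by (auto simp: nth_append)
    show "\<forall>v\<in>term_vars (ts ! k). okval A P (ss @ \<Gamma>) \<kappa>' p v"
    proof
      fix v assume "v \<in> term_vars (ts ! k)"
      then have "okval A P \<Gamma> \<kappa> p v" using Rel.prems that by auto
      then show "okval A P (ss @ \<Gamma>) \<kappa>' p v"
        by (auto simp: okval_def \<kappa>'_def split: option.splits)
    qed
  qed
  then have "dfn A P (ss @ \<Gamma>) (\<lambda>e. \<forall>k<length ts. e k = term_val A (val \<kappa>' p e) (ts ! k))"
    by (rule dfn_All_less)
  moreover have "dfn A P (ss @ \<Gamma>) (\<lambda>e. map e [0..<length ss] \<in> relI A r)"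
    using Rel.prems ss by (intro dfn_rel) (auto simp: nth_append ss_def intro!: nth_equalityI)
  ultimately have "dfn A P (ss @ \<Gamma>) (\<lambda>e. (\<forall>k<length ts. map e [0..<length ss] ! k =
      term_val A (val \<kappa> p (\<lambda>n. e (length ss + n))) (ts ! k)) \<and>
      map e [0..<length ss] \<in> relI A r)"
    unfolding v by (rule dfn_cong[OF dfn_conj]) (use ss in auto)
  then have "dfn A P \<Gamma> (\<lambda>e. \<exists>xs\<in>tuples A ss. (\<forall>k<length ts. xs ! k =
      term_val A (val \<kappa> p e) (ts ! k)) \<and> xs \<in> relI A r)"
    using dfn_block_ex[OF ss(1), where Q = "\<lambda>e xs. (\<forall>k<length ts. xs ! k =
      term_val A (val \<kappa> p e) (ts ! k)) \<and> xs \<in> relI A r"] by simp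
  then show ?case
  proof (rule dfn_cong)
    fix e assume e: "wt A \<Gamma> e"
    define ys where "ys = map (term_val A (val \<kappa> p e)) ts"
    have "term_val A (val \<kappa> p e) t \<in> carrier A (term_sort A t)" if "t \<in> set ts" for t
      using that Rel.prems by (intro term_val_in[OF wf _ e]) auto
    then have y: "ys \<in> tuples A ss"
      by (simp add: tuples_iff ys_def flip: ss(2))
    have n: "\<forall>k<length ts. ys ! k = term_val A (val \<kappa> p e) (ts ! k)" by (simp add: ys_def)
    have u: "xs = ys" if "xs \<in> tuples A ss" "\<forall>k<length ts. xs ! k = term_val A (val \<kappa> p e) (ts ! k)" for xs
      using that tuples_length[OF that(1)] ss(3) by (intro nth_equalityI) (simp_all add: ys_def)
    have t: "sat A (val \<kappa> p e) (Rel r ts) \<longleftrightarrow> ys \<in> relI A r" by (simp add: ys_def)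
    show "(\<exists>xs\<in>tuples A ss. (\<forall>k<length ts. xs ! k =
      term_val A (val \<kappa> p e) (ts ! k)) \<and> xs \<in> relI A r) \<longleftrightarrow> sat A (val \<kappa> p e) (Rel r ts)"
      unfolding t using y n u by blast
  qed
next
  case (Neg \<phi>)
  then show ?case by (auto intro: dfn_neg)
next
  case (Conj \<phi>1 \<phi>2)
  then show ?case by (auto intro: dfn_conj)
next
  case (Exi s i \<phi>)
  \<comment> \<open>The quantifier redirects its variable to the new place 0 and shifts all other
    places, so the formula itself need not be renamed.\<close>
  define \<kappa>' where "\<kappa>' = (map_option Suc \<circ> \<kappa>)((s, i) := Some 0)"
  have v: "val \<kappa>' p (case_nat x e) = (val \<kappa> p e)((s, i) := x)" for e x
    by (auto simp: val_def \<kappa>'_def fun_eq_iff split: option.split)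
  have "okval A P (s # \<Gamma>) \<kappa>' p v" if "v \<in> free_vars \<phi>" for v
  proof (cases "v = (s, i)")
    case False
    then have "okval A P \<Gamma> \<kappa> p v" using that Exi.prems by auto
    then show ?thesis using False by (auto simp: okval_def \<kappa>'_def split: option.splits)
  qed (auto simp: okval_def \<kappa>'_def)
  then have "dfn A P (s # \<Gamma>) (\<lambda>e. sat A (val \<kappa>' p e) \<phi>)" using Exi by auto
  from dfn_ex0[OF _ this] show ?case using Exi.prems by (simp add: v)
qed

lemma definable_over_dfn:
  assumes wf: "wf_structure A" and "definable_over A P ss D"
  shows "dfn A P ss (\<lambda>e. map e [0..<length ss] \<in> D)"
proof -
  obtain \<phi> p where 1: "wf_formula A \<phi>"
    "\<forall>(s, i) \<in> free_vars \<phi> - coord_vars ss. p (s, i) \<in> carrier A s \<inter> P s"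
    "D = {xs \<in> tuples A ss. sat A (\<lambda>(s, i). if (s, i) \<in> coord_vars ss then xs ! i else p (s, i)) \<phi>}"
    using assms(2) unfolding definable_over_def by blast
  define \<kappa> where "\<kappa> = (\<lambda>v. if v \<in> coord_vars ss then Some (snd v) else None)"
  have "\<forall>v\<in>free_vars \<phi>. okval A P ss \<kappa> p v"
    using 1(2) by (fastforce simp: okval_def \<kappa>_def coord_vars_iff)
  from dfn_sat[OF wf 1(1) this] show ?thesis
  proof (rule dfn_cong)
    fix e assume e: "wt A ss e"
    have "val \<kappa> p e = (\<lambda>(s, i). if (s, i) \<in> coord_vars ss then map e [0..<length ss] ! i else p (s, i))"
      by (auto simp: val_def \<kappa>_def coord_vars_iff fun_eq_iff)
    moreover have "map e [0..<length ss] \<in> tuples A ss" using e by (auto simp: tuples_iff wt_def)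
    ultimately show "sat A (val \<kappa> p e) \<phi> = (map e [0..<length ss] \<in> D)" using 1(3) by simp
  qed
qed

section \<open>Classical interpretations\<close>

definition okp :: "'s list => 's list => nat list => bool" where
  "okp \<Gamma> ts ps \<longleftrightarrow> (\<forall>p\<in>set ps. p < length \<Gamma>) \<and> map ((!) \<Gamma>) ps = ts"

lemma okp_length: "okp \<Gamma> ts ps ==> length ps = length ts"
  unfolding okp_def by auto

lemma okp_append: "okp \<Gamma> ts ps ==> okp \<Gamma> us qs ==> okp \<Gamma> (ts @ us) (ps @ qs)"
  unfolding okp_def by auto

lemma okp_prefix: "okp (ts @ \<Gamma>) ts [0..<length ts]"
  unfolding okp_def by (auto intro!: nth_equalityI simp: nth_append)

lemma okp_self: "okp \<Gamma> \<Gamma> [0..<length \<Gamma>]"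
  using okp_prefix[of \<Gamma> "[]"] by simp

lemma okp_shift: "okp \<Gamma> ts ps ==> okp (us @ \<Gamma>) ts (map ((+) (length us)) ps)"
  unfolding okp_def by (auto simp: comp_def)

lemma okp_Cons: "okp \<Gamma> (t # ts) (p # ps) \<longleftrightarrow> p < length \<Gamma> \<and> \<Gamma> ! p = t \<and> okp \<Gamma> ts ps"
  unfolding okp_def by auto

lemma okp_Nil [simp]: "okp \<Gamma> [] []"
  unfolding okp_def by auto

lemma dfn_okp:
  assumes "dfn A P ss (\<lambda>e. R (map e [0..<length ss]))" "okp \<Gamma> ss is"
  shows "dfn A P \<Gamma> (\<lambda>e. R (map e is))"
  using dfn_at[of A P ss R "is" \<Gamma>] assms by (simp add: okp_def)

lemma okp_tuples: "okp \<Gamma> ts ps ==> wt A \<Gamma> e ==> map e ps \<in> tuples A ts"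
  unfolding okp_def wt_def by (auto simp: tuples_iff)

section \<open>Concatenated tuples and their decoding\<close>

fun chunks :: "nat list => 'a list => 'a list list" where
  "chunks [] xs = []"
| "chunks (n # ns) xs = take n xs # chunks ns (drop n xs)"

lemma length_chunks [simp]: "length (chunks ns xs) = length ns"
  by (induction ns xs rule: chunks.induct) auto

lemma map_chunks: "map (map f) (chunks ns xs) = chunks ns (map f xs)"
  by (induction ns xs rule: chunks.induct) (auto simp: take_map drop_map)

lemma chunks_append: "chunks (map length xss @ ns) (concat xss @ ys) = xss @ chunks ns ys"
  by (induction xss) auto

lemma chunks_concat: "chunks (map length xss) (concat xss) = xss"
  using chunks_append[of xss "[]" "[]"] by simp

abbreviation tt :: "('t => 's list) => 't list => 's list" where
  "tt \<tau> ss \<equiv> concat (map \<tau> ss)"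

definition cks :: "('t => 's list) => 't list => 'a list => 'a list list" where
  "cks \<tau> ss ys = chunks (map (\<lambda>s. length (\<tau> s)) ss) ys"

definition valid :: "('t => 's list) => ('t => 'a list set) => 't list => 'a list => bool" where
  "valid \<tau> X ss ys \<longleftrightarrow> (\<forall>i<length ss. cks \<tau> ss ys ! i \<in> X (ss ! i))"

definition dec :: "('t => 's list) => ('t => 'a list => 'b) => 't list => 'a list => 'b list" where
  "dec \<tau> \<pi> ss ys = map2 \<pi> ss (cks \<tau> ss ys)"

lemma length_cks [simp]: "length (cks \<tau> ss ys) = length ss"
  by (simp add: cks_def)

lemma length_dec [simp]: "length (dec \<tau> \<pi> ss ys) = length ss"
  by (simp add: dec_def)

lemma nth_dec: "i < length ss ==> dec \<tau> \<pi> ss ys ! i = \<pi> (ss ! i) (cks \<tau> ss ys ! i)"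
  by (simp add: dec_def)

lemma cks_Nil [simp]: "cks \<tau> [] ys = []"
  by (simp add: cks_def)

lemma cks_map: "cks \<tau> ss (map e ps) ! i = map e (cks \<tau> ss ps ! i)" if "i < length ss"
  using that nth_map[of i "cks \<tau> ss ps" "map e"] by (simp add: cks_def map_chunks)

lemma cks_concat:
  assumes "length xss = length ss" "\<And>i. i < length ss ==> length (xss ! i) = length (\<tau> (ss ! i))"
  shows "cks \<tau> ss (concat xss) = xss"
proof -
  have "map (\<lambda>s. length (\<tau> s)) ss = map length xss"
    using assms by (intro nth_equalityI) auto
  then show ?thesis unfolding cks_def by (simp add: chunks_concat)
qed

lemma okp_cks: "okp \<Gamma> (tt \<tau> ss) ps ==> i < length ss ==> okp \<Gamma> (\<tau> (ss ! i)) (cks \<tau> ss ps ! i)"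
proof (induction ss arbitrary: ps i)
  case (Cons s ss)
  define n where "n = length (\<tau> s)"
  have len: "length ps = n + length (tt \<tau> ss)" using okp_length[OF Cons.prems(1)] by (simp add: n_def)
  have "map ((!) \<Gamma>) (take n ps @ drop n ps) = \<tau> s @ tt \<tau> ss" using Cons.prems(1) by (simp add: okp_def)
  then have 1: "map ((!) \<Gamma>) (take n ps) = \<tau> s" "map ((!) \<Gamma>) (drop n ps) = tt \<tau> ss"
    unfolding map_append using len by (simp_all add: append_eq_append_conv n_def)
  have 2: "\<forall>p\<in>set (take n ps). p < length \<Gamma>" "\<forall>p\<in>set (drop n ps). p < length \<Gamma>"
    using Cons.prems(1) in_set_takeD in_set_dropD unfolding okp_def by metis+
  have 3: "cks \<tau> (s # ss) ps = take n ps # cks \<tau> ss (drop n ps)" by (simp add: cks_def n_def)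
  show ?case
  proof (cases i)
    case 0
    then show ?thesis using 1 2 3 by (simp add: okp_def)
  next
    case (Suc j)
    have "okp \<Gamma> (tt \<tau> ss) (drop n ps)" using 1 2 by (simp add: okp_def)
    from Cons.IH[OF this, of j] show ?thesis using Suc Cons.prems 3 by simp
  qed
qed simp

lemma dec_append:
  assumes "length xs = length (tt \<tau> ss)"
  shows "dec \<tau> \<pi> (ss @ ts) (xs @ ys) = dec \<tau> \<pi> ss xs @ dec \<tau> \<pi> ts ys"
    and "valid \<tau> X (ss @ ts) (xs @ ys) \<longleftrightarrow> valid \<tau> X ss xs \<and> valid \<tau> X ts ys"
proof -
  have c: "cks \<tau> (ss @ ts) (xs @ ys) = cks \<tau> ss xs @ cks \<tau> ts ys"
    using assms unfolding cks_def by (induction ss arbitrary: xs) auto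
  show "dec \<tau> \<pi> (ss @ ts) (xs @ ys) = dec \<tau> \<pi> ss xs @ dec \<tau> \<pi> ts ys"
    unfolding dec_def c by simp
  show "valid \<tau> X (ss @ ts) (xs @ ys) \<longleftrightarrow> valid \<tau> X ss xs \<and> valid \<tau> X ts ys"
  proof
    assume L: "valid \<tau> X (ss @ ts) (xs @ ys)"
    have "cks \<tau> ss xs ! i \<in> X (ss ! i)" if "i < length ss" for i
      using L[unfolded valid_def c, rule_format, of i] that by (simp add: nth_append)
    moreover have "cks \<tau> ts ys ! i \<in> X (ts ! i)" if "i < length ts" for i
      using L[unfolded valid_def c, rule_format, of "length ss + i"] that by (simp add: nth_append)
    ultimately show "valid \<tau> X ss xs \<and> valid \<tau> X ts ys" by (simp add: valid_def)
  qed (auto simp: valid_def c nth_append)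
qed

lemma dec_Cons:
  assumes "length xs = length (\<tau> s)"
  shows "dec \<tau> \<pi> (s # ts) (xs @ ys) = \<pi> s xs # dec \<tau> \<pi> ts ys"
    and "valid \<tau> X (s # ts) (xs @ ys) \<longleftrightarrow> xs \<in> X s \<and> valid \<tau> X ts ys"
  using dec_append(1)[of xs \<tau> "[s]" \<pi> ts ys] assms
    dec_append(2)[of xs \<tau> "[s]" X ts ys]
  by (simp_all add: dec_def cks_def valid_def)

lemma dec_Nil [simp]: "dec \<tau> \<pi> [] ys = []" "valid \<tau> X [] ys"
  by (simp_all add: dec_def valid_def)

lemma dec_single:
  assumes "length xs = length (\<tau> s)"
  shows "dec \<tau> \<pi> [s] xs = [\<pi> s xs]" "valid \<tau> X [s] xs \<longleftrightarrow> xs \<in> X s"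
  using dec_Cons(1)[of xs \<tau> s \<pi> "[]" "[]"] dec_Cons(2)[of xs \<tau> s X "[]" "[]"] assms by simp_all

text \<open>Read as pullback along the coordinate maps. Validity is part of the predicate because
  \<pi> carries no meaning outside \<open>X\<close>.\<close>

definition pbk :: "('s, 'f, 'r, 'a) fo_structure => ('t => 's list) => ('t => 'a list set) =>
    ('t => 'a list => 'b) => 't list => ('b list => bool) => bool" where
  "pbk A \<tau> X \<pi> ss R \<longleftrightarrow> dfn A (carrier A) (tt \<tau> ss)
     (\<lambda>e. valid \<tau> X ss (map e [0..<length (tt \<tau> ss)]) \<and> R (dec \<tau> \<pi> ss (map e [0..<length (tt \<tau> ss)])))"

lemma pbk_at:
  assumes "pbk A \<tau> X \<pi> ss R" "okp \<Gamma> (tt \<tau> ss) ps"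
  shows "dfn A (carrier A) \<Gamma> (\<lambda>e. valid \<tau> X ss (map e ps) \<and> R (dec \<tau> \<pi> ss (map e ps)))"
  using dfn_okp[where R = "\<lambda>ys. valid \<tau> X ss ys \<and> R (dec \<tau> \<pi> ss ys)", OF assms(1)[unfolded pbk_def] assms(2)] .

text \<open>An interpretation of \<open>B\<close> in \<open>A\<close> in the sense of coordinate maps: \<open>\<pi> s\<close> maps a definable
  set \<open>X s\<close> of tuples of type \<open>\<tau> s\<close> onto the sort \<open>s\<close> of \<open>B\<close>, and the preimages of
  equality and of the primitives of \<open>B\<close> are definable.\<close>

locale cinterp =
  fixes A :: "('s, 'f, 'r, 'a) fo_structure" and B :: "('t, 'g, 'q, 'b) fo_structure"
    and \<tau> :: "'t => 's list" and X :: "'t => 'a list set" and \<pi> :: "'t => 'a list => 'b"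
  assumes wfA: "wf_structure A" and wfB: "wf_structure B"
    and \<tau>_sorts: "s \<in> sorts B ==> set (\<tau> s) \<subseteq> sorts A"
    and X_sub: "s \<in> sorts B ==> X s \<subseteq> tuples A (\<tau> s)"
    and surj: "s \<in> sorts B ==> \<pi> s ` X s = carrier B s"
    and X_dfn: "s \<in> sorts B ==> pbk A \<tau> X \<pi> [s] (\<lambda>_. True)"
    and eq_dfn: "s \<in> sorts B ==> pbk A \<tau> X \<pi> [s, s] (\<lambda>xs. xs ! 0 = xs ! 1)"
    and rel_dfn: "r \<in> rels B ==> pbk A \<tau> X \<pi> (rdom B r) (\<lambda>xs. xs \<in> relI B r)"
    and fun_dfn: "f \<in> funs B ==> pbk A \<tau> X \<pi> (fcod B f # fdom B f) (\<lambda>xs. hd xs = funI B f (tl xs))"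
begin

lemma tt_sorts: "set ss \<subseteq> sorts B ==> set (tt \<tau> ss) \<subseteq> sorts A"
  using \<tau>_sorts by auto

lemma X_length: "s \<in> sorts B ==> x \<in> X s ==> length x = length (\<tau> s)"
  using X_sub tuples_length by blast

lemma X_at: "s \<in> sorts B ==> okp \<Gamma> (\<tau> s) ps ==> dfn A (carrier A) \<Gamma> (\<lambda>e. map e ps \<in> X s)"
  using pbk_at[OF X_dfn, of s \<Gamma> ps] by (simp add: dec_single okp_length)

lemma valid_at:
  assumes "set ss \<subseteq> sorts B" "okp \<Gamma> (tt \<tau> ss) ps"
  shows "dfn A (carrier A) \<Gamma> (\<lambda>e. valid \<tau> X ss (map e ps))"
proof -
  have "dfn A (carrier A) \<Gamma> (\<lambda>e. \<forall>i<length ss. map e (cks \<tau> ss ps ! i) \<in> X (ss ! i))"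
    using assms by (intro dfn_All_less X_at okp_cks) auto
  then show ?thesis by (rule dfn_cong) (simp add: valid_def cks_map)
qed

lemma dec_in:
  assumes "set ss \<subseteq> sorts B" "valid \<tau> X ss ys"
  shows "dec \<tau> \<pi> ss ys \<in> tuples B ss"
proof -
  have "\<pi> (ss ! i) (cks \<tau> ss ys ! i) \<in> carrier B (ss ! i)" if "i < length ss" for i
  proof -
    have "ss ! i \<in> sorts B" using assms that by auto
    then show ?thesis using surj[of "ss ! i"] assms(2) that unfolding valid_def by blast
  qed
  then show ?thesis by (simp add: tuples_iff nth_dec)
qed

lemma dec_surj:
  assumes "set ss \<subseteq> sorts B" "bs \<in> tuples B ss"
  obtains ys where "ys \<in> tuples A (tt \<tau> ss)" "valid \<tau> X ss ys" "dec \<tau> \<pi> ss ys = bs"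
proof -
  have "\<exists>ys. ys \<in> tuples A (tt \<tau> ss) \<and> valid \<tau> X ss ys \<and> dec \<tau> \<pi> ss ys = bs"
    using assms
  proof (induction ss arbitrary: bs)
    case (Cons s ss)
    obtain b cs where b: "bs = b # cs" "b \<in> carrier B s" "cs \<in> tuples B ss"
      using Cons.prems by (elim tuples_ConsE)
    obtain ys where ys: "ys \<in> tuples A (tt \<tau> ss)" "valid \<tau> X ss ys" "dec \<tau> \<pi> ss ys = cs"
      using Cons.IH[OF _ b(3)] Cons.prems by auto
    have s: "s \<in> sorts B" using Cons.prems by simp
    obtain x where x: "x \<in> X s" "\<pi> s x = b" using b(2) unfolding surj[OF s, symmetric] by blast
    have len: "length x = length (\<tau> s)" using X_length x Cons.prems by auto
    have "x \<in> tuples A (\<tau> s)" using X_sub x Cons.prems by auto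
    then show ?case using ys x b len
      by (intro exI[of _ "x @ ys"]) (simp add: dec_Cons tuples_append)
  qed auto
  then show ?thesis using that by blast
qed

lemma eq_at:
  assumes "s \<in> sorts B" "okp \<Gamma> (\<tau> s) ps" "okp \<Gamma> (\<tau> s) qs"
  shows "dfn A (carrier A) \<Gamma> (\<lambda>e. map e ps \<in> X s \<and> map e qs \<in> X s \<and> \<pi> s (map e ps) = \<pi> s (map e qs))"
proof -
  have o: "okp \<Gamma> (tt \<tau> [s, s]) (ps @ qs)" using assms by (simp add: okp_append)
  have l: "length (map e ps) = length (\<tau> s)" "length (map e qs) = length (\<tau> s)" for e :: "nat => 'a"
    using okp_length[OF assms(2)] okp_length[OF assms(3)] by simp_all
  have "dec \<tau> \<pi> [s, s] (map e (ps @ qs)) = [\<pi> s (map e ps), \<pi> s (map e qs)]" for e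
    using dec_Cons(1)[of "map e ps" \<tau> s \<pi> "[s]" "map e qs"] dec_single(1)[of "map e qs" \<tau> s \<pi>] l
    by (simp del: length_map)
  note d = this
  have v: "valid \<tau> X [s, s] (map e (ps @ qs)) \<longleftrightarrow> map e ps \<in> X s \<and> map e qs \<in> X s" for e
    using dec_Cons(2)[of "map e ps" \<tau> s X "[s]" "map e qs"] dec_single(2)[of "map e qs" \<tau> s X] l
    by (simp del: length_map)
  from pbk_at[OF eq_dfn[OF assms(1)], of \<Gamma> "ps @ qs", OF o] show ?thesis
  proof (rule dfn_cong)
    fix e
    show "(valid \<tau> X [s, s] (map e (ps @ qs)) \<and>
        dec \<tau> \<pi> [s, s] (map e (ps @ qs)) ! 0 = dec \<tau> \<pi> [s, s] (map e (ps @ qs)) ! 1) \<longleftrightarrow>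
      map e ps \<in> X s \<and> map e qs \<in> X s \<and> \<pi> s (map e ps) = \<pi> s (map e qs)"
      unfolding d v by simp
  qed
qed

text \<open>A constant of B is compared with the image of one fixed preimage, whose entries serve as
  parameters in A.\<close>

lemma const_at:
  assumes "s \<in> sorts B" "okp \<Gamma> (\<tau> s) ps" "c \<in> carrier B s"
  shows "dfn A (carrier A) \<Gamma> (\<lambda>e. map e ps \<in> X s \<and> \<pi> s (map e ps) = c)"
proof -
  obtain x where x: "x \<in> X s" "\<pi> s x = c"
    using assms(3) unfolding surj[OF assms(1), symmetric] by blast
  have xt: "x \<in> tuples A (\<tau> s)" using X_sub assms x by blast
  define n where "n = length (\<tau> s)"
  have "dfn A (carrier A) (\<tau> s @ \<Gamma>) (\<lambda>e. \<forall>k<n. e k = x ! k)"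
  proof (intro dfn_All_less dfn_const)
    fix k assume "k < n"
    then show "k < length (\<tau> s @ \<Gamma>)" "x ! k \<in> carrier A ((\<tau> s @ \<Gamma>) ! k)" "x ! k \<in> carrier A ((\<tau> s @ \<Gamma>) ! k)"
      using xt by (auto simp: n_def tuples_iff nth_append)
  qed
  from dfn_conj[OF this eq_at[OF assms(1) okp_prefix[of "\<tau> s" \<Gamma>] okp_shift[OF assms(2), of "\<tau> s"]]]
  have "dfn A (carrier A) \<Gamma> (\<lambda>e. \<exists>y\<in>tuples A (\<tau> s). (\<forall>k<n. y ! k = x ! k) \<and> y \<in> X s \<and> map e ps \<in> X s \<and> \<pi> s y = \<pi> s (map e ps))"
    by (intro dfn_block_ex \<tau>_sorts assms(1)) (simp add: n_def comp_def)
  then show ?thesis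
  proof (rule dfn_cong)
    fix e
    have "y = x" if "y \<in> tuples A (\<tau> s)" "\<forall>k<n. y ! k = x ! k" for y
      using that tuples_length[OF xt] tuples_length[OF that(1)] by (intro nth_equalityI) (simp_all add: n_def)
    then show "(\<exists>y\<in>tuples A (\<tau> s). (\<forall>k<n. y ! k = x ! k) \<and> y \<in> X s \<and> map e ps \<in> X s \<and> \<pi> s y = \<pi> s (map e ps))
      \<longleftrightarrow> map e ps \<in> X s \<and> \<pi> s (map e ps) = c" using x xt by metis
  qed
qed

text \<open>The translation of formulas along an interpretation. A quantifier over a sort of B
  becomes one over the tuples representing its elements, which loses nothing because \<pi> is
  surjective.\<close>

lemma pull_env:
  assumes "dfn B P \<Gamma> Q" "set \<Gamma> \<subseteq> sorts B"
  shows "dfn A (carrier A) (tt \<tau> \<Gamma>) (\<lambda>e. valid \<tau> X \<Gamma> (map e [0..<length (tt \<tau> \<Gamma>)]) \<and>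
    Q (\<lambda>i. dec \<tau> \<pi> \<Gamma> (map e [0..<length (tt \<tau> \<Gamma>)]) ! i))"
  using assms
proof induction
  case (dfn_False \<Gamma>)
  show ?case using dfn.dfn_False by simp
next
  case (dfn_eq i \<Gamma> j)
  define ps where "ps = [0..<length (tt \<tau> \<Gamma>)]"
  have o: "okp (tt \<tau> \<Gamma>) (tt \<tau> \<Gamma>) ps" unfolding ps_def by (rule okp_self)
  have s: "\<Gamma> ! i \<in> sorts B" using dfn_eq.hyps(1) dfn_eq.prems by auto
  have oj: "okp (tt \<tau> \<Gamma>) (\<tau> (\<Gamma> ! i)) (cks \<tau> \<Gamma> ps ! j)" using okp_cks[OF o, of j] dfn_eq.hyps by simp
  from dfn_conj[OF valid_at[OF dfn_eq.prems o] eq_at[OF s okp_cks[OF o dfn_eq.hyps(1)] oj]]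
  show ?case unfolding ps_def[symmetric]
    by (rule dfn_cong) (use dfn_eq.hyps in \<open>auto simp: valid_def nth_dec cks_map\<close>)
next
  case (dfn_const i \<Gamma> c)
  define ps where "ps = [0..<length (tt \<tau> \<Gamma>)]"
  have o: "okp (tt \<tau> \<Gamma>) (tt \<tau> \<Gamma>) ps" unfolding ps_def by (rule okp_self)
  have s: "\<Gamma> ! i \<in> sorts B" using dfn_const.hyps(1) dfn_const.prems by auto
  from dfn_conj[OF valid_at[OF dfn_const.prems o] const_at[OF s okp_cks[OF o dfn_const.hyps(1)] dfn_const.hyps(2)]]
  show ?case unfolding ps_def[symmetric]
    by (rule dfn_cong) (use dfn_const.hyps in \<open>auto simp: valid_def nth_dec cks_map\<close>)
next
  case (dfn_rel r "is" \<Gamma>)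
  define ps where "ps = [0..<length (tt \<tau> \<Gamma>)]"
  have o: "okp (tt \<tau> \<Gamma>) (tt \<tau> \<Gamma>) ps" unfolding ps_def by (rule okp_self)
  define qs where "qs = map (\<lambda>i. cks \<tau> \<Gamma> ps ! i) is"
  define ss where "ss = map ((!) \<Gamma>) is"
  have len: "length qs = length ss" by (simp add: qs_def ss_def)
  have qo: "okp (tt \<tau> \<Gamma>) (\<tau> (ss ! k)) (qs ! k)" if "k < length ss" for k
    using that okp_cks[OF o, of "is ! k"] dfn_rel.hyps(2) by (simp add: qs_def ss_def)
  have oo: "okp (tt \<tau> \<Gamma>) (tt \<tau> ss) (concat qs)"
    using len qo
  proof (induction qs ss rule: list_induct2)
    case (Cons q qs s ss)
    have "okp (tt \<tau> \<Gamma>) (\<tau> s) q" using Cons.prems[of 0] by simp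
    moreover have "okp (tt \<tau> \<Gamma>) (\<tau> (ss ! k)) (qs ! k)" if "k < length ss" for k
      using Cons.prems[of "Suc k"] that by simp
    ultimately show ?case using Cons.IH by (simp add: okp_append)
  qed simp
  have ck: "cks \<tau> ss (map e (concat qs)) = map (map e) qs" for e :: "nat => 'a"
    unfolding map_concat using len qo okp_length by (intro cks_concat) fastforce+
  have d: "dec \<tau> \<pi> ss (map e (concat qs)) = map (\<lambda>i. dec \<tau> \<pi> \<Gamma> (map e ps) ! i) is" for e
    unfolding dec_def[of _ _ ss] ck using dfn_rel.hyps(2)
    by (intro nth_equalityI) (auto simp: qs_def ss_def nth_dec cks_map)
  have v: "valid \<tau> X ss (map e (concat qs))" if "valid \<tau> X \<Gamma> (map e ps)" for e
    unfolding valid_def ck using that dfn_rel.hyps(2)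
    by (auto simp: qs_def ss_def valid_def cks_map)
  have ss: "rdom B r = ss" using dfn_rel.hyps by (simp add: ss_def)
  from dfn_conj[OF valid_at[OF dfn_rel.prems o] pbk_at[OF rel_dfn[OF dfn_rel.hyps(1), unfolded ss], of "tt \<tau> \<Gamma>" "concat qs", OF oo]]
  show ?case unfolding ps_def[symmetric] by (rule dfn_cong) (use v d in auto)
next
  case (dfn_fun f "is" \<Gamma> j)
  define js where "js = j # is"
  have js: "\<forall>i\<in>set js. i < length \<Gamma>" using dfn_fun.hyps by (simp add: js_def)
  define ps where "ps = [0..<length (tt \<tau> \<Gamma>)]"
  have o: "okp (tt \<tau> \<Gamma>) (tt \<tau> \<Gamma>) ps" unfolding ps_def by (rule okp_self)
  define qs where "qs = map (\<lambda>i. cks \<tau> \<Gamma> ps ! i) js"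
  define ss where "ss = map ((!) \<Gamma>) js"
  have len: "length qs = length ss" by (simp add: qs_def ss_def)
  have qo: "okp (tt \<tau> \<Gamma>) (\<tau> (ss ! k)) (qs ! k)" if "k < length ss" for k
    using that okp_cks[OF o, of "js ! k"] js by (simp add: qs_def ss_def)
  have oo: "okp (tt \<tau> \<Gamma>) (tt \<tau> ss) (concat qs)"
    using len qo
  proof (induction qs ss rule: list_induct2)
    case (Cons q qs s ss)
    have "okp (tt \<tau> \<Gamma>) (\<tau> s) q" using Cons.prems[of 0] by simp
    moreover have "okp (tt \<tau> \<Gamma>) (\<tau> (ss ! k)) (qs ! k)" if "k < length ss" for k
      using Cons.prems[of "Suc k"] that by simp
    ultimately show ?case using Cons.IH by (simp add: okp_append)
  qed simp
  have ck: "cks \<tau> ss (map e (concat qs)) = map (map e) qs" for e :: "nat => 'a"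
    unfolding map_concat using len qo okp_length by (intro cks_concat) fastforce+
  have d: "dec \<tau> \<pi> ss (map e (concat qs)) = map (\<lambda>i. dec \<tau> \<pi> \<Gamma> (map e ps) ! i) js" for e
    unfolding dec_def[of _ _ ss] ck using js
    by (intro nth_equalityI) (auto simp: qs_def ss_def nth_dec cks_map)
  have v: "valid \<tau> X ss (map e (concat qs))" if "valid \<tau> X \<Gamma> (map e ps)" for e
    unfolding valid_def ck using that js
    by (auto simp: qs_def ss_def valid_def cks_map)
  have ss: "fcod B f # fdom B f = ss" using dfn_fun.hyps by (simp add: ss_def js_def)
  from dfn_conj[OF valid_at[OF dfn_fun.prems o] pbk_at[OF fun_dfn[OF dfn_fun.hyps(1), unfolded ss], of "tt \<tau> \<Gamma>" "concat qs", OF oo]]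
  show ?case unfolding ps_def[symmetric] by (rule dfn_cong) (use v d in \<open>auto simp: js_def\<close>)
next
  case (dfn_neg \<Gamma> Q)
  \<comment> \<open>Negation would admit invalid tuples, so validity is imposed once more.\<close>
  have "dfn A (carrier A) (tt \<tau> \<Gamma>) (\<lambda>e. valid \<tau> X \<Gamma> (map e [0..<length (tt \<tau> \<Gamma>)]))"
    by (rule valid_at[OF dfn_neg.prems okp_self])
  from dfn_conj[OF this dfn.dfn_neg[OF dfn_neg.IH[OF dfn_neg.prems]]]
  show ?case by (rule dfn_cong) blast
next
  case (dfn_conj \<Gamma> Q R)
  from dfn.dfn_conj[OF dfn_conj.IH(1)[OF dfn_conj.prems] dfn_conj.IH(2)[OF dfn_conj.prems]]
  show ?case by (rule dfn_cong) blast
next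
  case (dfn_ex0 s \<Gamma> Q)
  define n where "n = length (tt \<tau> \<Gamma>)"
  define m where "m = length (\<tau> s)"
  have ss: "set (s # \<Gamma>) \<subseteq> sorts B" using dfn_ex0.hyps dfn_ex0.prems by simp
  have 1: "[0..<length (tt \<tau> (s # \<Gamma>))] = [0..<m] @ map ((+) m) [0..<n]"
    by (intro nth_equalityI) (auto simp: nth_append m_def n_def)
  have 2: "(\<lambda>i. (x # xs) ! i) = case_nat x (\<lambda>i. xs ! i)" for x :: 'b and xs
    by (auto simp: fun_eq_iff split: nat.split)
  have 3: "map e ([0..<m] @ map ((+) m) [0..<n]) = map e [0..<m] @ map (\<lambda>k. e (m + k)) [0..<n]" for e :: "nat => 'a"
    by simp
  have "dfn A (carrier A) (\<tau> s @ tt \<tau> \<Gamma>) (\<lambda>e. map e [0..<m] \<in> X s \<and> valid \<tau> X \<Gamma> (map (\<lambda>k. e (m + k)) [0..<n]) \<and>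
    Q (case_nat (\<pi> s (map e [0..<m])) (\<lambda>i. dec \<tau> \<pi> \<Gamma> (map (\<lambda>k. e (m + k)) [0..<n]) ! i)))"
    using dfn_ex0.IH[OF ss] unfolding 1 3 by (simp add: dec_Cons m_def 2)
  then have "dfn A (carrier A) (tt \<tau> \<Gamma>) (\<lambda>e. \<exists>y\<in>tuples A (\<tau> s). y \<in> X s \<and> valid \<tau> X \<Gamma> (map e [0..<n]) \<and>
    Q (case_nat (\<pi> s y) (\<lambda>i. dec \<tau> \<pi> \<Gamma> (map e [0..<n]) ! i)))"
    by (intro dfn_block_ex \<tau>_sorts dfn_ex0.hyps(1)) (simp add: m_def)
  then show ?case unfolding n_def[symmetric]
  proof (rule dfn_cong)
    fix e
    show "(\<exists>y\<in>tuples A (\<tau> s). y \<in> X s \<and> valid \<tau> X \<Gamma> (map e [0..<n]) \<and>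
      Q (case_nat (\<pi> s y) (\<lambda>i. dec \<tau> \<pi> \<Gamma> (map e [0..<n]) ! i))) \<longleftrightarrow> valid \<tau> X \<Gamma> (map e [0..<n]) \<and>
      (\<exists>x\<in>carrier B s. Q (case_nat x (\<lambda>i. dec \<tau> \<pi> \<Gamma> (map e [0..<n]) ! i)))"
      unfolding surj[OF dfn_ex0.hyps(1), symmetric] using X_sub[OF dfn_ex0.hyps(1)] by blast
  qed
next
  case (dfn_cong \<Gamma> Q R)
  from dfn_cong.IH[OF dfn_cong.prems] show ?case
  proof (rule dfn.dfn_cong)
    fix e
    show "(valid \<tau> X \<Gamma> (map e [0..<length (tt \<tau> \<Gamma>)]) \<and> Q (\<lambda>i. dec \<tau> \<pi> \<Gamma> (map e [0..<length (tt \<tau> \<Gamma>)]) ! i)) \<longleftrightarrow>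
      (valid \<tau> X \<Gamma> (map e [0..<length (tt \<tau> \<Gamma>)]) \<and> R (\<lambda>i. dec \<tau> \<pi> \<Gamma> (map e [0..<length (tt \<tau> \<Gamma>)]) ! i))"
    proof (cases "valid \<tau> X \<Gamma> (map e [0..<length (tt \<tau> \<Gamma>)])")
      case True
      from dec_in[OF dfn_cong.prems this]
      have "wt B \<Gamma> (\<lambda>i. dec \<tau> \<pi> \<Gamma> (map e [0..<length (tt \<tau> \<Gamma>)]) ! i)" by (simp add: wt_def tuples_iff)
      from dfn_cong.hyps(2)[OF this] show ?thesis by simp
    qed simp
  qed
qed

lemma pull:
  assumes "dfn B P ss (\<lambda>e. R (map e [0..<length ss]))" "set ss \<subseteq> sorts B"
  shows "pbk A \<tau> X \<pi> ss R"
proof -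
  have *: "map ((!) (dec \<tau> \<pi> ss ys)) [0..<length ss] = dec \<tau> \<pi> ss ys" for ys
    using map_nth[of "dec \<tau> \<pi> ss ys"] by simp
  show ?thesis using pull_env[OF assms] unfolding pbk_def * .
qed

end

subsection \<open>Imaginaries\<close>

lemma eq_sorts [simp]:
  "Home s \<in> sorts (eq_structure A) \<longleftrightarrow> s \<in> sorts A"
  "Quot ss E \<in> sorts (eq_structure A) \<longleftrightarrow> zero_def_equiv A ss E"
  by (auto simp: eq_structure_def)

lemma eq_funs [simp]:
  "Old f \<in> funs (eq_structure A) \<longleftrightarrow> f \<in> funs A"
  "Proj ss E \<in> funs (eq_structure A) \<longleftrightarrow> zero_def_equiv A ss E"
  by (auto simp: eq_structure_def)

lemma eq_simps [simp]:
  "fdom (eq_structure A) (Old f) = map Home (fdom A f)"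
  "fcod (eq_structure A) (Old f) = Home (fcod A f)"
  "fdom (eq_structure A) (Proj ss E) = map Home ss"
  "fcod (eq_structure A) (Proj ss E) = Quot ss E"
  "rels (eq_structure A) = rels A"
  "rdom (eq_structure A) r = map Home (rdom A r)"
  "carrier (eq_structure A) (Home s) = Elem ` carrier A s"
  "carrier (eq_structure A) (Quot ss E) = Class ` (tuples A ss // E)"
  "funI (eq_structure A) (Old f) xs = Elem (funI A f (map the_Elem xs))"
  "funI (eq_structure A) (Proj ss E) xs = Class (E `` {map the_Elem xs})"
  "relI (eq_structure A) r = map Elem ` relI A r"
  by (auto simp: eq_structure_def)

lemma map_the_Elem [simp]: "map (the_Elem \<circ> Elem) xs = xs" "map (\<lambda>x. the_Elem (Elem x)) xs = xs"
  by (induction xs) auto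

lemma tuples_eq: "tuples (eq_structure A) (map Home ss) = map Elem ` tuples A ss"
proof (intro set_eqI iffI)
  fix xs assume "xs \<in> tuples (eq_structure A) (map Home ss)"
  then have "length xs = length ss" "\<forall>i<length ss. xs ! i \<in> Elem ` carrier A (ss ! i)"
    by (simp_all add: tuples_iff)
  then have "map the_Elem xs \<in> tuples A ss" "xs = map Elem (map the_Elem xs)"
    by (auto simp: tuples_iff intro!: nth_equalityI)
  then show "xs \<in> map Elem ` tuples A ss" by blast
qed (auto simp: tuples_iff)

lemma wf_eq:
  assumes "wf_structure A"
  shows "wf_structure (eq_structure A)"
  unfolding wf_structure_def
proof (intro conjI ballI)
  fix F assume F: "F \<in> funs (eq_structure A)"
  show "set (fdom (eq_structure A) F) \<subseteq> sorts (eq_structure A)"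
    using F wf_fun(1)[OF assms] by (cases F) (fastforce simp: zero_def_equiv_def)+
  show "fcod (eq_structure A) F \<in> sorts (eq_structure A)"
    using F wf_fun[OF assms] by (cases F) auto
  fix xs assume xs: "xs \<in> tuples (eq_structure A) (fdom (eq_structure A) F)"
  show "funI (eq_structure A) F xs \<in> carrier (eq_structure A) (fcod (eq_structure A) F)"
    using F xs wf_fun[OF assms] by (cases F) (auto simp: tuples_eq intro!: quotientI)
next
  fix r assume r: "r \<in> rels (eq_structure A)"
  show "set (rdom (eq_structure A) r) \<subseteq> sorts (eq_structure A)"
    using r wf_rel(1)[OF assms] by fastforce
  show "relI (eq_structure A) r \<subseteq> tuples (eq_structure A) (rdom (eq_structure A) r)"
    using r wf_rel(2)[OF assms] by (auto simp: tuples_eq)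
qed

text \<open>The home sorts of the expansion carry the old primitives, so a derivation can be
  repeated there rule by rule, with parameters renamed by \<open>Elem\<close>.\<close>

lemma dfn_lift:
  assumes "dfn A P \<Gamma> Q" "\<And>s. Elem ` P s \<subseteq> P' (Home s)"
  shows "dfn (eq_structure A) P' (map Home \<Gamma>) (\<lambda>e. Q (\<lambda>i. the_Elem (e i)))"
  using assms(1)
proof induction
  case (dfn_False \<Gamma>)
  show ?case by (rule dfn.dfn_False)
next
  case (dfn_eq i \<Gamma> j)
  have "dfn (eq_structure A) P' (map Home \<Gamma>) (\<lambda>e. e i = e j)"
    using dfn_eq by (intro dfn.dfn_eq) auto
  then show ?case
  proof (rule dfn_cong)
    fix e assume "wt (eq_structure A) (map Home \<Gamma>) e"
    then have "e i \<in> range Elem" "e j \<in> range Elem" using dfn_eq.hyps by (auto simp: wt_def)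
    then show "e i = e j \<longleftrightarrow> the_Elem (e i) = the_Elem (e j)" by auto
  qed
next
  case (dfn_const i \<Gamma> c)
  have "Elem c \<in> P' (Home (\<Gamma> ! i))" using assms(2) dfn_const.hyps(3) by blast
  then have "dfn (eq_structure A) P' (map Home \<Gamma>) (\<lambda>e. e i = Elem c)"
    using dfn_const by (intro dfn.dfn_const) auto
  then show ?case
  proof (rule dfn_cong)
    fix e assume "wt (eq_structure A) (map Home \<Gamma>) e"
    then have "e i \<in> range Elem" using dfn_const.hyps by (auto simp: wt_def)
    then show "e i = Elem c \<longleftrightarrow> the_Elem (e i) = c" by auto
  qed
next
  case (dfn_rel r "is" \<Gamma>)
  have "dfn (eq_structure A) P' (map Home \<Gamma>) (\<lambda>e. map e is \<in> relI (eq_structure A) r)"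
    using dfn_rel by (intro dfn.dfn_rel) (auto simp flip: dfn_rel.hyps(3))
  then show ?case
  proof (rule dfn_cong)
    fix e assume "wt (eq_structure A) (map Home \<Gamma>) e"
    then have "e i \<in> range Elem" if "i \<in> set is" for i
      using dfn_rel.hyps(2) that by (auto simp: wt_def)
    then have "map e is = map Elem (map (\<lambda>i. the_Elem (e i)) is)" by fastforce
    then show "map e is \<in> relI (eq_structure A) r \<longleftrightarrow> map (\<lambda>i. the_Elem (e i)) is \<in> relI A r"
      by (metis (no_types, lifting) eq_simps(11) imageE image_eqI map_map map_the_Elem(1))
  qed
next
  case (dfn_fun f "is" \<Gamma> j)
  have "dfn (eq_structure A) P' (map Home \<Gamma>) (\<lambda>e. e j = funI (eq_structure A) (Old f) (map e is))"
    using dfn_fun by (intro dfn.dfn_fun) (auto simp flip: dfn_fun.hyps(3))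
  then show ?case
  proof (rule dfn_cong)
    fix e assume "wt (eq_structure A) (map Home \<Gamma>) e"
    then have "e j \<in> range Elem" using dfn_fun.hyps by (auto simp: wt_def)
    then show "e j = funI (eq_structure A) (Old f) (map e is) \<longleftrightarrow>
      the_Elem (e j) = funI A f (map (\<lambda>i. the_Elem (e i)) is)" by (auto simp: comp_def)
  qed
next
  case (dfn_neg \<Gamma> Q)
  show ?case by (rule dfn.dfn_neg[OF dfn_neg.IH])
next
  case (dfn_conj \<Gamma> Q R)
  show ?case by (rule dfn.dfn_conj[OF dfn_conj.IH])
next
  case (dfn_ex0 s \<Gamma> Q)
  have "dfn (eq_structure A) P' (Home s # map Home \<Gamma>) (\<lambda>e. Q (\<lambda>i. the_Elem (e i)))"
    using dfn_ex0.IH by simp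
  from dfn.dfn_ex0[OF _ this] dfn_ex0.hyps(1)
  have "dfn (eq_structure A) P' (map Home \<Gamma>) (\<lambda>e. \<exists>x\<in>carrier (eq_structure A) (Home s).
      Q (\<lambda>i. the_Elem (case_nat x e i)))" by simp
  then show ?case
  proof (rule dfn_cong)
    fix e :: "nat => 'd eq_elem"
    have "(\<lambda>i. the_Elem (case_nat (Elem x) e i)) = case_nat x (\<lambda>i. the_Elem (e i))" for x :: 'd
      by (auto simp: fun_eq_iff split: nat.split)
    then show "(\<exists>x\<in>carrier (eq_structure A) (Home s). Q (\<lambda>i. the_Elem (case_nat x e i))) \<longleftrightarrow>
      (\<exists>x\<in>carrier A s. Q (case_nat x (\<lambda>i. the_Elem (e i))))" by simp
  qed
next
  case (dfn_cong \<Gamma> Q R)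
  from dfn_cong.IH show ?case
  proof (rule dfn.dfn_cong)
    fix e assume "wt (eq_structure A) (map Home \<Gamma>) e"
    then have "wt A \<Gamma> (\<lambda>i. the_Elem (e i))" by (auto simp: wt_def)
    then show "Q (\<lambda>i. the_Elem (e i)) \<longleftrightarrow> R (\<lambda>i. the_Elem (e i))" by (rule dfn_cong.hyps(2))
  qed
qed

text \<open>The data of the induced interpretation of the expansion: an imaginary is represented by
  any tuple that decodes to a member of its class.\<close>

definition tauE :: "('t => 's list) => ('t, 'b) eq_sort => 's list" where
  "tauE \<tau> S = (case S of Home s => \<tau> s | Quot ss E => tt \<tau> ss)"

definition XE :: "('s, 'f, 'r, 'a) fo_structure => ('t => 's list) => ('t => 'a list set) => ('t, 'b) eq_sort => 'a list set" where
  "XE A \<tau> X S = (case S of Home s => X s | Quot ss E => {ys \<in> tuples A (tt \<tau> ss). valid \<tau> X ss ys})"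

definition piE :: "('t => 's list) => ('t => 'a list => 'b) => ('t, 'b) eq_sort => 'a list => 'b eq_elem" where
  "piE \<tau> \<pi> S ys = (case S of Home s => Elem (\<pi> s ys) | Quot ss E => Class (E `` {dec \<tau> \<pi> ss ys}))"

lemma E_simps [simp]:
  "tauE \<tau> (Home s) = \<tau> s" "tauE \<tau> (Quot ss E) = tt \<tau> ss"
  "XE A \<tau> X (Home s) = X s" "XE A \<tau> X (Quot ss E) = {ys \<in> tuples A (tt \<tau> ss). valid \<tau> X ss ys}"
  "piE \<tau> \<pi> (Home s) ys = Elem (\<pi> s ys)" "piE \<tau> \<pi> (Quot ss E) ys = Class (E `` {dec \<tau> \<pi> ss ys})"
  by (simp_all add: tauE_def XE_def piE_def)

lemma tt_Home [simp]: "map (tauE \<tau> \<circ> Home) ss = map \<tau> ss"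
  by simp

lemma cks_Home: "cks (tauE \<tau>) (map Home ss) ys = cks \<tau> ss ys"
  by (simp add: cks_def comp_def)

lemma valid_Home: "valid (tauE \<tau>) (XE A \<tau> X) (map Home ss) ys \<longleftrightarrow> valid \<tau> X ss ys"
  by (simp add: valid_def cks_Home)

lemma dec_Home: "dec (tauE \<tau>) (piE \<tau> \<pi>) (map Home ss) ys = map Elem (dec \<tau> \<pi> ss ys)"
  by (rule nth_equalityI) (simp_all add: nth_dec cks_Home)

context cinterp
begin

lemma zero_def_pull:
  assumes "zero_def_equiv B ss E"
  shows "pbk A \<tau> X \<pi> (ss @ ss) (\<lambda>xs. xs \<in> {xs @ ys | xs ys. (xs, ys) \<in> E})"
proof -
  have "dfn B (\<lambda>_. {}) (ss @ ss) (\<lambda>e. map e [0..<length (ss @ ss)] \<in> {xs @ ys | xs ys. (xs, ys) \<in> E})"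
    using assms by (intro definable_over_dfn wfB) (simp add: zero_def_equiv_def)
  then show ?thesis using assms by (intro pull) (auto simp: zero_def_equiv_def)
qed

lemma zero_def_at:
  assumes E: "zero_def_equiv B ss E" and o: "okp \<Gamma> (tt \<tau> ss) ps" "okp \<Gamma> (tt \<tau> ss) qs"
  shows "dfn A (carrier A) \<Gamma> (\<lambda>e. valid \<tau> X ss (map e ps) \<and> valid \<tau> X ss (map e qs) \<and>
    (dec \<tau> \<pi> ss (map e ps), dec \<tau> \<pi> ss (map e qs)) \<in> E)"
proof -
  have oo: "okp \<Gamma> (tt \<tau> (ss @ ss)) (ps @ qs)" using o by (simp add: okp_append)
  have sub: "E \<subseteq> tuples B ss \<times> tuples B ss"
    using E unfolding zero_def_equiv_def equiv_def refl_on_def by blast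
  from pbk_at[OF zero_def_pull[OF E], of \<Gamma> "ps @ qs", OF oo] show ?thesis
  proof (rule dfn_cong)
    fix e :: "nat => 'a"
    have l: "length (map e ps) = length (tt \<tau> ss)" using okp_length[OF o(1)] by simp
    have d: "dec \<tau> \<pi> (ss @ ss) (map e (ps @ qs)) = dec \<tau> \<pi> ss (map e ps) @ dec \<tau> \<pi> ss (map e qs)"
      unfolding map_append by (rule dec_append(1)[OF l])
    have v: "valid \<tau> X (ss @ ss) (map e (ps @ qs)) \<longleftrightarrow> valid \<tau> X ss (map e ps) \<and> valid \<tau> X ss (map e qs)"
      unfolding map_append by (rule dec_append(2)[OF l])
    have "xs @ ys \<in> {xs @ ys | xs ys. (xs, ys) \<in> E} \<longleftrightarrow> (xs, ys) \<in> E" if "length xs = length ss" for xs ys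
    proof
      assume "xs @ ys \<in> {xs @ ys | xs ys. (xs, ys) \<in> E}"
      then obtain us vs where "xs @ ys = us @ vs" "(us, vs) \<in> E" by blast
      moreover from this have "length us = length ss" using sub tuples_length by blast
      ultimately show "(xs, ys) \<in> E" using that by auto
    qed auto
    then show "(valid \<tau> X (ss @ ss) (map e (ps @ qs)) \<and> dec \<tau> \<pi> (ss @ ss) (map e (ps @ qs)) \<in> {xs @ ys | xs ys. (xs, ys) \<in> E})
      \<longleftrightarrow> valid \<tau> X ss (map e ps) \<and> valid \<tau> X ss (map e qs) \<and> (dec \<tau> \<pi> ss (map e ps), dec \<tau> \<pi> ss (map e qs)) \<in> E"
      unfolding d v by simp
  qed
qed

lemma XE_at:
  assumes "S \<in> sorts (eq_structure B)" "okp \<Gamma> (tauE \<tau> S) ps"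
  shows "dfn A (carrier A) \<Gamma> (\<lambda>e. map e ps \<in> XE A \<tau> X S)"
proof (cases S)
  case (Home s)
  then show ?thesis using X_at[of s \<Gamma> ps] assms by simp
next
  case (Quot ss E)
  then have "set ss \<subseteq> sorts B" using assms by (simp add: zero_def_equiv_def)
  from valid_at[OF this] assms Quot have "dfn A (carrier A) \<Gamma> (\<lambda>e. valid \<tau> X ss (map e ps))" by simp
  then show ?thesis
    by (rule dfn_cong) (use Quot assms okp_tuples[of \<Gamma> "tt \<tau> ss" ps A] in auto)
qed

text \<open>Coordinate maps may identify tuples, so a quotient sort asks for no new construction:
  the old map is followed by the projection, and the kernel of the composite is the pullback of the
  definable relation E.\<close>

lemma eq_cinterp: "cinterp A (eq_structure B) (tauE \<tau>) (XE A \<tau> X) (piE \<tau> \<pi>)"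
proof
  show "wf_structure A" "wf_structure (eq_structure B)" by (rule wfA, rule wf_eq[OF wfB])
next
  fix S assume S: "S \<in> sorts (eq_structure B)"
  show "set (tauE \<tau> S) \<subseteq> sorts A"
  proof (cases S)
    case (Home s)
    then show ?thesis using \<tau>_sorts S by simp
  next
    case (Quot ss E)
    then show ?thesis using tt_sorts[of ss] S by (simp add: zero_def_equiv_def)
  qed
  show "XE A \<tau> X S \<subseteq> tuples A (tauE \<tau> S)" using X_sub S by (cases S) auto
  show "piE \<tau> \<pi> S ` XE A \<tau> X S = carrier (eq_structure B) S"
  proof (cases S)
    case (Home s)
    then have "s \<in> sorts B" using S by simp
    from surj[OF this, symmetric] Home show ?thesis by (auto simp: image_image)
  next
    case (Quot ss E)
    then have E: "zero_def_equiv B ss E" "set ss \<subseteq> sorts B" using S by (auto simp: zero_def_equiv_def)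
    have "Class ` (\<lambda>ys. E `` {dec \<tau> \<pi> ss ys}) ` {ys \<in> tuples A (tt \<tau> ss). valid \<tau> X ss ys} = Class ` (tuples B ss // E)"
    proof (intro arg_cong[of _ _ "(`) Class"] set_eqI iffI)
      fix c assume "c \<in> (\<lambda>ys. E `` {dec \<tau> \<pi> ss ys}) ` {ys \<in> tuples A (tt \<tau> ss). valid \<tau> X ss ys}"
      then show "c \<in> tuples B ss // E" using dec_in[OF E(2)] by (auto intro: quotientI)
    next
      fix c assume "c \<in> tuples B ss // E"
      then obtain bs where "bs \<in> tuples B ss" "c = E `` {bs}" by (auto elim: quotientE)
      then show "c \<in> (\<lambda>ys. E `` {dec \<tau> \<pi> ss ys}) ` {ys \<in> tuples A (tt \<tau> ss). valid \<tau> X ss ys}"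
        using dec_surj[OF E(2)] by blast
    qed
    then show ?thesis using Quot by (simp add: image_image)
  qed
  have o: "okp (tt (tauE \<tau>) [S]) (tauE \<tau> S) [0..<length (tt (tauE \<tau>) [S])]" using okp_self[of "tauE \<tau> S"] by simp
  from XE_at[OF S o] show "pbk A (tauE \<tau>) (XE A \<tau> X) (piE \<tau> \<pi>) [S] (\<lambda>_. True)" unfolding pbk_def
    by (rule dfn_cong) (simp add: dec_single)
  define n where "n = length (tauE \<tau> S)"
  define G where "G = tauE \<tau> S @ tauE \<tau> S"
  have o1: "okp G (tauE \<tau> S) [0..<n]" unfolding G_def n_def by (rule okp_prefix)
  have o2: "okp G (tauE \<tau> S) (map ((+) n) [0..<n])" unfolding G_def n_def by (rule okp_shift[OF okp_self])
  have D: "dfn A (carrier A) G (\<lambda>e. map e [0..<n] \<in> XE A \<tau> X S \<and> map e (map ((+) n) [0..<n]) \<in> XE A \<tau> X S \<and>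
     piE \<tau> \<pi> S (map e [0..<n]) = piE \<tau> \<pi> S (map e (map ((+) n) [0..<n])))"
  proof (cases S)
    case (Home s)
    then have s: "s \<in> sorts B" using S by simp
    from eq_at[OF s, of G "[0..<n]" "map ((+) n) [0..<n]"] o1 o2 Home show ?thesis by simp
  next
    case (Quot ss E)
    then have E: "zero_def_equiv B ss E" "set ss \<subseteq> sorts B" using S by (auto simp: zero_def_equiv_def)
    have eqv: "equiv (tuples B ss) E" using E by (simp add: zero_def_equiv_def)
    have p: "okp G (tt \<tau> ss) [0..<n]" "okp G (tt \<tau> ss) (map ((+) n) [0..<n])" using o1 o2 Quot by simp_all
    from zero_def_at[OF E(1) p] show ?thesis
    proof (rule dfn_cong)
      fix e assume e: "wt A G e"
      show "(valid \<tau> X ss (map e [0..<n]) \<and> valid \<tau> X ss (map e (map ((+) n) [0..<n])) \<and>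
        (dec \<tau> \<pi> ss (map e [0..<n]), dec \<tau> \<pi> ss (map e (map ((+) n) [0..<n]))) \<in> E) \<longleftrightarrow>
        (map e [0..<n] \<in> XE A \<tau> X S \<and> map e (map ((+) n) [0..<n]) \<in> XE A \<tau> X S \<and>
        piE \<tau> \<pi> S (map e [0..<n]) = piE \<tau> \<pi> S (map e (map ((+) n) [0..<n])))"
        using okp_tuples[OF p(1) e] okp_tuples[OF p(2) e] eq_equiv_class_iff[OF eqv] dec_in[OF E(2)]
        unfolding Quot E_simps by blast
    qed
  qed
  have G: "tt (tauE \<tau>) [S, S] = G" by (simp add: G_def)
  have u: "[0..<length G] = [0..<n] @ map ((+) n) [0..<n]"
    by (intro nth_equalityI) (auto simp: nth_append G_def n_def)
  from D show "pbk A (tauE \<tau>) (XE A \<tau> X) (piE \<tau> \<pi>) [S, S] (\<lambda>xs. xs ! 0 = xs ! 1)" unfolding pbk_def G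
  proof (rule dfn_cong)
    fix e :: "nat => 'a"
    have l: "length (map e [0..<n]) = length (tauE \<tau> S)" "length (map e (map ((+) n) [0..<n])) = length (tauE \<tau> S)"
      by (simp_all add: n_def)
    have d: "dec (tauE \<tau>) (piE \<tau> \<pi>) [S, S] (map e [0..<length G]) =
        [piE \<tau> \<pi> S (map e [0..<n]), piE \<tau> \<pi> S (map e (map ((+) n) [0..<n]))]"
      unfolding u map_append
      using dec_Cons(1)[of "map e [0..<n]" "tauE \<tau>" S "piE \<tau> \<pi>" "[S]" "map e (map ((+) n) [0..<n])"]
        dec_single(1)[of "map e (map ((+) n) [0..<n])" "tauE \<tau>" S "piE \<tau> \<pi>"] l by (simp only:)
    have v: "valid (tauE \<tau>) (XE A \<tau> X) [S, S] (map e [0..<length G]) \<longleftrightarrow>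
        map e [0..<n] \<in> XE A \<tau> X S \<and> map e (map ((+) n) [0..<n]) \<in> XE A \<tau> X S"
      unfolding u map_append
      using dec_Cons(2)[of "map e [0..<n]" "tauE \<tau>" S "XE A \<tau> X" "[S]" "map e (map ((+) n) [0..<n])"]
        dec_single(2)[of "map e (map ((+) n) [0..<n])" "tauE \<tau>" S "XE A \<tau> X"] l by (simp only:)
    show "(map e [0..<n] \<in> XE A \<tau> X S \<and> map e (map ((+) n) [0..<n]) \<in> XE A \<tau> X S \<and>
        piE \<tau> \<pi> S (map e [0..<n]) = piE \<tau> \<pi> S (map e (map ((+) n) [0..<n]))) \<longleftrightarrow>
      valid (tauE \<tau>) (XE A \<tau> X) [S, S] (map e [0..<length G]) \<and>
      dec (tauE \<tau>) (piE \<tau> \<pi>) [S, S] (map e [0..<length G]) ! 0 = dec (tauE \<tau>) (piE \<tau> \<pi>) [S, S] (map e [0..<length G]) ! 1"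
      unfolding d v by (simp del: map_map)
  qed
next
  fix r assume r: "r \<in> rels (eq_structure B)"
  then have r: "r \<in> rels B" by simp
  have inj: "map Elem xs \<in> map Elem ` Y \<longleftrightarrow> xs \<in> Y" for xs and Y :: "'b list set"
    by (rule inj_image_mem_iff) (auto intro: injI list.inj_map)
  show "pbk A (tauE \<tau>) (XE A \<tau> X) (piE \<tau> \<pi>) (rdom (eq_structure B) r) (\<lambda>xs. xs \<in> relI (eq_structure B) r)"
    using rel_dfn[OF r] unfolding pbk_def by (simp add: valid_Home dec_Home inj)
next
  fix F assume F: "F \<in> funs (eq_structure B)"
  show "pbk A (tauE \<tau>) (XE A \<tau> X) (piE \<tau> \<pi>) (fcod (eq_structure B) F # fdom (eq_structure B) F) (\<lambda>xs. hd xs = funI (eq_structure B) F (tl xs))"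
  proof (cases F)
    case (Old f)
    then have f: "f \<in> funs B" using F by simp
    have h: "fcod (eq_structure B) F # fdom (eq_structure B) F = map Home (fcod B f # fdom B f)" using Old by simp
    have t: "tt (tauE \<tau>) (map Home ss) = tt \<tau> ss" for ss by simp
    from fun_dfn[OF f] show ?thesis unfolding pbk_def h t
    proof (rule dfn_cong)
      fix e :: "nat => 'a"
      define ys where "ys = map e [0..<length (tt \<tau> (fcod B f # fdom B f))]"
      obtain x xs where x: "dec \<tau> \<pi> (fcod B f # fdom B f) ys = x # xs"
        by (metis length_dec list.exhaust length_0_conv list.distinct(1))
      have "valid \<tau> X (fcod B f # fdom B f) ys \<and> hd (dec \<tau> \<pi> (fcod B f # fdom B f) ys) = funI B f (tl (dec \<tau> \<pi> (fcod B f # fdom B f) ys))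
       \<longleftrightarrow> valid (tauE \<tau>) (XE A \<tau> X) (map Home (fcod B f # fdom B f)) ys \<and>
          hd (dec (tauE \<tau>) (piE \<tau> \<pi>) (map Home (fcod B f # fdom B f)) ys) =
          funI (eq_structure B) F (tl (dec (tauE \<tau>) (piE \<tau> \<pi>) (map Home (fcod B f # fdom B f)) ys))"
        unfolding valid_Home dec_Home x by (simp add: Old)
      then show "(valid \<tau> X (fcod B f # fdom B f) (map e [0..<length (tt \<tau> (fcod B f # fdom B f))]) \<and>
          hd (dec \<tau> \<pi> (fcod B f # fdom B f) (map e [0..<length (tt \<tau> (fcod B f # fdom B f))])) =
          funI B f (tl (dec \<tau> \<pi> (fcod B f # fdom B f) (map e [0..<length (tt \<tau> (fcod B f # fdom B f))]))))
       \<longleftrightarrow> valid (tauE \<tau>) (XE A \<tau> X) (map Home (fcod B f # fdom B f)) (map e [0..<length (tt \<tau> (fcod B f # fdom B f))]) \<and>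
          hd (dec (tauE \<tau>) (piE \<tau> \<pi>) (map Home (fcod B f # fdom B f)) (map e [0..<length (tt \<tau> (fcod B f # fdom B f))])) =
          funI (eq_structure B) F (tl (dec (tauE \<tau>) (piE \<tau> \<pi>) (map Home (fcod B f # fdom B f)) (map e [0..<length (tt \<tau> (fcod B f # fdom B f))])))"
        unfolding ys_def .
    qed
  next
    case (Proj ss E)
    then have E: "zero_def_equiv B ss E" "set ss \<subseteq> sorts B" using F by (auto simp: zero_def_equiv_def)
    have eqv: "equiv (tuples B ss) E" using E by (simp add: zero_def_equiv_def)
    define n where "n = length (tt \<tau> ss)"
    define G where "G = tt \<tau> ss @ tt \<tau> ss"
    define qs where "qs = map ((+) n) [0..<n]"
    have o1: "okp G (tt \<tau> ss) [0..<n]" unfolding G_def n_def by (rule okp_prefix)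
    have o2: "okp G (tt \<tau> ss) qs" unfolding G_def n_def qs_def by (rule okp_shift[OF okp_self])
    have u: "[0..<length G] = [0..<n] @ qs"
      by (intro nth_equalityI) (auto simp: nth_append G_def n_def qs_def)
    have h: "fcod (eq_structure B) F # fdom (eq_structure B) F = Quot ss E # map Home ss" using Proj by simp
    have t: "tt (tauE \<tau>) (Quot ss E # map Home ss) = G" by (simp add: G_def)
    from zero_def_at[OF E(1) o1 o2] show ?thesis unfolding pbk_def h t
    proof (rule dfn_cong)
      fix e assume e: "wt A G e"
      have l: "length (map e [0..<n]) = length (tauE \<tau> (Quot ss E))" by (simp add: n_def)
      have d: "dec (tauE \<tau>) (piE \<tau> \<pi>) (Quot ss E # map Home ss) (map e [0..<length G]) =
          Class (E `` {dec \<tau> \<pi> ss (map e [0..<n])}) # map Elem (dec \<tau> \<pi> ss (map e qs))"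
        unfolding u map_append
        using dec_Cons(1)[of "map e [0..<n]" "tauE \<tau>" "Quot ss E" "piE \<tau> \<pi>" "map Home ss" "map e qs"] l
        by (simp only: dec_Home E_simps)
      have v: "valid (tauE \<tau>) (XE A \<tau> X) (Quot ss E # map Home ss) (map e [0..<length G]) \<longleftrightarrow>
          valid \<tau> X ss (map e [0..<n]) \<and> valid \<tau> X ss (map e qs)"
        unfolding u map_append
        using dec_Cons(2)[of "map e [0..<n]" "tauE \<tau>" "Quot ss E" "XE A \<tau> X" "map Home ss" "map e qs"] l
          okp_tuples[OF o1 e]
        by (simp only: valid_Home E_simps mem_Collect_eq simp_thms)
      show "valid \<tau> X ss (map e [0..<n]) \<and> valid \<tau> X ss (map e qs) \<and> (dec \<tau> \<pi> ss (map e [0..<n]), dec \<tau> \<pi> ss (map e qs)) \<in> E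
       \<longleftrightarrow> valid (tauE \<tau>) (XE A \<tau> X) (Quot ss E # map Home ss) (map e [0..<length G]) \<and>
          hd (dec (tauE \<tau>) (piE \<tau> \<pi>) (Quot ss E # map Home ss) (map e [0..<length G])) =
          funI (eq_structure B) F (tl (dec (tauE \<tau>) (piE \<tau> \<pi>) (Quot ss E # map Home ss) (map e [0..<length G])))"
        unfolding d v Proj list.sel eq_simps map_map map_the_Elem
        using eq_equiv_class_iff[OF eqv] dec_in[OF E(2)] by auto
    qed
  qed
qed

end

subsection \<open>Coding quotients by imaginaries\<close>

context cinterp
begin

definition good :: "'t => 's list => 'a list => ('a list \<times> 'a list) set => bool" where
  "good s \<Delta> b E \<longleftrightarrow> zero_def_equiv A (\<tau> s @ \<Delta>) E \<and> b \<in> tuples A \<Delta> \<and>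
     (\<forall>x\<in>X s. \<forall>y\<in>X s. (x @ b, y @ b) \<in> E \<longleftrightarrow> \<pi> s x = \<pi> s y)"

text \<open>Two tuples are identified when they have the same parameters \<open>b\<close> and the sets they define
  with a formula for equality of coordinates agree; this is an equivalence relation for every
  value of the parameters, so it is definable without parameters.\<close>

lemma good_exists:
  assumes s: "s \<in> sorts B"
  shows "\<exists>\<Delta> b E. good s \<Delta> b E"
proof -
  define T where "T = \<tau> s"
  define n where "n = length T"
  have T: "set T \<subseteq> sorts A" using \<tau>_sorts s by (simp add: T_def)
  have o1: "okp (T @ T) (\<tau> s) [0..<n]" unfolding T_def n_def by (rule okp_prefix)
  have o2: "okp (T @ T) (\<tau> s) (map ((+) n) [0..<n])" unfolding T_def n_def by (rule okp_shift[OF okp_self])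
  define Q where "Q = (\<lambda>e. map e [0..<n] \<in> X s \<and> map e (map ((+) n) [0..<n]) \<in> X s \<and>
    \<pi> s (map e [0..<n]) = \<pi> s (map e (map ((+) n) [0..<n])))"
  have "dfn A (carrier A) (T @ T) Q" unfolding Q_def by (rule eq_at[OF s o1 o2])
  then obtain \<Delta> b Q0 where \<Delta>: "set \<Delta> \<subseteq> sorts A" and b: "b \<in> tuples A \<Delta>"
    and Q0: "dfn A (\<lambda>_. {}) ((T @ T) @ \<Delta>) Q0"
    and H: "\<And>xs e. xs \<in> tuples A (T @ T) ==> Q (cat xs e) \<longleftrightarrow> Q0 (cat xs (cat b e))"
    by (rule dfn_params) (use T in auto)
  define m where "m = length \<Delta>"
  define ss where "ss = T @ \<Delta>"
  define N where "N = n + m"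
  have lss: "length ss = N" by (simp add: ss_def N_def n_def m_def)
  \<comment> \<open>Here u is read as a point x followed by values of the parameters;
    \<open>F u z\<close> says that the parameter-free formula with these values relates x to
    z.\<close>
  define F where "F u z = Q0 (cat (take n u @ z @ drop n u) (\<lambda>_. undefined))" for u z
  define E where "E = {(u, w). u \<in> tuples A ss \<and> w \<in> tuples A ss \<and> drop n u = drop n w \<and>
    (\<forall>z\<in>tuples A T. F u z \<longleftrightarrow> F w z)}"
  have equiv: "equiv (tuples A ss) E"
    by (rule equivI) (auto simp: E_def refl_on_def sym_def trans_def)
  define D where "D = {xs @ ys | xs ys. (xs, ys) \<in> E}"
  have inD: "u @ w \<in> D \<longleftrightarrow> (u, w) \<in> E" if "length u = N" for u w
  proof
    assume "u @ w \<in> D"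
    then obtain xs ys where xy: "u @ w = xs @ ys" "(xs, ys) \<in> E" unfolding D_def by blast
    then have "length xs = N" using tuples_length[of xs A ss] lss by (simp add: E_def)
    then show "(u, w) \<in> E" using xy that by simp
  qed (auto simp: D_def)
  define G where "G = T @ ss @ ss"
  \<comment> \<open>The context consists of z, u, w in this order. The formula takes its second
    argument from z, and its first argument together with the parameters from u (for \<sigma>1) or
    from w (for \<sigma>2).\<close>
  define \<sigma>1 where "\<sigma>1 i = (if i < n then n + i else if i < 2 * n then i - n else i)" for i
  define \<sigma>2 where "\<sigma>2 i = (if i < n then n + N + i else if i < 2 * n then i - n else N + i)" for i
  have d1: "dfn A (\<lambda>_. {}) G (\<lambda>e. Q0 (\<lambda>i. e (\<sigma>1 i)))"
    by (rule dfn_reindex[OF Q0, of \<sigma>1 G])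
       (auto simp: \<sigma>1_def G_def ss_def N_def n_def m_def nth_append)
  have d2: "dfn A (\<lambda>_. {}) G (\<lambda>e. Q0 (\<lambda>i. e (\<sigma>2 i)))"
    by (rule dfn_reindex[OF Q0, of \<sigma>2 G])
       (auto simp: \<sigma>2_def G_def ss_def N_def n_def m_def nth_append)
  have d3: "dfn A (\<lambda>_. {}) (ss @ ss) (\<lambda>e. \<not> (\<exists>z\<in>tuples A T. \<not> (Q0 (\<lambda>i. cat z e (\<sigma>1 i)) \<longleftrightarrow> Q0 (\<lambda>i. cat z e (\<sigma>2 i)))))"
    by (rule dfn_neg[OF dfn_block_ex0[OF T dfn_neg[OF dfn_iff[OF d1[unfolded G_def] d2[unfolded G_def]]]]])
  have d4: "dfn A (\<lambda>_. {}) (ss @ ss) (\<lambda>e. \<forall>k<m. e (n + k) = e (N + n + k))"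
    by (intro dfn_All_less dfn_eq) (auto simp: ss_def N_def n_def m_def nth_append)
  have dD: "dfn A (\<lambda>_. {}) (ss @ ss) (\<lambda>e. map e [0..<length (ss @ ss)] \<in> D)"
    using dfn_conj[OF d3 d4]
  proof (rule dfn_cong)
    fix e assume e: "wt A (ss @ ss) e"
    define u where "u = map e [0..<N]"
    define w where "w = map (\<lambda>i. e (N + i)) [0..<N]"
    have uw: "map e [0..<length (ss @ ss)] = u @ w"
      by (intro nth_equalityI) (auto simp: u_def w_def lss nth_append)
    have "e i \<in> carrier A (ss ! i)" "e (N + i) \<in> carrier A (ss ! i)" if "i < N" for i
      using e[unfolded wt_def, rule_format, of i] e[unfolded wt_def, rule_format, of "N + i"] that
      by (simp_all add: lss nth_append)
    then have ut: "u \<in> tuples A ss" "w \<in> tuples A ss"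
      unfolding tuples_iff u_def w_def by (simp_all add: lss)
    have loc: "F u z \<longleftrightarrow> Q0 (\<lambda>i. cat z e (\<sigma>1 i))" "F w z \<longleftrightarrow> Q0 (\<lambda>i. cat z e (\<sigma>2 i))" if z: "z \<in> tuples A T" for z
    proof -
      have lz: "length z = n" using tuples_length[OF z] by (simp add: n_def)
      have *: "wt A ((T @ T) @ \<Delta>) (cat (take n v @ z @ drop n v) (\<lambda>_. undefined))" if v: "v \<in> tuples A ss" for v
      proof -
        obtain x c where xc: "v = x @ c" "x \<in> tuples A T" "c \<in> tuples A \<Delta>"
          using v unfolding ss_def by (elim tuples_appendE)
        have lx: "length x = n" using tuples_length[OF xc(2)] by (simp add: n_def)
        have "x @ z @ c \<in> tuples A (T @ T @ \<Delta>)"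
          using xc z lx lz by (simp add: tuples_append n_def)
        then have "wt A ((T @ T @ \<Delta>) @ []) (cat (x @ z @ c) (\<lambda>_. undefined))"
          using tuples_length[OF xc(3)] lx lz by (subst wt_cat) (auto simp: n_def wt_def)
        then show ?thesis using xc(1) lx by simp
      qed
      show "F u z \<longleftrightarrow> Q0 (\<lambda>i. cat z e (\<sigma>1 i))" unfolding F_def
        by (rule dfn_local[OF Q0 *[OF ut(1)]])
           (auto simp: u_def cat_def \<sigma>1_def lz N_def nth_append n_def[symmetric] m_def[symmetric])
      show "F w z \<longleftrightarrow> Q0 (\<lambda>i. cat z e (\<sigma>2 i))" unfolding F_def
        by (rule dfn_local[OF Q0 *[OF ut(2)]])
           (auto simp: w_def cat_def \<sigma>2_def lz N_def nth_append n_def[symmetric] m_def[symmetric] add.assoc)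
    qed
    have "drop n u = drop n w \<longleftrightarrow> (\<forall>k<m. e (n + k) = e (N + n + k))"
      by (auto simp: list_eq_iff_nth_eq u_def w_def N_def add.assoc)
    then show "(\<not> (\<exists>z\<in>tuples A T. \<not> (Q0 (\<lambda>i. cat z e (\<sigma>1 i)) \<longleftrightarrow> Q0 (\<lambda>i. cat z e (\<sigma>2 i))))) \<and>
        (\<forall>k<m. e (n + k) = e (N + n + k)) \<longleftrightarrow> map e [0..<length (ss @ ss)] \<in> D"
      unfolding uw using inD[of u w] ut loc by (simp add: E_def u_def) blast
  qed
  have ssS: "set ss \<subseteq> sorts A" using T \<Delta> by (simp add: ss_def)
  have "D \<subseteq> tuples A (ss @ ss)"
    using lss tuples_length unfolding D_def E_def by (fastforce simp: tuples_append)
  then have "zero_def_equiv A ss E"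
    unfolding zero_def_equiv_def D_def[symmetric] using equiv ssS dD by (auto intro!: definable_overI)
  moreover have "(x @ b, y @ b) \<in> E \<longleftrightarrow> \<pi> s x = \<pi> s y" if xy: "x \<in> X s" "y \<in> X s" for x y
  proof -
    have t: "x \<in> tuples A T" "y \<in> tuples A T" using X_sub[OF s] xy by (auto simp: T_def)
    have l: "length x = n" "length y = n" using t tuples_length by (auto simp: n_def)
    have FQ: "F (v @ b) z \<longleftrightarrow> v \<in> X s \<and> z \<in> X s \<and> \<pi> s v = \<pi> s z" if v: "v \<in> tuples A T" and z: "z \<in> tuples A T" for v z
    proof -
      have l: "length v = n" "length z = n" using v z tuples_length by (auto simp: n_def)
      have "F (v @ b) z \<longleftrightarrow> Q0 (cat (v @ z) (cat b (\<lambda>_. undefined)))"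
        using l by (simp add: F_def cat_cat)
      also have "\<dots> \<longleftrightarrow> Q (cat (v @ z) (\<lambda>_. undefined))"
        using H[of "v @ z"] v z l by (simp add: tuples_append n_def)
      also have "map (cat (v @ z) (\<lambda>_. undefined)) [0..<n] = v"
        using l by (intro nth_equalityI) (auto simp: cat_def nth_append)
      moreover have "map (cat (v @ z) (\<lambda>_. undefined)) (map ((+) n) [0..<n]) = z"
        using l by (intro nth_equalityI) (auto simp: cat_def nth_append)
      ultimately show ?thesis unfolding Q_def by simp
    qed
    have "x @ b \<in> tuples A ss" "y @ b \<in> tuples A ss" using t b l by (auto simp: ss_def tuples_append n_def)
    then have "(x @ b, y @ b) \<in> E \<longleftrightarrow> (\<forall>z\<in>tuples A T. F (x @ b) z \<longleftrightarrow> F (y @ b) z)"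
      using l by (simp add: E_def)
    \<comment> \<open>For the true parameters the sets compared are fibres of \<pi> inside
      \<open>X s\<close>; the instance z = y already forces equality of the images.\<close>
    also have "\<dots> \<longleftrightarrow> \<pi> s x = \<pi> s y" using FQ t xy by metis
    finally show ?thesis .
  qed
  ultimately have "good s \<Delta> b E" using b unfolding good_def ss_def T_def by blast
  then show ?thesis by blast
qed

definition qc :: "'t => 's list \<times> 'a list \<times> ('a list \<times> 'a list) set" where
  "qc s = (SOME t. case t of (\<Delta>, b, E) => good s \<Delta> b E)"

definition qsort :: "'t => ('s, 'a) eq_sort" where
  "qsort s = (case qc s of (\<Delta>, b, E) => Quot (\<tau> s @ \<Delta>) E)"

definition cls :: "'t => 'a list => 'a eq_elem" where
  "cls s x = (case qc s of (\<Delta>, b, E) => Class (E `` {x @ b}))"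

text \<open>Embeds a sort of B in a single imaginary sort of A; by \<open>gam_pi\<close> the choice
  of the preimage does not matter.\<close>

definition gam :: "'t => 'b => 'a eq_elem" where
  "gam s c = cls s (SOME x. x \<in> X s \<and> \<pi> s x = c)"

lemma qcE:
  assumes "s \<in> sorts B"
  obtains \<Delta> b E where "good s \<Delta> b E" "qsort s = Quot (\<tau> s @ \<Delta>) E" "\<And>x. cls s x = Class (E `` {x @ b})"
proof -
  obtain \<Delta> b E where q: "qc s = (\<Delta>, b, E)" by (cases "qc s")
  have "case qc s of (\<Delta>, b, E) => good s \<Delta> b E"
    unfolding qc_def using good_exists[OF assms] by (intro someI_ex[of "\<lambda>t. case t of (\<Delta>, b, E) => good s \<Delta> b E"]) auto
  then show ?thesis using q by (intro that[of \<Delta> b E]) (simp_all add: qsort_def cls_def)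
qed

lemma qsort_in: "s \<in> sorts B ==> qsort s \<in> sorts (eq_structure A)"
  by (erule qcE) (simp add: good_def)

lemma X_append:
  assumes "s \<in> sorts B" "x \<in> X s" "b \<in> tuples A \<Delta>"
  shows "x @ b \<in> tuples A (\<tau> s @ \<Delta>)"
proof -
  have "x \<in> tuples A (\<tau> s)" using X_sub assms by blast
  then show ?thesis using assms(3) tuples_append[OF tuples_length] by blast
qed

lemma cls_in:
  assumes "s \<in> sorts B" "x \<in> X s"
  shows "cls s x \<in> carrier (eq_structure A) (qsort s)"
  using assms(1)
proof (rule qcE)
  fix \<Delta> b E
  assume "good s \<Delta> b E" "qsort s = Quot (\<tau> s @ \<Delta>) E" "\<And>x. cls s x = Class (E `` {x @ b})"
  then show ?thesis using X_append[OF assms, of b \<Delta>] by (simp add: good_def quotientI)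
qed

lemma cls_iff:
  assumes "s \<in> sorts B" "x \<in> X s" "y \<in> X s"
  shows "cls s x = cls s y \<longleftrightarrow> \<pi> s x = \<pi> s y"
  using assms(1)
proof (rule qcE)
  fix \<Delta> b E assume g: "good s \<Delta> b E" "\<And>x. cls s x = Class (E `` {x @ b})"
  have "equiv (tuples A (\<tau> s @ \<Delta>)) E" "b \<in> tuples A \<Delta>" using g by (auto simp: good_def zero_def_equiv_def)
  then have "E `` {x @ b} = E `` {y @ b} \<longleftrightarrow> (x @ b, y @ b) \<in> E"
    using X_append assms by (intro eq_equiv_class_iff) auto
  then show ?thesis using g assms by (simp add: good_def)
qed

lemma gam_pi: "s \<in> sorts B ==> x \<in> X s ==> gam s (\<pi> s x) = cls s x"
proof -
  assume s: "s \<in> sorts B" "x \<in> X s"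
  define y where "y = (SOME y. y \<in> X s \<and> \<pi> s y = \<pi> s x)"
  have "y \<in> X s \<and> \<pi> s y = \<pi> s x" unfolding y_def by (rule someI_ex) (use s in auto)
  then show ?thesis using cls_iff[of s y x] s by (simp add: gam_def y_def)
qed

lemma gam_in: "s \<in> sorts B ==> c \<in> carrier B s ==> gam s c \<in> carrier (eq_structure A) (qsort s)"
proof -
  assume s: "s \<in> sorts B" "c \<in> carrier B s"
  obtain x where "x \<in> X s" "c = \<pi> s x" using s(2) unfolding surj[OF s(1), symmetric] by blast
  then show ?thesis using gam_pi cls_in s by simp
qed

lemma gam_inj: "s \<in> sorts B ==> inj_on (gam s) (carrier B s)"
proof (rule inj_onI)
  fix c d assume s: "s \<in> sorts B" "c \<in> carrier B s" "d \<in> carrier B s" "gam s c = gam s d"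
  obtain x where "x \<in> X s" "c = \<pi> s x" using s(2) unfolding surj[OF s(1), symmetric] by blast
  moreover obtain y where "y \<in> X s" "d = \<pi> s y" using s(3) unfolding surj[OF s(1), symmetric] by blast
  ultimately show "c = d" using s gam_pi cls_iff by auto
qed

text \<open>The map into the imaginary sort is a projection with its last arguments fixed to
  \<open>b\<close>; these arguments enter as quantified variables equated with constants.\<close>

lemma cls_dfn:
  assumes s: "s \<in> sorts B" and ps: "okp \<Gamma> (map Home (\<tau> s)) ps" and j: "j < length \<Gamma>" "\<Gamma> ! j = qsort s"
  shows "dfn (eq_structure A) (carrier (eq_structure A)) \<Gamma> (\<lambda>e. e j = cls s (map (\<lambda>i. the_Elem (e i)) ps))"
  using s
proof (rule qcE)
  fix \<Delta> b E assume g: "good s \<Delta> b E" and q: "qsort s = Quot (\<tau> s @ \<Delta>) E" and c: "\<And>x. cls s x = Class (E `` {x @ b})"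
  define H :: "('s, 'a) eq_sort list" where "H = map Home \<Delta>"
  define m where "m = length \<Delta>"
  have b: "b \<in> tuples A \<Delta>" and z: "zero_def_equiv A (\<tau> s @ \<Delta>) E" using g by (simp_all add: good_def)
  have H: "set H \<subseteq> sorts (eq_structure A)" using z by (auto simp: H_def zero_def_equiv_def)
  have lH: "length H = m" by (simp add: H_def m_def)
  have o: "okp (H @ \<Gamma>) (map Home (\<tau> s @ \<Delta>)) (map ((+) m) ps @ [0..<m])"
    using okp_append[OF okp_shift[OF ps, of H] okp_prefix[of H \<Gamma>]] by (simp add: lH) (simp add: H_def)
  have "dfn (eq_structure A) (carrier (eq_structure A)) (H @ \<Gamma>)
    (\<lambda>e. e (m + j) = funI (eq_structure A) (Proj (\<tau> s @ \<Delta>) E) (map e (map ((+) m) ps @ [0..<m])))"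
    using z o j q lH by (intro dfn_fun) (simp_all add: okp_def nth_append)
  moreover have "dfn (eq_structure A) (carrier (eq_structure A)) (H @ \<Gamma>) (\<lambda>e. \<forall>k<m. e k = Elem (b ! k))"
    using b by (intro dfn_All_less dfn_const) (auto simp: H_def m_def nth_append tuples_iff)
  ultimately have "dfn (eq_structure A) (carrier (eq_structure A)) (H @ \<Gamma>)
    (\<lambda>e. e (m + j) = funI (eq_structure A) (Proj (\<tau> s @ \<Delta>) E) (map e (map ((+) m) ps @ [0..<m])) \<and> (\<forall>k<m. e k = Elem (b ! k)))"
    by (rule dfn_conj)
  from dfn_block_ex0[OF H this] show ?thesis
  proof (rule dfn_cong)
    fix e :: "nat => 'a eq_elem"
    have bt: "map Elem b \<in> tuples (eq_structure A) H" using b by (simp add: H_def tuples_eq)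
    have lb: "length b = m" using tuples_length[OF b] by (simp add: m_def)
    have u: "xs = map Elem b" if "xs \<in> tuples (eq_structure A) H" "\<forall>k<m. cat xs e k = Elem (b ! k)" for xs
      using that tuples_length[OF that(1)] lb by (intro nth_equalityI) (auto simp: lH cat_def)
    have w: "\<forall>k<m. cat (map Elem b) e k = Elem (b ! k)" using lb by (simp add: cat_def)
    have v: "funI (eq_structure A) (Proj (\<tau> s @ \<Delta>) E) (map (cat (map Elem b) e) (map ((+) m) ps @ [0..<m])) =
      cls s (map (\<lambda>i. the_Elem (e i)) ps)"
    proof -
      have "cat (map Elem b) e (m + k) = e k" for k using lb by (simp add: cat_def)
      moreover have "map (cat (map Elem b) e) [0..<m] = map Elem b" using lb by (intro nth_equalityI) (auto simp: cat_def)
      ultimately show ?thesis by (simp add: c comp_def)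
    qed
    have x: "cat (map Elem b) e (m + j) = e j" using lb by (simp add: cat_def)
    show "(\<exists>xs\<in>tuples (eq_structure A) H. cat xs e (m + j) =
        funI (eq_structure A) (Proj (\<tau> s @ \<Delta>) E) (map (cat xs e) (map ((+) m) ps @ [0..<m])) \<and> (\<forall>k<m. cat xs e k = Elem (b ! k)))
      \<longleftrightarrow> e j = cls s (map (\<lambda>i. the_Elem (e i)) ps)"
      using u w bt v x by metis
  qed
qed

lemma okp_lift: "okp G ts ps ==> okp (map f G @ H) (map f ts) ps"
  unfolding okp_def by (auto simp: nth_append)

text \<open>A tuple lies in the image if its entries are the classes of the blocks of some valid
  tuple in the pullback of \<open>R\<close>, so one block of existential quantifiers over home sorts
  suffices.\<close>

lemma image_dfn:
  assumes SS: "set SS \<subseteq> sorts B" and R: "pbk A \<tau> X \<pi> SS R"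
  shows "dfn (eq_structure A) (carrier (eq_structure A)) (map qsort SS)
    (\<lambda>e. \<exists>ws\<in>tuples B SS. R ws \<and> map e [0..<length SS] = map2 gam SS ws)"
proof -
  define TS where "TS = tt \<tau> SS"
  define N where "N = length TS"
  have o: "okp TS TS [0..<N]" unfolding N_def by (rule okp_self)
  have TSs: "set (map Home TS) \<subseteq> sorts (eq_structure A)" using tt_sorts[OF SS] by (auto simp: TS_def)
  have "dfn (eq_structure A) (carrier (eq_structure A)) (map Home TS)
    (\<lambda>e. valid \<tau> X SS (map (\<lambda>i. the_Elem (e i)) [0..<N]) \<and> R (dec \<tau> \<pi> SS (map (\<lambda>i. the_Elem (e i)) [0..<N])))"
    using dfn_lift[OF R[unfolded pbk_def], of "carrier (eq_structure A)"] unfolding TS_def N_def by simp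
  from dfn_reindex[OF this, of "\<lambda>i. i" "map Home TS @ map qsort SS"]
  have d1: "dfn (eq_structure A) (carrier (eq_structure A)) (map Home TS @ map qsort SS)
    (\<lambda>e. valid \<tau> X SS (map (\<lambda>i. the_Elem (e i)) [0..<N]) \<and> R (dec \<tau> \<pi> SS (map (\<lambda>i. the_Elem (e i)) [0..<N])))"
    by (simp add: nth_append)
  have d2: "dfn (eq_structure A) (carrier (eq_structure A)) (map Home TS @ map qsort SS)
    (\<lambda>e. \<forall>k<length SS. e (N + k) = cls (SS ! k) (map (\<lambda>i. the_Elem (e i)) (cks \<tau> SS [0..<N] ! k)))"
  proof (intro dfn_All_less cls_dfn)
    fix k assume k: "k < length SS"
    show "SS ! k \<in> sorts B" using SS k by auto
    show "okp (map Home TS @ map qsort SS) (map Home (\<tau> (SS ! k))) (cks \<tau> SS [0..<N] ! k)"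
      by (rule okp_lift[OF okp_cks[OF _ k]]) (use o in \<open>simp add: TS_def\<close>)
  qed (auto simp: N_def nth_append)
  from dfn_block_ex0[OF TSs dfn_conj[OF d1 d2]] show ?thesis
  proof (rule dfn_cong)
    fix e :: "nat => 'a eq_elem"
    have a: "map (\<lambda>i. the_Elem (cat (map Elem zs) e i)) [0..<N] = zs" if "zs \<in> tuples A TS" for zs
      using tuples_length[OF that] by (intro nth_equalityI) (auto simp: cat_def N_def)
    have bb: "map (\<lambda>i. the_Elem (cat (map Elem zs) e i)) (cks \<tau> SS [0..<N] ! k) = cks \<tau> SS zs ! k"
      if "zs \<in> tuples A TS" "k < length SS" for zs k
      using cks_map[OF that(2), of \<tau> "\<lambda>i. the_Elem (cat (map Elem zs) e i)" "[0..<N]"] a[OF that(1)] by simp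
    have c: "cat (map Elem zs) e (N + k) = e k" if "zs \<in> tuples A TS" for zs k
      using tuples_length[OF that] by (simp add: cat_def N_def)
    have L: "(\<exists>ys\<in>tuples (eq_structure A) (map Home TS).
        (valid \<tau> X SS (map (\<lambda>i. the_Elem (cat ys e i)) [0..<N]) \<and> R (dec \<tau> \<pi> SS (map (\<lambda>i. the_Elem (cat ys e i)) [0..<N]))) \<and>
        (\<forall>k<length SS. cat ys e (N + k) = cls (SS ! k) (map (\<lambda>i. the_Elem (cat ys e i)) (cks \<tau> SS [0..<N] ! k)))) \<longleftrightarrow>
      (\<exists>zs\<in>tuples A TS. (valid \<tau> X SS zs \<and> R (dec \<tau> \<pi> SS zs)) \<and> (\<forall>k<length SS. e k = cls (SS ! k) (cks \<tau> SS zs ! k)))"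
      unfolding tuples_eq bex_simps(7) using a bb c by simp
    have M: "map e [0..<length SS] = map2 gam SS (dec \<tau> \<pi> SS zs) \<longleftrightarrow> (\<forall>k<length SS. e k = cls (SS ! k) (cks \<tau> SS zs ! k))"
      if "valid \<tau> X SS zs" for zs
    proof -
      have "gam (SS ! k) (\<pi> (SS ! k) (cks \<tau> SS zs ! k)) = cls (SS ! k) (cks \<tau> SS zs ! k)" if k: "k < length SS" for k
        using \<open>valid \<tau> X SS zs\<close> SS k by (intro gam_pi) (auto simp: valid_def)
      then have g: "map2 gam SS (dec \<tau> \<pi> SS zs) ! k = cls (SS ! k) (cks \<tau> SS zs ! k)" if "k < length SS" for k
        using that by (simp add: nth_dec)
      have "map e [0..<length SS] = map2 gam SS (dec \<tau> \<pi> SS zs) \<longleftrightarrow>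
          (\<forall>k<length SS. e k = map2 gam SS (dec \<tau> \<pi> SS zs) ! k)"
        using map_nth_const[of "map2 gam SS (dec \<tau> \<pi> SS zs)" "[0..<length SS]" e] by simp
      then show ?thesis using g by metis
    qed
    show "(\<exists>ys\<in>tuples (eq_structure A) (map Home TS).
        (valid \<tau> X SS (map (\<lambda>i. the_Elem (cat ys e i)) [0..<N]) \<and> R (dec \<tau> \<pi> SS (map (\<lambda>i. the_Elem (cat ys e i)) [0..<N]))) \<and>
        (\<forall>k<length SS. cat ys e (N + k) = cls (SS ! k) (map (\<lambda>i. the_Elem (cat ys e i)) (cks \<tau> SS [0..<N] ! k)))) \<longleftrightarrow>
      (\<exists>ws\<in>tuples B SS. R ws \<and> map e [0..<length SS] = map2 gam SS ws)"
      unfolding L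
    proof
      assume "\<exists>zs\<in>tuples A TS. (valid \<tau> X SS zs \<and> R (dec \<tau> \<pi> SS zs)) \<and> (\<forall>k<length SS. e k = cls (SS ! k) (cks \<tau> SS zs ! k))"
      then show "\<exists>ws\<in>tuples B SS. R ws \<and> map e [0..<length SS] = map2 gam SS ws"
        using M dec_in[OF SS] by blast
    next
      assume "\<exists>ws\<in>tuples B SS. R ws \<and> map e [0..<length SS] = map2 gam SS ws"
      then obtain ws where ws: "ws \<in> tuples B SS" "R ws" "map e [0..<length SS] = map2 gam SS ws" by blast
      obtain zs where "zs \<in> tuples A (tt \<tau> SS)" "valid \<tau> X SS zs" "dec \<tau> \<pi> SS zs = ws"
        using dec_surj[OF SS ws(1)] .
      then show "\<exists>zs\<in>tuples A TS. (valid \<tau> X SS zs \<and> R (dec \<tau> \<pi> SS zs)) \<and> (\<forall>k<length SS. e k = cls (SS ! k) (cks \<tau> SS zs ! k))"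
        using M[of zs] ws unfolding TS_def by blast
    qed
  qed
qed

end

subsection \<open>From coordinate maps to interpretations\<close>

lemma concat_map2_singleton: "concat (map2 (\<lambda>s b. [\<gamma> s b]) ss xs) = map2 \<gamma> ss xs"
  by (induction ss xs rule: list_induct2') auto

text \<open>The interpreting structure is B transported along the injections \<gamma>, each element
  becoming a list of length one. Its carriers, function graphs and relations are images of definable
  relations of B, so the single hypothesis \<open>img\<close> yields the definability of all of
  them.\<close>

lemma interpretsI:
  fixes A :: "('s, 'f, 'r, 'a) fo_structure" and B :: "('t, 'g, 'q, 'b) fo_structure"
  assumes wfB: "wf_structure B"
    and inj: "\<And>s. s \<in> sorts B ==> inj_on (\<gamma> s) (carrier B s)"
    and q: "\<And>s. s \<in> sorts B ==> q s \<in> sorts (eq_structure A)"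
    and \<gamma>: "\<And>s b. s \<in> sorts B ==> b \<in> carrier B s ==> \<gamma> s b \<in> carrier (eq_structure A) (q s)"
    and img: "\<And>SS R. set SS \<subseteq> sorts B ==> dfn B (carrier B) SS (\<lambda>e. R (map e [0..<length SS])) ==>
      dfn (eq_structure A) (carrier (eq_structure A)) (map q SS)
        (\<lambda>e. \<exists>ws\<in>tuples B SS. R ws \<and> map e [0..<length SS] = map2 \<gamma> SS ws)"
  shows "\<exists>C. interprets A B (\<lambda>s. [q s]) C (\<lambda>s b. [\<gamma> s b])"
proof -
  define g where "g = (\<lambda>s b. [\<gamma> s b])"
  define inv where "inv = (\<lambda>s y. inv_into (carrier B s) (\<gamma> s) (hd y))"
  define C :: "('t, 'g, 'q, 'a eq_elem list) fo_structure" where "C = \<lparr> sorts = sorts B, funs = funs B, fdom = fdom B, fcod = fcod B, rels = rels B, rdom = rdom B,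
    carrier = (\<lambda>s. g s ` carrier B s), funI = (\<lambda>f ys. g (fcod B f) (funI B f (map2 inv (fdom B f) ys))),
    relI = (\<lambda>r. map2 g (rdom B r) ` relI B r) \<rparr>"
  have C: "sorts C = sorts B" "funs C = funs B" "fdom C = fdom B" "fcod C = fcod B" "rels C = rels B" "rdom C = rdom B"
    "carrier C s = g s ` carrier B s" "funI C f ys = g (fcod B f) (funI B f (map2 inv (fdom B f) ys))"
    "relI C r = map2 g (rdom B r) ` relI B r" for s f r ys
    by (simp_all add: C_def)
  have tup: "tuples C ss = map2 g ss ` tuples B ss" for ss
  proof (induction ss)
    case (Cons s ss)
    show ?case
    proof (intro set_eqI iffI)
      fix ys assume "ys \<in> tuples C (s # ss)"
      then obtain y ys' where y: "ys = y # ys'" "y \<in> carrier C s" "ys' \<in> tuples C ss" by (elim tuples_ConsE)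
      then obtain b xs where b: "y = g s b" "b \<in> carrier B s" "ys' = map2 g ss xs" "xs \<in> tuples B ss"
        unfolding C Cons by blast
      then show "ys \<in> map2 g (s # ss) ` tuples B (s # ss)"
        using y by (intro image_eqI[of _ _ "b # xs"]) (simp_all add: tuples_Cons)
    next
      fix ys assume "ys \<in> map2 g (s # ss) ` tuples B (s # ss)"
      then obtain b xs where "ys = map2 g (s # ss) (b # xs)" "b \<in> carrier B s" "xs \<in> tuples B ss"
        by (auto elim!: tuples_ConsE)
      then show "ys \<in> tuples C (s # ss)" using Cons by (simp add: tuples_Cons C)
    qed
  qed simp
  have inv: "map2 inv ss (map2 g ss xs) = xs" if "xs \<in> tuples B ss" "set ss \<subseteq> sorts B" for xs ss
    using that
  proof (induction ss arbitrary: xs)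
    case (Cons s ss)
    obtain b ys where "xs = b # ys" "b \<in> carrier B s" "ys \<in> tuples B ss" using Cons.prems(1) by (elim tuples_ConsE)
    then show ?case using Cons.IH[of ys] Cons.prems(2) inj[of s] by (simp add: inv_def g_def)
  qed simp
  have wfC: "wf_structure C"
    unfolding wf_structure_def C(1-6)
  proof (intro conjI ballI)
    fix f xs assume f: "f \<in> funs B" "xs \<in> tuples C (fdom B f)"
    then obtain ys where ys: "ys \<in> tuples B (fdom B f)" "xs = map2 g (fdom B f) ys" unfolding tup by blast
    then show "funI C f xs \<in> carrier C (fcod B f)" using wf_fun[OF wfB f(1)] inv[OF ys(1)] by (simp add: C)
  next
    fix r assume "r \<in> rels B"
    then show "relI C r \<subseteq> tuples C (rdom B r)" using wf_rel(2)[OF wfB] by (auto simp: C tup)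
  qed (use wf_fun(1,2)[OF wfB] wf_rel(1)[OF wfB] in auto)
  have iso: "fo_iso g B C"
    unfolding fo_iso_def C(1-6)
  proof (intro conjI ballI refl)
    fix s assume "s \<in> sorts B"
    then show "bij_betw (g s) (carrier B s) (carrier C s)"
      using inj[of s] by (auto simp: bij_betw_def C g_def inj_on_def)
  next
    fix f xs assume f: "f \<in> funs B" "xs \<in> tuples B (fdom B f)"
    then show "g (fcod B f) (funI B f xs) = funI C f (map2 g (fdom B f) xs)"
      using inv[OF f(2)] wf_fun(1)[OF wfB f(1)] by (simp add: C)
  next
    fix r xs assume r: "r \<in> rels B" "xs \<in> tuples B (rdom B r)"
    show "xs \<in> relI B r \<longleftrightarrow> map2 g (rdom B r) xs \<in> relI C r"
    proof
      assume "map2 g (rdom B r) xs \<in> relI C r"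
      then obtain ys where ys: "ys \<in> relI B r" "map2 g (rdom B r) xs = map2 g (rdom B r) ys" unfolding C by blast
      then have "xs = ys" using inv[OF r(2) wf_rel(1)[OF wfB r(1)]] inv[of ys "rdom B r"] wf_rel[OF wfB r(1)]
        by (metis subsetD)
      then show "xs \<in> relI B r" using ys by simp
    qed (simp add: C)
  qed
  have len: "length (map2 \<gamma> ss ws) = length ss" if "ws \<in> tuples B ss" for ss ws using tuples_length[OF that] by simp
  have mem: "map2 \<gamma> ss ws \<in> tuples (eq_structure A) (map q ss)" if "ws \<in> tuples B ss" "set ss \<subseteq> sorts B" for ss ws
    using that \<gamma> by (auto simp: tuples_iff subset_iff)
  have img': "definable (eq_structure A) (map q SS) {map2 \<gamma> SS ws | ws. ws \<in> tuples B SS \<and> R ws}"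
    if SS: "set SS \<subseteq> sorts B" and R: "dfn B (carrier B) SS (\<lambda>e. R (map e [0..<length SS]))" for SS R
  proof (rule definable_overI)
    show "set (map q SS) \<subseteq> sorts (eq_structure A)" using SS q by auto
    show "{map2 \<gamma> SS ws | ws. ws \<in> tuples B SS \<and> R ws} \<subseteq> tuples (eq_structure A) (map q SS)"
      using mem SS by blast
    from img[OF SS R] show "dfn (eq_structure A) (carrier (eq_structure A)) (map q SS)
      (\<lambda>e. map e [0..<length (map q SS)] \<in> {map2 \<gamma> SS ws | ws. ws \<in> tuples B SS \<and> R ws})"
      by (rule dfn_cong) auto
  qed
  have "definable_structure (eq_structure A) (\<lambda>s. [q s]) C"
    unfolding definable_structure_def C(1-6)
  proof (intro conjI ballI wfC)
    fix s assume s: "s \<in> sorts B"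
    have "tuples B [s] = (\<lambda>b. [b]) ` carrier B s" by (auto simp: tuples_Cons elim!: tuples_ConsE)
    then have "{map2 \<gamma> [s] ws | ws. ws \<in> tuples B [s] \<and> True} = map2 \<gamma> [s] ` (\<lambda>b. [b]) ` carrier B s" by blast
    then have "{map2 \<gamma> [s] ws | ws. ws \<in> tuples B [s] \<and> True} = carrier C s"
      by (simp add: C g_def image_image)
    then show "definable (eq_structure A) [q s] (carrier C s)"
      using img'[of "[s]" "\<lambda>_. True", OF _ dfn_True] s by simp
  next
    fix f assume f: "f \<in> funs B"
    define n where "n = length (fdom B f)"
    have w: "set (fdom B f) \<subseteq> sorts B" "fcod B f \<in> sorts B" using wf_fun[OF wfB f] by auto
    have "dfn B (carrier B) (fdom B f @ [fcod B f]) (\<lambda>e. e n = funI B f (map e [0..<n]))"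
      using f by (intro dfn_fun) (auto simp: n_def nth_append intro!: nth_equalityI)
    \<comment> \<open>The required graph lists the arguments first and the value at the end.\<close>
    then have "dfn B (carrier B) (fdom B f @ [fcod B f]) (\<lambda>e. last (map e [0..<length (fdom B f @ [fcod B f])]) =
      funI B f (butlast (map e [0..<length (fdom B f @ [fcod B f])])))"
      by (rule dfn_cong) (simp add: n_def)
    from img'[OF _ this]
    have "definable (eq_structure A) (map q (fdom B f @ [fcod B f])) {map2 \<gamma> (fdom B f @ [fcod B f]) ws | ws.
      ws \<in> tuples B (fdom B f @ [fcod B f]) \<and> last ws = funI B f (butlast ws)}" using w by simp
    also have "{map2 \<gamma> (fdom B f @ [fcod B f]) ws | ws. ws \<in> tuples B (fdom B f @ [fcod B f]) \<and> last ws = funI B f (butlast ws)}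
      = {map2 \<gamma> (fdom B f) xs @ [\<gamma> (fcod B f) (funI B f xs)] | xs. xs \<in> tuples B (fdom B f)}" (is "?L = ?R")
    proof (intro set_eqI iffI)
      fix ys assume "ys \<in> ?L"
      then obtain ws where ws: "ys = map2 \<gamma> (fdom B f @ [fcod B f]) ws" "ws \<in> tuples B (fdom B f @ [fcod B f])"
        "last ws = funI B f (butlast ws)" by blast
      obtain xs vs where v: "ws = xs @ vs" "xs \<in> tuples B (fdom B f)" "vs \<in> tuples B [fcod B f]"
        using ws(2) by (elim tuples_appendE)
      then obtain v where "vs = [v]" by (auto elim!: tuples_ConsE)
      then show "ys \<in> ?R" using ws v tuples_length[OF v(2)] by auto
    next
      fix ys assume "ys \<in> ?R"
      then obtain xs where xs: "ys = map2 \<gamma> (fdom B f) xs @ [\<gamma> (fcod B f) (funI B f xs)]" "xs \<in> tuples B (fdom B f)" by blast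
      have "xs @ [funI B f xs] \<in> tuples B (fdom B f @ [fcod B f])"
        using xs(2) wf_fun(3)[OF wfB f xs(2)] tuples_length[OF xs(2)] by (simp add: tuples_append tuples_Cons)
      then show "ys \<in> ?L" using xs tuples_length[OF xs(2)]
        by (intro CollectI exI[of _ "xs @ [funI B f xs]"]) auto
    qed
    also have "\<dots> = {concat xs @ funI C f xs | xs. xs \<in> tuples C (fdom B f)}"
    proof -
      have "concat (map2 g (fdom B f) xs) @ funI C f (map2 g (fdom B f) xs) =
          map2 \<gamma> (fdom B f) xs @ [\<gamma> (fcod B f) (funI B f xs)]" if "xs \<in> tuples B (fdom B f)" for xs
        unfolding C inv[OF that w(1)] by (simp add: g_def concat_map2_singleton)
      then have "{map2 \<gamma> (fdom B f) xs @ [\<gamma> (fcod B f) (funI B f xs)] | xs. xs \<in> tuples B (fdom B f)} =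
        {concat (map2 g (fdom B f) xs) @ funI C f (map2 g (fdom B f) xs) | xs. xs \<in> tuples B (fdom B f)}"
        by (intro Collect_cong ex_cong1) auto
      also have "\<dots> = {concat ys @ funI C f ys | ys. ys \<in> map2 g (fdom B f) ` tuples B (fdom B f)}" by blast
      finally show ?thesis unfolding tup .
    qed
    finally show "definable (eq_structure A) (concat (map (\<lambda>s. [q s]) (fdom B f)) @ [q (fcod B f)])
      {concat xs @ funI C f xs | xs. xs \<in> tuples C (fdom B f)}" by simp
  next
    fix r assume r: "r \<in> rels B"
    have "dfn B (carrier B) (rdom B r) (\<lambda>e. map e [0..<length (rdom B r)] \<in> relI B r)"
      using r by (intro dfn_rel) (auto intro!: nth_equalityI)
    from img'[OF wf_rel(1)[OF wfB r], of "\<lambda>xs. xs \<in> relI B r", OF this]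
    have "definable (eq_structure A) (map q (rdom B r)) {map2 \<gamma> (rdom B r) ws | ws. ws \<in> tuples B (rdom B r) \<and> ws \<in> relI B r}" .
    also have "{map2 \<gamma> (rdom B r) ws | ws. ws \<in> tuples B (rdom B r) \<and> ws \<in> relI B r} = concat ` relI C r"
    proof -
      have "concat ` relI C r = map2 \<gamma> (rdom B r) ` relI B r"
        unfolding C image_image g_def concat_map2_singleton ..
      then show ?thesis using wf_rel(2)[OF wfB r] by blast
    qed
    finally show "definable (eq_structure A) (concat (map (\<lambda>s. [q s]) (rdom B r))) (concat ` relI C r)" by simp
  qed
  then show ?thesis using iso unfolding interprets_def g_def by blast
qed

subsection \<open>A criterion for bi-interpretability\<close>

abbreviation qE where "qE A \<tau> X \<pi> \<equiv> cinterp.qsort A (tauE \<tau>) (XE A \<tau> X) (piE \<tau> \<pi>)"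
abbreviation gE where "gE A \<tau> X \<pi> \<equiv> cinterp.gam A (tauE \<tau>) (XE A \<tau> X) (piE \<tau> \<pi>)"

lemma map2_Home: "map2 \<gamma> (map Home SS) (map Elem ws) = map2 (\<lambda>s b. \<gamma> (Home s) (Elem b)) SS ws"
  by (induction SS ws rule: list_induct2') auto

lemma dfn_lift_list:
  assumes "dfn B (carrier B) SS (\<lambda>e. R (map e [0..<length SS]))"
  shows "dfn (eq_structure B) (carrier (eq_structure B)) (map Home SS)
    (\<lambda>e. R (map the_Elem (map e [0..<length (map Home SS)])))"
  using dfn_lift[OF assms, of "carrier (eq_structure B)"] by (simp add: comp_def)

text \<open>B is interpreted by restricting the interpretation of its expansion to the home sorts,
  instead of by \<open>gam\<close> for B itself. Compatibility in the sense of
  \<open>extends_interp\<close> then holds by definition.\<close>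

lemma (in cinterp) interprets_eq:
  "\<exists>C. interprets A (eq_structure B) (\<lambda>S. [qE A \<tau> X \<pi> S]) C (\<lambda>S b. [gE A \<tau> X \<pi> S b])"
  "\<exists>C. interprets A B (\<lambda>s. [qE A \<tau> X \<pi> (Home s)]) C (\<lambda>s b. [gE A \<tau> X \<pi> (Home s) (Elem b)])"
proof -
  interpret E: cinterp A "eq_structure B" "tauE \<tau>" "XE A \<tau> X" "piE \<tau> \<pi>" by (rule eq_cinterp)
  show "\<exists>C. interprets A (eq_structure B) (\<lambda>S. [qE A \<tau> X \<pi> S]) C (\<lambda>S b. [gE A \<tau> X \<pi> S b])"
    by (rule interpretsI[OF E.wfB E.gam_inj E.qsort_in E.gam_in]) (use E.image_dfn E.pull in blast)+
  show "\<exists>C. interprets A B (\<lambda>s. [qE A \<tau> X \<pi> (Home s)]) C (\<lambda>s b. [gE A \<tau> X \<pi> (Home s) (Elem b)])"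
  proof (rule interpretsI[OF wfB])
    fix s assume s: "s \<in> sorts B"
    show "inj_on (\<lambda>b. E.gam (Home s) (Elem b)) (carrier B s)"
      using E.gam_inj[of "Home s"] s by (auto simp: inj_on_def)
    show "E.qsort (Home s) \<in> sorts (eq_structure A)" using E.qsort_in[of "Home s"] s by simp
    fix b assume "b \<in> carrier B s"
    then show "E.gam (Home s) (Elem b) \<in> carrier (eq_structure A) (E.qsort (Home s))"
      using E.gam_in[of "Home s" "Elem b"] s by simp
  next
    fix SS and R :: "'b list => bool"
    assume SS: "set SS \<subseteq> sorts B" and R: "dfn B (carrier B) SS (\<lambda>e. R (map e [0..<length SS]))"
    have S': "set (map Home SS) \<subseteq> sorts (eq_structure B)" using SS by auto
    have "pbk A (tauE \<tau>) (XE A \<tau> X) (piE \<tau> \<pi>) (map Home SS) (\<lambda>ws. R (map the_Elem ws))"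
      by (rule E.pull[OF dfn_lift_list[OF R] S'])
    from E.image_dfn[OF S' this] show "dfn (eq_structure A) (carrier (eq_structure A)) (map (\<lambda>s. E.qsort (Home s)) SS)
        (\<lambda>e. \<exists>ws\<in>tuples B SS. R ws \<and> map e [0..<length SS] = map2 (\<lambda>s b. E.gam (Home s) (Elem b)) SS ws)"
      by (simp add: tuples_eq comp_def map2_Home)
  qed
qed

text \<open>The graph of the composed coordinate map, with the value at the head: the tail decodes
  to a tuple of B, and this tuple decodes to the head.\<close>

definition comp_graph where
  "comp_graph \<tau>B XB \<pi>B \<tau>A XA \<pi>A s xs \<longleftrightarrow> valid \<tau>B XB (\<tau>A s) (tl xs) \<and>
     dec \<tau>B \<pi>B (\<tau>A s) (tl xs) \<in> XA s \<and> \<pi>A s (dec \<tau>B \<pi>B (\<tau>A s) (tl xs)) = hd xs"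

text \<open>The composed embedding passes through an imaginary of B that involves parameters
  \<open>b\<close>. Its value at a is therefore the class of a tuple y whose decoding is
  E-equivalent to x @ b for some preimage x of a, and it is the hypothesis on the composed
  coordinate map that ties x to a definably.\<close>

lemma composite_graph:
  fixes A :: "('s, 'f, 'r, 'a) fo_structure" and B :: "('t, 'g, 'q, 'b) fo_structure"
  assumes "cinterp A B \<tau>B XB \<pi>B" "cinterp B A \<tau>A XA \<pi>A"
    and s: "s \<in> sorts A"
    and H: "dfn A (carrier A) (s # tt \<tau>B (\<tau>A s)) (\<lambda>e. comp_graph \<tau>B XB \<pi>B \<tau>A XA \<pi>A s (map e [0..<length (s # tt \<tau>B (\<tau>A s))]))"
  shows "dfn (eq_structure A) (carrier (eq_structure A)) [Home s, qE A \<tau>B XB \<pi>B (qE B \<tau>A XA \<pi>A (Home s))]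
    (\<lambda>e. \<exists>a\<in>carrier A s. e 0 = Elem a \<and> e 1 = gE A \<tau>B XB \<pi>B (qE B \<tau>A XA \<pi>A (Home s)) (gE B \<tau>A XA \<pi>A (Home s) (Elem a)))"
proof -
  interpret P: cinterp A B \<tau>B XB \<pi>B by fact
  interpret R: cinterp B A \<tau>A XA \<pi>A by fact
  interpret PE: cinterp A "eq_structure B" "tauE \<tau>B" "XE A \<tau>B XB" "piE \<tau>B \<pi>B" by (rule P.eq_cinterp)
  interpret RE: cinterp B "eq_structure A" "tauE \<tau>A" "XE B \<tau>A XA" "piE \<tau>A \<pi>A" by (rule R.eq_cinterp)
  have hs: "Home s \<in> sorts (eq_structure A)" using s by simp
  show ?thesis
  proof (rule RE.qcE[OF hs])
    fix \<Delta> b E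
    assume g: "RE.good (Home s) \<Delta> b E" and qs: "RE.qsort (Home s) = Quot (tauE \<tau>A (Home s) @ \<Delta>) E"
      and c: "\<And>x. RE.cls (Home s) x = Class (E `` {x @ b})"
    define T where "T = \<tau>A s"
    define SS where "SS = T @ \<Delta>"
    define Q where "Q = Quot SS E"
    have q: "RE.qsort (Home s) = Q" using qs by (simp add: Q_def SS_def T_def)
    have z: "zero_def_equiv B SS E" and b: "b \<in> tuples B \<Delta>" using g by (simp_all add: RE.good_def SS_def T_def)
    have Qs: "Q \<in> sorts (eq_structure B)" using z by (simp add: Q_def)
    have SSs: "set SS \<subseteq> sorts B" and eqv: "equiv (tuples B SS) E" using z by (simp_all add: zero_def_equiv_def)
    have Ts: "set T \<subseteq> sorts B" and \<Delta>s: "set \<Delta> \<subseteq> sorts B" using SSs by (auto simp: SS_def)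
    define n1 n2 N where "n1 = length (tt \<tau>B T)" "n2 = length (tt \<tau>B \<Delta>)" "N = length (tt \<tau>B SS)"
    have N: "N = n1 + n2" by (simp add: n1_n2_N_def SS_def)
    have XT: "XA s \<subseteq> tuples B T" using R.X_sub[OF s] by (simp add: T_def)
    text \<open>Variables of the context: the code \<open>y\<close> at \<open>0\<close>, then the element \<open>a\<close>; two blocks \<open>u\<close>, \<open>v\<close>
      coding a preimage of \<open>a\<close> and the parameters are quantified.\<close>
    define \<Gamma> where "\<Gamma> = tt \<tau>B SS @ [s]"
    define W where "W y a \<longleftrightarrow> valid \<tau>B XB SS y \<and> (\<exists>u\<in>tuples A (tt \<tau>B T). \<exists>v\<in>tuples A (tt \<tau>B \<Delta>).
      comp_graph \<tau>B XB \<pi>B \<tau>A XA \<pi>A s (a # u) \<and> valid \<tau>B XB \<Delta> v \<and> dec \<tau>B \<pi>B \<Delta> v = b \<and>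
      (dec \<tau>B \<pi>B SS y, dec \<tau>B \<pi>B SS (u @ v)) \<in> E)" for y a
    have Wdfn: "dfn A (carrier A) \<Gamma> (\<lambda>e. W (map e [0..<N]) (e N))"
    proof -
      define \<Gamma>2 where "\<Gamma>2 = tt \<tau>B \<Delta> @ tt \<tau>B T @ \<Gamma>"
      define py where "py = map ((+) n2) (map ((+) n1) [0..<N])"
      define pu where "pu = map ((+) n2) [0..<n1]"
      have oy: "okp \<Gamma>2 (tt \<tau>B SS) py" unfolding \<Gamma>2_def py_def n1_n2_N_def \<Gamma>_def
        by (intro okp_shift okp_prefix)
      have ou: "okp \<Gamma>2 (tt \<tau>B T) pu" unfolding \<Gamma>2_def pu_def n1_n2_N_def by (intro okp_shift okp_prefix)
      have ov: "okp \<Gamma>2 (tt \<tau>B \<Delta>) [0..<n2]" unfolding \<Gamma>2_def n1_n2_N_def by (rule okp_prefix)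
      have oa: "n2 + (n1 + N) < length \<Gamma>2" "\<Gamma>2 ! (n2 + (n1 + N)) = s"
        by (auto simp: \<Gamma>2_def \<Gamma>_def n1_n2_N_def nth_append)
      have ouv: "okp \<Gamma>2 (tt \<tau>B SS) (pu @ [0..<n2])" using okp_append[OF ou ov] by (simp add: SS_def)
      have oau: "okp \<Gamma>2 (s # tt \<tau>B (\<tau>A s)) ((n2 + (n1 + N)) # pu)" using ou oa by (simp add: okp_Cons T_def)
      have "dfn B (carrier B) \<Delta> (\<lambda>e. \<forall>k<length \<Delta>. e k = b ! k)"
        using b by (intro dfn_All_less dfn_const) (auto simp: tuples_iff)
      then have "dfn B (carrier B) \<Delta> (\<lambda>e. map e [0..<length \<Delta>] = b)"
        by (rule dfn_cong) (use map_nth_const[of b "[0..<length \<Delta>]"] tuples_length[OF b] in simp)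
      from pbk_at[OF P.pull[where R = "\<lambda>ws. ws = b", OF this \<Delta>s], of \<Gamma>2 "[0..<n2]", OF ov]
      have d2: "dfn A (carrier A) \<Gamma>2 (\<lambda>e. valid \<tau>B XB \<Delta> (map e [0..<n2]) \<and> dec \<tau>B \<pi>B \<Delta> (map e [0..<n2]) = b)" .
      have d1: "dfn A (carrier A) \<Gamma>2 (\<lambda>e. comp_graph \<tau>B XB \<pi>B \<tau>A XA \<pi>A s (map e ((n2 + (n1 + N)) # pu)))"
        by (rule dfn_okp[OF H oau])
      have "dfn A (carrier A) \<Gamma>2 (\<lambda>e. comp_graph \<tau>B XB \<pi>B \<tau>A XA \<pi>A s (map e ((n2 + (n1 + N)) # pu)) \<and>
          (valid \<tau>B XB \<Delta> (map e [0..<n2]) \<and> dec \<tau>B \<pi>B \<Delta> (map e [0..<n2]) = b) \<and>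
          (valid \<tau>B XB SS (map e py) \<and> valid \<tau>B XB SS (map e (pu @ [0..<n2])) \<and>
           (dec \<tau>B \<pi>B SS (map e py), dec \<tau>B \<pi>B SS (map e (pu @ [0..<n2]))) \<in> E))"
        by (rule dfn_conj[OF d1 dfn_conj[OF d2 P.zero_def_at[OF z oy ouv]]])
      from dfn_block_ex0[OF P.tt_sorts[OF Ts] dfn_block_ex0[OF P.tt_sorts[OF \<Delta>s] this[unfolded \<Gamma>2_def]]]
      show ?thesis
      proof (rule dfn_cong)
        fix e
        have k: "map (cat v (cat u e)) ((n2 + (n1 + N)) # pu) = e N # u" "map (cat v (cat u e)) [0..<n2] = v"
          "map (cat v (cat u e)) py = map e [0..<N]" "map (cat v (cat u e)) (pu @ [0..<n2]) = u @ v"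
          if "u \<in> tuples A (tt \<tau>B T)" "v \<in> tuples A (tt \<tau>B \<Delta>)" for u v
        proof -
          have l: "length u = n1" "length v = n2" using that tuples_length by (auto simp: n1_n2_N_def)
          have c1: "cat v (cat u e) (n2 + i) = cat u e i" "cat u e (n1 + i) = e i" for i
            using l by (simp_all add: cat_def)
          have m: "map (cat u e) [0..<n1] = u" using l by (simp add: map_cat_prefix)
          show "map (cat v (cat u e)) [0..<n2] = v" using l by (simp add: map_cat_prefix)
          then show "map (cat v (cat u e)) ((n2 + (n1 + N)) # pu) = e N # u"
            "map (cat v (cat u e)) py = map e [0..<N]" "map (cat v (cat u e)) (pu @ [0..<n2]) = u @ v"
            using m by (simp_all add: pu_def py_def c1 comp_def)
        qed
        have vv: "valid \<tau>B XB SS (u @ v) \<longleftrightarrow> valid \<tau>B XB T u \<and> valid \<tau>B XB \<Delta> v" if "u \<in> tuples A (tt \<tau>B T)" for u v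
          unfolding SS_def by (rule dec_append(2)[OF tuples_length[OF that]])
        have cg: "comp_graph \<tau>B XB \<pi>B \<tau>A XA \<pi>A s (x # u) ==> valid \<tau>B XB T u" for x u
          by (simp add: comp_graph_def T_def)
        show "(\<exists>u\<in>tuples A (tt \<tau>B T). \<exists>v\<in>tuples A (tt \<tau>B \<Delta>).
          comp_graph \<tau>B XB \<pi>B \<tau>A XA \<pi>A s (map (cat v (cat u e)) ((n2 + (n1 + N)) # pu)) \<and>
          (valid \<tau>B XB \<Delta> (map (cat v (cat u e)) [0..<n2]) \<and> dec \<tau>B \<pi>B \<Delta> (map (cat v (cat u e)) [0..<n2]) = b) \<and>
          (valid \<tau>B XB SS (map (cat v (cat u e)) py) \<and> valid \<tau>B XB SS (map (cat v (cat u e)) (pu @ [0..<n2])) \<and>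
           (dec \<tau>B \<pi>B SS (map (cat v (cat u e)) py), dec \<tau>B \<pi>B SS (map (cat v (cat u e)) (pu @ [0..<n2]))) \<in> E)) \<longleftrightarrow>
          W (map e [0..<N]) (e N)" (is "?L \<longleftrightarrow> ?R")
        proof
          assume ?L
          then obtain u v where uv: "u \<in> tuples A (tt \<tau>B T)" "v \<in> tuples A (tt \<tau>B \<Delta>)" and h:
            "comp_graph \<tau>B XB \<pi>B \<tau>A XA \<pi>A s (e N # u) \<and> (valid \<tau>B XB \<Delta> v \<and> dec \<tau>B \<pi>B \<Delta> v = b) \<and>
             (valid \<tau>B XB SS (map e [0..<N]) \<and> valid \<tau>B XB SS (u @ v) \<and> (dec \<tau>B \<pi>B SS (map e [0..<N]), dec \<tau>B \<pi>B SS (u @ v)) \<in> E)"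
            using k by metis
          then show ?R unfolding W_def by blast
        next
          assume ?R
          then obtain u v where uv: "u \<in> tuples A (tt \<tau>B T)" "v \<in> tuples A (tt \<tau>B \<Delta>)" and h:
            "valid \<tau>B XB SS (map e [0..<N])" "comp_graph \<tau>B XB \<pi>B \<tau>A XA \<pi>A s (e N # u)" "valid \<tau>B XB \<Delta> v" "dec \<tau>B \<pi>B \<Delta> v = b"
            "(dec \<tau>B \<pi>B SS (map e [0..<N]), dec \<tau>B \<pi>B SS (u @ v)) \<in> E" unfolding W_def by blast
          show ?L
            by (rule bexI[OF bexI[OF _ uv(2)] uv(1)]) (unfold k[OF uv] vv[OF uv(1)], use h cg in blast)
        qed
      qed
    qed
    have W: "W y a \<and> a \<in> carrier A s \<longleftrightarrow> y \<in> XE A \<tau>B XB Q \<and> a \<in> carrier A s \<and> piE \<tau>B \<pi>B Q y = RE.gam (Home s) (Elem a)"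
      if y: "y \<in> tuples A (tt \<tau>B SS)" for y a
    proof -
      have gm: "RE.gam (Home s) (Elem (\<pi>A s x)) = Class (E `` {x @ b})" if "x \<in> XA s" for x
        using RE.gam_pi[OF hs, of x] that c by simp
      have xb: "x @ b \<in> tuples B SS" if "x \<in> XA s" for x
      proof -
        have "x \<in> tuples B T" using that XT by blast
        then show ?thesis using b tuples_append[OF tuples_length] unfolding SS_def by blast
      qed
      have du: "dec \<tau>B \<pi>B SS (u @ v) = dec \<tau>B \<pi>B T u @ dec \<tau>B \<pi>B \<Delta> v" if "u \<in> tuples A (tt \<tau>B T)" for u v
        unfolding SS_def by (rule dec_append(1)[OF tuples_length[OF that]])
      show ?thesis
      proof
        assume L: "W y a \<and> a \<in> carrier A s"
        then obtain u v where uv: "u \<in> tuples A (tt \<tau>B T)" "v \<in> tuples A (tt \<tau>B \<Delta>)" "valid \<tau>B XB SS y"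
          "comp_graph \<tau>B XB \<pi>B \<tau>A XA \<pi>A s (a # u)" "dec \<tau>B \<pi>B \<Delta> v = b"
          "(dec \<tau>B \<pi>B SS y, dec \<tau>B \<pi>B SS (u @ v)) \<in> E" unfolding W_def by blast
        define x where "x = dec \<tau>B \<pi>B T u"
        have x: "x \<in> XA s" "\<pi>A s x = a" using uv(4) by (simp_all add: comp_graph_def x_def T_def)
        have "(dec \<tau>B \<pi>B SS y, x @ b) \<in> E" using uv(6) du[OF uv(1), of v] uv(5) by (simp add: x_def)
        then have "E `` {dec \<tau>B \<pi>B SS y} = E `` {x @ b}" by (rule equiv_class_eq[OF eqv])
        then show "y \<in> XE A \<tau>B XB Q \<and> a \<in> carrier A s \<and> piE \<tau>B \<pi>B Q y = RE.gam (Home s) (Elem a)"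
          using gm[OF x(1)] x(2) L y uv(3) by (simp add: Q_def)
      next
        assume Rr: "y \<in> XE A \<tau>B XB Q \<and> a \<in> carrier A s \<and> piE \<tau>B \<pi>B Q y = RE.gam (Home s) (Elem a)"
        then have "a \<in> \<pi>A s ` XA s" using R.surj[OF s] by simp
        then obtain x where x: "x \<in> XA s" "a = \<pi>A s x" by blast
        have vy: "valid \<tau>B XB SS y" using Rr by (simp add: Q_def)
        have "E `` {dec \<tau>B \<pi>B SS y} = E `` {x @ b}" using Rr gm[OF x(1)] x(2) by (simp add: Q_def)
        then have e: "(dec \<tau>B \<pi>B SS y, x @ b) \<in> E"
          using eq_equiv_class_iff[OF eqv P.dec_in[OF SSs vy] xb[OF x(1)]] by simp
        have "x \<in> tuples B T" using x XT by blast
        then obtain u where u: "u \<in> tuples A (tt \<tau>B T)" "valid \<tau>B XB T u" "dec \<tau>B \<pi>B T u = x"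
          by (rule P.dec_surj[OF Ts])
        obtain v where v: "v \<in> tuples A (tt \<tau>B \<Delta>)" "valid \<tau>B XB \<Delta> v" "dec \<tau>B \<pi>B \<Delta> v = b"
          by (rule P.dec_surj[OF \<Delta>s b])
        have "comp_graph \<tau>B XB \<pi>B \<tau>A XA \<pi>A s (a # u)" using u x by (simp add: comp_graph_def T_def)
        moreover have "(dec \<tau>B \<pi>B SS y, dec \<tau>B \<pi>B SS (u @ v)) \<in> E" using e du[OF u(1), of v] u v by simp
        ultimately show "W y a \<and> a \<in> carrier A s" unfolding W_def using vy u v Rr by blast
      qed
    qed
    define TS :: "('s, 'a) eq_sort list" where "TS = map Home (tt \<tau>B SS)"
    have TSs: "set TS \<subseteq> sorts (eq_structure A)" using P.tt_sorts[OF SSs] by (auto simp: TS_def)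
    have lTS: "length TS = N" by (simp add: TS_def n1_n2_N_def)
    define \<Gamma>3 where "\<Gamma>3 = TS @ [Home s, PE.qsort Q]"
    have "dfn (eq_structure A) (carrier (eq_structure A)) (map Home \<Gamma>) (\<lambda>e. W (map (\<lambda>i. the_Elem (e i)) [0..<N]) (the_Elem (e N)))"
      using dfn_lift[OF Wdfn, of "carrier (eq_structure A)"] by simp
    from dfn_reindex[OF this, of "\<lambda>i. i" \<Gamma>3]
    have e1: "dfn (eq_structure A) (carrier (eq_structure A)) \<Gamma>3 (\<lambda>e. W (map (\<lambda>i. the_Elem (e i)) [0..<N]) (the_Elem (e N)))"
      by (simp add: \<Gamma>3_def \<Gamma>_def TS_def nth_append)
    have "okp \<Gamma>3 (map Home (tauE \<tau>B Q)) [0..<N]"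
      using okp_prefix[of TS "[Home s, PE.qsort Q]"] lTS by (simp add: \<Gamma>3_def TS_def Q_def)
    from PE.cls_dfn[OF Qs this, of "Suc N"] lTS
    have e2: "dfn (eq_structure A) (carrier (eq_structure A)) \<Gamma>3 (\<lambda>e. e (Suc N) = PE.cls Q (map (\<lambda>i. the_Elem (e i)) [0..<N]))"
      by (simp add: \<Gamma>3_def nth_append)
    from dfn_block_ex0[OF TSs dfn_conj[OF e1 e2, unfolded \<Gamma>3_def]]
    have "dfn (eq_structure A) (carrier (eq_structure A)) [Home s, PE.qsort Q]
      (\<lambda>e. \<exists>a\<in>carrier A s. e 0 = Elem a \<and> e 1 = PE.gam Q (RE.gam (Home s) (Elem a)))"
    proof (rule dfn_cong)
      fix e assume "wt (eq_structure A) [Home s, PE.qsort Q] e"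
      then have "e 0 \<in> Elem ` carrier A s" unfolding wt_def by fastforce
      then obtain a where a: "e 0 = Elem a" "a \<in> carrier A s" by blast
      have k: "map (\<lambda>i. the_Elem (cat (map Elem y) e i)) [0..<N] = y" "cat (map Elem y) e N = e 0" "cat (map Elem y) e (Suc N) = e 1"
        if "y \<in> tuples A (tt \<tau>B SS)" for y
      proof -
        have "length y = N" using tuples_length[OF that] by (simp add: n1_n2_N_def)
        then show "map (\<lambda>i. the_Elem (cat (map Elem y) e i)) [0..<N] = y" "cat (map Elem y) e N = e 0" "cat (map Elem y) e (Suc N) = e 1"
          by (auto simp: cat_def intro!: nth_equalityI)
      qed
      have ga: "RE.gam (Home s) (Elem a) \<in> carrier (eq_structure B) Q" using RE.gam_in[OF hs, of "Elem a"] a q by simp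
      have XQ: "XE A \<tau>B XB Q \<subseteq> tuples A (tt \<tau>B SS)" by (auto simp: Q_def)
      have "(\<exists>xs\<in>tuples (eq_structure A) TS. W (map (\<lambda>i. the_Elem (cat xs e i)) [0..<N]) (the_Elem (cat xs e N)) \<and>
          cat xs e (Suc N) = PE.cls Q (map (\<lambda>i. the_Elem (cat xs e i)) [0..<N])) \<longleftrightarrow>
        (\<exists>y\<in>tuples A (tt \<tau>B SS). W y a \<and> e 1 = PE.cls Q y)"
        unfolding TS_def tuples_eq bex_simps(7) using k a by simp
      also have "\<dots> \<longleftrightarrow> e 1 = PE.gam Q (RE.gam (Home s) (Elem a))"
      proof
        assume "\<exists>y\<in>tuples A (tt \<tau>B SS). W y a \<and> e 1 = PE.cls Q y"
        then obtain y where y: "y \<in> tuples A (tt \<tau>B SS)" "W y a" "e 1 = PE.cls Q y" by blast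
        have "y \<in> XE A \<tau>B XB Q" "piE \<tau>B \<pi>B Q y = RE.gam (Home s) (Elem a)" using W[OF y(1), of a] y(2) a(2) by blast+
        then show "e 1 = PE.gam Q (RE.gam (Home s) (Elem a))" using PE.gam_pi[OF Qs, of y] y(3) by simp
      next
        assume h: "e 1 = PE.gam Q (RE.gam (Home s) (Elem a))"
        obtain y where y: "y \<in> XE A \<tau>B XB Q" "RE.gam (Home s) (Elem a) = piE \<tau>B \<pi>B Q y"
          using ga unfolding PE.surj[OF Qs, symmetric] by blast
        then have "W y a" using W[of y a] XQ a by auto
        then show "\<exists>y\<in>tuples A (tt \<tau>B SS). W y a \<and> e 1 = PE.cls Q y" using y XQ h PE.gam_pi[OF Qs y(1)] by auto
      qed
      also have "\<dots> \<longleftrightarrow> (\<exists>a\<in>carrier A s. e 0 = Elem a \<and> e 1 = PE.gam Q (RE.gam (Home s) (Elem a)))"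
        using a by auto
      finally show "(\<exists>xs\<in>tuples (eq_structure A) TS. W (map (\<lambda>i. the_Elem (cat xs e i)) [0..<N]) (the_Elem (cat xs e N)) \<and>
          cat xs e (Suc N) = PE.cls Q (map (\<lambda>i. the_Elem (cat xs e i)) [0..<N])) \<longleftrightarrow>
        (\<exists>a\<in>carrier A s. e 0 = Elem a \<and> e 1 = PE.gam Q (RE.gam (Home s) (Elem a)))" .
    qed
    then show ?thesis unfolding q by simp
  qed
qed

text \<open>Both claims come from the graph of the composed embedding: the image of a definable
  relation under it is obtained by quantifying over the home elements and demanding the graph in
  each coordinate.\<close>

lemma composite:
  fixes A :: "('s, 'f, 'r, 'a) fo_structure" and B :: "('t, 'g, 'q, 'b) fo_structure"
  assumes P: "cinterp A B \<tau>B XB \<pi>B" and R: "cinterp B A \<tau>A XA \<pi>A"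
    and H: "\<And>s. s \<in> sorts A ==>
      dfn A (carrier A) (s # tt \<tau>B (\<tau>A s)) (\<lambda>e. comp_graph \<tau>B XB \<pi>B \<tau>A XA \<pi>A s (map e [0..<length (s # tt \<tau>B (\<tau>A s))]))"
  defines "\<gamma> \<equiv> \<lambda>s. [qE A \<tau>B XB \<pi>B (qE B \<tau>A XA \<pi>A (Home s))]"
    and "h \<equiv> \<lambda>s a. [gE A \<tau>B XB \<pi>B (qE B \<tau>A XA \<pi>A (Home s)) (gE B \<tau>A XA \<pi>A (Home s) (Elem a))]"
  shows "\<exists>C. interprets A A \<gamma> C h" "definable_self_iso A \<gamma> h"
proof -
  interpret P: cinterp A B \<tau>B XB \<pi>B by fact
  interpret R: cinterp B A \<tau>A XA \<pi>A by fact
  interpret PE: cinterp A "eq_structure B" "tauE \<tau>B" "XE A \<tau>B XB" "piE \<tau>B \<pi>B" by (rule P.eq_cinterp)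
  interpret RE: cinterp B "eq_structure A" "tauE \<tau>A" "XE B \<tau>A XA" "piE \<tau>A \<pi>A" by (rule R.eq_cinterp)
  define q where "q s = PE.qsort (RE.qsort (Home s))" for s
  define g where "g s a = PE.gam (RE.qsort (Home s)) (RE.gam (Home s) (Elem a))" for s a
  have \<gamma>: "\<gamma> = (\<lambda>s. [q s])" "h = (\<lambda>s a. [g s a])" by (simp_all add: \<gamma>_def h_def q_def g_def fun_eq_iff)
  have graph: "dfn (eq_structure A) (carrier (eq_structure A)) [Home s, q s] (\<lambda>e. \<exists>a\<in>carrier A s. e 0 = Elem a \<and> e 1 = g s a)"
    if "s \<in> sorts A" for s
    using composite_graph[OF P R that H[OF that]] unfolding q_def g_def .
  have Rq: "RE.qsort (Home s) \<in> sorts (eq_structure B)" if "s \<in> sorts A" for s using RE.qsort_in[of "Home s"] that by simp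
  have q: "q s \<in> sorts (eq_structure A)" if "s \<in> sorts A" for s
    unfolding q_def by (rule PE.qsort_in[OF Rq[OF that]])
  have Rg: "RE.gam (Home s) (Elem a) \<in> carrier (eq_structure B) (RE.qsort (Home s))" if "s \<in> sorts A" "a \<in> carrier A s" for s a
    using RE.gam_in[of "Home s" "Elem a"] that by simp
  have g: "g s a \<in> carrier (eq_structure A) (q s)" if "s \<in> sorts A" "a \<in> carrier A s" for s a
    unfolding q_def g_def by (rule PE.gam_in[OF Rq[OF that(1)] Rg[OF that]])
  have inj: "inj_on (g s) (carrier A s)" if s: "s \<in> sorts A" for s
  proof (rule inj_onI)
    fix a a' assume a: "a \<in> carrier A s" "a' \<in> carrier A s" "g s a = g s a'"
    then have "RE.gam (Home s) (Elem a) = RE.gam (Home s) (Elem a')"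
      using PE.gam_inj[OF Rq[OF s]] Rg[OF s] unfolding g_def by (blast dest: inj_onD)
    then have "Elem a = Elem a'" using RE.gam_inj[of "Home s"] s a by (auto dest: inj_onD)
    then show "a = a'" by simp
  qed
  show "\<exists>C. interprets A A \<gamma> C h" unfolding \<gamma>
  proof (rule interpretsI[OF P.wfA inj q g])
    fix SS and R :: "'a list => bool"
    assume SS: "set SS \<subseteq> sorts A" and R: "dfn A (carrier A) SS (\<lambda>e. R (map e [0..<length SS]))"
    define n where "n = length SS"
    define \<Gamma> where "\<Gamma> = map Home SS @ map q SS"
    have SSs: "set (map Home SS) \<subseteq> sorts (eq_structure A)" using SS by auto
    from dfn_reindex[OF dfn_lift_list[OF R], of "\<lambda>i. i" \<Gamma>]
    have d1: "dfn (eq_structure A) (carrier (eq_structure A)) \<Gamma> (\<lambda>e. R (map the_Elem (map e [0..<n])))"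
      by (simp add: \<Gamma>_def n_def nth_append)
    have d2: "dfn (eq_structure A) (carrier (eq_structure A)) \<Gamma> (\<lambda>e. \<forall>k<n. \<exists>a\<in>carrier A (SS ! k). e k = Elem a \<and> e (n + k) = g (SS ! k) a)"
    proof (rule dfn_All_less)
      fix k assume k: "k < n"
      then have s: "SS ! k \<in> sorts A" using SS by (auto simp: n_def)
      have idx: "(if i = 0 then k else n + k) < length \<Gamma> \<and>
          \<Gamma> ! (if i = 0 then k else n + k) = [Home (SS ! k), q (SS ! k)] ! i"
        if "i < length [Home (SS ! k), q (SS ! k)]" for i
        using that k by (auto simp: \<Gamma>_def n_def nth_append less_Suc_eq)
      from dfn_reindex[OF graph[OF s], of "\<lambda>i. if i = 0 then k else n + k" \<Gamma>, OF idx]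
      show "dfn (eq_structure A) (carrier (eq_structure A)) \<Gamma> (\<lambda>e. \<exists>a\<in>carrier A (SS ! k). e k = Elem a \<and> e (n + k) = g (SS ! k) a)"
        by simp
    qed
    from dfn_block_ex0[OF SSs dfn_conj[OF d1 d2, unfolded \<Gamma>_def]]
    show "dfn (eq_structure A) (carrier (eq_structure A)) (map q SS)
        (\<lambda>e. \<exists>ws\<in>tuples A SS. R ws \<and> map e [0..<length SS] = map2 g SS ws)"
    proof (rule dfn_cong)
      fix e
      have k: "map the_Elem (map (cat (map Elem ws) e) [0..<n]) = ws"
        "(\<forall>k<n. \<exists>a\<in>carrier A (SS ! k). cat (map Elem ws) e k = Elem a \<and> cat (map Elem ws) e (n + k) = g (SS ! k) a) \<longleftrightarrow>
         map e [0..<length SS] = map2 g SS ws" if ws: "ws \<in> tuples A SS" for ws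
      proof -
        have l: "length ws = n" using tuples_length[OF ws] by (simp add: n_def)
        then show "map the_Elem (map (cat (map Elem ws) e) [0..<n]) = ws"
          by (auto simp: cat_def intro!: nth_equalityI)
        have "(\<forall>k<n. \<exists>a\<in>carrier A (SS ! k). cat (map Elem ws) e k = Elem a \<and> cat (map Elem ws) e (n + k) = g (SS ! k) a) \<longleftrightarrow>
          (\<forall>k<n. e k = g (SS ! k) (ws ! k))"
          using l ws by (auto simp: cat_def tuples_iff n_def)
        also have "\<dots> \<longleftrightarrow> map e [0..<length SS] = map2 g SS ws"
          using map_nth_const[of "map2 g SS ws" "[0..<length SS]" e] l by (simp add: n_def)
        finally show "(\<forall>k<n. \<exists>a\<in>carrier A (SS ! k). cat (map Elem ws) e k = Elem a \<and> cat (map Elem ws) e (n + k) = g (SS ! k) a) \<longleftrightarrow>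
         map e [0..<length SS] = map2 g SS ws" .
      qed
      show "(\<exists>xs\<in>tuples (eq_structure A) (map Home SS). R (map the_Elem (map (cat xs e) [0..<n])) \<and>
          (\<forall>k<n. \<exists>a\<in>carrier A (SS ! k). cat xs e k = Elem a \<and> cat xs e (n + k) = g (SS ! k) a)) \<longleftrightarrow>
        (\<exists>ws\<in>tuples A SS. R ws \<and> map e [0..<length SS] = map2 g SS ws)"
        unfolding tuples_eq bex_simps(7) using k by (simp del: map_map)
    qed
  qed
  show "definable_self_iso A \<gamma> h" unfolding definable_self_iso_def \<gamma>
  proof
    fix s assume s: "s \<in> sorts A"
    show "definable (eq_structure A) [Home s, q s] {[Elem a, g s a] | a. a \<in> carrier A s}"
    proof (rule definable_overI)
      show "set [Home s, q s] \<subseteq> sorts (eq_structure A)" using q s by simp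
      show "{[Elem a, g s a] | a. a \<in> carrier A s} \<subseteq> tuples (eq_structure A) [Home s, q s]"
        using g[OF s] by (auto simp: tuples_Cons)
      from graph[OF s] show "dfn (eq_structure A) (carrier (eq_structure A)) [Home s, q s]
        (\<lambda>e. map e [0..<length [Home s, q s]] \<in> {[Elem a, g s a] | a. a \<in> carrier A s})"
        by (rule dfn_cong) auto
    qed
  qed
qed

text \<open>All interpretations produced here send an element to a list with one imaginary, so
  composed types and composed maps keep this shape and \<open>composite\<close> applies in both
  directions.\<close>

theorem bi_interpretableI:
  fixes A :: "('s, 'f, 'r, 'a) fo_structure" and B :: "('t, 'g, 'q, 'b) fo_structure"
  assumes P: "cinterp A B \<tau>B XB \<pi>B" and R: "cinterp B A \<tau>A XA \<pi>A"
    and HA: "\<And>s. s \<in> sorts A ==>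
      dfn A (carrier A) (s # tt \<tau>B (\<tau>A s)) (\<lambda>e. comp_graph \<tau>B XB \<pi>B \<tau>A XA \<pi>A s (map e [0..<length (s # tt \<tau>B (\<tau>A s))]))"
    and HB: "\<And>s. s \<in> sorts B ==>
      dfn B (carrier B) (s # tt \<tau>A (\<tau>B s)) (\<lambda>e. comp_graph \<tau>A XA \<pi>A \<tau>B XB \<pi>B s (map e [0..<length (s # tt \<tau>A (\<tau>B s))]))"
  shows "bi_interpretable A B"
proof -
  obtain C' where C': "interprets A (eq_structure B) (\<lambda>S. [qE A \<tau>B XB \<pi>B S]) C' (\<lambda>S b. [gE A \<tau>B XB \<pi>B S b])"
    using cinterp.interprets_eq(1)[OF P] by blast
  obtain C where C: "interprets A B (\<lambda>s. [qE A \<tau>B XB \<pi>B (Home s)]) C (\<lambda>s b. [gE A \<tau>B XB \<pi>B (Home s) (Elem b)])"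
    using cinterp.interprets_eq(2)[OF P] by blast
  obtain D' where D': "interprets B (eq_structure A) (\<lambda>S. [qE B \<tau>A XA \<pi>A S]) D' (\<lambda>S b. [gE B \<tau>A XA \<pi>A S b])"
    using cinterp.interprets_eq(1)[OF R] by blast
  obtain D where D: "interprets B A (\<lambda>s. [qE B \<tau>A XA \<pi>A (Home s)]) D (\<lambda>s b. [gE B \<tau>A XA \<pi>A (Home s) (Elem b)])"
    using cinterp.interprets_eq(2)[OF R] by blast
  have ct: "comp_type (\<lambda>S. [f S]) (\<lambda>s. [k s]) = (\<lambda>s. [f (k s)])" for f k
    by (simp add: comp_type_def fun_eq_iff)
  have cm: "comp_map (\<lambda>S b. [f S b]) (\<lambda>s. [k s]) (\<lambda>s b. [g s b]) = (\<lambda>s a. [f (k s) (g s a)])" for f k g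
    by (simp add: comp_map_def fun_eq_iff)
  obtain A' where A': "interprets A A (comp_type (\<lambda>S. [qE A \<tau>B XB \<pi>B S]) (\<lambda>s. [qE B \<tau>A XA \<pi>A (Home s)])) A'
    (comp_map (\<lambda>S b. [gE A \<tau>B XB \<pi>B S b]) (\<lambda>s. [qE B \<tau>A XA \<pi>A (Home s)]) (\<lambda>s b. [gE B \<tau>A XA \<pi>A (Home s) (Elem b)]))"
    unfolding ct cm using composite(1)[OF P R HA] by blast
  obtain B' where B': "interprets B B (comp_type (\<lambda>S. [qE B \<tau>A XA \<pi>A S]) (\<lambda>s. [qE A \<tau>B XB \<pi>B (Home s)])) B'
    (comp_map (\<lambda>S b. [gE B \<tau>A XA \<pi>A S b]) (\<lambda>s. [qE A \<tau>B XB \<pi>B (Home s)]) (\<lambda>s b. [gE A \<tau>B XB \<pi>B (Home s) (Elem b)]))"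
    unfolding ct cm using composite(1)[OF R P HB] by blast
  have sA: "definable_self_iso A (comp_type (\<lambda>S. [qE A \<tau>B XB \<pi>B S]) (\<lambda>s. [qE B \<tau>A XA \<pi>A (Home s)]))
    (comp_map (\<lambda>S b. [gE A \<tau>B XB \<pi>B S b]) (\<lambda>s. [qE B \<tau>A XA \<pi>A (Home s)]) (\<lambda>s b. [gE B \<tau>A XA \<pi>A (Home s) (Elem b)]))"
    unfolding ct cm by (rule composite(2)[OF P R HA])
  have sB: "definable_self_iso B (comp_type (\<lambda>S. [qE B \<tau>A XA \<pi>A S]) (\<lambda>s. [qE A \<tau>B XB \<pi>B (Home s)]))
    (comp_map (\<lambda>S b. [gE B \<tau>A XA \<pi>A S b]) (\<lambda>s. [qE A \<tau>B XB \<pi>B (Home s)]) (\<lambda>s b. [gE A \<tau>B XB \<pi>B (Home s) (Elem b)]))"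
    unfolding ct cm by (rule composite(2)[OF R P HB])
  have xA: "extends_interp B (\<lambda>S. [qE A \<tau>B XB \<pi>B S]) (\<lambda>S b. [gE A \<tau>B XB \<pi>B S b])
      (\<lambda>s. [qE A \<tau>B XB \<pi>B (Home s)]) (\<lambda>s b. [gE A \<tau>B XB \<pi>B (Home s) (Elem b)])"
    "extends_interp A (\<lambda>S. [qE B \<tau>A XA \<pi>A S]) (\<lambda>S b. [gE B \<tau>A XA \<pi>A S b])
      (\<lambda>s. [qE B \<tau>A XA \<pi>A (Home s)]) (\<lambda>s b. [gE B \<tau>A XA \<pi>A (Home s) (Elem b)])"
    by (simp_all add: extends_interp_def)
  show ?thesis unfolding bi_interpretable_def
    using C C' D D' xA A' B' sA sB by blast
qed

section \<open>Ternary forms\<close>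

text \<open>Forms are kept as functions on K^3, which loses nothing over an infinite field; the zero
  function is a form of every degree.\<close>

definition is_form :: "nat => ('k::field ^ 3 => 'k) => bool" where
  "is_form d F \<longleftrightarrow> (\<exists>c. F = form_val d c)"

definition vec3 :: "'k => 'k => 'k => 'k::zero ^ 3" where
  "vec3 x y z = vector [x, y, z]"

lemma vec3_nth [simp]: "vec3 x y z $ 1 = x" "vec3 x y z $ 2 = y" "vec3 x y z $ 3 = z"
  by (simp_all add: vec3_def)

lemma vec3_eq_iff: "v = w \<longleftrightarrow> v $ 1 = w $ 1 \<and> v $ 2 = w $ 2 \<and> v $ 3 = w $ 3" for v w :: "'k ^ 3"
  by (simp add: vec_eq_iff forall_3)

lemma vec3_collapse [simp]: "vec3 (v $ 1) (v $ 2) (v $ 3) = v"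
  by (simp add: vec3_eq_iff)

lemma finite_deg [simp]: "finite {(i, j). i + j \<le> (d :: nat)}"
  by (rule finite_subset[of _ "{..d} \<times> {..d}"]) auto

lemma is_form_monom:
  assumes "i + j \<le> d"
  shows "is_form d (\<lambda>v :: 'k::field ^ 3. a * v $ 1 ^ i * v $ 2 ^ j * v $ 3 ^ (d - i - j))"
proof -
  define c where "c = (\<lambda>i' j'. if (i', j') = (i, j) then a else 0)"
  have "form_val d c v = a * v $ 1 ^ i * v $ 2 ^ j * v $ 3 ^ (d - i - j)" for v :: "'k ^ 3"
  proof -
    have "form_val d c v = (\<Sum>p \<in> {(i, j). i + j \<le> d}. if p = (i, j) then a * v $ 1 ^ i * v $ 2 ^ j * v $ 3 ^ (d - i - j) else 0)"
      unfolding form_val_def by (intro sum.cong) (auto simp: c_def split: if_splits)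
    also have "\<dots> = a * v $ 1 ^ i * v $ 2 ^ j * v $ 3 ^ (d - i - j)"
      using assms by (subst sum.delta) auto
    finally show ?thesis .
  qed
  then show ?thesis unfolding is_form_def by (intro exI[of _ c]) (auto simp: fun_eq_iff)
qed

lemma is_form_add: "is_form d F ==> is_form d G ==> is_form d (\<lambda>v. F v + G v)"
proof -
  assume "is_form d F" "is_form d G"
  then obtain a b where "F = form_val d a" "G = form_val d b" by (auto simp: is_form_def)
  then have "(\<lambda>v. F v + G v) = form_val d (\<lambda>i j. a i j + b i j)"
    by (auto simp: form_val_def fun_eq_iff sum.distrib algebra_simps split_def)
  then show ?thesis unfolding is_form_def by blast
qed

lemma is_form_zero: "is_form d (\<lambda>v. 0)"
  using is_form_monom[of 0 0 d 0] by simp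

lemma is_form_sum: "(\<And>i. i \<in> S ==> is_form d (F i)) ==> is_form d (\<lambda>v. \<Sum>i\<in>S. F i v)"
  by (induction S rule: infinite_finite_induct) (auto intro: is_form_zero is_form_add)

lemma is_form_mult:
  fixes F G :: "'k::field ^ 3 => 'k"
  assumes "is_form d F" "is_form d' G"
  shows "is_form (d + d') (\<lambda>v. F v * G v)"
proof -
  obtain a b where ab: "F = form_val d a" "G = form_val d' b" using assms by (auto simp: is_form_def)
  let ?m = "\<lambda>p q v. (case p of (i, j) => a i j * v $ 1 ^ i * v $ 2 ^ j * v $ 3 ^ (d - i - j)) *
      (case q of (i, j) => b i j * v $ 1 ^ i * v $ 2 ^ j * v $ 3 ^ (d' - i - j))"
  have "(\<lambda>v. F v * G v) = (\<lambda>v. \<Sum>p \<in> {(i, j). i + j \<le> d}. \<Sum>q \<in> {(i, j). i + j \<le> d'}. ?m p q v)"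
    by (simp add: ab form_val_def sum_product)
  moreover have "is_form (d + d') (?m p q)" if pq: "p \<in> {(i, j). i + j \<le> d}" "q \<in> {(i, j). i + j \<le> d'}" for p q
  proof -
    obtain i j where p: "p = (i, j)" "i + j \<le> d" using pq(1) by auto
    obtain k l where q: "q = (k, l)" "k + l \<le> d'" using pq(2) by auto
    have e: "d + d' - (i + k) - (j + l) = (d - i - j) + (d' - k - l)" using p q by linarith
    have "?m p q = (\<lambda>v :: 'k ^ 3. (a i j * b k l) * v $ 1 ^ (i + k) * v $ 2 ^ (j + l) * v $ 3 ^ (d + d' - (i + k) - (j + l)))"
      unfolding e p prod.case q power_add by (rule ext) (simp only: mult_ac)
    then show ?thesis by (simp only:) (rule is_form_monom, use p q in simp)
  qed
  ultimately show ?thesis by (auto intro!: is_form_sum)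
qed

lemma is_form_const: "is_form 0 (\<lambda>v. a)"
  using is_form_monom[of 0 0 0 a] by simp

lemma is_form_nth: "is_form 1 (\<lambda>v. v $ 1)" "is_form 1 (\<lambda>v. v $ 2)" "is_form 1 (\<lambda>v. v $ 3)"
  using is_form_monom[of 1 0 1 1] is_form_monom[of 0 1 1 1] is_form_monom[of 0 0 1 1] by simp_all

lemma is_form_cmult: "is_form d F ==> is_form d (\<lambda>v. a * F v)"
  using is_form_mult[OF is_form_const, of d F a] by simp

lemma is_form_diff: "is_form d F ==> is_form d G ==> is_form d (\<lambda>v. F v - G v)"
  using is_form_add[OF _ is_form_cmult, of d F G "-1"] by simp

lemma is_form_pow: "is_form d F ==> is_form (n * d) (\<lambda>v. F v ^ n)"
proof (induction n)
  case (Suc n)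
  then show ?case using is_form_mult[of d F "n * d" "\<lambda>v. F v ^ n"] by simp
qed (simp add: is_form_const)

lemma is_form_prod: "(\<And>i. i \<in> S ==> is_form (d i) (F i)) ==> is_form (\<Sum>i\<in>S. d i) (\<lambda>v. \<Prod>i\<in>S. F i v)"
  by (induction S rule: infinite_finite_induct) (auto intro: is_form_const is_form_mult)

definition lin :: "'k::field ^ 3 => 'k ^ 3 => 'k" where
  "lin u v = u $ 1 * v $ 1 + u $ 2 * v $ 2 + u $ 3 * v $ 3"

lemma is_form_lin: "is_form 1 (lin u)"
proof -
  have "lin u = (\<lambda>v. (u $ 1 * v $ 1 + u $ 2 * v $ 2) + u $ 3 * v $ 3)" by (simp add: lin_def fun_eq_iff)
  then show ?thesis by (simp only:) (intro is_form_add is_form_cmult is_form_nth)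
qed

lemma is_form_1_lin:
  assumes "is_form 1 F"
  obtains u where "F = lin u"
proof -
  obtain c where c: "F = form_val 1 c" using assms by (auto simp: is_form_def)
  have s: "{(i, j). i + j \<le> (1::nat)} = {(0, 0), (1, 0), (0, 1)}" by auto
  have "F = lin (vec3 (c 1 0) (c 0 1) (c 0 0))"
    unfolding c form_val_def s by (auto simp: lin_def fun_eq_iff)
  then show ?thesis using that by blast
qed

lemma form_homog: "is_form d F ==> F (t *s v) = t ^ d * F v"
proof -
  assume "is_form d F"
  then obtain c where c: "F = form_val d c" by (auto simp: is_form_def)
  have "(case p of (i, j) => c i j * (t *s v) $ 1 ^ i * (t *s v) $ 2 ^ j * (t *s v) $ 3 ^ (d - i - j)) =
    t ^ d * (case p of (i, j) => c i j * v $ 1 ^ i * v $ 2 ^ j * v $ 3 ^ (d - i - j))"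
    if p: "p \<in> {(i, j). i + j \<le> d}" for p
  proof -
    obtain i j where ij: "p = (i, j)" "i + j \<le> d" using p by auto
    then have e: "i + j + (d - i - j) = d" by simp
    have "t ^ i * t ^ j * t ^ (d - i - j) = t ^ d" unfolding power_add[symmetric] e ..
    then show ?thesis unfolding ij(1) prod.case vector_smult_component power_mult_distrib
      by (simp only: flip: \<open>t ^ i * t ^ j * t ^ (d - i - j) = t ^ d\<close>) (simp only: mult_ac)
  qed
  then show ?thesis unfolding c form_val_def sum_distrib_left by (intro sum.cong) auto
qed

lemma form_at_0:
  fixes F :: "'k::field ^ 3 => 'k"
  assumes "is_form d F" "d > 0"
  shows "F 0 = 0"
  using form_homog[OF assms(1), of 0 "0 :: 'k ^ 3"] assms(2) by (auto simp: zero_power)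

lemma form_comp_linear:
  assumes "is_form d F" "\<And>i. is_form 1 (\<lambda>v. M v $ i)"
  shows "is_form d (\<lambda>v. F (M v))"
proof -
  obtain c where c: "F = form_val d c" using assms by (auto simp: is_form_def)
  have "is_form d (\<lambda>v. case p of (i, j) => c i j * M v $ 1 ^ i * M v $ 2 ^ j * M v $ 3 ^ (d - i - j))"
    if p: "p \<in> {(i, j). i + j \<le> d}" for p
  proof -
    obtain i j where ij: "p = (i, j)" "i + j \<le> d" using p by auto
    have m: "is_form n (\<lambda>v. M v $ k ^ n)" for n k using is_form_pow[OF assms(2), of n k] by simp
    have "is_form (0 + i + j + (d - i - j)) (\<lambda>v. c i j * M v $ 1 ^ i * M v $ 2 ^ j * M v $ 3 ^ (d - i - j))"
      by (intro is_form_mult is_form_const m)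
    then show ?thesis using ij by simp
  qed
  then show ?thesis unfolding c form_val_def by (intro is_form_sum) auto
qed

section \<open>Forms restricted to lines\<close>

lemma infinite_UNIV_0: "infinite (UNIV :: 'k::field_char_0 set)"
  by (rule infinite_UNIV_char_0)

lemma form_poly_line:
  assumes "is_form d F"
  obtains p where "\<And>t. poly p t = F (u + t *s w)"
proof -
  obtain c where c: "F = form_val d c" using assms by (auto simp: is_form_def)
  define p where "p = (\<Sum>(i, j) \<in> {(i, j). i + j \<le> d}. smult (c i j) ([:u $ 1, w $ 1:] ^ i * [:u $ 2, w $ 2:] ^ j * [:u $ 3, w $ 3:] ^ (d - i - j)))"
  have "poly p t = F (u + t *s w)" for t
    unfolding p_def c form_val_def poly_sum by (intro sum.cong) (auto simp: algebra_simps)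
  then show ?thesis using that by blast
qed

lemma form_eq_on_line:
  fixes F :: "'k::field_char_0 ^ 3 => 'k"
  assumes "is_form d F" "infinite {t. F (u + t *s w) = 0}"
  shows "F (u + t *s w) = 0" "F w = 0"
proof -
  obtain p where p: "\<And>t. poly p t = F (u + t *s w)" using form_poly_line[OF assms(1)] by blast
  \<comment> \<open>The point w, which no finite t attains, is reached by reversing the parameter: w
    + t u is proportional to u + w / t for t \<noteq> 0.\<close>
  obtain q where q: "\<And>t. poly q t = F (w + t *s u)" using form_poly_line[OF assms(1)] by blast
  have "p = 0" using assms(2) poly_roots_finite[of p] by (auto simp flip: p)
  then have F: "F (u + t *s w) = 0" for t using p[of t] by simp
  then show "F (u + t *s w) = 0" .
  have "poly q t = 0" if "t ~= 0" for t
  proof -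
    have "w + t *s u = t *s (u + inverse t *s w)" using that by (simp add: vec_eq_iff field_simps)
    then have "F (w + t *s u) = F (t *s (u + inverse t *s w))" by (rule arg_cong)
    also have "\<dots> = 0" unfolding form_homog[OF assms(1)] F by simp
    finally show ?thesis unfolding q .
  qed
  then have "UNIV - {0} \<subseteq> {t. poly q t = 0}" by auto
  then have "infinite {t. poly q t = 0}" using infinite_UNIV_0[where ?'k = 'k] by (meson finite.emptyI finite_insert finite_Diff2 finite_subset)
  then have "q = 0" using poly_roots_finite by blast
  then show "F w = 0" using q[of 0] by simp
qed

text \<open>The line through v in the direction of the third axis has only one vector with third
  coordinate 0, so the difference of the forms has infinitely many zeros on it.\<close>

lemma forms_eq_off_infinity:
  fixes F G :: "'k::field_char_0 ^ 3 => 'k"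
  assumes "is_form d F" "is_form d G" "\<And>v. v $ 3 ~= 0 ==> F v = G v"
  shows "F v = G v"
proof -
  have f: "is_form d (\<lambda>v. F v - G v)" by (rule is_form_diff[OF assms(1,2)])
  have "UNIV - {- v $ 3} \<subseteq> {t. F (v + t *s vec3 0 0 1) - G (v + t *s vec3 0 0 1) = 0}"
  proof (intro subsetI CollectI)
    fix t assume "t \<in> UNIV - {- v $ 3}"
    then have "(v + t *s vec3 0 0 1) $ 3 ~= 0" by (simp add: add_eq_0_iff)
    then show "F (v + t *s vec3 0 0 1) - G (v + t *s vec3 0 0 1) = 0" using assms(3) by simp
  qed
  then have "infinite {t. F (v + t *s vec3 0 0 1) - G (v + t *s vec3 0 0 1) = 0}"
    using infinite_UNIV_0[where ?'k = 'k] by (meson finite.emptyI finite_insert finite_Diff2 finite_subset)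
  from form_eq_on_line(1)[OF f this, of 0] show ?thesis by simp
qed

section \<open>Polynomials in two variables\<close>

text \<open>In \<open>'k poly poly\<close> the outer variable is \<open>x\<close> and the inner one is \<open>y\<close>.\<close>

definition ev :: "'k::comm_ring_1 poly poly => 'k => 'k => 'k" where
  "ev P x y = poly (poly P [:x:]) y"

lemma ev_simps [simp]:
  "ev 0 x y = 0" "ev 1 x y = 1" "ev (P + Q) x y = ev P x y + ev Q x y" "ev (P - Q) x y = ev P x y - ev Q x y"
  "ev (P * Q) x y = ev P x y * ev Q x y" "ev (- P) x y = - ev P x y" "ev (P ^ n) x y = ev P x y ^ n"
  "ev (smult r P) x y = poly r y * ev P x y" "ev (pCons r P) x y = poly r y + x * ev P x y"
  by (simp_all add: ev_def)

lemma ev_sum: "ev (\<Sum>i\<in>S. f i) x y = (\<Sum>i\<in>S. ev (f i) x y)"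
  by (simp add: ev_def poly_sum)

lemma ev_monom [simp]: "ev (monom r i) x y = poly r y * x ^ i"
  by (simp add: ev_def poly_monom poly_power)

lemma infinite_minus_one: "infinite (UNIV - {a :: 'k::field_char_0})"
  using infinite_UNIV_0[where ?'k = 'k] by simp

lemma poly_zero_off_point:
  fixes p :: "'k::field_char_0 poly"
  assumes "\<And>x. x ~= a ==> poly p x = 0"
  shows "p = 0"
proof -
  have "UNIV - {a} \<subseteq> {x. poly p x = 0}" using assms by auto
  then have "infinite {x. poly p x = 0}" using infinite_minus_one finite_subset by blast
  then show ?thesis using poly_roots_finite by blast
qed

text \<open>Vanishing is asked only for y \<noteq> 0, because the substitution x = X T, y = T behind
  \<open>Phi\<close> can be undone only there.\<close>

lemma ev_eq_0:
  fixes P :: "'k::field_char_0 poly poly"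
  assumes "\<And>x y. y ~= 0 ==> ev P x y = 0"
  shows "P = 0"
proof -
  have "poly P [:x:] = 0" for x
    by (rule poly_zero_off_point[of 0]) (use assms in \<open>simp add: ev_def\<close>)
  then have "range (\<lambda>x. [:x:]) \<subseteq> {q. poly P q = 0}" by auto
  moreover have "infinite (range (\<lambda>x :: 'k. [:x:]))"
    using infinite_UNIV_0 by (subst finite_image_iff) (auto simp: inj_def)
  ultimately show ?thesis using poly_roots_finite finite_subset by blast
qed

lemma ev_eqI:
  fixes P Q :: "'k::field_char_0 poly poly"
  assumes "\<And>x y. ev P x y = ev Q x y"
  shows "P = Q"
  using ev_eq_0[of "P - Q"] assms by simp

lemma ev_altdef: "ev P x y = (\<Sum>i\<le>degree P. poly (coeff P i) y * x ^ i)"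
  unfolding ev_def poly_altdef[of P] poly_sum by (simp add: poly_power)

text \<open>\<open>Phi P\<close> is \<open>P\<close> in the coordinates \<open>x = X T\<close>, \<open>y = T\<close>, with outer variable \<open>T\<close>: its degree
  is the total degree of \<open>P\<close>, and its leading coefficient is the leading form of \<open>P\<close>.\<close>

definition Phi :: "'k::comm_ring_1 poly poly => 'k poly poly" where
  "Phi P = (\<Sum>i\<le>degree P. \<Sum>j\<le>degree (coeff P i). monom (monom (coeff (coeff P i) j) i) (i + j))"

text \<open>The monomial x^i y^j turns into X^i T^(i + j), so the coefficient of T^n collects the
  terms of total degree n.\<close>

lemma coeff_Phi: "coeff (coeff (Phi P) n) i = (if i \<le> n then coeff (coeff P i) (n - i) else 0)"
proof -
  have "coeff (coeff (Phi P) n) i = (\<Sum>k\<le>degree P. \<Sum>j\<le>degree (coeff P k). if k + j = n \<and> k = i then coeff (coeff P k) j else 0)"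
    unfolding Phi_def coeff_sum by (intro sum.cong refl) (auto simp: coeff_monom)
  also have "\<dots> = (\<Sum>k\<le>degree P. if k = i then (\<Sum>j\<le>degree (coeff P i). if i + j = n then coeff (coeff P i) j else 0) else 0)"
    by (intro sum.cong refl) auto
  also have "\<dots> = (if i \<le> degree P then (\<Sum>j\<le>degree (coeff P i). if i + j = n then coeff (coeff P i) j else 0) else 0)"
    by (simp add: sum.delta)
  also have "(\<Sum>j\<le>degree (coeff P i). if i + j = n then coeff (coeff P i) j else 0) =
      (if i \<le> n then coeff (coeff P i) (n - i) else 0)"
  proof (cases "i \<le> n")
    case True
    then have "(\<Sum>j\<le>degree (coeff P i). if i + j = n then coeff (coeff P i) j else 0) =
       (\<Sum>j\<le>degree (coeff P i). if j = n - i then coeff (coeff P i) (n - i) else 0)"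
      by (intro sum.cong refl) auto
    then show ?thesis using True by (simp add: sum.delta coeff_eq_0)
  qed auto
  finally show ?thesis by (simp add: coeff_eq_0)
qed

lemma ev_Phi: "ev (Phi P) t x = ev P (x * t) t"
proof -
  have "ev (Phi P) t x = (\<Sum>i\<le>degree P. \<Sum>j\<le>degree (coeff P i). coeff (coeff P i) j * x ^ i * t ^ (i + j))"
    unfolding Phi_def ev_sum by (intro sum.cong refl) (simp add: poly_monom)
  also have "\<dots> = (\<Sum>i\<le>degree P. poly (coeff P i) t * (x * t) ^ i)"
    unfolding poly_altdef[of "coeff P _"] sum_distrib_right
    by (intro sum.cong refl) (simp add: power_add power_mult_distrib mult_ac)
  finally show ?thesis by (simp add: ev_altdef)
qed

lemma Phi_simps [simp]:
  fixes P Q :: "'k::field_char_0 poly poly"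
  shows "Phi (P * Q) = Phi P * Phi Q" "Phi (P + Q) = Phi P + Phi Q" "Phi (P - Q) = Phi P - Phi Q" "Phi (0 :: 'k poly poly) = 0" "Phi (1 :: 'k poly poly) = 1"
    "Phi (P ^ n) = Phi P ^ n"
  by (rule ev_eqI; simp add: ev_Phi)+

lemma Phi_eq_0 [simp]: "Phi P = 0 \<longleftrightarrow> P = 0" for P :: "'k::field_char_0 poly poly"
proof
  assume *: "Phi P = 0"
  show "P = 0"
  proof (rule ev_eq_0)
    fix x y :: 'k assume "y ~= 0"
    then show "ev P x y = 0" using ev_Phi[of P y "x / y"] * by simp
  qed
qed simp

lemma degree_Phi_mult: "P ~= 0 ==> Q ~= 0 ==> degree (Phi (P * Q)) = degree (Phi P) + degree (Phi Q)"
  for P Q :: "'k::field_char_0 poly poly"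
  by (simp add: degree_mult_eq)

lemma degree_coeff_Phi: "degree (coeff (Phi P) n) \<le> degree P"
  by (rule degree_le) (auto simp: coeff_Phi coeff_eq_0)

text \<open>Dehomogenisation. Coefficient d is recorded rather than the leading one: it is the
  restriction of the form to infinity, and it is 0 when the third coordinate divides the
  form.\<close>

lemma form_to_poly:
  fixes F :: "'k::field_char_0 ^ 3 => 'k"
  assumes "is_form d F"
  obtains P where "\<And>x y. ev P x y = F (vec3 x y 1)" "degree (Phi P) \<le> d" "\<And>x. poly (coeff (Phi P) d) x = F (vec3 x 1 0)"
proof -
  obtain c where c: "F = form_val d c" using assms by (auto simp: is_form_def)
  define S where "S = {(i, j). i + j \<le> d}"
  have fin: "finite S" unfolding S_def by simp
  define P where "P = (\<Sum>(i, j)\<in>S. monom (monom (c i j) j) i)"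
  define R where "R = (\<Sum>(i, j)\<in>S. monom (monom (c i j) i) (i + j))"
  have P: "ev P x y = F (vec3 x y 1)" for x y
    unfolding P_def ev_sum c form_val_def S_def[symmetric] by (intro sum.cong refl) (auto simp: poly_monom)
  have "Phi P = R"
  proof (rule ev_eqI)
    fix t x
    have "ev (Phi P) t x = (\<Sum>(i, j)\<in>S. c i j * t ^ j * (x * t) ^ i)"
      unfolding ev_Phi P_def ev_sum by (intro sum.cong refl) (auto simp: poly_monom)
    also have "\<dots> = ev R t x"
      unfolding R_def ev_sum by (intro sum.cong refl) (auto simp: poly_monom power_add power_mult_distrib)
    finally show "ev (Phi P) t x = ev R t x" .
  qed
  moreover have "degree R \<le> d" unfolding R_def
  proof (rule degree_sum_le[OF fin])
    fix p assume "p \<in> S"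
    then obtain i j where "p = (i, j)" "i + j \<le> d" by (auto simp: S_def)
    then show "degree (case p of (i, j) => monom (monom (c i j) i) (i + j)) \<le> d"
      using degree_monom_le[of "monom (c i j) i" "i + j"] by simp
  qed
  moreover have "poly (coeff R d) x = F (vec3 x 1 0)" for x
    unfolding R_def coeff_sum poly_sum c form_val_def S_def[symmetric]
  proof (intro sum.cong refl)
    fix p assume "p \<in> S"
    then obtain i j where p: "p = (i, j)" "i + j \<le> d" by (auto simp: S_def)
    show "poly (coeff (case p of (i, j) => monom (monom (c i j) i) (i + j)) d) x =
      (case p of (i, j) => c i j * vec3 x 1 0 $ 1 ^ i * vec3 x 1 0 $ 2 ^ j * vec3 x 1 0 $ 3 ^ (d - i - j))"
    proof (cases "i + j = d")
      case True
      then show ?thesis by (simp add: p poly_monom)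
    next
      case False
      then have "(0::'k) ^ (d - i - j) = 0" using p by (simp add: zero_power)
      then show ?thesis using False by (simp add: p)
    qed
  qed
  ultimately show ?thesis using that P by blast
qed

lemma poly_to_form:
  fixes P :: "'k::field_char_0 poly poly"
  assumes "degree (Phi P) \<le> d"
  obtains F where "is_form d F" "\<And>x y. F (vec3 x y 1) = ev P x y"
proof -
  define F where "F = form_val d (\<lambda>i j. coeff (coeff P i) j)"
  have z: "coeff (coeff P i) j = 0" if "\<not> i + j \<le> d" for i j
    using coeff_Phi[of P "i + j" i] that assms by (simp add: coeff_eq_0)
  have "F (vec3 x y 1) = ev P x y" for x y
  proof -
    define N where "N = max d (max (degree P) (Max ((\<lambda>i. degree (coeff P i)) ` {..degree P})))"
    have "degree (coeff P i) \<le> N" if "i \<le> degree P" for i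
    proof -
      have "degree (coeff P i) \<le> Max ((\<lambda>i. degree (coeff P i)) ` {..degree P})" using that by (intro Max_ge) auto
      then show ?thesis by (simp add: N_def)
    qed
    then have N: "degree (coeff P i) \<le> N" for i by (cases "i \<le> degree P") (auto simp: coeff_eq_0)
    have "ev P x y = (\<Sum>i\<le>N. poly (coeff P i) y * x ^ i)"
      unfolding ev_altdef by (rule sum.mono_neutral_left) (auto simp: N_def coeff_eq_0)
    also have "\<dots> = (\<Sum>i\<le>N. \<Sum>j\<le>N. coeff (coeff P i) j * y ^ j * x ^ i)"
    proof (rule sum.cong[OF refl])
      fix i
      have "poly (coeff P i) y = (\<Sum>j\<le>N. coeff (coeff P i) j * y ^ j)"
        unfolding poly_altdef using N[of i] by (intro sum.mono_neutral_left) (auto simp: coeff_eq_0)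
      then show "poly (coeff P i) y * x ^ i = (\<Sum>j\<le>N. coeff (coeff P i) j * y ^ j * x ^ i)" by (simp add: sum_distrib_right)
    qed
    also have "\<dots> = (\<Sum>(i, j)\<in>{..N} \<times> {..N}. coeff (coeff P i) j * y ^ j * x ^ i)" by (simp add: sum.cartesian_product)
    also have "\<dots> = (\<Sum>(i, j)\<in>{(i, j). i + j \<le> d}. coeff (coeff P i) j * y ^ j * x ^ i)"
    proof (rule sum.mono_neutral_right)
      show "{(i, j). i + j \<le> d} \<subseteq> {..N} \<times> {..N}" by (auto simp: N_def)
      show "\<forall>p\<in>{..N} \<times> {..N} - {(i, j). i + j \<le> d}. (case p of (i, j) => coeff (coeff P i) j * y ^ j * x ^ i) = 0"
      proof
        fix p assume "p \<in> {..N} \<times> {..N} - {(i, j). i + j \<le> d}"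
        then obtain i j where "p = (i, j)" "\<not> i + j \<le> d" by auto
        then show "(case p of (i, j) => coeff (coeff P i) j * y ^ j * x ^ i) = 0" using z[of i j] by simp
      qed
    qed simp
    also have "\<dots> = F (vec3 x y 1)" unfolding F_def form_val_def by (intro sum.cong refl) (auto simp: mult_ac)
    finally show ?thesis by simp
  qed
  moreover have "is_form d F" unfolding F_def is_form_def by blast
  ultimately show ?thesis using that by blast
qed

section \<open>Prime ideals of plane curves\<close>

text \<open>The restriction of P to the horizontal line y = c, as a polynomial in x. Fibres of the
  projection to y are studied through it.\<close>

definition sp :: "'k => 'k::field_char_0 poly poly => 'k poly" where
  "sp c P = map_poly (\<lambda>q. poly q c) P"

lemma coeff_sp: "coeff (sp c P) i = poly (coeff P i) c"
  by (simp add: sp_def coeff_map_poly)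

lemma poly_sp: "poly (sp c P) x = ev P x c"
  unfolding sp_def by (induction P) (simp_all add: map_poly_pCons)

lemma sp_mult: "sp c (P * Q) = sp c P * sp c Q"
  by (simp add: poly_eq_poly_eq_iff[symmetric] fun_eq_iff poly_sp)

lemma sp_diff: "sp c (P - Q) = sp c P - sp c Q"
  by (simp add: poly_eq_poly_eq_iff[symmetric] fun_eq_iff poly_sp)

lemma sp_const: "sp c (map_poly (\<lambda>a. [:a:]) s) = s"
  by (rule poly_eqI) (simp add: coeff_sp coeff_map_poly)

lemma sp_eq_0:
  assumes "sp c P = 0"
  obtains Q where "P = [:[:-c, 1:]:] * Q"
proof -
  define Q where "Q = map_poly (\<lambda>q. q div [:-c, 1:]) P"
  have "P = smult [:-c, 1:] Q"
  proof (rule poly_eqI)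
    fix i
    have "poly (coeff P i) c = 0" using assms coeff_sp[of c P i] by simp
    then have "[:-c, 1:] dvd coeff P i" by (simp add: poly_eq_0_iff_dvd)
    then have "[:-c, 1:] * (coeff P i div [:-c, 1:]) = coeff P i" by (rule dvd_mult_div_cancel)
    moreover have "coeff Q i = coeff P i div [:-c, 1:]" by (simp add: Q_def coeff_map_poly)
    ultimately show "coeff P i = coeff (smult [:-c, 1:] Q) i" by (simp only: coeff_smult)
  qed
  then show ?thesis using that[of Q] by simp
qed

text \<open>Coprimality in the form needed here: over an algebraically closed field the linear
  factors of p are cancelled one at a time, none of them dividing q.\<close>

lemma dvd_cancel_no_common_root:
  fixes p q a :: "'k::alg_closed_field poly"
  assumes "p ~= 0" "\<And>x. poly p x = 0 ==> poly q x ~= 0" "p dvd a * q"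
  shows "p dvd a"
  using assms
proof (induction "degree p" arbitrary: p a)
  case 0
  then have "is_unit p" by (simp add: is_unit_iff_degree)
  then show ?case by (rule unit_imp_dvd)
next
  case (Suc n)
  then obtain x where x: "poly p x = 0" using alg_closed_imp_poly_has_root[of p] by auto
  then obtain p' where p': "p = [:-x, 1:] * p'" by (auto simp: poly_eq_0_iff_dvd)
  obtain k where "a * q = p * k" using Suc.prems(3) by (elim dvdE)
  then have "poly (a * q) x = poly p x * poly k x" by simp
  then have "poly (a * q) x = 0" using x by simp
  then have "poly a x = 0" using Suc.prems(2)[OF x] by simp
  then obtain a' where a': "a = [:-x, 1:] * a'" by (auto simp: poly_eq_0_iff_dvd)
  have p0: "p' ~= 0" using Suc.prems(1) p' by auto
  have "degree p = Suc (degree p')" unfolding p' by (subst degree_mult_eq) (use p0 in auto)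
  then have "n = degree p'" using Suc.hyps(2) by simp
  moreover have "[:-x, 1:] * p' dvd [:-x, 1:] * (a' * q)" using Suc.prems(3) unfolding p' a' by (simp only: mult.assoc)
  then have "p' dvd a' * q" by (simp only: dvd_mult_cancel_left) simp
  ultimately have "p' dvd a'" using Suc.hyps(1)[of p' a'] p0 Suc.prems(2) unfolding p' by simp
  then show ?case unfolding p' a' by (rule mult_dvd_mono[OF dvd_refl])
qed

lemma lead_coeff_diff_lt:
  fixes p q :: "'a::idom poly"
  assumes "degree q < degree p"
  shows "lead_coeff (p - q) = lead_coeff p"
proof -
  have "degree (p - q) = degree p" using degree_add_eq_left[of "- q" p] assms by simp
  then show ?thesis using assms by (simp add: coeff_eq_0)
qed

lemma pseudo_division:
  fixes f g :: "'a::idom poly"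
  assumes "g ~= 0"
  obtains n q r where "smult (lead_coeff g ^ n) f = g * q + r" "r = 0 \<or> degree r < degree g"
proof -
  obtain q r where qr: "pseudo_divmod f g = (q, r)" by (cases "pseudo_divmod f g")
  show ?thesis using that pseudo_divmod[OF assms qr] by blast
qed

text \<open>Modelled on the polynomials that vanish on the affine part of an irreducible curve. Here
  \<open>[:r:]\<close> is a polynomial in y alone, so \<open>no_const\<close> excludes the unit
  ideal and horizontal lines and gives generators a positive degree in x.\<close>

locale curve_ideal =
  fixes I :: "'k::{alg_closed_field, field_char_0} poly poly set"
  assumes add: "P \<in> I ==> Q \<in> I ==> P + Q \<in> I"
    and mult: "P \<in> I ==> R * P \<in> I"
    and prime: "P * Q \<in> I ==> P \<in> I \<or> Q \<in> I"
    and no_const: "[:r:] \<in> I ==> r = 0"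
    and nontrivial: "\<exists>P\<in>I. P ~= 0"
begin

lemma minus: "P \<in> I ==> - P \<in> I"
  using mult[of P "-1"] by simp

lemma diff: "P \<in> I ==> Q \<in> I ==> P - Q \<in> I"
  using add[OF _ minus, of P Q] by simp

lemma mult_right: "P \<in> I ==> P * R \<in> I"
  using mult[of P R] by (simp add: mult.commute)

lemma cancel_const: "[:r:] * P \<in> I ==> r ~= 0 ==> P \<in> I"
  using prime no_const by blast

text \<open>Gauss's lemma. As G vanishes identically on no horizontal line, each linear factor y - c
  of \<open>a\<close> must divide q and can be cancelled.\<close>

lemma cancel_smult:
  fixes G P q :: "'k poly poly" and a :: "'k poly"
  assumes "\<And>c. sp c G ~= 0" "a ~= 0" "smult a P = G * q"
  shows "G dvd P"
  using assms(2,3)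
proof (induction "degree a" arbitrary: a q)
  case 0
  then obtain u where u: "a = [:u:]" "u ~= 0" by (metis degree_eq_zeroE pCons_0_0)
  have "P = smult [:inverse u:] (smult a P)" using u by (simp add: one_pCons[symmetric])
  also have "\<dots> = G * smult [:inverse u:] q" unfolding 0(3) by simp
  finally show ?case by (rule dvdI)
next
  case (Suc n)
  then obtain c where c: "poly a c = 0" using alg_closed_imp_poly_has_root[of a] by auto
  then obtain a' where a': "a = [:-c, 1:] * a'" by (auto simp: poly_eq_0_iff_dvd)
  have a0: "a' ~= 0" using Suc.prems(1) a' by auto
  have "degree a = Suc (degree a')" unfolding a' by (subst degree_mult_eq) (use a0 in auto)
  then have n: "n = degree a'" using Suc.hyps(2) by simp
  have "sp c (smult a P) = 0" using c by (simp add: poly_eq_poly_eq_iff[symmetric] fun_eq_iff poly_sp)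
  then have "sp c q = 0" using assms(1)[of c] unfolding Suc.prems(2) sp_mult by simp
  then obtain q' where q': "q = [:[:-c, 1:]:] * q'" by (rule sp_eq_0)
  have "smult [:-c, 1:] (smult a' P) = smult [:-c, 1:] (G * q')"
    using Suc.prems(2) unfolding a' q' by (simp add: mult_ac)
  then have "smult a' P = G * q'"
    by (metis Suc.prems(1) a' mult_zero_left smult_cancel smult_eq_iff)
  then show ?case using Suc.hyps(1)[OF n a0] by blast
qed

lemma principal:
  obtains G where "G \<in> I" "degree G > 0" "\<And>P. P \<in> I ==> G dvd P"
proof -
  obtain P0 where "P0 \<in> I \<and> P0 ~= 0" using nontrivial by blast
  then obtain P1 where P1: "P1 \<in> I \<and> P1 ~= 0" "\<And>P. P \<in> I \<and> P ~= 0 ==> degree P1 \<le> degree P"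
    using ex_has_least_nat[of "\<lambda>P. P \<in> I \<and> P ~= 0" P0 degree] by blast
  \<comment> \<open>The second minimisation makes G primitive: a factor y - c could be removed
    without leaving the prime ideal, and this would lower the degree of the leading
    coefficient.\<close>
  then obtain G where G: "G \<in> I \<and> G ~= 0 \<and> degree G = degree P1"
    "\<And>P. P \<in> I \<and> P ~= 0 \<and> degree P = degree P1 ==> degree (lead_coeff G) \<le> degree (lead_coeff P)"
    using ex_has_least_nat[of "\<lambda>P. P \<in> I \<and> P ~= 0 \<and> degree P = degree P1" P1 "\<lambda>P. degree (lead_coeff P)"] by blast
  have min: "degree G \<le> degree P" if "P \<in> I" "P ~= 0" for P using P1(2)[of P] G(1) that by simp
  have sp0: "sp c G ~= 0" for c
  proof
    assume "sp c G = 0"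
    then obtain Q where Q: "G = [:[:-c, 1:]:] * Q" by (rule sp_eq_0)
    then have QI: "Q \<in> I" using G(1) cancel_const[of "[:-c, 1:]" Q] by simp
    have Q0: "Q ~= 0" using G(1) Q by auto
    have d: "degree G = degree Q" unfolding Q using Q0 by simp
    have "lead_coeff G = [:-c, 1:] * lead_coeff Q" unfolding Q using Q0 by simp
    then have "degree (lead_coeff G) = Suc (degree (lead_coeff Q))"
      using Q0 by (simp only:) (subst degree_mult_eq, auto)
    then show False using G(2)[of Q] QI Q0 d G(1) by simp
  qed
  have "degree G > 0"
  proof (rule ccontr)
    assume "\<not> degree G > 0"
    then obtain r where "G = [:r:]" by (metis degree_eq_zeroE gr0I)
    then show False using no_const[of r] G(1) by simp
  qed
  moreover have "G dvd P" if P: "P \<in> I" for P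
  proof -
    obtain n q r where r: "smult (lead_coeff G ^ n) P = G * q + r" "r = 0 \<or> degree r < degree G"
      using pseudo_division[of G P] G(1) by blast
    have re: "r = [:lead_coeff G ^ n:] * P - q * G" using r(1) by (simp add: mult.commute)
    have "r \<in> I" unfolding re by (rule diff[OF mult[OF P] mult[OF conjunct1[OF G(1)]]])
    then have "r = 0" using min[of r] r(2) by (meson leD)
    then have "smult (lead_coeff G ^ n) P = G * q" using r(1) by simp
    moreover have "G ~= 0" using G(1) by blast
    then have "lead_coeff G ^ n ~= 0" by simp
    ultimately show ?thesis using cancel_smult[OF sp0] by blast
  qed
  ultimately show ?thesis using that G(1) by blast
qed

end

locale plane_curve = curve_ideal I for I :: "'k::{alg_closed_field, field_char_0} poly poly set" +
  fixes G
  assumes GI: "G \<in> I" and Gdvd: "\<And>P. P \<in> I ==> G dvd P" and Gdeg: "degree G > 0"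
begin

lemma G0: "G ~= 0" using Gdeg by auto

lemma vanish: "P \<in> I ==> ev G x y = 0 ==> ev P x y = 0"
  using Gdvd[of P] by (auto elim!: dvdE)

lemma degree_ge: "P \<in> I ==> P ~= 0 ==> degree G \<le> degree P"
  using Gdvd dvd_imp_degree_le by blast

text \<open>Over the field K(y) the polynomial G is irreducible and does not divide f, so the two
  generate the unit ideal; r is the cleared denominator. An element of least degree in J takes the
  role of the greatest common divisor.\<close>

lemma elimination:
  assumes f: "f \<notin> I"
  obtains a b r where "a * f + b * G = [:r:]" "r ~= 0"
proof -
  define J where "J = {a * f + b * G | a b. True}"
  have JG: "G \<in> J" unfolding J_def by (intro CollectI exI[of _ 0] exI[of _ 1]) simp
  have Jf: "f \<in> J" unfolding J_def by (intro CollectI exI[of _ 1] exI[of _ 0]) simp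
  have Jc: "R * P - S * Q \<in> J" if PQ: "P \<in> J" "Q \<in> J" for P Q R S
  proof -
    obtain a b a' b' where "P = a * f + b * G" "Q = a' * f + b' * G" using PQ unfolding J_def by blast
    then have "R * P - S * Q = (R * a - S * a') * f + (R * b - S * b') * G" by (simp add: algebra_simps)
    then show ?thesis unfolding J_def by blast
  qed
  obtain s where s: "s \<in> J \<and> s ~= 0" "\<And>P. P \<in> J \<and> P ~= 0 ==> degree s \<le> degree P"
    using ex_has_least_nat[of "\<lambda>P. P \<in> J \<and> P ~= 0" G degree] JG G0 by blast
  have div: "\<exists>n q. smult (lead_coeff s ^ n) P = s * q" if P: "P \<in> J" for P
  proof -
    obtain n q r where r: "smult (lead_coeff s ^ n) P = s * q + r" "r = 0 \<or> degree r < degree s"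
      using pseudo_division[of s P] s(1) by blast
    have re: "r = [:lead_coeff s ^ n:] * P - q * s" using r(1) by (simp add: mult.commute)
    have "r \<in> J" unfolding re by (rule Jc[OF P conjunct1[OF s(1)]])
    then have "r = 0" using s(2)[of r] r(2) by (meson leD)
    then show ?thesis using r(1) by auto
  qed
  have lc: "lead_coeff s ^ n ~= 0" for n using s(1) by simp
  have "degree s = 0"
  proof -
    obtain n q where q: "smult (lead_coeff s ^ n) G = s * q" using div[OF JG] by blast
    have "s * q \<in> I" using mult[OF GI, of "[:lead_coeff s ^ n:]"] by (simp flip: q)
    \<comment> \<open>If s were in I, so would be f. If q is in I, the factor G cancels and s
      divides a polynomial in y alone.\<close>
    then consider "s \<in> I" | "q \<in> I" using prime by blast
    then show ?thesis
    proof cases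
      case 1
      obtain m q' where q': "smult (lead_coeff s ^ m) f = s * q'" using div[OF Jf] by blast
      have "[:lead_coeff s ^ m:] * f \<in> I" using mult_right[OF 1, of q'] by (simp add: q')
      then show ?thesis using cancel_const lc f by blast
    next
      case 2
      then obtain u where u: "q = G * u" using Gdvd by (auto elim!: dvdE)
      then have "G * [:lead_coeff s ^ n:] = G * (s * u)" using q by (simp add: mult_ac)
      then have e: "[:lead_coeff s ^ n:] = s * u" by (rule mult_left_cancel[THEN iffD1, OF G0])
      then have "u ~= 0" using lc[of n] by auto
      then have "degree (s * u) = degree s + degree u" using s(1) by (simp add: degree_mult_eq)
      then show ?thesis using e by (metis add_is_0 degree_pCons_0)
    qed
  qed
  then obtain r where r: "s = [:r:]" by (metis degree_eq_zeroE)
  moreover obtain a b where "s = a * f + b * G" using s(1) unfolding J_def by blast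
  moreover have "r ~= 0" using s(1) r by auto
  ultimately show ?thesis using that[of a b r] by metis
qed

text \<open>In characteristic 0 the derivative in x is nonzero, and its degree is too small for I.
  By elimination it shares zeros with G only above the roots of r, and these are avoided.\<close>

lemma generic_point:
  assumes "\<And>c. degree (sp c G) > 0"
  obtains x c where "ev G x c = 0" "ev (pderiv G) x c ~= 0"
proof -
  have "pderiv G ~= 0" using Gdeg by (simp add: pderiv_eq_0_iff)
  moreover have "degree (pderiv G) < degree G" using Gdeg by (simp add: degree_pderiv)
  ultimately have "pderiv G \<notin> I" using degree_ge[of "pderiv G"] by auto
  then obtain a b r where r: "a * pderiv G + b * G = [:r:]" "r ~= 0" by (rule elimination)
  obtain c where c: "poly r c ~= 0" using poly_zero_off_point[of 0 r] r(2) by blast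
  obtain x where x: "ev G x c = 0" using alg_closed_imp_poly_has_root[OF assms[of c]] by (auto simp: poly_sp)
  have "ev (a * pderiv G + b * G) x c = poly r c" unfolding r(1) by simp
  then have "ev (pderiv G) x c ~= 0" using x c by auto
  then show ?thesis using that x by blast
qed

text \<open>If the equation of the fibre divides the restriction of k, then modulo G the polynomial
  k is a multiple of the linear factor of that fibre, which cancels because I is prime.\<close>

lemma kill_fibre:
  assumes "k * h - [:[:-y, 1:]:] * m \<in> I" "sp y G dvd sp y k"
  obtains k' where "k' * h - m \<in> I"
proof -
  obtain s where s: "sp y k = sp y G * s" using assms(2) by (auto elim: dvdE)
  \<comment> \<open>The quotient s with coefficients constant in y, so that S restricts to s on the
    fibre.\<close>
  define S where "S = map_poly (\<lambda>a. [:a:]) s"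
  have "sp y (k - G * S) = 0" unfolding sp_diff sp_mult S_def sp_const s by simp
  then obtain k' where k': "k - G * S = [:[:-y, 1:]:] * k'" by (rule sp_eq_0)
  define Y where "Y = [:[:-y, 1:]:]"
  have kk: "k = Y * k' + G * S" using k' by (simp only: Y_def algebra_simps)
  have "[:[:-y, 1:]:] * (k' * h - m) = (k * h - [:[:-y, 1:]:] * m) - G * (S * h)"
    unfolding Y_def[symmetric] kk by (simp add: algebra_simps)
  then have "[:[:-y, 1:]:] * (k' * h - m) \<in> I" using diff[OF assms(1) mult_right[OF GI]] by simp
  then show ?thesis using cancel_const[of "[:-y, 1:]"] that by auto
qed

end

text \<open>By \<open>lc\<close> each fibre of the projection to y is finite and nonempty;
  \<open>simple\<close> makes the projection unramified at the chosen point, so that y - c is a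
  local parameter there.\<close>

locale curve_point = plane_curve I G for I G +
  fixes xv c :: "'k::{alg_closed_field, field_char_0}"
  assumes lc: "\<And>y. sp y G ~= 0 \<and> degree (sp y G) > 0"
    and pt: "ev G xv c = 0" and simple: "ev (pderiv G) xv c ~= 0"
begin

definition only :: "'k poly poly => bool" where
  "only h \<longleftrightarrow> (\<forall>x y. ev G x y = 0 --> (ev h x y = 0 \<longleftrightarrow> x = xv \<and> y = c))"

definition t :: "'k poly" where "t = [:-c, 1:]"

lemma only_notin: "only h ==> h \<notin> I"
proof
  assume h: "only h" "h \<in> I"
  obtain x where x: "ev G x (c + 1) = 0"
    using lc[of "c + 1"] alg_closed_imp_poly_has_root[of "sp (c + 1) G"] by (auto simp: poly_sp)
  then show False using vanish[OF h(2) x] h(1) unfolding only_def by auto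
qed

text \<open>Elimination makes a multiple of h equal to a polynomial in y modulo I. A root other than
  c can be divided out: h has no zero on that fibre, so the equation of the fibre divides the
  restriction of the cofactor and \<open>kill_fibre\<close> applies.\<close>

lemma power_of_t:
  assumes h: "only h"
  obtains \<alpha> n where "\<alpha> * h - [:t ^ n:] \<in> I"
proof -
  obtain a b r where r: "a * h + b * G = [:r:]" "r ~= 0" using elimination[OF only_notin[OF h]] .
  have "a * h - [:t ^ 0 * r:] = - (b * G)" using r(1) by (simp add: algebra_simps flip: r(1))
  then have "a * h - [:t ^ 0 * r:] \<in> I" using minus[OF mult[OF GI]] by simp
  \<comment> \<open>Generalised so that roots equal to c can be collected in the power of t while r
    loses a linear factor in either case.\<close>
  moreover have "\<exists>\<alpha> n. \<alpha> * h - [:t ^ n:] \<in> I" if "r ~= 0" "a * h - [:t ^ m * r:] \<in> I" for a m r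
    using that
  proof (induction "degree r" arbitrary: r a m)
    case 0
    then obtain u where u: "r = [:u:]" "u ~= 0" by (metis degree_eq_zeroE pCons_0_0)
    have "[:[:inverse u:]:] * (a * h - [:t ^ m * r:]) = ([:[:inverse u:]:] * a) * h - [:t ^ m:]"
      using u by (simp add: algebra_simps)
    then show ?case using mult[OF 0(3), of "[:[:inverse u:]:]"] by metis
  next
    case (Suc n)
    then obtain y where y: "poly r y = 0" using alg_closed_imp_poly_has_root[of r] by auto
    then obtain r' where r': "r = [:-y, 1:] * r'" by (auto simp: poly_eq_0_iff_dvd)
    have r0: "r' ~= 0" using Suc.prems(1) r' by auto
    have "degree r = Suc (degree r')" unfolding r' by (subst degree_mult_eq) (use r0 in auto)
    then have n: "n = degree r'" using Suc.hyps(2) by simp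
    show ?case
    proof (cases "y = c")
      case True
      have e: "t ^ m * r = t ^ Suc m * r'" unfolding r' t_def True by (simp only: power_Suc mult_ac)
      show ?thesis using Suc.hyps(1)[OF n r0, of a "Suc m"] Suc.prems(2) unfolding e by blast
    next
      case False
      have cc: "[:p:] * [:q:] = [:p * q:]" for p q :: "'k poly" by simp
      have e: "[:t ^ m * r:] = [:[:-y, 1:]:] * [:t ^ m * r':]" unfolding cc r' by (simp only: mult_ac)
      have I1: "a * h - [:[:-y, 1:]:] * [:t ^ m * r':] \<in> I" using Suc.prems(2) unfolding e .
      then obtain q where q: "a * h - [:[:-y, 1:]:] * [:t ^ m * r':] = G * q" using Gdvd by (auto elim!: dvdE)
      have "sp y (a * h) = sp y (G * q)"
      proof (rule poly_eq_poly_eq_iff[THEN iffD1], rule ext)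
        fix x
        have "ev (a * h - [:[:-y, 1:]:] * [:t ^ m * r':]) x y = ev (G * q) x y" unfolding q ..
        then show "poly (sp y (a * h)) x = poly (sp y (G * q)) x" by (simp add: poly_sp)
      qed
      then have "sp y G dvd sp y a * sp y h" unfolding sp_mult by simp
      then have "sp y G dvd sp y a"
        by (rule dvd_cancel_no_common_root[rotated 2])
           (use lc h False in \<open>auto simp: poly_sp only_def\<close>)
      from kill_fibre[OF I1 this] obtain a' where "a' * h - [:t ^ m * r':] \<in> I" .
      then show ?thesis using Suc.hyps(1)[OF n r0] by blast
    qed
  qed
  ultimately show ?thesis using r(2) that by blast
qed

text \<open>Writes h2 / h1 on the curve as k / t^i with i least. If i > 0 and k vanished at the
  point, the equation of the fibre over c would divide the restriction of k, and a factor t could be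
  cancelled.\<close>

lemma minimal_exponent:
  assumes h1: "only h1" and h2: "only h2"
  obtains k i where "k * h1 - [:t ^ i:] * h2 \<in> I" "i = 0 \<or> ev k xv c ~= 0"
proof -
  obtain \<alpha> n where "\<alpha> * h1 - [:t ^ n:] \<in> I" using power_of_t[OF h1] .
  then have "h2 * (\<alpha> * h1 - [:t ^ n:]) \<in> I" by (rule mult)
  then have ex: "(h2 * \<alpha>) * h1 - [:t ^ n:] * h2 \<in> I" by (simp add: algebra_simps)
  define i where "i = (LEAST i. \<exists>k. k * h1 - [:t ^ i:] * h2 \<in> I)"
  have "\<exists>k. k * h1 - [:t ^ i:] * h2 \<in> I" unfolding i_def by (rule LeastI_ex) (use ex in blast)
  then obtain k where k: "k * h1 - [:t ^ i:] * h2 \<in> I" by blast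
  have "ev k xv c ~= 0" if i0: "i ~= 0"
  proof
    assume k0: "ev k xv c = 0"
    obtain j where j: "i = Suc j" using i0 by (cases i) auto
    have I1: "k * h1 - [:[:-c, 1:]:] * ([:t ^ j:] * h2) \<in> I" using k unfolding j by (simp add: t_def mult_ac)
    have "poly (sp c G) xv = 0" using pt by (simp add: poly_sp)
    \<comment> \<open>The factor g accounts for the other points of the fibre; by simplicity it does
      not vanish at xv, so g and x - xv can be treated separately.\<close>
    then obtain g where g: "sp c G = [:-xv, 1:] * g" by (auto simp: poly_eq_0_iff_dvd)
    have "sp c (pderiv G) = pderiv (sp c G)"
      by (rule poly_eqI) (simp add: coeff_sp coeff_pderiv)
    then have "poly (pderiv ([:-xv, 1:] * g)) xv ~= 0" using simple poly_sp[of c "pderiv G" xv] g by simp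
    moreover have "poly (pderiv ([:-xv, 1:] * g)) xv = poly g xv"
      unfolding pderiv_mult poly_add poly_mult by (simp add: pderiv_pCons)
    ultimately have gx: "poly g xv ~= 0" by (simp only:) simp
    have g0: "g ~= 0" using gx by auto
    obtain q where q: "k * h1 - [:[:-c, 1:]:] * ([:t ^ j:] * h2) = G * q" using I1 Gdvd by (auto elim!: dvdE)
    have "sp c (k * h1) = sp c (G * q)"
    proof (rule poly_eq_poly_eq_iff[THEN iffD1], rule ext)
      fix x
      have "ev (k * h1 - [:[:-c, 1:]:] * ([:t ^ j:] * h2)) x c = ev (G * q) x c" unfolding q ..
      then show "poly (sp c (k * h1)) x = poly (sp c (G * q)) x" by (simp add: poly_sp)
    qed
    then have "sp c k * sp c h1 = g * ([:-xv, 1:] * sp c q)" unfolding sp_mult g by (simp only: mult_ac)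
    then have "g dvd sp c k * sp c h1" by (rule dvdI)
    moreover have "poly (sp c h1) x ~= 0" if "poly g x = 0" for x
    proof -
      have "ev G x c = 0" using that g poly_sp[of c G x] by simp
      moreover have "x ~= xv" using that gx by auto
      ultimately show ?thesis using h1 by (auto simp: only_def poly_sp)
    qed
    ultimately have "g dvd sp c k" using dvd_cancel_no_common_root[OF g0] by blast
    then obtain w where w: "sp c k = g * w" by (auto elim: dvdE)
    have "poly w xv = 0" using k0 gx w poly_sp[of c k xv] by simp
    then have "[:-xv, 1:] dvd w" by (simp add: poly_eq_0_iff_dvd)
    then have "[:-xv, 1:] * g dvd w * g" by (rule mult_dvd_mono) simp
    then have "sp c G dvd sp c k" unfolding w g by (simp only: mult.commute[of w g])
    from kill_fibre[OF I1 this] obtain k' where "k' * h1 - [:t ^ j:] * h2 \<in> I" .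
    then have "i \<le> j" unfolding i_def by (intro Least_le exI)
    then show False using j by simp
  qed
  then have "i = 0 \<or> ev k xv c ~= 0" by blast
  then show ?thesis by (rule that[OF k])
qed

text \<open>A function without zeros and poles outside a point with a single branch has no pole or no
  zero there either.\<close>

lemma divides_one_way:
  assumes h1: "only h1" and h2: "only h2"
  shows "(\<exists>k. k * h1 - h2 \<in> I) \<or> (\<exists>k. k * h2 - h1 \<in> I)"
proof -
  obtain k i where k: "k * h1 - [:t ^ i:] * h2 \<in> I" "i = 0 \<or> ev k xv c ~= 0" by (rule minimal_exponent[OF h1 h2])
  obtain l j where l: "l * h2 - [:t ^ j:] * h1 \<in> I" "j = 0 \<or> ev l xv c ~= 0" by (rule minimal_exponent[OF h2 h1])
  consider "i = 0" | "j = 0" | "i > 0" "j > 0" by auto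
  then show ?thesis
  proof cases
    case 1
    then show ?thesis using k(1) by (auto simp: one_pCons[symmetric])
  next
    case 2
    then show ?thesis using l(1) by (auto simp: one_pCons[symmetric])
  next
    case 3
    \<comment> \<open>If both quotients had poles at the point, their product would give k l = t^(i
      + j) on the curve; at the point t vanishes while k and l do not.\<close>
    have "h1 * (k * l - [:t ^ i * t ^ j:]) = l * (k * h1 - [:t ^ i:] * h2) + [:t ^ i:] * (l * h2 - [:t ^ j:] * h1)"
      by (simp add: algebra_simps)
    then have "h1 * (k * l - [:t ^ i * t ^ j:]) \<in> I" using add mult k(1) l(1) by metis
    then have "k * l - [:t ^ i * t ^ j:] \<in> I" using prime only_notin[OF h1] by blast
    from vanish[OF this pt] have "ev k xv c * ev l xv c = 0" using 3 by (simp add: t_def)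
    then show ?thesis using k(2) l(2) 3 by simp
  qed
qed

end

section \<open>Leading forms and the degree of the curve\<close>

context plane_curve
begin

text \<open>Reduced modulo G, the quotient has degree below e in x. If its total degree were
  positive, X^e, the leading form of G, would divide the product of its leading form with that of
  h1, hence its own leading form, as that of h1 is nonzero at X = 0; the degree in x is too small
  for this.\<close>

lemma constant_quotient:
  assumes e: "degree (Phi G) = e" "coeff (Phi G) e = monom g0 e" "g0 ~= 0" "degree G = e" "lead_coeff G = [:g0:]"
    and h1: "degree (Phi h1) = d" "poly (coeff (Phi h1) d) 0 ~= 0" and h2: "degree (Phi h2) \<le> d"
    and k: "k * h1 - h2 \<in> I"
  obtains \<kappa> where "[:[:\<kappa>:]:] * h1 - h2 \<in> I"
proof -
  obtain n q r where r: "smult (lead_coeff G ^ n) k = G * q + r" "r = 0 \<or> degree r < degree G"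
    using pseudo_division[OF G0, of k] .
  define s where "s = smult [:inverse (g0 ^ n):] r"
  \<comment> \<open>The leading coefficient of G in x is a nonzero constant, so pseudo-division
    becomes division with remainder after scaling.\<close>
  have lcn: "lead_coeff G ^ n = [:g0 ^ n:]" unfolding e(5) by (induction n) (simp_all add: one_pCons)
  have "smult [:inverse (g0 ^ n):] (smult (lead_coeff G ^ n) k) = k" using e(3) unfolding lcn by (simp add: one_pCons[symmetric])
  then have ks: "k = G * smult [:inverse (g0 ^ n):] q + s" unfolding r(1) s_def by (simp add: smult_add_right)
  have "s * h1 - h2 = (k * h1 - h2) - G * (smult [:inverse (g0 ^ n):] q * h1)" unfolding ks by (simp add: algebra_simps)
  then have sI: "s * h1 - h2 \<in> I" using diff[OF k mult_right[OF GI]] by metis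
  have sdeg: "s = 0 \<or> degree s < e" using r(2) e(4) unfolding s_def by auto
  have "degree (Phi s) = 0"
  proof (rule ccontr)
    assume n0: "degree (Phi s) ~= 0"
    then have s0: "s ~= 0" by auto
    have h10: "Phi h1 ~= 0" using h1(2) by auto
    have lch1: "lead_coeff (Phi h1) = coeff (Phi h1) d" using h1 by simp
    obtain Q where Q: "s * h1 - h2 = G * Q" using sI Gdvd by (auto elim!: dvdE)
    have "Phi (s * h1 - h2) = Phi (G * Q)" unfolding Q ..
    then have PQ: "Phi s * Phi h1 - Phi h2 = Phi G * Phi Q" by simp
    have d1: "degree (Phi s * Phi h1) = degree (Phi s) + d" using s0 h10 h1 by (simp add: degree_mult_eq)
    then have lt: "degree (Phi h2) < degree (Phi s * Phi h1)" using h2 n0 by simp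
    have "lead_coeff (Phi s * Phi h1 - Phi h2) = lead_coeff (Phi s * Phi h1)"
      by (rule lead_coeff_diff_lt[OF lt])
    then have "lead_coeff (Phi s) * coeff (Phi h1) d = monom g0 e * lead_coeff (Phi Q)"
      unfolding PQ lead_coeff_mult lch1 using e(1,2) by simp
    then have "monom g0 e dvd lead_coeff (Phi s) * coeff (Phi h1) d" by simp
    then have "monom g0 e dvd lead_coeff (Phi s)"
      by (rule dvd_cancel_no_common_root[rotated 2]) (use e(3) h1(2) in \<open>auto simp: poly_monom\<close>)
    moreover have "lead_coeff (Phi s) ~= 0" using s0 by simp
    ultimately have "degree (monom g0 e) \<le> degree (lead_coeff (Phi s))" by (rule dvd_imp_degree_le)
    also have "\<dots> \<le> degree s" by (rule degree_coeff_Phi)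
    finally show False using sdeg s0 e(3) by (simp add: degree_monom_eq)
  qed
  then have c0: "coeff (coeff s i) j = 0" if "i + j > 0" for i j
    using coeff_Phi[of s "i + j" i] that by (simp add: coeff_eq_0)
  have "s = [:[:coeff (coeff s 0) 0:]:]"
    by (rule poly_eqI, rule poly_eqI) (use c0 in \<open>auto simp: coeff_pCons split: nat.split\<close>)
  then show ?thesis using that sI by metis
qed

end

lemma coeff_power_top:
  fixes P :: "'a::idom poly"
  assumes "degree P \<le> d" "coeff P d ~= 0"
  shows "degree (P ^ n) = n * d" "coeff (P ^ n) (n * d) = coeff P d ^ n"
proof -
  have "degree P = d" using assms le_degree[of P d] by simp
  then show "degree (P ^ n) = n * d" "coeff (P ^ n) (n * d) = coeff P d ^ n"
    using assms lead_coeff_power[of P n] by (auto simp: degree_power_eq)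
qed

text \<open>After raising to the common degree D, one of the two functions is a constant multiple of
  the other modulo G. The coefficients in degree D then differ by a multiple of X^e, and for e \<ge>
  2 the values and derivatives at X = 0 contradict the difference of b1 and b2.\<close>

lemma (in curve_point) degree_one:
  assumes e: "degree (Phi G) = e" "coeff (Phi G) e = monom g0 e" "g0 ~= 0" "degree G = e" "lead_coeff G = [:g0:]"
    and h1: "only h1" "degree (Phi h1) \<le> d1" "\<And>x. poly (coeff (Phi h1) d1) x = c1 * (1 - b1 * x) ^ d1" "c1 ~= 0" "d1 > 0"
    and h2: "only h2" "degree (Phi h2) \<le> d2" "\<And>x. poly (coeff (Phi h2) d2) x = c2 * (1 - b2 * x) ^ d2" "c2 ~= 0" "d2 > 0"
    and b: "b1 ~= b2"
  shows "e \<le> 1"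
proof (rule ccontr)
  assume "\<not> e \<le> 1"
  then have e2: "e \<ge> 2" by simp
  define D where "D = d1 * d2"
  have D0: "D > 0" using h1 h2 by (simp add: D_def)
  define H1 where "H1 = h1 ^ d2"
  define H2 where "H2 = h2 ^ d1"
  have o: "only H1" "only H2" using h1 h2 by (auto simp: H1_def H2_def only_def)
  have t1: "coeff (Phi h1) d1 ~= 0" using h1(3)[of 0] h1(4) by auto
  have t2: "coeff (Phi h2) d2 ~= 0" using h2(3)[of 0] h2(4) by auto
  have deg: "degree (Phi H1) = D" "degree (Phi H2) = D"
    using coeff_power_top(1)[OF h1(2) t1, of d2] coeff_power_top(1)[OF h2(2) t2, of d1]
    by (simp_all add: H1_def H2_def D_def mult.commute)
  have cf: "coeff (Phi H1) D = coeff (Phi h1) d1 ^ d2" "coeff (Phi H2) D = coeff (Phi h2) d2 ^ d1"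
    using coeff_power_top(2)[OF h1(2) t1, of d2] coeff_power_top(2)[OF h2(2) t2, of d1]
    by (simp_all add: H1_def H2_def D_def mult.commute)
  define u1 where "u1 = c1 ^ d2"
  define u2 where "u2 = c2 ^ d1"
  have top: "poly (coeff (Phi H1) D) x = u1 * (1 - b1 * x) ^ D" "poly (coeff (Phi H2) D) x = u2 * (1 - b2 * x) ^ D" for x
  proof -
    show "poly (coeff (Phi H1) D) x = u1 * (1 - b1 * x) ^ D"
      unfolding cf poly_power h1(3) unfolding u1_def D_def by (simp add: power_mult_distrib power_mult)
    show "poly (coeff (Phi H2) D) x = u2 * (1 - b2 * x) ^ D"
      unfolding cf poly_power h2(3) unfolding u2_def D_def mult.commute[of d1 d2] by (simp add: power_mult_distrib power_mult)
  qed
  have u0: "u1 ~= 0" "u2 ~= 0" using h1(4) h2(4) by (simp_all add: u1_def u2_def)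
  have n1: "poly (coeff (Phi H1) D) 0 ~= 0" "poly (coeff (Phi H2) D) 0 ~= 0" using top u0 by simp_all
  have main: False if \<kappa>: "[:[:\<kappa>:]:] * H - H' \<in> I" and Hs: "degree (Phi H) \<le> D" "degree (Phi H') \<le> D"
    and tt: "\<And>x. poly (coeff (Phi H) D) x = u * (1 - b * x) ^ D" "\<And>x. poly (coeff (Phi H') D) x = u' * (1 - b' * x) ^ D"
    and bb: "b ~= b'" "u' ~= 0" for \<kappa> H H' u u' b b'
  proof -
    obtain Q where Q: "[:[:\<kappa>:]:] * H - H' = G * Q" using \<kappa> Gdvd by (auto elim!: dvdE)
    have P1: "Phi [:[:\<kappa>:]:] = [:[:\<kappa>:]:]" by (rule ev_eqI) (simp add: ev_Phi)
    have PQ: "Phi G * Phi Q = [:[:\<kappa>:]:] * Phi H - Phi H'" using arg_cong[OF Q, of Phi] by (simp only: Phi_simps P1)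
    have le: "degree (Phi G * Phi Q) \<le> D" unfolding PQ
      by (rule degree_diff_le) (use Hs degree_mult_le[of "[:[:\<kappa>:]:]" "Phi H"] in \<open>auto intro: order_trans\<close>)
    have dv: "monom 1 2 dvd coeff (Phi G * Phi Q) D"
    proof (cases "Phi Q = 0 \<or> degree (Phi G * Phi Q) < D")
      case True
      then show ?thesis by (auto simp: coeff_eq_0)
    next
      case False
      then have "degree (Phi G * Phi Q) = D" using le by simp
      then have "coeff (Phi G * Phi Q) D = lead_coeff (Phi G) * lead_coeff (Phi Q)" by (metis lead_coeff_mult)
      also have "lead_coeff (Phi G) = monom g0 e" using e by simp
      also have "monom g0 e = monom 1 2 * monom g0 (e - 2)" using e2 by (simp only: mult_monom mult_1 le_add_diff_inverse)
      finally show ?thesis by (simp add: mult.assoc)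
    qed
    define p where "p = coeff (Phi G * Phi Q) D"
    have "coeff p 0 = 0" "coeff p 1 = 0"
      using dv unfolding p_def[symmetric] by (auto simp: monom_1_dvd_iff' )
    have pe: "p = smult (\<kappa> * u) ([:1, -b:] ^ D) - smult u' ([:1, -b':] ^ D)"
    proof (rule poly_eq_poly_eq_iff[THEN iffD1], rule ext)
      fix x
      show "poly p x = poly (smult (\<kappa> * u) ([:1, -b:] ^ D) - smult u' ([:1, -b':] ^ D)) x"
        unfolding p_def PQ using tt by (simp add: algebra_simps)
    qed
    have "poly p 0 = \<kappa> * u - u'" unfolding pe by simp
    then have q1: "\<kappa> * u = u'" using \<open>coeff p 0 = 0\<close> by (simp add: poly_0_coeff_0)
    have "poly (pderiv p) 0 = \<kappa> * u * (of_nat D * - b) - u' * (of_nat D * - b')"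
      unfolding pe by (simp add: pderiv_diff pderiv_smult pderiv_power pderiv_pCons)
    moreover have "poly (pderiv p) 0 = coeff p 1" by (simp add: poly_0_coeff_0 coeff_pderiv)
    \<comment> \<open>The integer D > 0 stays nonzero in K because the characteristic is 0.\<close>
    ultimately have "u' * of_nat D * (b' - b) = 0" using \<open>coeff p 1 = 0\<close> q1 by (auto simp: algebra_simps)
    then show False using bb D0 by simp
  qed
  from divides_one_way[OF o] show False
  proof (elim disjE exE)
    fix k assume "k * H1 - H2 \<in> I"
    then obtain \<kappa> where "[:[:\<kappa>:]:] * H1 - H2 \<in> I" by (rule constant_quotient[OF e deg(1) n1(1) eq_refl[OF deg(2)]])
    then show False by (rule main[OF _ eq_refl[OF deg(1)] eq_refl[OF deg(2)] top b u0(2)])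
  next
    fix k assume "k * H2 - H1 \<in> I"
    then obtain \<kappa> where "[:[:\<kappa>:]:] * H2 - H1 \<in> I" by (rule constant_quotient[OF e deg(2) n1(2) eq_refl[OF deg(1)]])
    then show False by (rule main[OF _ eq_refl[OF deg(2)] eq_refl[OF deg(1)] top(2) top(1) b[symmetric] u0(1)])
  qed
qed

section \<open>The projective plane\<close>

definition pt :: "'k::field ^ 3 => ('k ^ 3) set" where
  "pt v = proportional `` {v}"

lemma pt_mem: "w \<in> pt v \<longleftrightarrow> v ~= 0 \<and> w ~= 0 \<and> (\<exists>c. w = c *s v)"
  by (auto simp: pt_def proportional_def)

lemma pt_self: "v ~= 0 ==> v \<in> pt v"
  unfolding pt_mem by (auto intro: exI[of _ 1])

lemma pt_eq_iff:
  assumes "v ~= 0" "w ~= 0"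
  shows "pt v = pt w \<longleftrightarrow> (\<exists>c. w = c *s v)"
proof
  assume "pt v = pt w"
  then have "w \<in> pt v" using pt_self assms by auto
  then show "\<exists>c. w = c *s v" by (auto simp: pt_mem)
next
  assume "\<exists>c. w = c *s v"
  then obtain c where c: "w = c *s v" by blast
  then have c0: "c ~= 0" using assms by auto
  have "u \<in> pt v \<longleftrightarrow> u \<in> pt w" for u
  proof
    assume "u \<in> pt v"
    then obtain d where "u = d *s v" "u ~= 0" by (auto simp: pt_mem)
    then have "u = (d / c) *s w" using c c0 by (simp add: vector_smult_assoc)
    then show "u \<in> pt w" using assms \<open>u ~= 0\<close> by (auto simp: pt_mem)
  next
    assume "u \<in> pt w"
    then obtain d where "u = d *s w" "u ~= 0" by (auto simp: pt_mem)
    then have "u = (d * c) *s v" using c by (simp add: vector_smult_assoc)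
    then show "u \<in> pt v" using assms \<open>u ~= 0\<close> by (auto simp: pt_mem)
  qed
  then show "pt v = pt w" by blast
qed

lemma proj_plane_iff: "p \<in> proj_plane \<longleftrightarrow> (\<exists>v. v ~= 0 \<and> p = pt v)"
  unfolding proj_plane_def pt_def quotient_def by auto

lemma pt_in [simp]: "v ~= 0 ==> pt v \<in> proj_plane"
  by (auto simp: proj_plane_iff)

type_synonym 'k pset = "('k ^ 3) set set"

definition Zset :: "('k::field ^ 3 => 'k) => 'k pset" where
  "Zset F = {p \<in> proj_plane. \<forall>v\<in>p. F v = 0}"

lemma Zset_sub: "Zset F \<subseteq> proj_plane"
  by (auto simp: Zset_def)

lemma pt_Zset:
  fixes v :: "'k::field ^ 3"
  assumes "is_form d F" "v ~= 0"
  shows "pt v \<in> Zset F \<longleftrightarrow> F v = 0"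
  using assms pt_self[of v] by (auto simp: Zset_def pt_mem form_homog[OF assms(1)])

text \<open>Trades the family of equations for separation: each outside point is excluded by a
  single form that vanishes on the set.\<close>

lemma closed_iff:
  "zariski_closed Z \<longleftrightarrow> Z \<subseteq> proj_plane \<and>
     (\<forall>p\<in>proj_plane - Z. \<exists>d F. is_form d F \<and> Z \<subseteq> Zset F \<and> p \<notin> Zset F)"
proof
  assume "zariski_closed Z"
  then obtain S where S: "Z = {p \<in> proj_plane. \<forall>(d, c) \<in> S. \<forall>v \<in> p. form_val d c v = 0}"
    unfolding zariski_closed_def by blast
  show "Z \<subseteq> proj_plane \<and> (\<forall>p\<in>proj_plane - Z. \<exists>d F. is_form d F \<and> Z \<subseteq> Zset F \<and> p \<notin> Zset F)"
  proof (intro conjI ballI)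
    show "Z \<subseteq> proj_plane" using S by auto
    fix p assume p: "p \<in> proj_plane - Z"
    then obtain d c where dc: "(d, c) \<in> S" "\<not> (\<forall>v\<in>p. form_val d c v = 0)" unfolding S by auto
    have "Z \<subseteq> Zset (form_val d c)" using dc(1) unfolding S Zset_def by auto
    moreover have "p \<notin> Zset (form_val d c)" using dc(2) by (simp add: Zset_def)
    ultimately show "\<exists>d F. is_form d F \<and> Z \<subseteq> Zset F \<and> p \<notin> Zset F" unfolding is_form_def by blast
  qed
next
  assume *: "Z \<subseteq> proj_plane \<and> (\<forall>p\<in>proj_plane - Z. \<exists>d F. is_form d F \<and> Z \<subseteq> Zset F \<and> p \<notin> Zset F)"
  define S where "S = {(d, c). Z \<subseteq> Zset (form_val d c)}"
  have "Z = {p \<in> proj_plane. \<forall>(d, c) \<in> S. \<forall>v \<in> p. form_val d c v = 0}"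
  proof (intro set_eqI iffI)
    fix p assume "p \<in> Z"
    then show "p \<in> {p \<in> proj_plane. \<forall>(d, c) \<in> S. \<forall>v \<in> p. form_val d c v = 0}"
      using * unfolding S_def Zset_def by auto
  next
    fix p assume p: "p \<in> {p \<in> proj_plane. \<forall>(d, c) \<in> S. \<forall>v \<in> p. form_val d c v = 0}"
    show "p \<in> Z"
    proof (rule ccontr)
      assume "p \<notin> Z"
      then obtain d c where "Z \<subseteq> Zset (form_val d c)" "p \<notin> Zset (form_val d c)"
        using * p unfolding is_form_def by blast
      then show False using p unfolding S_def Zset_def by blast
    qed
  qed
  then show "zariski_closed Z" unfolding zariski_closed_def by blast
qed

lemma closed_Zset: "is_form d F ==> zariski_closed (Zset F)"
  unfolding closed_iff using Zset_sub by blast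

lemma closed_inter:
  assumes "zariski_closed Y" "zariski_closed Z"
  shows "zariski_closed (Y \<inter> Z)"
  unfolding closed_iff
proof (intro conjI ballI)
  show "Y \<inter> Z \<subseteq> proj_plane" using assms unfolding closed_iff by blast
  fix p assume "p \<in> proj_plane - Y \<inter> Z"
  then consider "p \<in> proj_plane - Y" | "p \<in> proj_plane - Z" by blast
  then show "\<exists>d F. is_form d F \<and> Y \<inter> Z \<subseteq> Zset F \<and> p \<notin> Zset F"
    using assms unfolding closed_iff by cases blast+
qed

lemma Zset_un:
  assumes "is_form d F" "is_form d' G"
  shows "Z \<subseteq> proj_plane ==> Z \<subseteq> Zset F \<union> Zset G \<longleftrightarrow> (\<forall>v. v ~= 0 \<and> pt v \<in> Z --> F v = 0 \<or> G v = 0)"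
  using pt_Zset[OF assms(1)] pt_Zset[OF assms(2)] by (auto simp: subset_iff proj_plane_iff)

lemma sub_Zset: "is_form d F ==> Z \<subseteq> proj_plane ==> Z \<subseteq> Zset F \<longleftrightarrow> (\<forall>v. v ~= 0 \<and> pt v \<in> Z --> F v = 0)"
  using Zset_un[of d F d F Z] by simp

text \<open>Coverings by two zero sets of forms are the critical ones: if neither V nor W is all of
  Z, a point outside each is separated from it by one form.\<close>

lemma irreducible_iff:
  "irreducible_closed Z \<longleftrightarrow> zariski_closed Z \<and> Z ~= {} \<and>
     (\<forall>d F d' G. is_form d F \<and> is_form d' G \<and> Z \<subseteq> Zset F \<union> Zset G --> Z \<subseteq> Zset F \<or> Z \<subseteq> Zset G)"
proof
  assume Z: "irreducible_closed Z"
  then have c: "zariski_closed Z" "Z ~= {}" by (auto simp: irreducible_closed_def)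
  have "Z \<subseteq> Zset F \<or> Z \<subseteq> Zset G" if "is_form d F" "is_form d' G" "Z \<subseteq> Zset F \<union> Zset G" for d F d' G
  proof -
    have "Z = (Z \<inter> Zset F) \<union> (Z \<inter> Zset G)" using that by blast
    then have "Z \<inter> Zset F = Z \<or> Z \<inter> Zset G = Z"
      using Z closed_inter[OF c(1) closed_Zset] that unfolding irreducible_closed_def by blast
    then show ?thesis by blast
  qed
  then show "zariski_closed Z \<and> Z ~= {} \<and>
     (\<forall>d F d' G. is_form d F \<and> is_form d' G \<and> Z \<subseteq> Zset F \<union> Zset G --> Z \<subseteq> Zset F \<or> Z \<subseteq> Zset G)"
    using c by blast
next
  assume *: "zariski_closed Z \<and> Z ~= {} \<and>
     (\<forall>d F d' G. is_form d F \<and> is_form d' G \<and> Z \<subseteq> Zset F \<union> Zset G --> Z \<subseteq> Zset F \<or> Z \<subseteq> Zset G)"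
  show "irreducible_closed Z" unfolding irreducible_closed_def
  proof (intro conjI allI impI)
    fix V W assume VW: "zariski_closed V \<and> zariski_closed W \<and> Z = V \<union> W"
    show "V = Z \<or> W = Z"
    proof (rule ccontr)
      assume "\<not> (V = Z \<or> W = Z)"
      then obtain p q where pq: "p \<in> Z" "p \<notin> V" "q \<in> Z" "q \<notin> W" using VW by blast
      have sub: "Z \<subseteq> proj_plane" using * closed_iff by blast
      obtain d F where F: "is_form d F" "V \<subseteq> Zset F" "p \<notin> Zset F" using VW pq sub unfolding closed_iff by blast
      obtain d' G where G: "is_form d' G" "W \<subseteq> Zset G" "q \<notin> Zset G" using VW pq sub unfolding closed_iff by blast
      have "Z \<subseteq> Zset F \<union> Zset G" using VW F G by blast
      then show False using * F G pq by blast
    qed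
  qed (use * in auto)
qed

definition VV :: "'k::field pset set" where
  "VV = {Z. irreducible_closed Z \<and> Z ~= proj_plane}"

lemma VV_sub: "Z \<in> VV ==> Z \<subseteq> proj_plane"
  unfolding VV_def irreducible_iff closed_iff by blast

lemma VV_closed: "Z \<in> VV ==> p \<in> proj_plane ==> p \<notin> Z ==> \<exists>d F. is_form d F \<and> Z \<subseteq> Zset F \<and> p \<notin> Zset F"
  unfolding VV_def irreducible_iff closed_iff by blast

lemma VV_irred: "Z \<in> VV ==> is_form d F ==> is_form d' G ==> Z \<subseteq> Zset F \<union> Zset G ==> Z \<subseteq> Zset F \<or> Z \<subseteq> Zset G"
  unfolding VV_def irreducible_iff by blast

lemma VV_pt:
  assumes "Z \<in> VV" "p \<in> Z"
  obtains v where "v ~= 0" "p = pt v"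
  using VV_sub[OF assms(1)] assms(2) unfolding subset_iff proj_plane_iff by blast

lemma VV_nonempty: "Z \<in> VV ==> Z ~= {}"
  unfolding VV_def irreducible_closed_def by blast

text \<open>The components of the cross product of \<open>v\<close> and \<open>w\<close> cut out the point of \<open>v\<close>.\<close>

lemma proportional_iff:
  fixes v w :: "'k::field ^ 3"
  assumes "v ~= 0"
  shows "(\<exists>c. w = c *s v) \<longleftrightarrow> v $ 1 * w $ 2 = v $ 2 * w $ 1 \<and> v $ 2 * w $ 3 = v $ 3 * w $ 2 \<and> v $ 1 * w $ 3 = v $ 3 * w $ 1"
proof
  assume *: "v $ 1 * w $ 2 = v $ 2 * w $ 1 \<and> v $ 2 * w $ 3 = v $ 3 * w $ 2 \<and> v $ 1 * w $ 3 = v $ 3 * w $ 1"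
  consider "v $ 1 ~= 0" | "v $ 2 ~= 0" | "v $ 3 ~= 0" using assms by (auto simp: vec3_eq_iff)
  then show "\<exists>c. w = c *s v"
  proof cases
    case 1
    then show ?thesis using * by (intro exI[of _ "w $ 1 / v $ 1"]) (auto simp: vec3_eq_iff field_simps)
  next
    case 2
    then show ?thesis using * by (intro exI[of _ "w $ 2 / v $ 2"]) (auto simp: vec3_eq_iff field_simps)
  next
    case 3
    then show ?thesis using * by (intro exI[of _ "w $ 3 / v $ 3"]) (auto simp: vec3_eq_iff field_simps)
  qed
qed (auto simp: mult_ac)

lemma separating_form:
  fixes v w :: "'k::field ^ 3"
  assumes "v ~= 0" "w ~= 0" "pt v ~= pt w"
  obtains u where "lin u v = 0" "lin u w ~= 0"
proof -
  have "\<not> (v $ 1 * w $ 2 = v $ 2 * w $ 1 \<and> v $ 2 * w $ 3 = v $ 3 * w $ 2 \<and> v $ 1 * w $ 3 = v $ 3 * w $ 1)"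
    using assms pt_eq_iff[of v w] proportional_iff[of v w] by blast
  then consider "v $ 1 * w $ 2 ~= v $ 2 * w $ 1" | "v $ 2 * w $ 3 ~= v $ 3 * w $ 2" | "v $ 1 * w $ 3 ~= v $ 3 * w $ 1" by blast
  then show ?thesis
  proof cases
    case 1
    then show ?thesis by (intro that[of "vec3 (- v $ 2) (v $ 1) 0"]) (auto simp: lin_def)
  next
    case 2
    then show ?thesis by (intro that[of "vec3 0 (- v $ 3) (v $ 2)"]) (auto simp: lin_def)
  next
    case 3
    then show ?thesis by (intro that[of "vec3 (- v $ 3) 0 (v $ 1)"]) (auto simp: lin_def)
  qed
qed

lemma proj_plane_nontrivial: "\<exists>p\<in>proj_plane. p ~= pt (v :: 'k::field ^ 3)"
proof -
  have nz: "vec3 1 0 0 ~= (0 :: 'k ^ 3)" "vec3 0 1 0 ~= (0 :: 'k ^ 3)" by (auto simp: vec3_eq_iff)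
  have "pt (vec3 1 0 (0::'k)) ~= pt (vec3 0 1 0)"
    unfolding pt_eq_iff[OF nz] by (auto simp: vec3_eq_iff)
  then show ?thesis using pt_in[OF nz(1)] pt_in[OF nz(2)] by metis
qed

section \<open>Points, lines and parametrised curves\<close>

lemma point_VV:
  fixes v :: "'k::field ^ 3"
  assumes "v ~= 0"
  shows "{pt v} \<in> VV"
proof -
  have "zariski_closed {pt v}" unfolding closed_iff
  proof (intro conjI ballI)
    fix p assume "p \<in> proj_plane - {pt v}"
    then obtain w where w: "p = pt w" "w ~= 0" "pt v ~= pt w" by (auto simp: proj_plane_iff)
    obtain u where u: "lin u v = 0" "lin u w ~= 0" by (rule separating_form[OF assms w(2,3)])
    then show "\<exists>d F. is_form d F \<and> {pt v} \<subseteq> Zset F \<and> p \<notin> Zset F"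
      using pt_Zset[OF is_form_lin assms, of u] pt_Zset[OF is_form_lin w(2), of u] w(1) is_form_lin[of u] by auto
  qed (use assms in simp)
  moreover have "{pt v} ~= proj_plane" using proj_plane_nontrivial[of v] by auto
  ultimately show ?thesis unfolding VV_def irreducible_iff by auto
qed

text \<open>Pulled back along \<gamma>, forms become polynomials in t, and a product of polynomials
  vanishes only if a factor does. The hypothesis \<open>dense\<close> covers the points that the
  parametrisation misses.\<close>

lemma parametrised_VV:
  fixes F :: "'k::field_char_0 ^ 3 => 'k"
  assumes F: "is_form d F" and \<gamma>: "\<And>t. \<gamma> t ~= 0" "\<And>t. F (\<gamma> t) = 0"
    and poly: "\<And>d G. is_form d G ==> \<exists>p. \<forall>t. poly p t = G (\<gamma> t)"
    and dense: "\<And>d G v. is_form d G ==> (\<And>t. G (\<gamma> t) = 0) ==> F v = 0 ==> v ~= 0 ==> G v = 0"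
    and proper: "v0 ~= 0" "F v0 ~= 0"
  shows "Zset F \<in> VV"
proof -
  have "Zset F \<subseteq> Zset G \<or> Zset F \<subseteq> Zset H" if G: "is_form d1 G" and H: "is_form d2 H" and s: "Zset F \<subseteq> Zset G \<union> Zset H" for d1 G d2 H
  proof -
    obtain p where p: "\<And>t. poly p t = G (\<gamma> t)" using poly[OF G] by blast
    obtain q where q: "\<And>t. poly q t = H (\<gamma> t)" using poly[OF H] by blast
    have "G (\<gamma> t) = 0 \<or> H (\<gamma> t) = 0" for t
      using s[unfolded Zset_un[OF G H Zset_sub]] pt_Zset[OF F \<gamma>(1)] \<gamma> by blast
    then have "poly (p * q) t = poly 0 t" for t using p q by auto
    then have "p * q = 0" using poly_eq_poly_eq_iff[of "p * q" 0] by blast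
    then have "p = 0 \<or> q = 0" by simp
    then show ?thesis
    proof
      assume "p = 0"
      then have "G (\<gamma> t) = 0" for t using p[of t] by simp
      then show ?thesis using dense[OF G] sub_Zset[OF G Zset_sub, of F] pt_Zset[OF F] by blast
    next
      assume "q = 0"
      then have "H (\<gamma> t) = 0" for t using q[of t] by simp
      then show ?thesis using dense[OF H] sub_Zset[OF H Zset_sub, of F] pt_Zset[OF F] by blast
    qed
  qed
  moreover have "Zset F ~= {}" using pt_Zset[OF F \<gamma>(1)] \<gamma>(2) by blast
  moreover have "Zset F ~= proj_plane" using pt_Zset[OF F proper(1)] proper by auto
  ultimately show ?thesis unfolding VV_def irreducible_iff using closed_Zset[OF F] by blast
qed

definition ln :: "'k::field ^ 3 => 'k pset" where
  "ln u = Zset (lin u)"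

lemma pt_ln: "v ~= 0 ==> pt v \<in> ln u \<longleftrightarrow> lin u v = 0"
  unfolding ln_def by (rule pt_Zset[OF is_form_lin])

lemma ln_sub: "ln u \<subseteq> proj_plane"
  unfolding ln_def by (rule Zset_sub)

lemma line_param:
  fixes u :: "'k::field ^ 3"
  assumes "u ~= 0"
  obtains a b where "a ~= 0" "b ~= 0" "\<And>t. a + t *s b ~= 0" "lin u a = 0" "lin u b = 0"
    "\<And>v. lin u v = 0 ==> \<exists>s t. v = s *s a + t *s b"
proof -
  consider "u $ 1 ~= 0" | "u $ 2 ~= 0" | "u $ 3 ~= 0" using assms by (auto simp: vec3_eq_iff)
  then show ?thesis
  proof cases
    case 1
    have v: "\<exists>s t. v = s *s vec3 (- u $ 2) (u $ 1) 0 + t *s vec3 (- u $ 3) 0 (u $ 1)" if "lin u v = 0" for v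
    proof -
      have "v $ 1 * u $ 1 = - v $ 2 * u $ 2 - v $ 3 * u $ 3" using that unfolding lin_def by algebra
      then show ?thesis using 1 by (intro exI[of _ "v $ 2 / u $ 1"] exI[of _ "v $ 3 / u $ 1"]) (simp add: vec3_eq_iff field_simps)
    qed
    show ?thesis
      by (rule that[OF _ _ _ _ _ v])
         ((assumption | use 1 in \<open>simp add: vec3_eq_iff lin_def\<close>)+)
  next
    case 2
    have v: "\<exists>s t. v = s *s vec3 (u $ 2) (- u $ 1) 0 + t *s vec3 0 (- u $ 3) (u $ 2)" if "lin u v = 0" for v
    proof -
      have "v $ 2 * u $ 2 = - v $ 1 * u $ 1 - v $ 3 * u $ 3" using that unfolding lin_def by algebra
      then show ?thesis using 2 by (intro exI[of _ "v $ 1 / u $ 2"] exI[of _ "v $ 3 / u $ 2"]) (simp add: vec3_eq_iff field_simps)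
    qed
    show ?thesis
      by (rule that[OF _ _ _ _ _ v])
         ((assumption | use 2 in \<open>simp add: vec3_eq_iff lin_def\<close>)+)
  next
    case 3
    have v: "\<exists>s t. v = s *s vec3 (u $ 3) 0 (- u $ 1) + t *s vec3 0 (u $ 3) (- u $ 2)" if "lin u v = 0" for v
    proof -
      have "v $ 3 * u $ 3 = - v $ 1 * u $ 1 - v $ 2 * u $ 2" using that unfolding lin_def by algebra
      then show ?thesis using 3 by (intro exI[of _ "v $ 1 / u $ 3"] exI[of _ "v $ 2 / u $ 3"]) (simp add: vec3_eq_iff field_simps)
    qed
    show ?thesis
      by (rule that[OF _ _ _ _ _ v])
         ((assumption | use 3 in \<open>simp add: vec3_eq_iff lin_def\<close>)+)
  qed
qed

lemma nonzero_on_lin: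
  fixes u :: "'k::field ^ 3"
  assumes "u ~= 0"
  obtains v where "v ~= 0" "lin u v ~= 0"
proof -
  consider "u $ 1 ~= 0" | "u $ 2 ~= 0" | "u $ 3 ~= 0" using assms by (auto simp: vec3_eq_iff)
  then show ?thesis
  proof cases
    case 1
    then show ?thesis by (intro that[of "vec3 1 0 0"]) (auto simp: vec3_eq_iff lin_def)
  next
    case 2
    then show ?thesis by (intro that[of "vec3 0 1 0"]) (auto simp: vec3_eq_iff lin_def)
  next
    case 3
    then show ?thesis by (intro that[of "vec3 0 0 1"]) (auto simp: vec3_eq_iff lin_def)
  qed
qed

lemma form_span:
  fixes F :: "'k::field_char_0 ^ 3 => 'k"
  assumes F: "is_form d F" and inf: "infinite {t. F (a + t *s b) = 0}" and nz: "s *s a + t *s b ~= 0"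
  shows "F (s *s a + t *s b) = 0"
proof (cases "s = 0")
  case True
  have "F (t *s b) = 0" unfolding form_homog[OF F] using form_eq_on_line(2)[OF F inf] by simp
  then show ?thesis using True by simp
next
  case False
  then have eq: "s *s a + t *s b = s *s (a + (t / s) *s b)" by (simp add: vec3_eq_iff field_simps)
  show ?thesis unfolding eq form_homog[OF F] using form_eq_on_line(1)[OF F inf, of "t / s"] by simp
qed

lemma ln_VV:
  fixes u :: "'k::field_char_0 ^ 3"
  assumes "u ~= 0"
  shows "ln u \<in> VV"
proof -
  obtain a b where ab: "a ~= 0" "b ~= 0" "\<And>t. a + t *s b ~= 0" "lin u a = 0" "lin u b = 0"
    "\<And>v. lin u v = 0 ==> \<exists>s t. v = s *s a + t *s b" using line_param[OF assms] by blast
  obtain v0 where v0: "v0 ~= 0" "lin u v0 ~= 0" using nonzero_on_lin[OF assms] .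
  show ?thesis unfolding ln_def
  proof (rule parametrised_VV[OF is_form_lin, of "\<lambda>t. a + t *s b", OF ab(3) _ _ _ v0])
    fix t
    have "lin u (a + t *s b) = lin u a + t * lin u b" by (simp add: lin_def algebra_simps)
    then show "lin u (a + t *s b) = 0" using ab by simp
  next
    fix d G assume "is_form d (G :: 'k ^ 3 => 'k)"
    then show "\<exists>p. \<forall>t. poly p t = G (a + t *s b)" using form_poly_line[of d G a b] by metis
  next
    fix d v and G :: "'k ^ 3 => 'k"
    assume G: "is_form d G" "\<And>t. G (a + t *s b) = 0" and v: "lin u v = 0" "v ~= 0"
    have "infinite {t. G (a + t *s b) = 0}" using G(2) infinite_UNIV_0[where ?'k = 'k] by simp
    then show "G v = 0" using form_span[OF G(1)] ab(6)[OF v(1)] v(2) by metis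
  qed
qed

definition is_pt where "is_pt Z \<longleftrightarrow> (\<exists>v. v ~= 0 \<and> Z = {pt v})"

text \<open>With two points p and q, a linear form through p avoids q, and a product of linear forms
  through all points other than p avoids p; together they would cover the set.\<close>

lemma finite_irreducible:
  fixes Z :: "'k::field pset"
  assumes Z: "Z \<in> VV" "finite Z"
  shows "is_pt Z"
proof (rule ccontr)
  assume n: "\<not> is_pt Z"
  obtain p where p: "p \<in> Z" using VV_nonempty[OF Z(1)] by blast
  obtain v where v: "v ~= 0" "p = pt v" by (rule VV_pt[OF Z(1) p])
  have "Z ~= {p}" using n v unfolding is_pt_def by blast
  then obtain q where q: "q \<in> Z" "q ~= p" using p by blast
  obtain w where w: "w ~= 0" "q = pt w" by (rule VV_pt[OF Z(1) q(1)])
  have vw: "pt v ~= pt w" using q(2) v(2) w(2) by simp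
  obtain u where u: "lin u v = 0" "lin u w ~= 0" by (rule separating_form[OF v(1) w(1) vw])
  have "\<forall>r\<in>Z - {p}. \<exists>m. r \<in> Zset (lin m) \<and> lin m v ~= 0"
  proof
    fix r assume r: "r \<in> Z - {p}"
    then have "r \<in> Z" by blast
    then obtain z where z: "z ~= 0" "r = pt z" by (rule VV_pt[OF Z(1)])
    have zv: "pt z ~= pt v" using r z(2) v(2) by simp
    obtain m where "lin m z = 0" "lin m v ~= 0" by (rule separating_form[OF z(1) v(1) zv])
    then show "\<exists>m. r \<in> Zset (lin m) \<and> lin m v ~= 0" using pt_Zset[OF is_form_lin z(1), of m] z(2) by blast
  qed
  then obtain m where m: "\<And>r. r \<in> Z - {p} ==> r \<in> Zset (lin (m r)) \<and> lin (m r) v ~= 0" by metis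
  define G where "G = (\<lambda>x. \<Prod>r\<in>Z - {p}. lin (m r) x)"
  have G: "is_form (\<Sum>r\<in>Z - {p}. 1) G" unfolding G_def by (rule is_form_prod) (rule is_form_lin)
  have Gv: "G v ~= 0" unfolding G_def using m Z(2) by simp
  have "Z \<subseteq> Zset (lin u) \<union> Zset G"
  proof
    fix r assume r: "r \<in> Z"
    show "r \<in> Zset (lin u) \<union> Zset G"
    proof (cases "r = p")
      case True
      then show ?thesis using pt_Zset[OF is_form_lin v(1), of u] v(2) u(1) by simp
    next
      case False
      then have "r \<in> Zset (lin (m r))" using m r by blast
      then have "r \<in> Zset G" unfolding Zset_def G_def using r False Z(2) by (auto intro!: prod_zero)
      then show ?thesis by blast
    qed
  qed
  then have "Z \<subseteq> Zset (lin u) \<or> Z \<subseteq> Zset G" by (rule VV_irred[OF Z(1) is_form_lin G])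
  moreover have "q \<notin> Zset (lin u)" unfolding w(2) pt_Zset[OF is_form_lin w(1)] by (rule u(2))
  moreover have "p \<notin> Zset G" unfolding v(2) pt_Zset[OF G v(1)] by (rule Gv)
  ultimately show False using p q(1) by blast
qed

text \<open>An irreducible set that is no point is infinite, and a form with infinitely many zeros
  on a line vanishes on all of it.\<close>

lemma infinite_on_line:
  fixes Z :: "'k::field_char_0 pset"
  assumes Z: "Z \<in> VV" "\<not> is_pt Z" "Z \<subseteq> ln u" "u ~= 0"
  shows "Z = ln u"
proof -
  obtain a b where ab: "a ~= 0" "b ~= 0" "\<And>t. a + t *s b ~= 0" "lin u a = 0" "lin u b = 0"
    "\<And>v. lin u v = 0 ==> \<exists>s t. v = s *s a + t *s b" using line_param[OF Z(4)] by blast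
  have inf: "infinite Z" using finite_irreducible Z by blast
  define T where "T = {t. pt (a + t *s b) \<in> Z}"
  have "Z \<subseteq> insert (pt b) ((\<lambda>t. pt (a + t *s b)) ` T)"
  proof
    fix p assume p: "p \<in> Z"
    then obtain v where v: "v ~= 0" "p = pt v" using VV_pt[OF Z(1)] by blast
    then obtain s t where st: "v = s *s a + t *s b" using ab(6) pt_ln[OF v(1), of u] Z(3) p by blast
    show "p \<in> insert (pt b) ((\<lambda>t. pt (a + t *s b)) ` T)"
    proof (cases "s = 0")
      case True
      then have "pt b = pt v" using pt_eq_iff[OF ab(2) v(1)] st by auto
      then show ?thesis using v by simp
    next
      case False
      then have "v = s *s (a + (t / s) *s b)" using st by (simp add: vec3_eq_iff field_simps)
      then have "pt (a + (t / s) *s b) = pt v" using pt_eq_iff[OF ab(3) v(1)] by blast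
      then show ?thesis using v p unfolding T_def by force
    qed
  qed
  then have T: "infinite T" using inf finite_subset by blast
  have "ln u \<subseteq> Z"
  proof
    fix p assume p: "p \<in> ln u"
    show "p \<in> Z"
    proof (rule ccontr)
      assume np: "p \<notin> Z"
      have pp: "p \<in> proj_plane" using p ln_sub by blast
      then obtain v where v: "v ~= 0" "p = pt v" unfolding proj_plane_iff by blast
      obtain d F where F: "is_form d F" "Z \<subseteq> Zset F" "p \<notin> Zset F" using VV_closed[OF Z(1) pp np] by blast
      have "T \<subseteq> {t. F (a + t *s b) = 0}" using F(2) pt_Zset[OF F(1) ab(3)] unfolding T_def by blast
      then have "infinite {t. F (a + t *s b) = 0}" using T finite_subset by blast
      moreover obtain s t where "v = s *s a + t *s b" using ab(6) pt_ln[OF v(1)] p v by blast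
      ultimately have "F v = 0" using form_span[OF F(1)] v(1) by blast
      then show False using F(3) pt_Zset[OF F(1) v(1)] v(2) by blast
    qed
  qed
  then show ?thesis using Z(3) by blast
qed

section \<open>Irreducible curves\<close>

definition irr_cone :: "('k::field ^ 3) set => bool" where
  "irr_cone W \<longleftrightarrow> (\<forall>d F d' G. is_form d F \<and> is_form d' G \<and> (\<forall>w\<in>W. F w = 0 \<or> G w = 0) -->
     (\<forall>w\<in>W. F w = 0) \<or> (\<forall>w\<in>W. G w = 0))"

definition cideal :: "('k::field_char_0 ^ 3) set => 'k poly poly set" where
  "cideal W = {P. \<forall>w\<in>W. w $ 3 ~= 0 --> ev P (w $ 1 / w $ 3) (w $ 2 / w $ 3) = 0}"

lemma form_dehom:
  fixes w :: "'k::field ^ 3"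
  assumes "is_form d F" "w $ 3 ~= 0"
  shows "F w = (w $ 3) ^ d * F (vec3 (w $ 1 / w $ 3) (w $ 2 / w $ 3) 1)"
proof -
  have "w = w $ 3 *s vec3 (w $ 1 / w $ 3) (w $ 2 / w $ 3) 1" using assms(2) by (simp add: vec3_eq_iff)
  then show ?thesis using form_homog[OF assms(1), of "w $ 3" "vec3 (w $ 1 / w $ 3) (w $ 2 / w $ 3) 1"] by simp
qed

text \<open>If the ideal contains a nonzero polynomial in y alone, primality yields a linear factor
  y - c in it, and the cone lies over a horizontal line. Otherwise \<open>no_const\<close> holds,
  the one requirement that could fail.\<close>

lemma cone_ideal:
  fixes W :: "('k::{alg_closed_field, field_char_0} ^ 3) set"
  assumes irr: "irr_cone W" and off: "\<exists>w\<in>W. w $ 3 ~= 0"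
    and F: "is_form d F" "\<forall>w\<in>W. F w = 0" "\<exists>v. F v ~= 0"
  shows "(\<exists>c. \<forall>w\<in>W. w $ 2 = c * w $ 3) \<or> curve_ideal (cideal W)"
proof -
  have z: "is_form 1 (\<lambda>v :: 'k ^ 3. v $ 3)" by (rule is_form_nth)
  have key: "P \<in> cideal W \<longleftrightarrow> (\<forall>w\<in>W. w $ 3 ~= 0 --> G w = 0)"
    if G: "is_form d G" "\<And>x y. G (vec3 x y 1) = ev P x y" for d G P
  proof -
    have "G w = 0 \<longleftrightarrow> ev P (w $ 1 / w $ 3) (w $ 2 / w $ 3) = 0" if "w $ 3 ~= 0" for w
      unfolding form_dehom[OF G(1) that] G(2) using that by simp
    then show ?thesis unfolding cideal_def by blast
  qed
  have prime: "P \<in> cideal W \<or> Q \<in> cideal W" if PQ: "P * Q \<in> cideal W" for P Q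
  proof -
    obtain G where G: "is_form (degree (Phi P)) G" "\<And>x y. G (vec3 x y 1) = ev P x y" using poly_to_form[OF order_refl] by blast
    obtain H where H: "is_form (degree (Phi Q)) H" "\<And>x y. H (vec3 x y 1) = ev Q x y" using poly_to_form[OF order_refl] by blast
    \<comment> \<open>Membership in the ideal says nothing about vectors at infinity; the factor w $
      3 makes the product vanish there too, so that irreducibility of the cone applies.\<close>
    have zG: "is_form (1 + degree (Phi P)) (\<lambda>v. v $ 3 * G v)" by (rule is_form_mult[OF z G(1)])
    have GH: "is_form (degree (Phi P) + degree (Phi Q)) (\<lambda>v. G v * H v)" by (rule is_form_mult[OF G(1) H(1)])
    have "G (vec3 x y 1) * H (vec3 x y 1) = ev (P * Q) x y" for x y using G(2) H(2) by simp
    then have "\<forall>w\<in>W. w $ 3 ~= 0 --> G w * H w = 0" using PQ key[OF GH] by blast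
    then have "\<forall>w\<in>W. w $ 3 * G w = 0 \<or> H w = 0" by auto
    then have "(\<forall>w\<in>W. w $ 3 * G w = 0) \<or> (\<forall>w\<in>W. H w = 0)" using irr zG H(1) unfolding irr_cone_def by blast
    then show ?thesis unfolding key[OF G] key[OF H] by auto
  qed
  have one: "1 \<notin> cideal W" using off unfolding cideal_def by auto
  show ?thesis
  proof (cases "\<exists>r. r ~= 0 \<and> [:r:] \<in> cideal W")
    case False
    have "curve_ideal (cideal W)"
    proof
      obtain P where P: "\<And>x y. ev P x y = F (vec3 x y 1)" using form_to_poly[OF F(1)] by metis
      have "P \<in> cideal W" using F(2) key[OF F(1), of P] P by metis
      moreover have "P ~= 0"
      proof
        assume "P = 0"
        then have "F v = 0" if "v $ 3 ~= 0" for v using form_dehom[OF F(1) that] P by (simp flip: P)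
        then have "F v = 0" for v using forms_eq_off_infinity[OF F(1) is_form_zero] by blast
        then show False using F(3) by blast
      qed
      ultimately show "\<exists>P\<in>cideal W. P ~= 0" by blast
    qed (use prime False in \<open>auto simp: cideal_def\<close>)
    then show ?thesis by blast
  next
    case True
    then obtain r where r: "r ~= 0" "[:r:] \<in> cideal W" by blast
    have "\<exists>c. [:[:-c, 1:]:] \<in> cideal W" using r
    proof (induction "degree r" arbitrary: r)
      case 0
      then obtain u where u: "r = [:u:]" "u ~= 0" by (metis degree_eq_zeroE pCons_0_0)
      then show ?case using 0(3) off unfolding cideal_def by auto
    next
      case (Suc n)
      then obtain y where y: "poly r y = 0" using alg_closed_imp_poly_has_root[of r] by auto
      then obtain s where s: "r = [:-y, 1:] * s" by (auto simp: poly_eq_0_iff_dvd)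
      have s0: "s ~= 0" using Suc.prems(1) s by auto
      have "degree r = Suc (degree s)" unfolding s by (subst degree_mult_eq) (use s0 in auto)
      moreover have "[:[:-y, 1:]:] * [:s:] \<in> cideal W" using Suc.prems(2) unfolding s by simp
      then have "[:[:-y, 1:]:] \<in> cideal W \<or> [:s:] \<in> cideal W" by (rule prime)
      ultimately show ?case using Suc.hyps(1)[of s] Suc.hyps(2) s0 by auto
    qed
    then obtain c where c: "[:[:-c, 1:]:] \<in> cideal W" by blast
    have "\<forall>w\<in>W. w $ 3 = 0 \<or> lin (vec3 0 1 (-c)) w = 0"
      using c unfolding cideal_def by (auto simp: lin_def field_simps)
    then have "\<forall>w\<in>W. lin (vec3 0 1 (-c)) w = 0"
      using irr z is_form_lin[of "vec3 0 1 (-c)"] off unfolding irr_cone_def by blast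
    then have "\<forall>w\<in>W. w $ 2 = c * w $ 3" by (simp add: lin_def)
    then show ?thesis by blast
  qed
qed

text \<open>Let g be the homogenised generator. A form vanishing on the cone dehomogenises to a
  multiple of G, and homogenising the cofactor shows that it is a multiple of g.\<close>

lemma cone_curve:
  fixes W :: "('k::{alg_closed_field, field_char_0} ^ 3) set"
  assumes irr: "irr_cone W" and off: "\<exists>w\<in>W. w $ 3 ~= 0" and G: "plane_curve (cideal W) G"
  obtains g where "is_form (degree (Phi G)) g" "\<And>x y. g (vec3 x y 1) = ev G x y" "\<And>w. w \<in> W ==> g w = 0"
    "\<And>d f v. is_form d f ==> \<forall>w\<in>W. f w = 0 ==> g v = 0 ==> f v = 0"
proof -
  interpret plane_curve "cideal W" G by fact
  obtain g where g: "is_form (degree (Phi G)) g" "\<And>x y. g (vec3 x y 1) = ev G x y" using poly_to_form[OF order_refl] by blast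
  have "w $ 3 = 0 \<or> g w = 0" if "w \<in> W" for w
  proof (cases "w $ 3 = 0")
    case False
    then have "ev G (w $ 1 / w $ 3) (w $ 2 / w $ 3) = 0" using GI that unfolding cideal_def by blast
    then show ?thesis unfolding form_dehom[OF g(1) False] g(2) by simp
  qed simp
  then have gW: "\<forall>w\<in>W. g w = 0" using irr is_form_nth(3) g(1) off unfolding irr_cone_def by blast
  have "f v = 0" if f: "is_form d f" "\<forall>w\<in>W. f w = 0" "g v = 0" for d f v
  proof -
    obtain P where P: "\<And>x y. ev P x y = f (vec3 x y 1)" "degree (Phi P) \<le> d" using form_to_poly[OF f(1)] by metis
    have "ev P (w $ 1 / w $ 3) (w $ 2 / w $ 3) = 0" if "w \<in> W" "w $ 3 ~= 0" for w
      using f(2) that form_dehom[OF f(1) that(2)] P(1) by simp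
    then have "P \<in> cideal W" unfolding cideal_def by blast
    then obtain Q where Q: "P = G * Q" using Gdvd by (auto elim!: dvdE)
    show ?thesis
    proof (cases "Q = 0")
      case True
      then have "f v = 0" if "v $ 3 ~= 0" for v using form_dehom[OF f(1) that] P(1) Q by (simp flip: P(1))
      then show ?thesis using forms_eq_off_infinity[OF f(1) is_form_zero] by blast
    next
      case False
      have "degree (Phi P) = degree (Phi G) + degree (Phi Q)" unfolding Q by (rule degree_Phi_mult[OF G0 False])
      then have dq: "degree (Phi Q) \<le> d - degree (Phi G)" "degree (Phi G) + (d - degree (Phi G)) = d" using P(2) by simp_all
      obtain q where q: "is_form (d - degree (Phi G)) q" "\<And>x y. q (vec3 x y 1) = ev Q x y" using poly_to_form[OF dq(1)] by blast
      have gq: "is_form d (\<lambda>v. g v * q v)" using is_form_mult[OF g(1) q(1)] dq(2) by simp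
      have "f v = g v * q v" if "v $ 3 ~= 0" for v
        using form_dehom[OF f(1) that] form_dehom[OF gq that] P(1) Q g(2) q(2) by (simp flip: P(1))
      then have "f v = g v * q v" by (rule forms_eq_off_infinity[OF f(1) gq])
      then show ?thesis using f(3) by simp
    qed
  qed
  then show ?thesis using gW by (intro that[OF g]) auto
qed

definition cone :: "'k::field pset => ('k ^ 3) set" where
  "cone Z = {v. v ~= 0 \<and> pt v \<in> Z}"

lemma VV_irr_cone: "Z \<in> VV ==> irr_cone (cone Z)"
  unfolding irr_cone_def
proof (intro allI impI, elim conjE)
  fix d F d' G assume Z: "Z \<in> VV" and F: "is_form d F" and G: "is_form d' G" and *: "\<forall>w\<in>cone Z. F w = 0 \<or> G w = 0"
  have "Z \<subseteq> Zset F \<union> Zset G" using * unfolding Zset_un[OF F G VV_sub[OF Z]] cone_def by blast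
  then have "Z \<subseteq> Zset F \<or> Z \<subseteq> Zset G" by (rule VV_irred[OF Z F G])
  then show "(\<forall>w\<in>cone Z. F w = 0) \<or> (\<forall>w\<in>cone Z. G w = 0)"
    unfolding sub_Zset[OF F VV_sub[OF Z]] sub_Zset[OF G VV_sub[OF Z]] cone_def by blast
qed

text \<open>A curve inside the line at infinity or a horizontal line equals that line. For the
  others the ideal of the affine part is principal, and the homogenised generator defines the
  curve.\<close>

theorem curve_is_Zset:
  fixes Z :: "'k::{alg_closed_field, field_char_0} pset"
  assumes Z: "Z \<in> VV" "\<not> is_pt Z"
  shows "\<exists>d F. is_form d F \<and> Z = Zset F"
proof -
  define W where "W = cone Z"
  have irr: "irr_cone W" unfolding W_def by (rule VV_irr_cone[OF Z(1)])
  have line: ?thesis if "u ~= 0" "\<forall>w\<in>W. lin u w = 0" for u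
  proof -
    have "Z \<subseteq> ln u"
      using that(2) sub_Zset[OF is_form_lin VV_sub[OF Z(1)], of u] unfolding W_def cone_def ln_def by blast
    then have "Z = ln u" using infinite_on_line[OF Z] that(1) by blast
    then show ?thesis using is_form_lin unfolding ln_def by blast
  qed
  show ?thesis
  proof (cases "\<exists>w\<in>W. w $ 3 ~= 0")
    case False
    then show ?thesis by (intro line[of "vec3 0 0 1"]) (auto simp: lin_def vec3_eq_iff)
  next
    case off: True
    have "Z ~= proj_plane" using Z(1) by (simp add: VV_def)
    then obtain p where p: "p \<in> proj_plane" "p \<notin> Z" using VV_sub[OF Z(1)] by blast
    then obtain d F where F: "is_form d F" "Z \<subseteq> Zset F" "p \<notin> Zset F" using VV_closed[OF Z(1)] by blast
    obtain v where v: "v ~= 0" "p = pt v" using p by (auto simp: proj_plane_iff)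
    have Fv: "F v ~= 0" using F(3) pt_Zset[OF F(1) v(1)] v(2) by blast
    have FW: "\<forall>w\<in>W. F w = 0" using F(2) sub_Zset[OF F(1) VV_sub[OF Z(1)]] unfolding W_def cone_def by blast
    from cone_ideal[OF irr off F(1) FW] Fv
    consider c where "\<forall>w\<in>W. w $ 2 = c * w $ 3" | "curve_ideal (cideal W)" by blast
    then show ?thesis
    proof cases
      case 1
      then show ?thesis by (intro line[of "vec3 0 1 (-c)"]) (auto simp: lin_def vec3_eq_iff)
    next
      case 2
      interpret curve_ideal "cideal W" by fact
      obtain G where G: "G \<in> cideal W" "degree G > 0" "\<And>P. P \<in> cideal W ==> G dvd P" by (rule principal) blast
      have "plane_curve (cideal W) G" by unfold_locales (use G in auto)
      then obtain g where g: "is_form (degree (Phi G)) g" "\<And>w. w \<in> W ==> g w = 0"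
        "\<And>d f v. is_form d f ==> \<forall>w\<in>W. f w = 0 ==> g v = 0 ==> f v = 0" using cone_curve[OF irr off] by metis
      have "Z = Zset g"
      proof
        show "Z \<subseteq> Zset g" using g(2) sub_Zset[OF g(1) VV_sub[OF Z(1)]] unfolding W_def cone_def by blast
        show "Zset g \<subseteq> Z"
        proof
          fix p assume p: "p \<in> Zset g"
          then obtain v where v: "v ~= 0" "p = pt v" using Zset_sub unfolding subset_iff proj_plane_iff by blast
          have gv: "g v = 0" using p pt_Zset[OF g(1) v(1)] v by blast
          show "p \<in> Z"
          proof (rule ccontr)
            assume "p \<notin> Z"
            then obtain d F where F: "is_form d F" "Z \<subseteq> Zset F" "p \<notin> Zset F" using VV_closed[OF Z(1)] p Zset_sub by blast
            have "\<forall>w\<in>W. F w = 0" using F(2) sub_Zset[OF F(1) VV_sub[OF Z(1)]] unfolding W_def cone_def by blast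
            then have "F v = 0" using g(3)[OF F(1) _ gv] by blast
            then show False using F(3) pt_Zset[OF F(1) v(1)] v(2) by blast
          qed
        qed
      qed
      then show ?thesis using g(1) by blast
    qed
  qed
qed

section \<open>Recognising lines\<close>

lemma plane_eqI:
  assumes "D \<subseteq> proj_plane" "E \<subseteq> proj_plane" "\<And>v. v ~= 0 ==> pt v \<in> D \<longleftrightarrow> pt v \<in> E"
  shows "D = E"
proof (rule set_eqI)
  fix p
  show "p \<in> D \<longleftrightarrow> p \<in> E"
  proof (cases "p \<in> proj_plane")
    case True
    then obtain v where "v ~= 0" "p = pt v" unfolding proj_plane_iff by (elim exE conjE)
    then show ?thesis using assms(3)[of v] by simp
  qed (use assms(1,2) in auto)
qed

section \<open>Linear coordinate changes that keep the third coordinate\<close>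

locale coordinate_change =
  fixes M N :: "'k::field_char_0 ^ 3 => 'k ^ 3"
  assumes M_form: "is_form 1 (\<lambda>v. M v $ i)" and N_form: "is_form 1 (\<lambda>v. N v $ i)"
    and MN: "M (N v) = v" and NM: "N (M v) = v" and M_3: "M v $ 3 = v $ 3"
begin

lemma M_scale: "M (c *s v) = c *s M v"
  by (simp add: vec_eq_iff form_homog[OF M_form])

lemma M_nz: "v ~= 0 ==> M v ~= 0"
proof -
  have "N 0 = 0" using form_at_0[OF N_form] by (simp add: vec_eq_iff)
  then show "v ~= 0 ==> M v ~= 0" using NM[of v] by auto
qed

lemma N_nz: "v ~= 0 ==> N v ~= 0"
proof -
  have "M 0 = 0" using form_at_0[OF M_form] by (simp add: vec_eq_iff)
  then show "v ~= 0 ==> N v ~= 0" using MN[of v] by auto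
qed

lemma N_3: "N v $ 3 = v $ 3"
  using M_3[of "N v"] MN by simp

lemma pt_M_eq: "v ~= 0 ==> w ~= 0 ==> pt (M v) = pt (M w) \<longleftrightarrow> pt v = pt w"
  unfolding pt_eq_iff[OF M_nz M_nz] pt_eq_iff using M_scale NM by metis

definition pull :: "'k pset => 'k pset" where
  "pull Z = {p. \<exists>v. v ~= 0 \<and> p = pt v \<and> pt (M v) \<in> Z}"

lemma pull_sub: "pull Z \<subseteq> proj_plane"
  unfolding pull_def by auto

lemma pt_pull: "v ~= 0 ==> pt v \<in> pull Z \<longleftrightarrow> pt (M v) \<in> Z"
proof -
  assume v: "v ~= 0"
  show "pt v \<in> pull Z \<longleftrightarrow> pt (M v) \<in> Z"
  proof
    assume "pt v \<in> pull Z"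
    then obtain w where "w ~= 0" "pt v = pt w" "pt (M w) \<in> Z" unfolding pull_def mem_Collect_eq by (elim exE conjE)
    then show "pt (M v) \<in> Z" using pt_M_eq[OF v, of w] by simp
  qed (use v pull_def in auto)
qed

lemma ball_pull: "(\<forall>v. v ~= 0 \<and> pt v \<in> pull Z --> Q (M v)) \<longleftrightarrow> (\<forall>v. v ~= 0 \<and> pt v \<in> Z --> Q v)"
proof (intro iffI allI impI)
  fix v assume *: "\<forall>v. v ~= 0 \<and> pt v \<in> pull Z --> Q (M v)" and v: "v ~= 0 \<and> pt v \<in> Z"
  have nz: "N v ~= 0" using v N_nz by blast
  have "pt (N v) \<in> pull Z" unfolding pt_pull[OF nz] MN using v by (rule conjunct2)
  then have "Q (M (N v))" using nz by (intro *[THEN spec, THEN mp] conjI)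
  then show "Q v" unfolding MN .
next
  fix v assume *: "\<forall>v. v ~= 0 \<and> pt v \<in> Z --> Q v" and v: "v ~= 0 \<and> pt v \<in> pull Z"
  have nz: "v ~= 0" using v by (rule conjunct1)
  show "Q (M v)" by (rule *[THEN spec, THEN mp]) (use v M_nz[OF nz] in \<open>simp only: pt_pull[OF nz]\<close>, simp)
qed

lemma pull_Zset:
  assumes F: "is_form d F" and Z: "Z \<subseteq> proj_plane"
  shows "pull Z \<subseteq> Zset (\<lambda>v. F (M v)) \<longleftrightarrow> Z \<subseteq> Zset F"
  unfolding sub_Zset[OF form_comp_linear[OF F M_form] pull_sub] sub_Zset[OF F Z]
  by (rule ball_pull[of Z "\<lambda>v. F v = 0"])

lemma pull_un:
  assumes F: "is_form d F" and G: "is_form d' G" and Z: "Z \<subseteq> proj_plane"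
  shows "pull Z \<subseteq> Zset F \<union> Zset G \<longleftrightarrow> Z \<subseteq> Zset (\<lambda>v. F (N v)) \<union> Zset (\<lambda>v. G (N v))"
  unfolding Zset_un[OF F G pull_sub] Zset_un[OF form_comp_linear[OF F N_form] form_comp_linear[OF G N_form] Z]
  using ball_pull[of Z "\<lambda>v. F (N v) = 0 \<or> G (N v) = 0"] NM by simp

text \<open>Separating forms are composed with M, while coverings of the pulled-back set are tested
  on Z after composition with the inverse N.\<close>

lemma pull_VV:
  assumes Z: "Z \<in> VV"
  shows "pull Z \<in> VV"
proof -
  note ZP = VV_sub[OF Z]
  have "zariski_closed (pull Z)" unfolding closed_iff
  proof (intro conjI ballI pull_sub)
    fix p assume p: "p \<in> proj_plane - pull Z"
    then have "p \<in> proj_plane" by blast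
    then obtain v where v: "v ~= 0" "p = pt v" unfolding proj_plane_iff by (elim exE conjE)
    then have "pt (M v) \<notin> Z" using p pt_pull[OF v(1), of Z] by simp
    then obtain d F where F: "is_form d F" "Z \<subseteq> Zset F" "pt (M v) \<notin> Zset F"
      using VV_closed[OF Z pt_in[OF M_nz[OF v(1)]]] by blast
    have "is_form d (\<lambda>v. F (M v))" by (rule form_comp_linear[OF F(1) M_form])
    moreover have "p \<notin> Zset (\<lambda>v. F (M v))"
      using F(3) pt_Zset[OF F(1) M_nz[OF v(1)]] pt_Zset[OF calculation v(1)] v(2) by blast
    ultimately show "\<exists>d F. is_form d F \<and> pull Z \<subseteq> Zset F \<and> p \<notin> Zset F"
      using pull_Zset[OF F(1) ZP] F(2) by blast
  qed
  moreover have "pull Z ~= {}"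
  proof -
    obtain p where p: "p \<in> Z" using VV_nonempty[OF Z] by blast
    obtain v where v: "v ~= 0" "p = pt v" by (rule VV_pt[OF Z p])
    have "pt (N v) \<in> pull Z" using pt_pull[OF N_nz[OF v(1)]] MN p v(2) by simp
    then show ?thesis by blast
  qed
  moreover have "pull Z ~= proj_plane"
  proof
    assume *: "pull Z = proj_plane"
    have "p \<in> Z" if p: "p \<in> proj_plane" for p
    proof -
      obtain v where v: "v ~= 0" "p = pt v" using p unfolding proj_plane_iff by blast
      then have "pt (N v) \<in> pull Z" using * N_nz by simp
      then show ?thesis using pt_pull[OF N_nz[OF v(1)]] MN v by simp
    qed
    then show False using Z ZP unfolding VV_def by blast
  qed
  moreover have "pull Z \<subseteq> Zset F \<or> pull Z \<subseteq> Zset G"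
    if F: "is_form d F" and G: "is_form d' G" and s: "pull Z \<subseteq> Zset F \<union> Zset G" for d F d' G
  proof -
    have "Z \<subseteq> Zset (\<lambda>v. F (N v)) \<or> Z \<subseteq> Zset (\<lambda>v. G (N v))"
      using s VV_irred[OF Z form_comp_linear[OF F N_form] form_comp_linear[OF G N_form]] unfolding pull_un[OF F G ZP] by blast
    then show ?thesis using pull_un[OF F F ZP] pull_un[OF G G ZP] by simp
  qed
  ultimately show ?thesis unfolding VV_def irreducible_iff by blast
qed

end

section \<open>Curves with a single point at infinity\<close>

lemma nonvanishing_poly_constant:
  fixes p :: "'k::alg_closed_field poly"
  assumes "\<And>t. poly p t ~= 0"
  obtains c where "c ~= 0" "\<And>t. poly p t = c"
proof -
  have "degree p = 0" using alg_closed_imp_poly_has_root[of p] assms by blast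
  then obtain c where "p = [:c:]" by (metis degree_eq_zeroE)
  then show ?thesis using that[of c] assms[of 0] by simp
qed

text \<open>Moving the zero of \<open>h(X, Y, 0)\<close> to infinity leaves a polynomial without zeros.\<close>

lemma form_one_infinite_point:
  fixes h :: "'k::{alg_closed_field, field_char_0} ^ 3 => 'k"
  assumes h: "is_form d h" and zero: "\<And>x y. x ~= 0 \<or> y ~= 0 ==> h (vec3 x y 0) = 0 \<longleftrightarrow> a * x + b * y = 0"
    and ab: "a * p + b * q = 0" "a * p' + b * q' = 1" "p ~= 0 \<or> q ~= 0"
  obtains c where "c ~= 0" "d > 0" "\<And>x y. h (vec3 x y 0) = c * (a * x + b * y) ^ d"
proof -
  obtain s where s: "\<And>t. poly s t = h (vec3 p' q' 0 + t *s vec3 p q 0)" using form_poly_line[OF h] by blast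
  have "vec3 p' q' 0 + t *s vec3 p q 0 = vec3 (p' + t * p) (q' + t * q) 0" for t by (simp add: vec3_eq_iff)
  then have s': "poly s t = h (vec3 (p' + t * p) (q' + t * q) 0)" for t using s by simp
  have ev: "a * (p' + t * p) + b * (q' + t * q) = 1" for t
  proof -
    have "a * (p' + t * p) + b * (q' + t * q) = (a * p' + b * q') + t * (a * p + b * q)" by (simp add: algebra_simps)
    then show ?thesis using ab by simp
  qed
  have "poly s t ~= 0" for t
  proof -
    have "p' + t * p ~= 0 \<or> q' + t * q ~= 0" using ev[of t] by auto
    then show ?thesis using zero[of "p' + t * p" "q' + t * q"] ev[of t] s' by simp
  qed
  then obtain c where c: "c ~= 0" "\<And>t. poly s t = c" using nonvanishing_poly_constant[of s] by metis
  have hs: "h (vec3 (r * x) (r * y) 0) = r ^ d * h (vec3 x y 0)" for r x y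
  proof -
    have "vec3 (r * x) (r * y) 0 = r *s vec3 x y 0" by (simp add: vec3_eq_iff)
    then show ?thesis using form_homog[OF h] by simp
  qed
  have d: "d > 0"
  proof (rule ccontr)
    assume "\<not> d > 0"
    then have "h (vec3 x y 0) = h (vec3 0 0 0)" for x y using hs[of 0 x y] by simp
    then have "h (vec3 p' q' 0) = h (vec3 p q 0)" by metis
    moreover have "h (vec3 p q 0) = 0" using zero ab by blast
    moreover have "p' ~= 0 \<or> q' ~= 0" using ab by auto
    ultimately show False using zero[of p' q'] ab by simp
  qed
  have "h (vec3 x y 0) = c * (a * x + b * y) ^ d" for x y
  proof (cases "a * x + b * y = 0")
    case True
    have "h (vec3 x y 0) = 0"
    proof (cases "x ~= 0 \<or> y ~= 0")
      case False
      then have "x = 0" "y = 0" by auto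
      moreover have "h (vec3 0 0 0) = 0" using hs[of 0 1 1] d by simp
      ultimately show ?thesis by simp
    qed (use zero True in simp)
    then show ?thesis using True d by simp
  next
    case False
    define r where "r = a * x + b * y"
    have r: "r ~= 0" using False r_def by simp
    \<comment> \<open>\<open>(x/r - p', y/r - q')\<close> is killed by \<open>(a, b)\<close>, hence a multiple of \<open>(p, q)\<close>.\<close>
    have k: "a * (x / r - p') + b * (y / r - q') = 0"
    proof -
      have "a * (x / r - p') + b * (y / r - q') = (a * x + b * y) / r - (a * p' + b * q')" by (simp add: algebra_simps add_divide_distrib)
      then show ?thesis using ab r r_def by simp
    qed
    have "\<exists>t. x / r = p' + t * p \<and> y / r = q' + t * q"
    proof -
      define X where "X = x / r - p'"
      define Y where "Y = y / r - q'"
      have XY: "a * X + b * Y = 0" using k X_def Y_def by simp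
      have "X * q = Y * p"
      proof -
        have "a * (X * q - Y * p) = 0" "b * (X * q - Y * p) = 0" using XY ab(1) by algebra+
        then show ?thesis using ab(2) by auto
      qed
      then have "\<exists>t. X = t * p \<and> Y = t * q"
      proof (cases "p = 0")
        case True
        then show ?thesis using ab(3) \<open>X * q = Y * p\<close> by (intro exI[of _ "Y / q"]) auto
      next
        case False
        then show ?thesis using \<open>X * q = Y * p\<close> by (intro exI[of _ "X / p"]) (auto simp: field_simps)
      qed
      then show ?thesis unfolding X_def Y_def by (auto simp: diff_eq_eq add.commute)
    qed
    then obtain t where t: "x / r = p' + t * p" "y / r = q' + t * q" by blast
    have "h (vec3 x y 0) = r ^ d * h (vec3 (x / r) (y / r) 0)" using hs[of r "x / r" "y / r"] r by simp
    then show ?thesis using s'[of t] c t r_def by simp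
  qed
  then show ?thesis using that c d by blast
qed

text \<open>As (0 : 1 : 0) is the only point of D at infinity, the leading form of the generator is
  a multiple of X^e and its leading coefficient in x is constant, so fibres over y are finite and
  nonempty. Then \<open>pair\<close> is applied at an unramified point and \<open>degree_one\<close>
  concludes.\<close>

lemma normalised_line:
  fixes D :: "'k::{alg_closed_field, field_char_0} pset"
  assumes D: "D \<in> VV" "\<not> is_pt D"
    and inf: "\<And>v. v ~= 0 ==> v $ 3 = 0 ==> pt v \<in> D \<longleftrightarrow> v $ 1 = 0"
    and pair: "\<And>v. v $ 3 ~= 0 ==> pt v \<in> D ==> \<exists>b1 b2. b1 ~= b2 \<and> (\<forall>b\<in>{b1, b2}. \<exists>E\<in>VV.
      (\<forall>w. w ~= 0 \<and> w $ 3 = 0 --> (pt w \<in> E \<longleftrightarrow> w $ 2 = b * w $ 1)) \<and>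
      (\<forall>w. w ~= 0 \<and> pt w \<in> D --> (pt w \<in> E \<longleftrightarrow> pt w = pt v)))"
  shows "\<exists>u. u ~= 0 \<and> D = ln u"
proof -
  define W where "W = cone D"
  have Wiff: "w \<in> W \<longleftrightarrow> w ~= 0 \<and> pt w \<in> D" for w unfolding W_def cone_def by simp
  have irr: "irr_cone W" unfolding W_def by (rule VV_irr_cone[OF D(1)])
  have y0: "vec3 0 1 0 ~= (0 :: 'k ^ 3)" by (simp add: vec3_eq_iff)
  have y1: "pt (vec3 0 1 0) \<in> D" using inf[OF y0] by simp
  have off: "\<exists>w\<in>W. w $ 3 ~= 0"
  proof (rule ccontr)
    assume *: "\<not> (\<exists>w\<in>W. w $ 3 ~= 0)"
    have "p = pt (vec3 0 1 0)" if p: "p \<in> D" for p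
    proof -
      obtain v where v: "v ~= 0" "p = pt v" using VV_pt[OF D(1) p] .
      have v3: "v $ 3 = 0" using * v p Wiff by blast
      then have "v $ 1 = 0" using inf[OF v(1)] v(2) p by blast
      then have "v = v $ 2 *s vec3 0 1 0" using v3 by (simp add: vec3_eq_iff)
      then show ?thesis using pt_eq_iff[OF y0 v(1)] v(2) by blast
    qed
    then have "D = {pt (vec3 0 1 0)}" using y1 by blast
    then show False using D(2) y0 unfolding is_pt_def by blast
  qed
  obtain d0 F where F: "is_form d0 F" "D = Zset F" using curve_is_Zset[OF D] by blast
  have FW: "w \<in> W \<longleftrightarrow> w ~= 0 \<and> F w = 0" for w unfolding Wiff F(2) using pt_Zset[OF F(1)] by blast
  have "\<exists>v. F v ~= 0"
  proof (rule ccontr)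
    assume "\<not> (\<exists>v. F v ~= 0)"
    then have "D = proj_plane" unfolding F(2) Zset_def by blast
    then show False using D(1) unfolding VV_def by blast
  qed
  moreover have "\<not> (\<exists>c. \<forall>w\<in>W. w $ 2 = c * w $ 3)"
    using y0 y1 Wiff[of "vec3 0 1 0"] by (metis mult_zero_right vec3_nth(2,3) zero_neq_one)
  ultimately have ci: "curve_ideal (cideal W)" using cone_ideal[OF irr off F(1)] FW by blast
  obtain G where G: "G \<in> cideal W" "degree G > 0" "\<And>P. P \<in> cideal W ==> G dvd P"
    by (rule curve_ideal.principal[OF ci]) blast
  have pc: "plane_curve (cideal W) G"
    by (intro plane_curve.intro ci plane_curve_axioms.intro) (use G in auto)
  define e where "e = degree (Phi G)"
  obtain g where g: "is_form e g" "\<And>x y. g (vec3 x y 1) = ev G x y" "\<And>w. w \<in> W ==> g w = 0"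
    "\<And>d f v. is_form d f ==> \<forall>w\<in>W. f w = 0 ==> g v = 0 ==> f v = 0" using cone_curve[OF irr off pc] unfolding e_def by metis
  have gW: "w \<in> W \<longleftrightarrow> g w = 0" if "w ~= 0" for w using g(3) g(4)[OF F(1)] FW that by blast
  have "g (vec3 x y 0) = 0 \<longleftrightarrow> 1 * x + 0 * y = 0" if "x ~= 0 \<or> y ~= 0" for x y
  proof -
    have "vec3 x y 0 ~= (0 :: 'k ^ 3)" using that by (auto simp: vec3_eq_iff)
    then show ?thesis using gW[of "vec3 x y 0"] inf[of "vec3 x y 0"] Wiff[of "vec3 x y 0"] by simp
  qed
  \<comment> \<open>The restriction of g to infinity vanishes exactly where the functional x does;
    (0, 1) spans its kernel and (1, 0) has value 1.\<close>
  then obtain g0 where g0: "g0 ~= 0" "e > 0" "\<And>x y. g (vec3 x y 0) = g0 * (1 * x + 0 * y) ^ e"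
    by (rule form_one_infinite_point[OF g(1), of 1 0 0 1 1 0]) simp_all
  obtain P where P: "\<And>x y. ev P x y = g (vec3 x y 1)" "\<And>x. poly (coeff (Phi P) e) x = g (vec3 x 1 0)"
    using form_to_poly[OF g(1)] by metis
  have "P = G" by (rule ev_eqI) (use P(1) g(2) in simp)
  then have "poly (coeff (Phi G) e) x = poly (monom g0 e) x" for x using P(2) g0(3) by (simp add: poly_monom)
  then have top: "coeff (Phi G) e = monom g0 e" using poly_eq_poly_eq_iff by blast
  \<comment> \<open>The total degree is e and the part of degree e is g0 X^e, so the coefficient of
    x^e is the constant g0 and no higher power of x occurs.\<close>
  have cG: "coeff (coeff G i) j = coeff (coeff (Phi G) (i + j)) i" for i j by (simp add: coeff_Phi)
  have Ge: "coeff G e = [:g0:]"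
  proof (rule poly_eqI)
    fix j
    show "coeff (coeff G e) j = coeff [:g0:] j"
    proof (cases j)
      case 0
      then show ?thesis using cG[of e 0] top by simp
    next
      case (Suc m)
      then have "coeff (Phi G) (e + j) = 0" by (intro coeff_eq_0) (simp add: e_def)
      then show ?thesis using cG[of e j] Suc by simp
    qed
  qed
  have "coeff G i = 0" if "i > e" for i
  proof (rule poly_eqI)
    fix j
    have "coeff (Phi G) (i + j) = 0" using that by (intro coeff_eq_0) (simp add: e_def)
    then show "coeff (coeff G i) j = coeff 0 j" using cG[of i j] by simp
  qed
  then have "degree G \<le> e" by (intro degree_le) blast
  moreover have "e \<le> degree G" using Ge g0 by (intro le_degree) simp
  ultimately have dG: "degree G = e" by simp
  have lc: "sp y G ~= 0 \<and> degree (sp y G) > 0" for y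
  proof -
    have "coeff (sp y G) e ~= 0" unfolding coeff_sp Ge using g0 by simp
    then have "e \<le> degree (sp y G)" by (rule le_degree)
    then show ?thesis using g0 by auto
  qed
  obtain xv c where xc: "ev G xv c = 0" "ev (pderiv G) xv c ~= 0"
    using plane_curve.generic_point[OF pc] lc by metis
  interpret curve_point "cideal W" G xv c
    by (intro curve_point.intro pc curve_point_axioms.intro) (use lc xc in auto)
  have nz1: "vec3 x y 1 ~= (0 :: 'k ^ 3)" for x y by (simp add: vec3_eq_iff)
  have GD: "pt (vec3 x y 1) \<in> D \<longleftrightarrow> ev G x y = 0" for x y
    using gW[OF nz1] Wiff[of "vec3 x y 1"] nz1 g(2) by simp
  obtain b1 b2 where b: "b1 ~= b2" "\<And>b. b \<in> {b1, b2} ==> \<exists>E\<in>VV.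
      (\<forall>w. w ~= 0 \<and> w $ 3 = 0 --> (pt w \<in> E \<longleftrightarrow> w $ 2 = b * w $ 1)) \<and>
      (\<forall>w. w ~= 0 \<and> pt w \<in> D --> (pt w \<in> E \<longleftrightarrow> pt w = pt (vec3 xv c 1)))"
    using pair[of "vec3 xv c 1"] GD xc(1) by (metis vec3_nth(3) zero_neq_one)
  have h: "\<exists>h d c1. only h \<and> degree (Phi h) \<le> d \<and> (\<forall>x. poly (coeff (Phi h) d) x = c1 * (1 - b * x) ^ d) \<and> c1 ~= 0 \<and> d > 0"
    if bm: "b \<in> {b1, b2}" for b
  proof -
    obtain E where E: "E \<in> VV" "\<forall>w. w ~= 0 \<and> w $ 3 = 0 --> (pt w \<in> E \<longleftrightarrow> w $ 2 = b * w $ 1)"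
      "\<forall>w. w ~= 0 \<and> pt w \<in> D --> (pt w \<in> E \<longleftrightarrow> pt w = pt (vec3 xv c 1))" using b(2)[OF bm] by (elim bexE conjE)
    have b0: "vec3 1 b 0 ~= (0 :: 'k ^ 3)" by (simp add: vec3_eq_iff)
    have bE: "pt (vec3 1 b 0) \<in> E" using E(2)[rule_format, of "vec3 1 b 0"] b0 by simp
    have vE: "pt (vec3 xv c 1) \<in> E" using E(3)[rule_format, of "vec3 xv c 1"] nz1 GD xc(1) by simp
    have "pt (vec3 1 b 0) ~= pt (vec3 xv c 1)" unfolding pt_eq_iff[OF b0 nz1] by (auto simp: vec3_eq_iff)
    then have "\<not> is_pt E" using bE vE unfolding is_pt_def by auto
    then obtain d H where H: "is_form d H" "E = Zset H" using curve_is_Zset[OF E(1)] by blast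
    have "H (vec3 x y 0) = 0 \<longleftrightarrow> (- b) * x + 1 * y = 0" if "x ~= 0 \<or> y ~= 0" for x y
    proof -
      have n: "vec3 x y 0 ~= (0 :: 'k ^ 3)" using that by (auto simp: vec3_eq_iff)
      show ?thesis using E(2)[rule_format, of "vec3 x y 0"] n pt_Zset[OF H(1) n] H(2) by auto
    qed
    then obtain c1 where c1: "c1 ~= 0" "d > 0" "\<And>x y. H (vec3 x y 0) = c1 * ((- b) * x + 1 * y) ^ d"
      by (rule form_one_infinite_point[OF H(1), of "- b" 1 1 b 0 1]) simp_all
    obtain h where h: "\<And>x y. ev h x y = H (vec3 x y 1)" "degree (Phi h) \<le> d" "\<And>x. poly (coeff (Phi h) d) x = H (vec3 x 1 0)"
      using form_to_poly[OF H(1)] by metis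
    have "only h" unfolding only_def
    proof (intro allI impI)
      fix x y assume "ev G x y = 0"
      then have "pt (vec3 x y 1) \<in> E \<longleftrightarrow> pt (vec3 x y 1) = pt (vec3 xv c 1)" using E(3)[rule_format, of "vec3 x y 1"] nz1 GD by simp
      also have "\<dots> \<longleftrightarrow> x = xv \<and> y = c" unfolding pt_eq_iff[OF nz1 nz1] by (auto simp: vec3_eq_iff)
      finally show "ev h x y = 0 \<longleftrightarrow> x = xv \<and> y = c" unfolding H(2) pt_Zset[OF H(1) nz1] h(1) .
    qed
    moreover have "poly (coeff (Phi h) d) x = c1 * (1 - b * x) ^ d" for x unfolding h(3) c1(3) by simp
    ultimately show ?thesis using h(2) c1 by blast
  qed
  obtain h1 d1 c1 where h1: "only h1" "degree (Phi h1) \<le> d1" "\<And>x. poly (coeff (Phi h1) d1) x = c1 * (1 - b1 * x) ^ d1" "c1 ~= 0" "d1 > 0"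
    using h[of b1] by blast
  obtain h2 d2 c2 where h2: "only h2" "degree (Phi h2) \<le> d2" "\<And>x. poly (coeff (Phi h2) d2) x = c2 * (1 - b2 * x) ^ d2" "c2 ~= 0" "d2 > 0"
    using h[of b2] by blast
  have "e \<le> 1"
    by (rule degree_one[OF e_def[symmetric] top g0(1) dG _ h1 h2 b(1)]) (simp add: dG Ge)
  then have "e = 1" using g0 by simp
  then obtain u where u: "g = lin u" using is_form_1_lin[of g] g(1) by metis
  have "D = ln u" unfolding ln_def
  proof (rule plane_eqI[OF VV_sub[OF D(1)] Zset_sub])
    show "pt v \<in> D \<longleftrightarrow> pt v \<in> Zset (lin u)" if "v ~= 0" for v
      using gW[OF that] Wiff[of v] that pt_Zset[OF is_form_lin that, of u] u by simp
  qed
  moreover have "u ~= 0" using g0(1) g0(3)[of 1 0] unfolding u by (auto simp: lin_def)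
  ultimately show ?thesis by blast
qed


section \<open>Lines in terms of the order\<close>

abbreviation Linf :: "'k::field pset" where
  "Linf \<equiv> ln (vec3 0 0 1)"

definition meets :: "'k::field pset => 'k pset => 'k pset => bool" where
  "meets D E P \<longleftrightarrow> is_pt P \<and> D \<inter> E = P"

text \<open>P0, P1 and P2 are the points at infinity of D and of the auxiliary curves. All
  intersections are meant as sets, without multiplicities, since the order sees nothing
  more.\<close>

definition Lin :: "'k::field pset => bool" where
  "Lin D \<longleftrightarrow> D \<in> VV \<and> \<not> is_pt D \<and> (\<exists>P0. meets D Linf P0 \<and> (\<forall>V. is_pt V \<and> V \<subseteq> D \<and> \<not> V \<subseteq> Linf -->
     (\<exists>D1\<in>VV. \<exists>D2\<in>VV. \<exists>P1 P2. meets D1 Linf P1 \<and> meets D2 Linf P2 \<and> P0 ~= P1 \<and> P0 ~= P2 \<and> P1 ~= P2 \<and>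
       meets D D1 V \<and> meets D D2 V)))"

lemma pt_Linf: "v ~= 0 ==> pt v \<in> Linf \<longleftrightarrow> v $ 3 = 0"
  by (simp add: pt_ln lin_def)

definition cross :: "'k::field ^ 3 => 'k ^ 3 => 'k ^ 3" where
  "cross u v = vec3 (u $ 2 * v $ 3 - u $ 3 * v $ 2) (u $ 3 * v $ 1 - u $ 1 * v $ 3) (u $ 1 * v $ 2 - u $ 2 * v $ 1)"

lemma lines_meet:
  assumes "cross u u' ~= 0"
  shows "meets (ln u) (ln u') {pt (cross u u')}"
proof -
  have "p \<in> ln u \<inter> ln u' \<longleftrightarrow> p = pt (cross u u')" for p
  proof
    assume "p = pt (cross u u')"
    moreover have "lin u (cross u u') = 0" "lin u' (cross u u') = 0" by (simp_all add: lin_def cross_def algebra_simps)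
    ultimately show "p \<in> ln u \<inter> ln u'" using pt_ln[OF assms] by blast
  next
    assume p: "p \<in> ln u \<inter> ln u'"
    then have "p \<in> proj_plane" using ln_sub by blast
    then obtain v where v: "v ~= 0" "p = pt v" unfolding proj_plane_iff by blast
    have l: "lin u v = 0" "lin u' v = 0" using p pt_ln[OF v(1)] v(2) by auto
    have "\<exists>c. v = c *s cross u u'"
      unfolding proportional_iff[OF assms] using l unfolding lin_def cross_def vec3_nth by (intro conjI; algebra)
    then show "p = pt (cross u u')" using pt_eq_iff[OF assms v(1)] v(2) by simp
  qed
  then show ?thesis unfolding meets_def is_pt_def using assms by blast
qed

lemma pt_neq: "v ~= 0 ==> w ~= 0 ==> v $ 1 * w $ 2 ~= v $ 2 * w $ 1 ==> pt v ~= pt w"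
  unfolding pt_eq_iff proportional_iff by blast

text \<open>For a line the auxiliary curves can be taken to be lines through V in two further
  directions.\<close>

lemma line_Lin:
  fixes u :: "'k::field_char_0 ^ 3"
  assumes u: "u $ 1 ~= 0 \<or> u $ 2 ~= 0"
  shows "Lin (ln u)"
proof -
  have u0: "u ~= 0" using u by auto
  define n where "n = cross u (vec3 0 0 1)"
  have n: "n $ 1 = u $ 2" "n $ 2 = - u $ 1" "n $ 3 = 0" by (simp_all add: n_def cross_def)
  have n0: "n ~= 0" using u n by (auto simp: vec3_eq_iff)
  have m0: "meets (ln u) Linf {pt n}" unfolding n_def by (rule lines_meet) (use n0 n_def in simp)
  have "\<not> is_pt (ln u)"
  proof
    obtain w where w: "w $ 3 = 1" "lin u w = 0"
    proof (cases "u $ 1 = 0")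
      case True
      then show ?thesis using u that[of "vec3 0 (- u $ 3 / u $ 2) 1"] by (simp add: lin_def)
    next
      case False
      then show ?thesis using that[of "vec3 (- u $ 3 / u $ 1) 0 1"] by (simp add: lin_def)
    qed
    have w0: "w ~= 0" using w by auto
    assume "is_pt (ln u)"
    moreover have "pt n \<in> ln u" "pt w \<in> ln u" using m0 pt_ln[OF w0] w unfolding meets_def by auto
    ultimately have "pt n = pt w" unfolding is_pt_def by auto
    then show False using pt_Linf[OF n0] pt_Linf[OF w0] n w by simp
  qed
  moreover have "\<exists>D1\<in>VV. \<exists>D2\<in>VV. \<exists>P1 P2. meets D1 Linf P1 \<and> meets D2 Linf P2 \<and> {pt n} ~= P1 \<and> {pt n} ~= P2 \<and> P1 ~= P2 \<and>
       meets (ln u) D1 V \<and> meets (ln u) D2 V" if V: "is_pt V \<and> V \<subseteq> ln u \<and> \<not> V \<subseteq> Linf" for V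
  proof -
    obtain v where v: "v ~= 0" "V = {pt v}" using V unfolding is_pt_def by blast
    have v3: "v $ 3 ~= 0" "lin u v = 0" using V pt_Linf[OF v(1)] pt_ln[OF v(1)] v(2) by auto
    have line: "\<exists>D\<in>VV. meets D Linf {pt (vec3 a b 0)} \<and> meets (ln u) D V \<and> pt n ~= pt (vec3 a b 0)"
      if ab: "u $ 1 * a + u $ 2 * b ~= 0" for a b
    proof -
      \<comment> \<open>The cross product of (a, b, 0) and v, that is, the line through v with point
        (a : b : 0) at infinity.\<close>
      define m where "m = vec3 (b * v $ 3) (- (a * v $ 3)) (a * v $ 2 - b * v $ 1)"
      have ab0: "vec3 a b 0 ~= (0 :: 'k ^ 3)" using ab by (auto simp: vec3_eq_iff)
      have m1: "m ~= 0" using ab v3 by (auto simp: m_def vec3_eq_iff)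
      have c1: "cross m (vec3 0 0 1) = (- v $ 3) *s vec3 a b 0" by (simp add: cross_def m_def vec3_eq_iff)
      have c1n: "cross m (vec3 0 0 1) ~= 0" unfolding c1 using v3 ab0 by simp
      have "pt (vec3 a b 0) = pt (cross m (vec3 0 0 1))" unfolding pt_eq_iff[OF ab0 c1n] using c1 by blast
      then have 1: "meets (ln m) Linf {pt (vec3 a b 0)}" using lines_meet[OF c1n] by simp
      have "cross u m $ 3 = - v $ 3 * (u $ 1 * a + u $ 2 * b)" by (simp add: cross_def m_def algebra_simps)
      then have c2n: "cross u m ~= 0" using ab v3 by auto
      have "lin m v = 0" by (simp add: lin_def m_def algebra_simps)
      then have "pt v \<in> ln u \<inter> ln m" using pt_ln[OF v(1)] v3 by blast
      then have 2: "meets (ln u) (ln m) V" using lines_meet[OF c2n] v(2) unfolding meets_def by simp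
      have "pt n ~= pt (vec3 a b 0)" 
      proof (rule pt_neq[OF n0 ab0])
        have "u $ 2 * b ~= - u $ 1 * a"
        proof
          assume "u $ 2 * b = - u $ 1 * a"
          then have "u $ 1 * a + u $ 2 * b = 0" by algebra
          then show False using ab by simp
        qed
        then show "n $ 1 * vec3 a b 0 $ 2 ~= n $ 2 * vec3 a b 0 $ 1" unfolding n vec3_nth .
      qed
      then show ?thesis using 1 2 ln_VV[OF m1] by blast
    qed
    \<comment> \<open>Two different directions, neither of them that of the given line.\<close>
    obtain a b a' b' where ab: "u $ 1 * a + u $ 2 * b ~= 0" "u $ 1 * a' + u $ 2 * b' ~= 0" "a * b' ~= b * a'"
    proof -
      consider "u $ 1 ~= 0" "u $ 2 ~= 0" | "u $ 1 ~= 0" "u $ 2 = 0" | "u $ 1 = 0" "u $ 2 ~= 0" using u by blast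
      then show ?thesis
      proof cases
        case 1 then show ?thesis by (intro that[of 1 0 0 1]) simp_all
      next
        case 2 then show ?thesis by (intro that[of 1 0 1 1]) simp_all
      next
        case 3 then show ?thesis by (intro that[of 0 1 1 1]) simp_all
      qed
    qed
    have nz: "vec3 a b 0 ~= (0 :: 'k ^ 3)" "vec3 a' b' 0 ~= (0 :: 'k ^ 3)" using ab by (auto simp: vec3_eq_iff)
    have "pt (vec3 a b 0) ~= pt (vec3 a' b' 0)" by (rule pt_neq[OF nz]) (use ab in simp)
    then show ?thesis using line[OF ab(1)] line[OF ab(2)] by (meson singleton_inject)
  qed
  ultimately show ?thesis unfolding Lin_def using ln_VV[OF u0] m0 by blast
qed

lemma coordinate_change_exists:
  fixes p :: "'k::field_char_0 ^ 3"
  assumes p: "p ~= 0" "p $ 3 = 0"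
  obtains M N where "coordinate_change M N" "M (vec3 0 1 0) = p"
proof -
  have lf: "is_form 1 (\<lambda>v. lin u v)" for u :: "'k ^ 3" by (rule is_form_lin)
  have form: "is_form 1 (\<lambda>v. vec3 (lin a v) (lin b v) (lin c v) $ i)" for a b c :: "'k ^ 3" and i
  proof -
    have "i = 1 \<or> i = 2 \<or> i = 3" by (rule exhaust_3)
    then show ?thesis using is_form_lin by auto
  qed
  show ?thesis
  proof (cases "p $ 2 = 0")
    case False
    show ?thesis
    proof (rule that)
      show "coordinate_change (\<lambda>v. vec3 (lin (vec3 1 (p $ 1) 0) v) (lin (vec3 0 (p $ 2) 0) v) (lin (vec3 0 0 1) v))
        (\<lambda>v. vec3 (lin (vec3 1 (- p $ 1 / p $ 2) 0) v) (lin (vec3 0 (1 / p $ 2) 0) v) (lin (vec3 0 0 1) v))"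
        by (rule coordinate_change.intro, rule form, rule form) (use False in \<open>simp_all add: vec3_eq_iff lin_def\<close>)
    qed (use p in \<open>simp add: vec3_eq_iff lin_def\<close>)
  next
    case True
    have p1: "p $ 1 ~= 0" using p True by (auto simp: vec3_eq_iff)
    show ?thesis
    proof (rule that)
      show "coordinate_change (\<lambda>v. vec3 (lin (vec3 0 (p $ 1) 0) v) (lin (vec3 1 0 0) v) (lin (vec3 0 0 1) v))
        (\<lambda>v. vec3 (lin (vec3 0 1 0) v) (lin (vec3 (1 / p $ 1) 0 0) v) (lin (vec3 0 0 1) v))"
        by (rule coordinate_change.intro, rule form, rule form) (use p1 in \<open>simp_all add: vec3_eq_iff lin_def\<close>)
    qed (use p True in \<open>simp add: vec3_eq_iff lin_def\<close>)
  qed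
qed

lemma pt_at_infinity:
  fixes w :: "'k::field ^ 3"
  assumes "w ~= 0" "w $ 3 = 0" "q $ 3 = 0" "q $ 1 ~= 0"
  shows "pt w = pt q \<longleftrightarrow> w $ 2 = q $ 2 / q $ 1 * w $ 1"
proof -
  have q: "q ~= 0" using assms by auto
  show ?thesis unfolding eq_commute[of "pt w"] pt_eq_iff[OF q assms(1)] proportional_iff[OF q] using assms by (auto simp: field_simps)
qed

lemma (in coordinate_change) pull_infinity:
  assumes "meets E Linf {pt p}" "p ~= 0" "w ~= 0" "w $ 3 = 0"
  shows "p $ 3 = 0" "pt w \<in> pull E \<longleftrightarrow> pt w = pt (N p)"
proof -
  have e: "E \<inter> Linf = {pt p}" using assms(1) by (simp add: meets_def)
  show "p $ 3 = 0" using e pt_Linf[OF assms(2)] by blast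
  have "pt (M w) \<in> Linf" using pt_Linf[OF M_nz[OF assms(3)]] M_3 assms(4) by simp
  then have "pt w \<in> pull E \<longleftrightarrow> pt (M w) = pt p" unfolding pt_pull[OF assms(3)] using e by blast
  also have "\<dots> \<longleftrightarrow> pt w = pt (N p)" using pt_M_eq[OF assms(3) N_nz[OF assms(2)]] MN by simp
  finally show "pt w \<in> pull E \<longleftrightarrow> pt w = pt (N p)" .
qed

text \<open>A coordinate change moves the infinite point of D to (0 : 1 : 0). The auxiliary curves
  then have infinite points (1 : b : 0) with two different slopes b, which is the situation of
  \<open>normalised_line\<close>.\<close>

theorem Lin_iff_line:
  fixes D :: "'k::{alg_closed_field, field_char_0} pset"
  shows "Lin D \<longleftrightarrow> (\<exists>u. (u $ 1 ~= 0 \<or> u $ 2 ~= 0) \<and> D = ln u)"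
proof
  assume L: "Lin D"
  then have D: "D \<in> VV" "\<not> is_pt D" unfolding Lin_def by blast+
  obtain P0 where P0: "meets D Linf P0" and pair: "\<And>V. is_pt V \<and> V \<subseteq> D \<and> \<not> V \<subseteq> Linf ==>
     (\<exists>D1\<in>VV. \<exists>D2\<in>VV. \<exists>P1 P2. meets D1 Linf P1 \<and> meets D2 Linf P2 \<and> P0 ~= P1 \<and> P0 ~= P2 \<and> P1 ~= P2 \<and>
       meets D D1 V \<and> meets D D2 V)" using L unfolding Lin_def by blast
  obtain p0 where p0: "p0 ~= 0" "P0 = {pt p0}" using P0 unfolding meets_def is_pt_def by blast
  have p03: "p0 $ 3 = 0" using P0 pt_Linf[OF p0(1)] p0(2) unfolding meets_def by blast
  obtain M N where cc: "coordinate_change M N" and Mp: "M (vec3 0 1 0) = p0" by (rule coordinate_change_exists[OF p0(1) p03])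
  interpret coordinate_change M N by (rule cc)
  have y0: "vec3 0 1 0 ~= (0 :: 'k ^ 3)" by (simp add: vec3_eq_iff)
  have Np: "N p0 = vec3 0 1 0" using NM[of "vec3 0 1 0"] Mp by simp
  have "\<exists>u. u ~= 0 \<and> pull D = ln u"
  proof (rule normalised_line[OF pull_VV[OF D(1)]])
    show "\<not> is_pt (pull D)"
    proof
      assume "is_pt (pull D)"
      then obtain v where v: "v ~= 0" "pull D = {pt v}" unfolding is_pt_def by blast
      have "p = pt (M v)" if p: "p \<in> D" for p
      proof -
        obtain w where w: "w ~= 0" "p = pt w" by (rule VV_pt[OF D(1) p])
        have "pt (N w) \<in> pull D" using pt_pull[OF N_nz[OF w(1)]] MN w(2) p by simp
        then have "pt (N w) = pt v" using v(2) by simp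
        then show ?thesis using pt_M_eq[OF N_nz[OF w(1)] v(1)] MN w(2) by simp
      qed
      moreover have "D ~= {}" by (rule VV_nonempty[OF D(1)])
      ultimately have "D = {pt (M v)}" by blast
      then show False using D(2) M_nz[OF v(1)] unfolding is_pt_def by blast
    qed
  next
    fix v :: "'k ^ 3" assume v: "v ~= 0" "v $ 3 = 0"
    have "pt v \<in> pull D \<longleftrightarrow> pt v = pt (vec3 0 1 0)" using pull_infinity(2)[OF _ p0(1) v] P0 p0(2) Np by simp
    also have "\<dots> \<longleftrightarrow> v $ 1 = 0"
      unfolding eq_commute[of "pt v"] pt_eq_iff[OF y0 v(1)] proportional_iff[OF y0] using v by auto
    finally show "pt v \<in> pull D \<longleftrightarrow> v $ 1 = 0" .
  next
    fix v :: "'k ^ 3" assume v: "v $ 3 ~= 0" "pt v \<in> pull D"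
    have v0: "v ~= 0" using v by auto
    have "pt (M v) \<in> D" "pt (M v) \<notin> Linf" using v pt_pull[OF v0] pt_Linf[OF M_nz[OF v0]] M_3 by simp_all
    then obtain D1 D2 P1 P2 where D12: "D1 \<in> VV" "D2 \<in> VV" and P12: "meets D1 Linf P1" "meets D2 Linf P2" "P0 ~= P1" "P0 ~= P2" "P1 ~= P2"
       and m: "meets D D1 {pt (M v)}" "meets D D2 {pt (M v)}"
      using pair[of "{pt (M v)}"] M_nz[OF v0] unfolding is_pt_def by blast
    have key: "\<exists>p. p ~= 0 \<and> P = {pt p} \<and> N p $ 3 = 0 \<and> N p $ 1 ~= 0 \<and>
        (\<forall>w. w ~= 0 \<and> w $ 3 = 0 --> (pt w \<in> pull E \<longleftrightarrow> w $ 2 = N p $ 2 / N p $ 1 * w $ 1)) \<and>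
        (\<forall>w. w ~= 0 \<and> pt w \<in> pull D --> (pt w \<in> pull E \<longleftrightarrow> pt w = pt v))"
      if E: "meets E Linf P" "P0 ~= P" "meets D E {pt (M v)}" for E P
    proof -
      obtain p where p: "p ~= 0" "P = {pt p}" using E(1) unfolding meets_def is_pt_def by blast
      have p3: "N p $ 3 = 0" using pull_infinity(1)[OF E(1)[unfolded p(2)] p(1) y0] N_3 by simp
      have ne: "pt (N p0) ~= pt (N p)" using E(2) p0(2) p(2) pt_M_eq[OF N_nz[OF p0(1)] N_nz[OF p(1)]] MN by simp
      have p1: "N p $ 1 ~= 0"
      proof
        assume "N p $ 1 = 0"
        then have "N p = N p $ 2 *s vec3 0 1 0" using p3 by (simp add: vec3_eq_iff)
        then show False using ne pt_eq_iff[OF y0 N_nz[OF p(1)]] Np by auto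
      qed
      have 1: "pt w \<in> pull E \<longleftrightarrow> w $ 2 = N p $ 2 / N p $ 1 * w $ 1" if w: "w ~= 0" "w $ 3 = 0" for w
        using pull_infinity(2)[OF E(1)[unfolded p(2)] p(1) w] pt_at_infinity[OF w p3 p1] by simp
      have 2: "pt w \<in> pull E \<longleftrightarrow> pt w = pt v" if w: "w ~= 0" "pt w \<in> pull D" for w
      proof -
        have "D \<inter> E = {pt (M v)}" using E(3) unfolding meets_def by blast
        then have "pt (M w) \<in> E \<longleftrightarrow> pt (M w) = pt (M v)" using w(2) unfolding pt_pull[OF w(1)] by blast
        then show ?thesis unfolding pt_pull[OF w(1)] pt_M_eq[OF w(1) v0] .
      qed
      show ?thesis using p p3 p1 1 2 by blast
    qed
    obtain p1 where p1: "p1 ~= 0" "P1 = {pt p1}" "N p1 $ 3 = 0" "N p1 $ 1 ~= 0"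
        "\<forall>w. w ~= 0 \<and> w $ 3 = 0 --> (pt w \<in> pull D1 \<longleftrightarrow> w $ 2 = N p1 $ 2 / N p1 $ 1 * w $ 1)"
        "\<forall>w. w ~= 0 \<and> pt w \<in> pull D --> (pt w \<in> pull D1 \<longleftrightarrow> pt w = pt v)" using key[OF P12(1) P12(3) m(1)] by blast
    obtain p2 where p2: "p2 ~= 0" "P2 = {pt p2}" "N p2 $ 3 = 0" "N p2 $ 1 ~= 0"
        "\<forall>w. w ~= 0 \<and> w $ 3 = 0 --> (pt w \<in> pull D2 \<longleftrightarrow> w $ 2 = N p2 $ 2 / N p2 $ 1 * w $ 1)"
        "\<forall>w. w ~= 0 \<and> pt w \<in> pull D --> (pt w \<in> pull D2 \<longleftrightarrow> pt w = pt v)" using key[OF P12(2) P12(4) m(2)] by blast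
    have "pt (N p1) ~= pt (N p2)" using P12(5) p1(2) p2(2) pt_M_eq[OF N_nz[OF p1(1)] N_nz[OF p2(1)]] MN by simp
    then have "N p1 $ 2 / N p1 $ 1 ~= N p2 $ 2 / N p2 $ 1"
      unfolding pt_at_infinity[OF N_nz[OF p1(1)] p1(3) p2(3,4)] using p1(4) by (auto simp: field_simps)
    then show "\<exists>b1 b2. b1 ~= b2 \<and> (\<forall>b\<in>{b1, b2}. \<exists>E\<in>VV.
      (\<forall>w. w ~= 0 \<and> w $ 3 = 0 --> (pt w \<in> E \<longleftrightarrow> w $ 2 = b * w $ 1)) \<and>
      (\<forall>w. w ~= 0 \<and> pt w \<in> pull D --> (pt w \<in> E \<longleftrightarrow> pt w = pt v)))"
    proof (intro exI conjI ballI)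
      fix b assume "b \<in> {N p1 $ 2 / N p1 $ 1, N p2 $ 2 / N p2 $ 1}"
      then consider "b = N p1 $ 2 / N p1 $ 1" | "b = N p2 $ 2 / N p2 $ 1" by blast
      then show "\<exists>E\<in>VV.
        (\<forall>w. w ~= 0 \<and> w $ 3 = 0 --> (pt w \<in> E \<longleftrightarrow> w $ 2 = b * w $ 1)) \<and>
        (\<forall>w. w ~= 0 \<and> pt w \<in> pull D --> (pt w \<in> E \<longleftrightarrow> pt w = pt v))"
      proof cases
        case 1
        show ?thesis unfolding 1 by (rule bexI[OF _ pull_VV[OF D12(1)]], rule conjI, rule p1(5), rule p1(6))
      next
        case 2
        show ?thesis unfolding 2 by (rule bexI[OF _ pull_VV[OF D12(2)]], rule conjI, rule p2(5), rule p2(6))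
      qed
    qed
  qed
  then obtain u where u: "pull D = ln u" by blast
  have "is_form 1 (\<lambda>v. lin u (N v))" by (rule form_comp_linear[OF is_form_lin N_form])
  then obtain u' where u': "\<And>v. lin u (N v) = lin u' v" using is_form_1_lin by metis
  have Dl: "D = ln u'"
  proof (rule plane_eqI[OF VV_sub[OF D(1)] ln_sub])
    show "pt v \<in> D \<longleftrightarrow> pt v \<in> ln u'" if "v ~= 0" for v
      using pt_pull[OF N_nz[OF that], of D] MN pt_ln[OF that, of u'] pt_ln[OF N_nz[OF that], of u] u' u by simp
  qed
  \<comment> \<open>Otherwise D would contain the whole line at infinity, against its single point
    there.\<close>
  have "u' $ 1 ~= 0 \<or> u' $ 2 ~= 0"
  proof (rule ccontr)
    assume *: "\<not> (u' $ 1 ~= 0 \<or> u' $ 2 ~= 0)"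
    have x0: "vec3 1 0 0 ~= (0 :: 'k ^ 3)" by (simp add: vec3_eq_iff)
    have "pt (vec3 1 0 0) \<in> D \<inter> Linf" "pt (vec3 0 1 0) \<in> D \<inter> Linf"
      unfolding Dl Int_iff pt_ln[OF x0] pt_ln[OF y0] using * by (simp_all add: lin_def)
    then have "pt (vec3 1 0 (0::'k)) = pt (vec3 0 1 0)" using P0 p0(2) unfolding meets_def by blast
    then show False unfolding pt_eq_iff[OF x0 y0] by (simp add: vec3_eq_iff)
  qed
  then show "\<exists>u. (u $ 1 ~= 0 \<or> u $ 2 ~= 0) \<and> D = ln u" using Dl by blast
qed (use line_Lin in blast)

section \<open>The field and its finite subsets inside the poset of curves\<close>

abbreviation VarS :: "(unit, unit, poset_rel, 'k::field pset) fo_structure" where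
  "VarS \<equiv> Var_structure TYPE('k)"

abbreviation FinS :: "(fin_sort, ring_fun, fin_rel, 'k::field fin_elem) fo_structure" where
  "FinS \<equiv> Fin_structure TYPE('k)"

lemma VarS_simps [simp]:
  "sorts VarS = UNIV" "funs VarS = {}" "rels VarS = UNIV" "rdom VarS r = [(), ()]" "carrier VarS s = VV"
  "relI VarS r = {[Z, W] | Z W. Z \<in> VV \<and> W \<in> VV \<and> Z \<subseteq> W}"
  unfolding Var_structure_def VV_def Let_def by simp_all

lemma wf_VarS: "wf_structure VarS"
  unfolding wf_structure_def by (auto simp: tuples_def)

lemma FinS_simps [simp]:
  "sorts FinS = UNIV" "funs FinS = UNIV" "rels FinS = UNIV" "rdom FinS r = [Field_Sort, Fin_Sort]"
  "fcod FinS f = Field_Sort" "carrier FinS Field_Sort = range Scalar" "carrier FinS Fin_Sort = {FinSet X | X. finite X}"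
  "funI FinS f xs = Scalar (ring_fun_val f (map the_Scalar xs))"
  "relI FinS r = {[Scalar x, FinSet X] | x X. finite X \<and> x \<in> X}"
  "fdom FinS Zero = []" "fdom FinS One = []" "fdom FinS Plus = [Field_Sort, Field_Sort]"
  "fdom FinS Minus = [Field_Sort]" "fdom FinS Times = [Field_Sort, Field_Sort]"
  unfolding Fin_structure_def by simp_all

lemma wf_FinS: "wf_structure FinS"
  unfolding wf_structure_def by (auto simp: tuples_def)

section \<open>Definability over the poset\<close>

abbreviation dfV :: "unit list => ((nat => 'k::field pset) => bool) => bool" where
  "dfV \<equiv> dfn VarS (carrier VarS)"

lemma dfV_ex: "dfV (() # \<Gamma>) (\<lambda>e. Q (\<lambda>n. e (Suc n)) (e 0)) ==> dfV \<Gamma> (\<lambda>e. \<exists>x\<in>VV. Q e x)"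
  using dfn_ex[of "()" VarS "carrier VarS" \<Gamma> Q] by simp

lemma dfV_all: "dfV (() # \<Gamma>) (\<lambda>e. Q (\<lambda>n. e (Suc n)) (e 0)) ==> dfV \<Gamma> (\<lambda>e. \<forall>x\<in>VV. Q e x)"
  using dfn_all[of "()" VarS "carrier VarS" \<Gamma> Q] by simp

lemma wt_VarS: "wt VarS \<Gamma> e ==> i < length \<Gamma> ==> e i \<in> VV"
  unfolding wt_def by simp

lemma dfV_eq: "i < length \<Gamma> ==> j < length \<Gamma> ==> dfV \<Gamma> (\<lambda>e. e i = e j)"
  by (rule dfn_eq) simp_all

lemma dfV_const: "i < length \<Gamma> ==> c \<in> VV ==> dfV \<Gamma> (\<lambda>e. e i = c)"
  by (rule dfn_const) simp_all

lemma dfV_sub: "i < length \<Gamma> ==> j < length \<Gamma> ==> dfV \<Gamma> (\<lambda>e. e i \<subseteq> e j)"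
  by (rule dfn_cong[OF dfn_rel[of Leq VarS "[i, j]"]]) (auto simp: wt_VarS)

text \<open>A fixed member of the poset is replaced by a quantified variable equated with it, so
  that rules stated for variables also serve for parameters.\<close>

lemma dfV_inst:
  assumes "c \<in> VV" "dfV (() # \<Gamma>) (\<lambda>e. Q (\<lambda>n. e (Suc n)) (e 0))"
  shows "dfV \<Gamma> (\<lambda>e. Q e c)"
proof -
  have "dfV \<Gamma> (\<lambda>e. \<exists>x\<in>VV. x = c \<and> Q e x)"
    by (intro dfV_ex dfn_conj dfV_const assms) simp
  then show ?thesis by (rule dfn_cong) (use assms(1) in blast)
qed

lemma dfV_sub_const: "i < length \<Gamma> ==> c \<in> VV ==> dfV \<Gamma> (\<lambda>e. e i \<subseteq> c)"
  by (rule dfV_inst[where Q = "\<lambda>e x. e i \<subseteq> x"], assumption, rule dfV_sub) simp_all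

lemma dfV_const_sub: "i < length \<Gamma> ==> c \<in> VV ==> dfV \<Gamma> (\<lambda>e. c \<subseteq> e i)"
  by (rule dfV_inst[where Q = "\<lambda>e x. x \<subseteq> e i"], assumption, rule dfV_sub) simp_all

lemma is_pt_minimal: "Z \<in> VV ==> is_pt Z \<longleftrightarrow> (\<forall>W\<in>VV. W \<subseteq> Z --> Z \<subseteq> W)"
proof
  assume Z: "Z \<in> VV" and *: "\<forall>W\<in>VV. W \<subseteq> Z --> Z \<subseteq> W"
  obtain p where p: "p \<in> Z" using VV_nonempty[OF Z] by blast
  obtain v where v: "v ~= 0" "p = pt v" by (rule VV_pt[OF Z p])
  have "Z \<subseteq> {pt v}" using *[THEN bspec, of "{pt v}"] point_VV[OF v(1)] p v(2) by simp
  then show "is_pt Z" unfolding is_pt_def using v p by auto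
next
  assume Z: "Z \<in> VV" "is_pt Z"
  then obtain v where v: "Z = {pt v}" unfolding is_pt_def by (elim exE conjE)
  show "\<forall>W\<in>VV. W \<subseteq> Z --> Z \<subseteq> W" unfolding v using VV_nonempty by (auto simp: subset_singleton_iff)
qed

lemma dfV_is_pt: "i < length \<Gamma> ==> dfV \<Gamma> (\<lambda>e. is_pt (e i))"
proof -
  assume i: "i < length \<Gamma>"
  have "dfV \<Gamma> (\<lambda>e. \<forall>W\<in>VV. W \<subseteq> e i --> e i \<subseteq> W)"
    by (intro dfV_all dfn_imp dfV_sub) (use i in simp_all)
  then show ?thesis by (rule dfn_cong) (simp add: is_pt_minimal wt_VarS[OF _ i])
qed

lemma is_pt_VV: "is_pt Z ==> Z \<in> VV"
  unfolding is_pt_def using point_VV by auto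

lemma is_pt_I: "v ~= 0 ==> is_pt {pt v}"
  unfolding is_pt_def by blast

text \<open>An intersection is in general no member of the poset, so it is described by the points
  below both curves.\<close>

lemma meets_iff:
  assumes "D \<in> VV" "E \<in> VV"
  shows "meets D E P \<longleftrightarrow> is_pt P \<and> P \<subseteq> D \<and> P \<subseteq> E \<and> (\<forall>W\<in>VV. is_pt W \<and> W \<subseteq> D \<and> W \<subseteq> E --> W \<subseteq> P)"
proof
  assume *: "is_pt P \<and> P \<subseteq> D \<and> P \<subseteq> E \<and> (\<forall>W\<in>VV. is_pt W \<and> W \<subseteq> D \<and> W \<subseteq> E --> W \<subseteq> P)"
  have "p \<in> P" if p: "p \<in> D" "p \<in> E" for p
  proof -
    obtain v where v: "v ~= 0" "p = pt v" by (rule VV_pt[OF assms(1) p(1)])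
    have "\<forall>W\<in>VV. is_pt W \<and> W \<subseteq> D \<and> W \<subseteq> E --> W \<subseteq> P" using * by blast
    from bspec[OF this point_VV[OF v(1)]] have "{pt v} \<subseteq> P" using is_pt_I[OF v(1)] p v(2) by simp
    then show ?thesis using v(2) by simp
  qed
  then show "meets D E P" unfolding meets_def using * by blast
qed (auto simp: meets_def)

lemma dfV_meets:
  assumes "i < length \<Gamma>" "j < length \<Gamma>" "k < length \<Gamma>"
  shows "dfV \<Gamma> (\<lambda>e. meets (e i) (e j) (e k))"
proof -
  have "dfV \<Gamma> (\<lambda>e. is_pt (e k) \<and> e k \<subseteq> e i \<and> e k \<subseteq> e j \<and> (\<forall>W\<in>VV. is_pt W \<and> W \<subseteq> e i \<and> W \<subseteq> e j --> W \<subseteq> e k))"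
    by (intro dfV_all dfn_imp dfn_conj dfV_sub dfV_is_pt) (use assms in simp_all)
  then show ?thesis by (rule dfn_cong) (simp add: meets_iff wt_VarS assms)
qed

lemma Linf_VV: "(Linf :: 'k::field_char_0 pset) \<in> VV"
  by (rule ln_VV) (simp add: vec3_eq_iff)

lemma dfV_meets_Linf:
  assumes "i < length \<Gamma>" "k < length \<Gamma>"
  shows "dfV \<Gamma> (\<lambda>e :: nat => 'k::field_char_0 pset. meets (e i) Linf (e k))"
  by (rule dfV_inst[where Q = "\<lambda>e x. meets (e i) x (e k)", OF Linf_VV], rule dfV_meets) (use assms in simp_all)

lemma ex_meets:
  fixes D D' :: "'a::field pset"
  shows
  "(\<exists>P. meets D E P \<and> R P) \<longleftrightarrow> (\<exists>P\<in>VV. meets D E P \<and> R P)"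
  "(\<exists>P P'. meets D E P \<and> meets D' E' P' \<and> R' P P') \<longleftrightarrow> (\<exists>P\<in>VV. \<exists>P'\<in>VV. meets D E P \<and> meets D' E' P' \<and> R' P P')"
  "(\<forall>P. is_pt P \<and> R P --> S P) \<longleftrightarrow> (\<forall>P\<in>VV. is_pt P \<and> R P --> S P)"
proof -
  have m: "meets D E P ==> P \<in> VV" for D E P :: "'a pset" unfolding meets_def using is_pt_VV by blast
  show "(\<exists>P. meets D E P \<and> R P) \<longleftrightarrow> (\<exists>P\<in>VV. meets D E P \<and> R P)"
    unfolding Bex_def using m[of D E] by meson
  show "(\<exists>P P'. meets D E P \<and> meets D' E' P' \<and> R' P P') \<longleftrightarrow> (\<exists>P\<in>VV. \<exists>P'\<in>VV. meets D E P \<and> meets D' E' P' \<and> R' P P')"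
    unfolding Bex_def using m[of D E] m[of D' E'] by meson
  show "(\<forall>P. is_pt P \<and> R P --> S P) \<longleftrightarrow> (\<forall>P\<in>VV. is_pt P \<and> R P --> S P)"
    unfolding Ball_def using is_pt_VV by meson
qed

lemma dfV_Lin:
  assumes "i < length \<Gamma>"
  shows "dfV \<Gamma> (\<lambda>e :: nat => 'k::field_char_0 pset. Lin (e i))"
proof -
  have "dfV \<Gamma> (\<lambda>e :: nat => 'k pset. \<not> is_pt (e i) \<and> (\<exists>P0\<in>VV. meets (e i) Linf P0 \<and> (\<forall>V\<in>VV. is_pt V \<and> V \<subseteq> e i \<and> \<not> V \<subseteq> Linf -->
     (\<exists>D1\<in>VV. \<exists>D2\<in>VV. \<exists>P1\<in>VV. \<exists>P2\<in>VV. meets D1 Linf P1 \<and> meets D2 Linf P2 \<and> \<not> P0 = P1 \<and> \<not> P0 = P2 \<and> \<not> P1 = P2 \<and>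
       meets (e i) D1 V \<and> meets (e i) D2 V))))"
    by (intro dfV_all dfV_ex dfn_imp dfn_conj dfn_neg dfV_eq dfV_sub dfV_sub_const dfV_is_pt dfV_meets dfV_meets_Linf Linf_VV)
       (use assms in simp_all)
  then show ?thesis
  proof (rule dfn_cong)
    fix e :: "nat => 'k pset" assume e: "wt VarS \<Gamma> e"
    show "(\<not> is_pt (e i) \<and> (\<exists>P0\<in>VV. meets (e i) Linf P0 \<and> (\<forall>V\<in>VV. is_pt V \<and> V \<subseteq> e i \<and> \<not> V \<subseteq> Linf -->
     (\<exists>D1\<in>VV. \<exists>D2\<in>VV. \<exists>P1\<in>VV. \<exists>P2\<in>VV. meets D1 Linf P1 \<and> meets D2 Linf P2 \<and> \<not> P0 = P1 \<and> \<not> P0 = P2 \<and> \<not> P1 = P2 \<and>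
       meets (e i) D1 V \<and> meets (e i) D2 V)))) \<longleftrightarrow> Lin (e i)"
      unfolding Lin_def using wt_VarS[OF e assms] by (simp only: ex_meets simp_thms)
  qed
qed

section \<open>Collinearity, coordinates and arithmetic on the axis\<close>

definition col :: "'k::field pset => 'k pset => 'k pset => bool" where
  "col P Q R \<longleftrightarrow> (\<exists>D\<in>VV. Lin D \<and> P \<subseteq> D \<and> Q \<subseteq> D \<and> R \<subseteq> D)"

lemma dfV_col_const:
  assumes "i < length \<Gamma>" "j < length \<Gamma>" "c \<in> VV"
  shows "dfV \<Gamma> (\<lambda>e :: nat => 'k::field_char_0 pset. col c (e i) (e j))"
  unfolding col_def
  by (intro dfV_ex dfn_conj dfV_Lin dfV_sub dfV_const_sub assms) (use assms in simp_all)

abbreviation ptA :: "'k::field => 'k => 'k pset" where "ptA x y \<equiv> {pt (vec3 x y 1)}"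
abbreviation ptI :: "'k::field => 'k => 'k pset" where "ptI x y \<equiv> {pt (vec3 x y 0)}"

lemma nzA [simp]: "vec3 x y 1 ~= (0 :: 'k::field ^ 3)"
  by (simp add: vec3_eq_iff)

lemma nzI: "vec3 x y 0 ~= (0 :: 'k::field ^ 3) \<longleftrightarrow> x ~= 0 \<or> y ~= 0"
  by (simp add: vec3_eq_iff)

lemma pt_A_eq [simp]: "pt (vec3 x y 1) = pt (vec3 x' y' (1::'k::field)) \<longleftrightarrow> x = x' \<and> y = y'"
  unfolding pt_eq_iff[OF nzA nzA] by (auto simp: vec3_eq_iff)

lemma ptA_VV [simp]: "ptA x y \<in> VV"
  by (rule point_VV) simp

lemma col_iff:
  fixes p q r :: "'k::{alg_closed_field, field_char_0} ^ 3"
  assumes "p ~= 0" "q ~= 0" "r ~= 0"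
  shows "col {pt p} {pt q} {pt r} \<longleftrightarrow> (\<exists>u. (u $ 1 ~= 0 \<or> u $ 2 ~= 0) \<and> lin u p = 0 \<and> lin u q = 0 \<and> lin u r = 0)"
proof
  assume "col {pt p} {pt q} {pt r}"
  then obtain D where D: "Lin D" "pt p \<in> D" "pt q \<in> D" "pt r \<in> D" unfolding col_def by auto
  obtain u where u: "u $ 1 ~= 0 \<or> u $ 2 ~= 0" "D = ln u" using D(1) unfolding Lin_iff_line by blast
  have "lin u p = 0" "lin u q = 0" "lin u r = 0" using D(2-4) unfolding u(2) pt_ln[OF assms(1)] pt_ln[OF assms(2)] pt_ln[OF assms(3)] .
  then show "\<exists>u. (u $ 1 ~= 0 \<or> u $ 2 ~= 0) \<and> lin u p = 0 \<and> lin u q = 0 \<and> lin u r = 0" using u(1) by blast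
next
  assume "\<exists>u. (u $ 1 ~= 0 \<or> u $ 2 ~= 0) \<and> lin u p = 0 \<and> lin u q = 0 \<and> lin u r = 0"
  then obtain u where u: "u $ 1 ~= 0 \<or> u $ 2 ~= 0" "lin u p = 0" "lin u q = 0" "lin u r = 0" by blast
  have "Lin (ln u)" by (rule line_Lin[OF u(1)])
  moreover have "pt p \<in> ln u" "pt q \<in> ln u" "pt r \<in> ln u"
    unfolding pt_ln[OF assms(1)] pt_ln[OF assms(2)] pt_ln[OF assms(3)] by (fact u(2-4))+
  moreover have "ln u \<in> VV" using calculation(1) unfolding Lin_def by blast
  ultimately show "col {pt p} {pt q} {pt r}" unfolding col_def by auto
qed

lemma col_inf:
  fixes a b :: "'k::{alg_closed_field, field_char_0}"
  assumes "a ~= 0 \<or> b ~= 0"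
  shows "col (ptI a b) (ptA x y) (ptA x' y') \<longleftrightarrow> a * (y' - y) = b * (x' - x)"
proof -
  have n: "vec3 a b 0 ~= (0 :: 'k ^ 3)" using assms by (simp add: nzI)
  show ?thesis unfolding col_iff[OF n nzA nzA]
  proof
    assume "\<exists>u. (u $ 1 ~= 0 \<or> u $ 2 ~= 0) \<and> lin u (vec3 a b 0) = 0 \<and> lin u (vec3 x y 1) = 0 \<and> lin u (vec3 x' y' 1) = 0"
    then obtain u :: "'k ^ 3" where u: "u $ 1 ~= 0 \<or> u $ 2 ~= 0" "u $ 1 * a + u $ 2 * b = 0"
      "u $ 1 * x + u $ 2 * y + u $ 3 = 0" "u $ 1 * x' + u $ 2 * y' + u $ 3 = 0" by (auto simp: lin_def)
    have "u $ 1 * (a * (y' - y) - b * (x' - x)) = 0" "u $ 2 * (a * (y' - y) - b * (x' - x)) = 0" using u(2-4) by algebra+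
    then show "a * (y' - y) = b * (x' - x)" using u(1) by auto
  next
    assume *: "a * (y' - y) = b * (x' - x)"
    have "lin (vec3 b (- a) (a * y - b * x)) (vec3 x' y' 1) = - (a * (y' - y) - b * (x' - x)) + (a * (y' - y) - b * (x' - x)) + (b * (x' - x) - a * (y' - y))"
      by (simp add: lin_def algebra_simps)
    then have "lin (vec3 b (- a) (a * y - b * x)) (vec3 x' y' 1) = 0" using * by simp
    then show "\<exists>u. (u $ 1 ~= 0 \<or> u $ 2 ~= 0) \<and> lin u (vec3 a b 0) = 0 \<and> lin u (vec3 x y 1) = 0 \<and> lin u (vec3 x' y' 1) = 0"
      using assms by (intro exI[of _ "vec3 b (- a) (a * y - b * x)"]) (auto simp: lin_def)
  qed
qed

lemma col_origin:
  fixes q r :: "'k::{alg_closed_field, field_char_0} ^ 3"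
  assumes "q ~= 0" "r ~= 0"
  shows "col (ptA 0 0) {pt q} {pt r} \<longleftrightarrow> q $ 1 * r $ 2 = q $ 2 * r $ 1"
  unfolding col_iff[OF nzA assms]
proof
  assume "\<exists>u. (u $ 1 ~= 0 \<or> u $ 2 ~= 0) \<and> lin u (vec3 0 0 1) = 0 \<and> lin u q = 0 \<and> lin u r = 0"
  then obtain u where u0: "u $ 1 ~= 0 \<or> u $ 2 ~= 0" "lin u (vec3 0 0 1) = 0" "lin u q = 0" "lin u r = 0" by blast
  then have u: "u $ 1 ~= 0 \<or> u $ 2 ~= 0" "u $ 1 * q $ 1 + u $ 2 * q $ 2 = 0" "u $ 1 * r $ 1 + u $ 2 * r $ 2 = 0" by (simp_all add: lin_def)
  have "u $ 1 * (q $ 1 * r $ 2 - q $ 2 * r $ 1) = 0" "u $ 2 * (q $ 1 * r $ 2 - q $ 2 * r $ 1) = 0" using u(2,3) by algebra+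
  then show "q $ 1 * r $ 2 = q $ 2 * r $ 1" using u(1) by auto
next
  assume *: "q $ 1 * r $ 2 = q $ 2 * r $ 1"
  have w: "\<exists>u. (u $ 1 ~= 0 \<or> u $ 2 ~= 0) \<and> lin u (vec3 0 0 1) = 0 \<and> lin u q = 0 \<and> lin u r = 0"
    if "a ~= 0 \<or> b ~= 0" "b * q $ 1 = a * q $ 2" "b * r $ 1 = a * r $ 2" for a b
    by (rule exI[of _ "vec3 b (- a) 0"]) (use that in \<open>auto simp: lin_def\<close>)
  consider "q $ 1 ~= 0 \<or> q $ 2 ~= 0" | "r $ 1 ~= 0 \<or> r $ 2 ~= 0" | "q $ 1 = 0" "q $ 2 = 0" "r $ 1 = 0" "r $ 2 = 0" by blast
  then show "\<exists>u. (u $ 1 ~= 0 \<or> u $ 2 ~= 0) \<and> lin u (vec3 0 0 1) = 0 \<and> lin u q = 0 \<and> lin u r = 0"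
  proof cases
    case 1 then show ?thesis by (rule w) (use * in \<open>simp_all add: mult.commute\<close>)
  next
    case 2 then show ?thesis by (rule w) (use * in \<open>simp_all add: mult.commute\<close>)
  next
    case 3 then show ?thesis by (intro w[of 1 0]) simp_all
  qed
qed

definition aff :: "'k::field pset => bool" where
  "aff Z \<longleftrightarrow> is_pt Z \<and> \<not> Z \<subseteq> Linf"

lemma aff_iff: "aff Z \<longleftrightarrow> (\<exists>x y. Z = ptA x y)"
proof
  assume a: "aff Z"
  then obtain v where v: "v ~= 0" "Z = {pt v}" unfolding aff_def is_pt_def by (elim exE conjE)
  then have v3: "v $ 3 ~= 0" using a pt_Linf[OF v(1)] unfolding aff_def by simp
  then have "v = v $ 3 *s vec3 (v $ 1 / v $ 3) (v $ 2 / v $ 3) 1" by (simp add: vec3_eq_iff)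
  then have "pt (vec3 (v $ 1 / v $ 3) (v $ 2 / v $ 3) 1) = pt v" unfolding pt_eq_iff[OF nzA v(1)] by (rule exI)
  then show "\<exists>x y. Z = ptA x y" using v(2) by metis
next
  assume "\<exists>x y. Z = ptA x y"
  then obtain x y where Z: "Z = ptA x y" by (elim exE)
  show "aff Z" unfolding aff_def Z using is_pt_I[OF nzA] pt_Linf[OF nzA, of x y] by simp
qed

abbreviation Sc :: "'k::field => 'k pset" where "Sc a \<equiv> ptA a 0"
abbreviation Mline :: "'k::field pset" where "Mline \<equiv> ln (vec3 0 1 0)"
abbreviation Nline :: "'k::field pset" where "Nline \<equiv> ln (vec3 1 0 0)"

lemma MN_VV: "(Mline :: 'k::field_char_0 pset) \<in> VV" "(Nline :: 'k pset) \<in> VV"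
  by (rule ln_VV, simp add: vec3_eq_iff)+

definition isS :: "'k::field pset => bool" where "isS Z \<longleftrightarrow> aff Z \<and> Z \<subseteq> Mline"
definition isN :: "'k::field pset => bool" where "isN Z \<longleftrightarrow> aff Z \<and> Z \<subseteq> Nline"

lemma isS_iff: "isS Z \<longleftrightarrow> (\<exists>a. Z = Sc a)"
  unfolding isS_def aff_iff by (auto simp: pt_ln lin_def)

lemma isN_iff: "isN Z \<longleftrightarrow> (\<exists>b. Z = ptA 0 b)"
  unfolding isN_def aff_iff by (auto simp: pt_ln lin_def)

lemma dfV_aff: "i < length \<Gamma> ==> dfV \<Gamma> (\<lambda>e :: nat => 'k::field_char_0 pset. aff (e i))"
  unfolding aff_def by (intro dfn_conj dfn_neg dfV_is_pt dfV_sub_const Linf_VV)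

lemma dfV_isS: "i < length \<Gamma> ==> dfV \<Gamma> (\<lambda>e :: nat => 'k::field_char_0 pset. isS (e i))"
  unfolding isS_def by (intro dfn_conj dfV_aff dfV_sub_const MN_VV)

lemma dfV_isN: "i < length \<Gamma> ==> dfV \<Gamma> (\<lambda>e :: nat => 'k::field_char_0 pset. isN (e i))"
  unfolding isN_def by (intro dfn_conj dfV_aff dfV_sub_const MN_VV)

text \<open>\<open>Z\<close> is the affine point with coordinates \<open>A\<close> and \<open>B\<close>; the second coordinate is
  carried from the vertical axis to the horizontal one by a line of slope \<open>-1\<close>.\<close>

definition Coord :: "'k::field pset => 'k pset => 'k pset => bool" where
  "Coord Z A B \<longleftrightarrow> aff Z \<and> isS A \<and> isS B \<and> col (ptI 0 1) Z A \<and>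
     (\<exists>W\<in>VV. isN W \<and> col (ptI 1 0) Z W \<and> col (ptI 1 (-1)) W B)"

text \<open>The line of slope -1 through (a, b) meets the axis at a + b.\<close>

definition Add :: "'k::field pset => 'k pset => 'k pset => bool" where
  "Add A B C \<longleftrightarrow> (\<exists>Z\<in>VV. Coord Z A B \<and> isS C \<and> col (ptI 1 (-1)) Z C)"

text \<open>The points (a, c) and (1, b) are collinear with the origin exactly if c = a b. The unit
  point is a quantified variable so that the rule for \<open>Coord\<close> applies.\<close>

definition Mul :: "'k::field pset => 'k pset => 'k pset => bool" where
  "Mul A B C \<longleftrightarrow> (\<exists>Z\<in>VV. \<exists>W\<in>VV. \<exists>I\<in>VV. I = Sc 1 \<and> Coord Z A C \<and> Coord W I B \<and> col (ptA 0 0) Z W)"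

lemma ptI_VV: "a ~= 0 \<or> b ~= 0 ==> ptI a b \<in> VV"
  by (rule point_VV) (simp add: nzI)

lemma dfV_Coord:
  assumes "i < length \<Gamma>" "j < length \<Gamma>" "k < length \<Gamma>"
  shows "dfV \<Gamma> (\<lambda>e :: nat => 'k::field_char_0 pset. Coord (e i) (e j) (e k))"
  unfolding Coord_def
  by (intro dfV_ex dfn_conj dfV_aff dfV_isS dfV_isN dfV_col_const ptI_VV) (use assms in simp_all)

lemma dfV_Add:
  assumes "i < length \<Gamma>" "j < length \<Gamma>" "k < length \<Gamma>"
  shows "dfV \<Gamma> (\<lambda>e :: nat => 'k::field_char_0 pset. Add (e i) (e j) (e k))"
  unfolding Add_def
  by (intro dfV_ex dfn_conj dfV_Coord dfV_isS dfV_col_const ptI_VV) (use assms in simp_all)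

lemma dfV_Mul:
  assumes "i < length \<Gamma>" "j < length \<Gamma>" "k < length \<Gamma>"
  shows "dfV \<Gamma> (\<lambda>e :: nat => 'k::field_char_0 pset. Mul (e i) (e j) (e k))"
  unfolding Mul_def
  by (intro dfV_ex dfn_conj dfV_Coord dfV_const dfV_col_const ptA_VV) (use assms in simp_all)

lemma Coord_iff:
  fixes Z :: "'k::{alg_closed_field, field_char_0} pset"
  shows "Coord Z A B \<longleftrightarrow> (\<exists>a b. Z = ptA a b \<and> A = Sc a \<and> B = Sc b)"
proof
  assume "Coord Z A B"
  then obtain W where *: "aff Z" "isS A" "isS B" "col (ptI 0 1) Z A" "isN W" "col (ptI 1 0) Z W" "col (ptI 1 (-1)) W B"
    unfolding Coord_def by (elim conjE bexE)
  obtain x y where Z: "Z = ptA x y" using *(1) aff_iff by blast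
  obtain a where A: "A = Sc a" using *(2) isS_iff by blast
  obtain b where B: "B = Sc b" using *(3) isS_iff by blast
  obtain w where W: "W = ptA 0 w" using *(5) isN_iff by blast
  have "x = a" "w = y" "b = w" using *(4,6,7) unfolding Z A B W by (simp_all add: col_inf)
  then show "\<exists>a b. Z = ptA a b \<and> A = Sc a \<and> B = Sc b" using Z A B by blast
next
  assume "\<exists>a b. Z = ptA a b \<and> A = Sc a \<and> B = Sc b"
  then obtain a b where Z: "Z = ptA a b" "A = Sc a" "B = Sc b" by (elim exE conjE)
  have "aff Z" "isS A" "isS B" "isN (ptA 0 b)" unfolding aff_iff isS_iff isN_iff Z by blast+
  moreover have "col (ptI 0 1) Z A" "col (ptI 1 0) Z (ptA 0 b)" "col (ptI 1 (-1)) (ptA 0 b) B"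
    unfolding Z by (simp_all add: col_inf)
  ultimately show "Coord Z A B" unfolding Coord_def using ptA_VV[of 0 b] by blast
qed

lemma Add_iff:
  fixes A :: "'k::{alg_closed_field, field_char_0} pset"
  shows "Add A B C \<longleftrightarrow> (\<exists>a b. A = Sc a \<and> B = Sc b \<and> C = Sc (a + b))"
proof
  assume "Add A B C"
  then obtain Z where *: "Coord Z A B" "isS C" "col (ptI 1 (-1)) Z C" unfolding Add_def by (elim conjE bexE)
  obtain a b where Z: "Z = ptA a b" "A = Sc a" "B = Sc b" using *(1) unfolding Coord_iff by (elim exE conjE)
  obtain c where C: "C = Sc c" using *(2) isS_iff by blast
  have "c = a + b" using *(3) unfolding Z C by (simp add: col_inf algebra_simps)
  then show "\<exists>a b. A = Sc a \<and> B = Sc b \<and> C = Sc (a + b)" using Z C by blast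
next
  assume "\<exists>a b. A = Sc a \<and> B = Sc b \<and> C = Sc (a + b)"
  then obtain a b where Z: "A = Sc a" "B = Sc b" "C = Sc (a + b)" by (elim exE conjE)
  have "Coord (ptA a b) A B" "isS C" using Z Coord_iff isS_iff by blast+
  moreover have "col (ptI 1 (-1)) (ptA a b) C" unfolding Z by (simp add: col_inf)
  ultimately show "Add A B C" unfolding Add_def using ptA_VV[of a b] by blast
qed

lemma Mul_iff:
  fixes A :: "'k::{alg_closed_field, field_char_0} pset"
  shows "Mul A B C \<longleftrightarrow> (\<exists>a b. A = Sc a \<and> B = Sc b \<and> C = Sc (a * b))"
proof
  assume "Mul A B C"
  then obtain Z W where *: "Coord Z A C" "Coord W (Sc 1) B" "col (ptA 0 0) Z W" unfolding Mul_def by auto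
  obtain a c where Z: "Z = ptA a c" "A = Sc a" "C = Sc c" using *(1) unfolding Coord_iff by (elim exE conjE)
  obtain b where W: "W = ptA 1 b" "B = Sc b" using *(2) unfolding Coord_iff by auto
  have "c = a * b" using *(3) unfolding Z W by (simp add: col_origin)
  then show "\<exists>a b. A = Sc a \<and> B = Sc b \<and> C = Sc (a * b)" using Z W by blast
next
  assume "\<exists>a b. A = Sc a \<and> B = Sc b \<and> C = Sc (a * b)"
  then obtain a b where Z: "A = Sc a" "B = Sc b" "C = Sc (a * b)" by (elim exE conjE)
  have "Coord (ptA a (a * b)) A C" "Coord (ptA 1 b) (Sc 1) B" using Z Coord_iff by blast+
  moreover have "col (ptA 0 0) (ptA a (a * b)) (ptA 1 b)" unfolding Z by (simp add: col_origin)
  ultimately show "Mul A B C" unfolding Mul_def using ptA_VV by blast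
qed

section \<open>Finite sets as traces on the axis\<close>

definition isC :: "'k::field pset => bool" where "isC C \<longleftrightarrow> \<not> Mline \<subseteq> C"
definition fs :: "'k::field pset => 'k set" where "fs C = {a. Sc a \<subseteq> C}"

lemma fs_mem: "a \<in> fs C \<longleftrightarrow> pt (vec3 a 0 1) \<in> C"
  by (simp add: fs_def)

lemma finite_fs:
  fixes C :: "'k::field_char_0 pset"
  assumes C: "C \<in> VV" "isC C"
  shows "finite (fs C)"
proof (rule ccontr)
  assume inf: "infinite (fs C)"
  obtain p where p: "p \<in> Mline" "p \<notin> C" using C(2) unfolding isC_def by blast
  then have pp: "p \<in> proj_plane" using ln_sub by blast
  then obtain v where v: "v ~= 0" "p = pt v" unfolding proj_plane_iff by (elim exE conjE)
  obtain d F where F: "is_form d F" "C \<subseteq> Zset F" "p \<notin> Zset F" using VV_closed[OF C(1) pp p(2)] by blast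
  have v2: "v $ 2 = 0" using p(1) unfolding v(2) pt_ln[OF v(1)] by (simp add: lin_def)
  have eq: "vec3 0 0 1 + t *s vec3 1 0 0 = vec3 t 0 (1::'k)" for t by (simp add: vec3_eq_iff)
  have "fs C \<subseteq> {t. F (vec3 0 0 1 + t *s vec3 1 0 0) = 0}"
    unfolding eq fs_def using F(2) pt_Zset[OF F(1) nzA] by blast
  then have i: "infinite {t. F (vec3 0 0 1 + t *s vec3 1 0 0) = 0}" using inf finite_subset by blast
  have vv: "v = v $ 3 *s vec3 0 0 1 + v $ 1 *s vec3 1 0 0" using v2 by (simp add: vec3_eq_iff)
  have "F v = 0" using form_span[OF F(1) i, of "v $ 3" "v $ 1"] vv v(1) by simp
  then show False using F(3) unfolding v(2) pt_Zset[OF F(1) v(1)] by simp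
qed

lemma form_poly_curve:
  fixes a b c :: "'k::field poly"
  assumes "is_form d G"
  shows "\<exists>p. \<forall>t. poly p t = G (vec3 (poly a t) (poly b t) (poly c t))"
proof -
  obtain g where g: "G = form_val d g" using assms unfolding is_form_def by blast
  have "poly (\<Sum>(i, j)\<in>{(i, j). i + j \<le> d}. [:g i j:] * a ^ i * b ^ j * c ^ (d - i - j)) t = G (vec3 (poly a t) (poly b t) (poly c t))" for t
    unfolding g form_val_def by (simp add: poly_sum case_prod_unfold mult.assoc)
  then show ?thesis by blast
qed

text \<open>A finite set with at least two elements is cut out on the axis by the graph of a polynomial; near the
  point at infinity of that graph the parametrisation is reversed, \<open>t \<mapsto> 1 / t\<close>.\<close>

lemma graph_curve:
  fixes X :: "'k::field_char_0 set"
  assumes X: "finite X" "card X \<ge> 2"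
  obtains C where "C \<in> VV" "isC C" "fs C = X"
proof -
  define n where "n = card X"
  have n: "n \<ge> 2" using X n_def by simp
  define q where "q = (\<Prod>a\<in>X. [:- a, 1:])"
  define q' where "q' = (\<Prod>a\<in>X. [:1, - a:])"
  \<comment> \<open>Homogenises y = q(x). For n \<ge> 2 the term with y vanishes at infinity, so
    that (0 : 1 : 0) is the only point there.\<close>
  define F where "F = (\<lambda>v :: 'k ^ 3. v $ 2 * v $ 3 ^ (n - 1) - (\<Prod>a\<in>X. lin (vec3 1 0 (- a)) v))"
  have "is_form (1 + (n - 1) * 1) (\<lambda>v :: 'k ^ 3. v $ 2 * v $ 3 ^ (n - 1))"
    by (rule is_form_mult[OF is_form_nth(2) is_form_pow[OF is_form_nth(3)]])
  moreover have "is_form (\<Sum>a\<in>X. 1) (\<lambda>v. \<Prod>a\<in>X. lin (vec3 1 0 (- a)) v)" by (rule is_form_prod) (rule is_form_lin)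
  ultimately have F: "is_form n F" unfolding F_def using n by (intro is_form_diff) (simp_all add: n_def)
  have q: "poly q t = (\<Prod>a\<in>X. t - a)" for t unfolding q_def poly_prod by simp
  have F1: "F (vec3 x y 1) = y - poly q x" for x y unfolding F_def q by (simp add: lin_def)
  have F0: "F (vec3 x y 0) = - (x ^ n)" for x y
    using n unfolding F_def by (simp add: lin_def n_def power_0_left)
  have x0: "vec3 1 0 0 ~= (0 :: 'k ^ 3)" by (simp add: nzI)
  have Fx: "F (vec3 1 0 0) ~= 0" unfolding F0 by simp
  have V: "Zset F \<in> VV"
  proof (rule parametrised_VV[OF F, of "\<lambda>t. vec3 t (poly q t) 1", OF nzA _ _ _ x0 Fx])
    show "F (vec3 t (poly q t) 1) = 0" for t unfolding F1 by simp
    show "\<exists>p. \<forall>t. poly p t = G (vec3 t (poly q t) 1)" if "is_form d G" for d G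
      using form_poly_curve[OF that, of "[:0, 1:]" q 1] by simp
  next
    fix d v and G :: "'k ^ 3 => 'k"
    assume G: "is_form d G" "\<And>t. G (vec3 t (poly q t) 1) = 0" and v: "F v = 0" "v ~= 0"
    show "G v = 0"
    proof (cases "v $ 3 = 0")
      case False
      have "F (vec3 (v $ 1 / v $ 3) (v $ 2 / v $ 3) 1) = 0" using form_dehom[OF F False] v(1) False by simp
      then have y: "v $ 2 / v $ 3 = poly q (v $ 1 / v $ 3)" unfolding F1 by simp
      show ?thesis unfolding form_dehom[OF G(1) False] y G(2) by simp
    next
      case True
      have v': "v = vec3 (v $ 1) (v $ 2) 0" using True by (simp add: vec3_eq_iff)
      then have "v $ 1 = 0" using F0[of "v $ 1" "v $ 2"] v(1) by simp
      then have vy: "v = v $ 2 *s vec3 0 1 0" using True by (simp add: vec3_eq_iff)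
      obtain p where p: "\<And>s. poly p s = G (vec3 (poly (monom 1 (n - 1)) s) (poly q' s) (poly (monom 1 n) s))"
        using form_poly_curve[OF G(1)] by metis
      have "poly p s = 0" if s: "s ~= 0" for s
      proof -
        have "poly q' s = (\<Prod>a\<in>X. s * (1 / s - a))" unfolding q'_def poly_prod using s by (intro prod.cong) (simp_all add: field_simps)
        also have "\<dots> = s ^ n * poly q (1 / s)" unfolding q by (simp add: prod.distrib n_def)
        finally have 1: "poly q' s = s ^ n * poly q (1 / s)" .
        have 2: "s ^ (n - 1) = s ^ n * (1 / s)" using s n by (cases n) simp_all
        have "vec3 (poly (monom 1 (n - 1)) s) (poly q' s) (poly (monom 1 n) s) = s ^ n *s vec3 (1 / s) (poly q (1 / s)) 1"
          using 1 2 by (simp add: vec3_eq_iff poly_monom)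
        then show ?thesis unfolding p by (simp add: form_homog[OF G(1)] G(2))
      qed
      then have "p = 0" using poly_zero_off_point[of 0 p] by blast
      moreover have "poly q' 0 = 1" unfolding q'_def poly_prod by simp
      ultimately have "G (vec3 0 1 0) = 0" using p[of 0] n by (simp add: poly_monom power_0_left)
      then show ?thesis using vy form_homog[OF G(1), of "v $ 2" "vec3 0 1 0"] by simp
    qed
  qed
  have "pt (vec3 1 0 0) \<in> (Mline :: 'k pset)" unfolding pt_ln[OF x0] by (simp add: lin_def)
  moreover have "pt (vec3 1 0 0) \<notin> Zset F" unfolding pt_Zset[OF F x0] by (rule Fx)
  ultimately have "isC (Zset F)" unfolding isC_def by blast
  moreover have "fs (Zset F) = X" unfolding fs_def using X(1) by (simp add: pt_Zset[OF F nzA] F1 q)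
  ultimately show ?thesis using that V by blast
qed

text \<open>Sets with fewer than two elements are traces of points: the infinite point of the axis
  for the empty set, the element itself for a singleton.\<close>

lemma fs_surj:
  fixes X :: "'k::field_char_0 set"
  assumes X: "finite X"
  obtains C where "C \<in> VV" "isC C" "fs C = X"
proof -
  have O: "pt (vec3 0 0 1) \<in> (Mline :: 'k pset)" "pt (vec3 1 0 1) \<in> (Mline :: 'k pset)"
    unfolding pt_ln[OF nzA] by (simp_all add: lin_def)
  consider "X = {}" | a where "X = {a}" | "card X \<ge> 2"
  proof -
    have "card X = 0 \<or> card X = 1 \<or> card X \<ge> 2" by linarith
    then show thesis using X that by (metis card_0_eq card_1_singletonE)
  qed
  then show ?thesis
  proof cases
    case 1
    have x0: "vec3 1 0 0 ~= (0 :: 'k ^ 3)" by (simp add: nzI)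
    have ne: "pt (vec3 a 0 1) ~= pt (vec3 1 0 (0::'k))" for a unfolding pt_eq_iff[OF nzA x0] by (simp add: vec3_eq_iff)
    show ?thesis by (rule that[of "{pt (vec3 1 0 0)}"]) (use 1 O ne point_VV[OF x0] in \<open>auto simp: isC_def fs_def\<close>)
  next
    case (2 a)
    have "isC (Sc a)" unfolding isC_def
    proof
      assume "Mline \<subseteq> Sc a"
      then have "pt (vec3 0 0 1) = pt (vec3 a 0 1)" "pt (vec3 1 0 1) = pt (vec3 a 0 1)" using O by blast+
      then show False by simp
    qed
    then show ?thesis by (intro that[of "Sc a"]) (auto simp: 2 fs_def)
  next
    case 3
    then show ?thesis using graph_curve[OF X] that by metis
  qed
qed

section \<open>The field with finite sets interpreted in the poset\<close>

definition \<tau>F :: "fin_sort => unit list" where "\<tau>F s = [()]"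
definition XF :: "fin_sort => 'k::field pset list set" where
  "XF s = (case s of Field_Sort => {[Z] | Z. isS Z} | Fin_Sort => {[C] | C. C \<in> VV \<and> isC C})"
definition \<pi>F :: "fin_sort => 'k::field pset list => 'k fin_elem" where
  "\<pi>F s ys = (case s of Field_Sort => Scalar (THE a. hd ys = Sc a) | Fin_Sort => FinSet (fs (hd ys)))"

lemma XF_simps [simp]: "[Z] \<in> XF Field_Sort \<longleftrightarrow> isS Z" "[Z] \<in> XF Fin_Sort \<longleftrightarrow> Z \<in> VV \<and> isC Z"
  "\<pi>F Field_Sort [Sc a] = Scalar a" "\<pi>F Fin_Sort [Z] = FinSet (fs Z)"
  by (simp_all add: XF_def \<pi>F_def)

lemma F_Cons [simp]:
  "dec \<tau>F \<pi>F (s # ss) (y # ys) = \<pi>F s [y] # dec \<tau>F \<pi>F ss ys"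
  "valid \<tau>F XF (s # ss) (y # ys) \<longleftrightarrow> [y] \<in> XF s \<and> valid \<tau>F XF ss ys"
  using dec_Cons(1)[of "[y]" \<tau>F s \<pi>F ss ys] dec_Cons(2)[of "[y]" \<tau>F s XF ss ys] by (simp_all add: \<tau>F_def)

lemma tt_\<tau>F: "tt \<tau>F ss = replicate (length ss) ()"
  by (induction ss) (simp_all add: \<tau>F_def)

lemma pbk_VarI:
  fixes Q :: "'k::field pset list => bool"
  assumes "dfV (replicate (length ss) ()) (\<lambda>e. Q (map e [0..<length ss]))"
    and "\<And>zs. length zs = length ss ==> set zs \<subseteq> VV ==> Q zs \<longleftrightarrow> valid \<tau>F XF ss zs \<and> R (dec \<tau>F \<pi>F ss zs)"
  shows "pbk VarS \<tau>F XF \<pi>F ss R"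
  unfolding pbk_def tt_\<tau>F length_replicate
proof (rule dfn_cong[OF assms(1)])
  fix e :: "nat => 'k pset" assume "wt VarS (replicate (length ss) ()) e"
  then have "set (map e [0..<length ss]) \<subseteq> VV" using wt_VarS by fastforce
  then show "Q (map e [0..<length ss]) \<longleftrightarrow> valid \<tau>F XF ss (map e [0..<length ss]) \<and> R (dec \<tau>F \<pi>F ss (map e [0..<length ss]))"
    by (intro assms(2)) simp_all
qed

lemma fs_eq_iff: "fs C = fs C' \<longleftrightarrow> (\<forall>Z\<in>VV. isS Z --> (Z \<subseteq> C \<longleftrightarrow> Z \<subseteq> C'))"
proof
  assume "fs C = fs C'"
  then show "\<forall>Z\<in>VV. isS Z --> (Z \<subseteq> C \<longleftrightarrow> Z \<subseteq> C')" unfolding isS_iff fs_def by (metis mem_Collect_eq)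
next
  assume "\<forall>Z\<in>VV. isS Z --> (Z \<subseteq> C \<longleftrightarrow> Z \<subseteq> C')"
  from bspec[OF this ptA_VV] have "Sc a \<subseteq> C \<longleftrightarrow> Sc a \<subseteq> C'" for a unfolding isS_iff by blast
  then show "fs C = fs C'" unfolding fs_def by simp
qed

lemma pbk_fun:
  "pbk VarS \<tau>F XF \<pi>F (fcod FinS f # fdom FinS f) (\<lambda>xs :: 'k::{alg_closed_field, field_char_0} fin_elem list. hd xs = funI FinS f (tl xs))"
proof (cases f)
  case Zero
  show ?thesis unfolding Zero FinS_simps
    by (rule pbk_VarI[where Q = "\<lambda>zs. zs ! 0 = Sc 0"], simp, rule dfV_const)
       (auto simp: length_Suc_conv isS_iff)
next
  case One
  show ?thesis unfolding One FinS_simps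
    by (rule pbk_VarI[where Q = "\<lambda>zs. zs ! 0 = Sc 1"], simp, rule dfV_const)
       (auto simp: length_Suc_conv isS_iff)
next
  case Plus
  show ?thesis unfolding Plus FinS_simps
    by (rule pbk_VarI[where Q = "\<lambda>zs. Add (zs ! 1) (zs ! 2) (zs ! 0)"], simp, rule dfV_Add)
       (auto simp: length_Suc_conv isS_iff Add_iff)
next
  case Minus
  have "dfV (replicate (length [Field_Sort, Field_Sort]) ()) (\<lambda>e. \<exists>U\<in>VV. U = Sc 0 \<and> Add (map e [0..<length [Field_Sort, Field_Sort]] ! 0) (map e [0..<length [Field_Sort, Field_Sort]] ! 1) (U :: 'k pset))"
    by (rule dfV_ex, rule dfn_conj, rule dfV_const, simp, simp, simp, rule dfV_Add) simp_all
  then show ?thesis unfolding Minus FinS_simps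
    by (rule pbk_VarI[where Q = "\<lambda>zs. \<exists>U\<in>VV. U = Sc 0 \<and> Add (zs ! 0) (zs ! 1) U"])
       (auto simp: length_Suc_conv isS_iff Add_iff eq_neg_iff_add_eq_0)
next
  case Times
  show ?thesis unfolding Times FinS_simps
    by (rule pbk_VarI[where Q = "\<lambda>zs. Mul (zs ! 1) (zs ! 2) (zs ! 0)"], simp, rule dfV_Mul)
       (auto simp: length_Suc_conv isS_iff Mul_iff)
qed

lemma dfV_isC: "i < length \<Gamma> ==> dfV \<Gamma> (\<lambda>e :: nat => 'k::field_char_0 pset. isC (e i))"
  unfolding isC_def by (intro dfn_neg dfV_const_sub MN_VV)

theorem Fin_in_Var: "cinterp VarS (FinS :: (_, _, _, 'k::{alg_closed_field, field_char_0} fin_elem) fo_structure) \<tau>F XF \<pi>F"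
proof (rule cinterp.intro[OF wf_VarS wf_FinS])
  fix s :: fin_sort
  show "set (\<tau>F s) \<subseteq> sorts VarS" by simp
  show "(XF s :: 'k pset list set) \<subseteq> tuples VarS (\<tau>F s)"
    by (cases s) (auto simp: XF_def \<tau>F_def tuples_def isS_def aff_def is_pt_VV)
  show "\<pi>F s ` XF s = carrier (FinS :: (_, _, _, 'k fin_elem) fo_structure) s"
  proof (cases s)
    case Field_Sort
    have "XF s = range (\<lambda>a :: 'k. [Sc a])" unfolding Field_Sort XF_def by (auto simp: isS_iff)
    then show ?thesis unfolding Field_Sort by (simp add: image_image)
  next
    case Fin_Sort
    have "\<pi>F s ` XF s = {FinSet (fs C) | C. C \<in> VV \<and> isC (C :: 'k pset)}" unfolding Fin_Sort by (simp add: XF_def \<pi>F_def setcompr_eq_image image_image)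
    also have "\<dots> = {FinSet X | X. finite X}" using finite_fs fs_surj by (auto; metis)
    finally show ?thesis unfolding Fin_Sort by simp
  qed
  show "pbk VarS \<tau>F XF \<pi>F [s] (\<lambda>_ :: 'k fin_elem list. True)"
  proof (cases s)
    case Field_Sort
    show ?thesis unfolding Field_Sort
      by (rule pbk_VarI[where Q = "\<lambda>zs. isS (zs ! 0)"], simp, rule dfV_isS) (auto simp: length_Suc_conv)
  next
    case Fin_Sort
    show ?thesis unfolding Fin_Sort
      by (rule pbk_VarI[where Q = "\<lambda>zs. isC (zs ! 0)"], simp, rule dfV_isC) (auto simp: length_Suc_conv)
  qed
  show "pbk VarS \<tau>F XF \<pi>F [s, s] (\<lambda>xs :: 'k fin_elem list. xs ! 0 = xs ! 1)"
  proof (cases s)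
    case Field_Sort
    show ?thesis unfolding Field_Sort
      by (rule pbk_VarI[where Q = "\<lambda>zs. isS (zs ! 0) \<and> zs ! 0 = zs ! 1"], simp, intro dfn_conj dfV_isS dfV_eq)
         (auto simp: length_Suc_conv isS_iff)
  next
    case Fin_Sort
    have "dfV (replicate (length [Fin_Sort, Fin_Sort]) ()) (\<lambda>e :: nat => 'k pset. isC (e 0) \<and> isC (e 1) \<and> (\<forall>Z\<in>VV. isS Z --> (Z \<subseteq> e 0 \<longleftrightarrow> Z \<subseteq> e 1)))"
      by (intro dfn_conj dfV_isC dfV_all dfn_imp dfV_isS dfn_iff dfV_sub) simp_all
    then show ?thesis unfolding Fin_Sort
      by (intro pbk_VarI[where Q = "\<lambda>zs. isC (zs ! 0) \<and> isC (zs ! 1) \<and> (\<forall>Z\<in>VV. isS Z --> (Z \<subseteq> zs ! 0 \<longleftrightarrow> Z \<subseteq> zs ! 1))"])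
         (auto simp: length_Suc_conv simp flip: fs_eq_iff)
  qed
next
  fix r :: fin_rel
  have "dfV (replicate (length [Field_Sort, Fin_Sort]) ()) (\<lambda>e :: nat => 'k pset. isS (e 0) \<and> isC (e 1) \<and> e 0 \<subseteq> e 1)"
    by (intro dfn_conj dfV_isS dfV_isC dfV_sub) simp_all
  then show "pbk VarS \<tau>F XF \<pi>F (rdom FinS r) (\<lambda>xs :: 'k fin_elem list. xs \<in> relI FinS r)"
    unfolding FinS_simps
    by (intro pbk_VarI[where Q = "\<lambda>zs. isS (zs ! 0) \<and> isC (zs ! 1) \<and> zs ! 0 \<subseteq> zs ! 1"])
       (auto simp: length_Suc_conv isS_iff finite_fs fs_mem)
next
  fix f
  show "pbk VarS \<tau>F XF \<pi>F (fcod FinS f # fdom FinS f) (\<lambda>xs :: 'k fin_elem list. hd xs = funI FinS f (tl xs))" by (rule pbk_fun)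
qed

section \<open>Curves coded by finite sets\<close>

abbreviation dfF :: "fin_sort list => ((nat => 'k::field fin_elem) => bool) => bool" where
  "dfF \<equiv> dfn FinS (carrier FinS)"

lemma wt_Field: "wt FinS \<Gamma> e ==> i < length \<Gamma> ==> \<Gamma> ! i = Field_Sort ==> e i = Scalar (the_Scalar (e i))"
  unfolding wt_def by force

lemma wt_Fin: "wt FinS \<Gamma> e ==> i < length \<Gamma> ==> \<Gamma> ! i = Fin_Sort ==> e i = FinSet (the_FinSet (e i)) \<and> finite (the_FinSet (e i))"
  unfolding wt_def by force

text \<open>A definable function into K, given by its graph with the value as variable 0. It lets
  compound polynomial expressions stand in equations and memberships.\<close>

definition tm :: "fin_sort list => ((nat => 'k::field fin_elem) => 'k) => bool" where
  "tm \<Gamma> f \<longleftrightarrow> dfF (Field_Sort # \<Gamma>) (\<lambda>e. e 0 = Scalar (f (\<lambda>n. e (Suc n))))"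

lemma dfF_bex: "dfF (Field_Sort # \<Gamma>) (\<lambda>e. Q (\<lambda>n. e (Suc n)) (e 0)) ==> dfF \<Gamma> (\<lambda>e. \<exists>x\<in>range Scalar. Q e x)"
  using dfn_ex[of Field_Sort FinS "carrier FinS" \<Gamma> Q] by simp

lemma dfF_ex: "dfF (Field_Sort # \<Gamma>) (\<lambda>e. Q (\<lambda>n. e (Suc n)) (the_Scalar (e 0))) ==> dfF \<Gamma> (\<lambda>e. \<exists>x. Q e x)"
  using dfF_bex[of \<Gamma> "\<lambda>e x. Q e (the_Scalar x)"] by simp

lemma dfF_all: "dfF (Field_Sort # \<Gamma>) (\<lambda>e. Q (\<lambda>n. e (Suc n)) (the_Scalar (e 0))) ==> dfF \<Gamma> (\<lambda>e. \<forall>x. Q e x)"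
  using dfn_neg[OF dfF_ex[OF dfn_neg, of \<Gamma> Q]] by simp

lemma dfF_exS:
  assumes "dfF (Fin_Sort # \<Gamma>) (\<lambda>e. Q (\<lambda>n. e (Suc n)) (the_FinSet (e 0)))"
  shows "dfF \<Gamma> (\<lambda>e. \<exists>A. finite A \<and> Q e A)"
proof -
  have "dfF \<Gamma> (\<lambda>e. \<exists>x\<in>carrier FinS Fin_Sort. Q e (the_FinSet x))"
    by (rule dfn_ex[where Q = "\<lambda>e x. Q e (the_FinSet x)"]) (use assms in simp_all)
  then show ?thesis by (rule dfn_cong) force
qed

lemma tm_at:
  assumes "tm \<Gamma> f" "\<And>i. i < length \<Gamma> ==> \<rho> i < length \<Gamma>' \<and> \<Gamma>' ! \<rho> i = \<Gamma> ! i" "j < length \<Gamma>'" "\<Gamma>' ! j = Field_Sort"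
  shows "dfF \<Gamma>' (\<lambda>e. e j = Scalar (f (\<lambda>n. e (\<rho> n))))"
proof -
  have "dfF \<Gamma>' (\<lambda>e. (\<lambda>e. e 0 = Scalar (f (\<lambda>n. e (Suc n)))) (\<lambda>i. e (case_nat j \<rho> i)))"
    by (rule dfn_reindex[OF assms(1)[unfolded tm_def]]) (use assms(2-4) in \<open>auto split: nat.split\<close>)
  then show ?thesis by simp
qed

lemma tm_var: "i < length \<Gamma> ==> \<Gamma> ! i = Field_Sort ==> tm \<Gamma> (\<lambda>e. the_Scalar (e i))"
  unfolding tm_def
proof (rule dfn_cong[OF dfn_eq[of 0 _ "Suc i"]])
  fix e :: "nat => 'a fin_elem" assume i: "i < length \<Gamma>" "\<Gamma> ! i = Field_Sort" "wt FinS (Field_Sort # \<Gamma>) e"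
  have "e (Suc i) = Scalar (the_Scalar (e (Suc i)))" by (rule wt_Field[OF i(3)]) (use i in simp_all)
  then show "e 0 = e (Suc i) \<longleftrightarrow> e 0 = Scalar (the_Scalar (e (Suc i)))" by metis
qed simp_all

lemma tm_const: "tm \<Gamma> (\<lambda>_. c)"
  unfolding tm_def by (rule dfn_const) auto

lemma tm_binary:
  assumes "tm \<Gamma> f" "tm \<Gamma> g"
    and h: "dfF [Field_Sort, Field_Sort, Field_Sort] (\<lambda>e. e 0 = Scalar (h (the_Scalar (e 1)) (the_Scalar (e 2))))"
  shows "tm \<Gamma> (\<lambda>e. h (f e) (g e))"
  unfolding tm_def
proof -
  have 1: "dfF (Field_Sort # Field_Sort # Field_Sort # \<Gamma>) (\<lambda>e. e 1 = Scalar (f (\<lambda>n. e (n + 3))))"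
    by (rule tm_at[OF assms(1)]) simp_all
  have 2: "dfF (Field_Sort # Field_Sort # Field_Sort # \<Gamma>) (\<lambda>e. e 0 = Scalar (g (\<lambda>n. e (n + 3))))"
    by (rule tm_at[OF assms(2)]) simp_all
  \<comment> \<open>The two quantified values are stacked as g, then f, then the outer result, so
    the places 0, 1, 2 of h are read in reverse.\<close>
  have 3: "dfF (Field_Sort # Field_Sort # Field_Sort # \<Gamma>) (\<lambda>e. (\<lambda>e. e 0 = Scalar (h (the_Scalar (e 1)) (the_Scalar (e 2)))) (\<lambda>i. e (2 - i)))"
  proof (rule dfn_reindex[OF h])
    fix i assume "i < length [Field_Sort, Field_Sort, Field_Sort]"
    then have "i = 0 \<or> i = 1 \<or> i = 2" by (simp, arith)
    then show "2 - i < length (Field_Sort # Field_Sort # Field_Sort # \<Gamma>) \<and>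
        (Field_Sort # Field_Sort # Field_Sort # \<Gamma>) ! (2 - i) = [Field_Sort, Field_Sort, Field_Sort] ! i"
      by (elim disjE) simp_all
  qed
  have "dfF (Field_Sort # \<Gamma>) (\<lambda>e. \<exists>x\<in>range Scalar. \<exists>y\<in>range Scalar. x = Scalar (f (\<lambda>n. e (Suc n))) \<and> y = Scalar (g (\<lambda>n. e (Suc n))) \<and> e 0 = Scalar (h (the_Scalar x) (the_Scalar y)))"
    by (intro dfF_bex dfn_conj) (use 1 2 3 in \<open>simp_all add: numeral_3_eq_3 numeral_2_eq_2\<close>)
  then show "dfF (Field_Sort # \<Gamma>) (\<lambda>e. e 0 = Scalar (h (f (\<lambda>n. e (Suc n))) (g (\<lambda>n. e (Suc n)))))"
    by (rule dfn_cong) simp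
qed

lemma tm_add: "tm \<Gamma> f ==> tm \<Gamma> g ==> tm \<Gamma> (\<lambda>e. f e + g e)"
  by (rule tm_binary[where h = "(+)"], assumption+)
     (use dfn_fun[of Plus FinS "[1, 2]" "[Field_Sort, Field_Sort, Field_Sort]" 0 "carrier FinS"] in simp)

lemma tm_mult: "tm \<Gamma> f ==> tm \<Gamma> g ==> tm \<Gamma> (\<lambda>e. f e * g e)"
  by (rule tm_binary[where h = "(*)"], assumption+)
     (use dfn_fun[of Times FinS "[1, 2]" "[Field_Sort, Field_Sort, Field_Sort]" 0 "carrier FinS"] in simp)

lemma tm_eq:
  assumes "tm \<Gamma> f" "tm \<Gamma> g"
  shows "dfF \<Gamma> (\<lambda>e. f e = g e)"
proof -
  have "dfF \<Gamma> (\<lambda>e. \<exists>x\<in>range Scalar. x = Scalar (f e) \<and> x = Scalar (g e))"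
    by (intro dfF_bex dfn_conj) (use assms in \<open>simp_all add: tm_def\<close>)
  then show ?thesis by (rule dfn_cong) auto
qed

lemma tm_mem:
  assumes "tm \<Gamma> f" "i < length \<Gamma>" "\<Gamma> ! i = Fin_Sort"
  shows "dfF \<Gamma> (\<lambda>e. f e \<in> the_FinSet (e i))"
proof -
  have "dfF (Field_Sort # \<Gamma>) (\<lambda>e. map e [0, Suc i] \<in> relI FinS Member)"
    by (rule dfn_rel) (use assms(2,3) in simp_all)
  then have "dfF \<Gamma> (\<lambda>e. \<exists>x\<in>range Scalar. x = Scalar (f e) \<and> [x, e i] \<in> relI FinS Member)"
    by (intro dfF_bex dfn_conj) (use assms in \<open>simp_all add: tm_def\<close>)
  then show ?thesis
  proof (rule dfn_cong)
    fix e :: "nat => 'a fin_elem" assume "wt FinS \<Gamma> e"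
    then obtain X where "e i = FinSet X" "finite X" using wt_Fin[OF _ assms(2,3)] by metis
    then show "(\<exists>x\<in>range Scalar. x = Scalar (f e) \<and> [x, e i] \<in> relI FinS Member) \<longleftrightarrow> f e \<in> the_FinSet (e i)" by auto
  qed
qed

text \<open>A ternary finite relation coded by a set B of entries and the set A of values k + t m +
  t^2 s. For t as in \<open>coding\<close>, the value determines the triple among those with entries
  in B. The same scheme, in Horner form, gives \<open>rel6\<close>.\<close>

definition rel3 :: "'k::field => 'k set => 'k set => 'k => 'k => 'k => bool" where
  "rel3 t A B k m s \<longleftrightarrow> k \<in> B \<and> m \<in> B \<and> s \<in> B \<and> k + t * (m + t * s) \<in> A"

definition rel6 :: "'k::field => 'k set => 'k set => 'k => 'k => 'k => 'k => 'k => 'k => bool" where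
  "rel6 t A B k a b c e f \<longleftrightarrow> k \<in> B \<and> a \<in> B \<and> b \<in> B \<and> c \<in> B \<and> e \<in> B \<and> f \<in> B \<and>
     k + t * (a + t * (b + t * (c + t * (e + t * f)))) \<in> A"

text \<open>A finite set of instructions (line number, then coefficients) acts on a state of a line number, an
  accumulated monomial and an accumulated sum; a run is witnessed by a finite set of states. Infinite
  runs are excluded because line numbers increase.\<close>

definition Run :: "'k::field => 'k => 'k set => 'k set => 'k => 'k => 'k => bool" where
  "Run n t A B x y z \<longleftrightarrow> (\<exists>t'. \<exists>A'. finite A' \<and> (\<exists>B'. finite B' \<and> rel3 t' A' B' 0 1 0 \<and>
     (\<forall>k m s. rel3 t' A' B' k m s --> (k = n \<and> s = 0) \<or> (\<exists>a b c e f. rel6 t A B k a b c e f \<and>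
        rel3 t' A' B' (k + 1) (m * (a * x + b * y + c * z) + e) (s + f * m)))))"

text \<open>Two kinds of code: a nonzero (x, y, z) names a point, tested by the vanishing of the
  cross product, and x = y = z = 0 announces a program. Demanding a run for all nonzero l makes the
  latter set stable under scaling even if the computed polynomial is not homogeneous.\<close>

definition ZF :: "'k::field => 'k => 'k => 'k => 'k => 'k set => 'k set => 'k => 'k => 'k => bool" where
  "ZF x y z n t A B u v w \<longleftrightarrow> \<not> (u = 0 \<and> v = 0 \<and> w = 0) \<and>
     (\<not> (x = 0 \<and> y = 0 \<and> z = 0) \<and> x * v = y * u \<and> y * w = z * v \<and> x * w = z * u \<or>
      (x = 0 \<and> y = 0 \<and> z = 0) \<and> (\<forall>l. \<not> l = 0 --> Run n t A B (l * u) (l * v) (l * w)))"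

abbreviation CT :: "fin_sort list" where
  "CT \<equiv> [Field_Sort, Field_Sort, Field_Sort, Field_Sort, Field_Sort, Fin_Sort, Fin_Sort]"
abbreviation VT :: "fin_sort list" where
  "VT \<equiv> [Field_Sort, Field_Sort, Field_Sort]"

definition vv :: "'k::field fin_elem list => 'k ^ 3" where
  "vv u = vec3 (the_Scalar (u ! 0)) (the_Scalar (u ! 1)) (the_Scalar (u ! 2))"

definition ZL :: "'k::field fin_elem list => 'k ^ 3 => bool" where
  "ZL c v \<longleftrightarrow> ZF (the_Scalar (c ! 0)) (the_Scalar (c ! 1)) (the_Scalar (c ! 2)) (the_Scalar (c ! 3)) (the_Scalar (c ! 4))
     (the_FinSet (c ! 5)) (the_FinSet (c ! 6)) (v $ 1) (v $ 2) (v $ 3)"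

lemma dfF_ZF:
  "dfF (CT @ VT) (\<lambda>e. ZF (the_Scalar (e 0)) (the_Scalar (e 1)) (the_Scalar (e 2)) (the_Scalar (e 3)) (the_Scalar (e 4))
     (the_FinSet (e 5)) (the_FinSet (e 6)) (the_Scalar (e 7)) (the_Scalar (e 8)) (the_Scalar (e 9)))"
  unfolding ZF_def Run_def rel3_def rel6_def
  by (intro dfn_conj dfn_disj dfn_imp dfn_neg dfF_ex dfF_all dfF_exS tm_mem tm_eq tm_add tm_mult tm_const tm_var) simp_all

lemma dfF_ZL_base:
  "dfF (CT @ VT) (\<lambda>e. (\<lambda>xs. ZL (take 7 xs) (vv (drop 7 xs))) (map e [0..<length (CT @ VT)]))"
  by (rule dfn_cong[OF dfF_ZF]) (simp add: ZL_def vv_def eval_nat_numeral)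

lemma dfF_ZL:
  assumes "okp \<Gamma> CT ps" "okp \<Gamma> VT qs"
  shows "dfF \<Gamma> (\<lambda>e. ZL (map e ps) (vv (map e qs)))"
proof -
  have "length ps = 7" using okp_length[OF assms(1)] by simp
  then show ?thesis using dfn_okp[OF dfF_ZL_base okp_append[OF assms]] by simp
qed

definition Zc :: "'k::field fin_elem list => 'k pset" where
  "Zc c = {p. \<exists>v. v ~= 0 \<and> p = pt v \<and> ZL c v}"

lemma ZL_nz: "ZL c v ==> v ~= 0"
  unfolding ZL_def ZF_def by auto

lemma ZL_scale:
  fixes v :: "'k::field ^ 3"
  assumes "ZL c v" "r ~= 0"
  shows "ZL c (r *s v)"
proof -
  have "\<forall>l. l ~= 0 --> Run n t A B (l * (r * a)) (l * (r * b)) (l * (r * d))"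
    if "\<forall>l. l ~= 0 --> Run n t A B (l * a) (l * b) (l * d)" for n t A B and a b d :: 'k
  proof (intro allI impI)
    fix l :: 'k assume "l ~= 0"
    then show "Run n t A B (l * (r * a)) (l * (r * b)) (l * (r * d))"
      using that[rule_format, of "l * r"] assms(2) by (simp add: mult.assoc)
  qed
  note run = this[of "the_Scalar (c ! 3)" "the_Scalar (c ! 4)" "the_FinSet (c ! 5)" "the_FinSet (c ! 6)" "v $ 1" "v $ 2" "v $ 3"]
  show ?thesis
    using assms run unfolding ZL_def ZF_def vector_smult_component mult_eq_0_iff mult.left_commute[of _ r] mult_cancel_left
    by blast
qed

lemma pt_Zc: "v ~= 0 ==> pt v \<in> Zc c \<longleftrightarrow> ZL c v"
proof
  assume v: "v ~= 0" and "pt v \<in> Zc c"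
  then obtain w where w: "w ~= 0" "pt v = pt w" "ZL c w" unfolding Zc_def mem_Collect_eq by (elim exE conjE)
  then obtain r where r: "v = r *s w" using pt_eq_iff[OF w(1) v] by auto
  then have "r ~= 0" using v by auto
  then show "ZL c v" unfolding r by (rule ZL_scale[OF w(3)])
next
  assume "v ~= 0" "ZL c v"
  then show "pt v \<in> Zc c" unfolding Zc_def by blast
qed

lemma Zc_sub: "Zc c \<subseteq> proj_plane"
  unfolding Zc_def by auto

lemma vv_surj:
  fixes v :: "'k::field ^ 3"
  obtains u where "u \<in> tuples FinS VT" "vv u = v"
  by (rule that[of "[Scalar (v $ 1), Scalar (v $ 2), Scalar (v $ 3)]"]) (simp_all add: tuples_def vv_def)

lemma all_vv: "(\<forall>u\<in>tuples FinS VT. Q (vv u)) \<longleftrightarrow> (\<forall>v. Q v)"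
  using vv_surj by metis

lemma ex_vv: "(\<exists>u\<in>tuples FinS VT. Q (vv u)) \<longleftrightarrow> (\<exists>v. Q v)"
  using vv_surj by metis

lemma Zc_sub_iff: "Zc c \<subseteq> Zc c' \<union> Zc c'' \<longleftrightarrow> (\<forall>u\<in>tuples FinS VT. ZL c (vv u) --> ZL c' (vv u) \<or> ZL c'' (vv u))"
  unfolding all_vv[of "\<lambda>v. ZL c v --> ZL c' v \<or> ZL c'' v"]
proof
  assume *: "Zc c \<subseteq> Zc c' \<union> Zc c''"
  show "\<forall>v. ZL c v --> ZL c' v \<or> ZL c'' v"
  proof (intro allI impI)
    fix v assume v: "ZL c v"
    have nz: "v ~= 0" by (rule ZL_nz[OF v])
    have "pt v \<in> Zc c' \<union> Zc c''" using * v pt_Zc[OF nz, of c] by blast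
    then show "ZL c' v \<or> ZL c'' v" by (simp add: pt_Zc[OF nz])
  qed
next
  assume *: "\<forall>v. ZL c v --> ZL c' v \<or> ZL c'' v"
  show "Zc c \<subseteq> Zc c' \<union> Zc c''" unfolding Zc_def using * by blast
qed

text \<open>The one pattern of inclusions from which equality, order and irreducibility are
  assembled; a plain inclusion is the case of two equal sets on the right.\<close>

lemma dfF_Zc_un:
  assumes "okp \<Gamma> CT ps" "okp \<Gamma> CT qs" "okp \<Gamma> CT rs"
  shows "dfF \<Gamma> (\<lambda>e. Zc (map e ps) \<subseteq> Zc (map e qs) \<union> Zc (map e rs))"
  unfolding Zc_sub_iff
proof (rule dfn_block_all[where Q = "\<lambda>e u. ZL (map e ps) (vv u) --> ZL (map e qs) (vv u) \<or> ZL (map e rs) (vv u)"])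
  have "dfF (VT @ \<Gamma>) (\<lambda>e. ZL (map e (map ((+) (length VT)) ps)) (vv (map e [0..<length VT])) -->
      ZL (map e (map ((+) (length VT)) qs)) (vv (map e [0..<length VT])) \<or> ZL (map e (map ((+) (length VT)) rs)) (vv (map e [0..<length VT])))"
    by (intro dfn_imp dfn_disj dfF_ZL okp_prefix okp_shift assms)
  then show "dfF (VT @ \<Gamma>) (\<lambda>e. ZL (map (\<lambda>n. e (length VT + n)) ps) (vv (map e [0..<length VT])) -->
      ZL (map (\<lambda>n. e (length VT + n)) qs) (vv (map e [0..<length VT])) \<or> ZL (map (\<lambda>n. e (length VT + n)) rs) (vv (map e [0..<length VT])))"
    by (simp only: map_map comp_def)
qed simp

section \<open>Zero sets of programs\<close>

text \<open>The map \<iota> of coefficients allows the same program to run over K and over K[T]. An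
  instruction lists the entries a, b, c, e, f of \<open>Run\<close> in this order.\<close>

fun rn :: "('k => 'r::comm_ring_1) => 'r => 'r => 'r => 'k list list => 'r \<times> 'r => 'r \<times> 'r" where
  "rn \<iota> x y z [] st = st"
| "rn \<iota> x y z (i # is) (m, s) = rn \<iota> x y z is (m * (\<iota> (i ! 0) * x + \<iota> (i ! 1) * y + \<iota> (i ! 2) * z) + \<iota> (i ! 3), s + \<iota> (i ! 4) * m)"

lemma rn_append: "rn \<iota> x y z (is @ js) st = rn \<iota> x y z js (rn \<iota> x y z is st)"
  by (induction "is" arbitrary: st) (auto split: prod.splits)

text \<open>Replacing \<open>v\<close> by \<open>v T\<close> splits the polynomial computed by a program into its homogeneous parts.\<close>

abbreviation hrn :: "'k::field ^ 3 => 'k list list => 'k poly \<times> 'k poly => 'k poly \<times> 'k poly" where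
  "hrn v \<equiv> rn (\<lambda>c. [:c:]) [:0, v $ 1:] [:0, v $ 2:] [:0, v $ 3:]"

lemma poly_hrn:
  "(poly (fst (hrn v is (M, S))) l, poly (snd (hrn v is (M, S))) l) =
   rn id (l * v $ 1) (l * v $ 2) (l * v $ 3) is (poly M l, poly S l)"
  by (induction "is" arbitrary: M S) (simp_all add: algebra_simps)

text \<open>In each step the accumulated monomial is multiplied by T times a linear form in v and
  receives a constant, so the degree in T remains the degree in v.\<close>

lemma hrn_forms:
  assumes "\<And>d. is_form d (\<lambda>v. coeff (M v) d)" "\<And>d. is_form d (\<lambda>v. coeff (S v) d)"
  shows "is_form d (\<lambda>v. coeff (snd (hrn v is (M v, S v))) d)"
  using assms
proof (induction "is" arbitrary: M S)
  case (Cons i "is")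
  define N where "N = (\<lambda>v :: 'a ^ 3. M v * ([:i ! 0:] * [:0, v $ 1:] + [:i ! 1:] * [:0, v $ 2:] + [:i ! 2:] * [:0, v $ 3:]) + [:i ! 3:])"
  define U where "U = (\<lambda>v. S v + [:i ! 4:] * M v)"
  have N: "coeff (N v) d = (case d of 0 => i ! 3 | Suc d' => coeff (M v) d' * lin (vec3 (i ! 0) (i ! 1) (i ! 2)) v)" for v d
    unfolding N_def lin_def by (simp split: nat.split add: mult.commute)
  have "is_form d (\<lambda>v. coeff (N v) d)" for d
  proof (cases d)
    case 0
    then show ?thesis unfolding N using is_form_const by simp
  next
    case (Suc d')
    then show ?thesis unfolding N using is_form_mult[OF Cons.prems(1)[of d'] is_form_lin[of "vec3 (i ! 0) (i ! 1) (i ! 2)"]] by simp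
  qed
  moreover have "is_form d (\<lambda>v. coeff (U v) d)" for d
    unfolding U_def using is_form_add[OF Cons.prems(2)[of d] is_form_cmult[OF Cons.prems(1)[of d], of "i ! 4"]] by simp
  ultimately have "is_form d (\<lambda>v. coeff (snd (hrn v is (N v, U v))) d)" by (rule Cons.IH)
  then show ?case by (simp add: N_def U_def)
qed simp

text \<open>A straight-line program picked from the instruction relation, one instruction per line
  number. An arbitrary code may offer several instructions for the same line and hence several
  paths.\<close>

definition path :: "'k::field => 'k => 'k set => 'k set => 'k list list => bool" where
  "path n t A B is \<longleftrightarrow> of_nat (length is) = n \<and> (\<forall>j<length is. length (is ! j) = 5 \<and>
     rel6 t A B (of_nat j) (is ! j ! 0) (is ! j ! 1) (is ! j ! 2) (is ! j ! 3) (is ! j ! 4))"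

lemma set_length5: "length i = 5 ==> set i = {i ! 0, i ! 1, i ! 2, i ! 3, i ! 4}"
  by (auto simp: numeral_eq_Suc length_Suc_conv)

text \<open>The entries come from the finite set B, and n determines the length in characteristic 0;
  if n is not a natural number there is no path.\<close>

lemma finite_paths:
  fixes B :: "'k::field_char_0 set"
  assumes "finite B"
  shows "finite {is. path n t A B is}"
proof (cases "\<exists>N. n = of_nat N")
  case True
  then obtain N where N: "n = of_nat N" by blast
  have "set i \<subseteq> B" if "length i = 5" "rel6 t A B k (i ! 0) (i ! 1) (i ! 2) (i ! 3) (i ! 4)" for i k
    using that(2) unfolding set_length5[OF that(1)] rel6_def by simp
  then have "{is. path n t A B is} \<subseteq> {is. set is \<subseteq> {i. set i \<subseteq> B \<and> length i = 5} \<and> length is = N}"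
    unfolding path_def N by (auto simp: in_set_conv_nth subset_iff) blast
  moreover have "finite {is. set is \<subseteq> {i. set i \<subseteq> B \<and> length i = 5} \<and> length is = N}"
    by (intro finite_lists_length_eq assms)
  ultimately show ?thesis by (rule finite_subset)
next
  case False
  then have "{is. path n t A B is} = {}" unfolding path_def by auto
  then show ?thesis by simp
qed

text \<open>Different lists over B of equal length are different polynomials, so t only has to avoid
  the finitely many roots of their differences.\<close>

lemma coding:
  fixes R :: "'k::field_char_0 list set"
  assumes "finite R" "\<And>xs. xs \<in> R ==> length xs = m"
  obtains t A B where "finite A" "finite B" "\<And>xs. length xs = m ==> set xs \<subseteq> B \<and> poly (Poly xs) t \<in> A \<longleftrightarrow> xs \<in> R"
proof -
  define B where "B = (\<Union>xs\<in>R. set xs)"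
  define L where "L = {xs. set xs \<subseteq> B \<and> length xs = m}"
  have B: "finite B" unfolding B_def using assms(1) by simp
  have L: "finite L" unfolding L_def by (rule finite_lists_length_eq[OF B])
  have inj: "xs = ys" if "xs \<in> L" "ys \<in> L" "Poly xs = Poly ys" for xs ys
  proof (rule nth_equalityI)
    show "length xs = length ys" using that(1,2) by (simp add: L_def)
    then show "xs ! i = ys ! i" if "i < length xs" for i
      using that \<open>Poly xs = Poly ys\<close> by (metis coeff_Poly_eq nth_default_nth)
  qed
  define T where "T = (\<Union>p\<in>{(xs, ys). xs \<in> L \<and> ys \<in> L \<and> xs ~= ys}. {t. poly (Poly (fst p) - Poly (snd p)) t = 0})"
  have "finite {(xs, ys). xs \<in> L \<and> ys \<in> L \<and> xs ~= ys}" by (rule finite_subset[of _ "L \<times> L"]) (use L in auto)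
  moreover have "finite {t. poly (Poly (fst p) - Poly (snd p)) t = 0}" if "p \<in> {(xs, ys). xs \<in> L \<and> ys \<in> L \<and> xs ~= ys}" for p
    by (rule poly_roots_finite) (use that inj in auto)
  ultimately have "finite T" unfolding T_def by (rule finite_UN_I)
  then obtain t where t: "t \<notin> T" using infinite_UNIV_0 ex_new_if_finite by blast
  have "set xs \<subseteq> B \<and> poly (Poly xs) t \<in> (\<lambda>xs. poly (Poly xs) t) ` R \<longleftrightarrow> xs \<in> R" if "length xs = m" for xs
  proof
    assume *: "set xs \<subseteq> B \<and> poly (Poly xs) t \<in> (\<lambda>xs. poly (Poly xs) t) ` R"
    then obtain ys where ys: "ys \<in> R" "poly (Poly xs) t = poly (Poly ys) t" by auto
    have "xs \<in> L" "ys \<in> L" using * that ys(1) assms(2) unfolding L_def B_def by auto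
    then have "xs = ys" using t ys(2) unfolding T_def by fastforce
    then show "xs \<in> R" using ys by simp
  qed (auto simp: B_def)
  then show ?thesis using that[of "(\<lambda>xs. poly (Poly xs) t) ` R" B t] B assms(1) by blast
qed

lemma rel3_Poly: "rel3 t A B k m s \<longleftrightarrow> set [k, m, s] \<subseteq> B \<and> poly (Poly [k, m, s]) t \<in> A"
  by (simp add: rel3_def)

lemma rel6_Poly: "rel6 t A B k a b c e f \<longleftrightarrow> set [k, a, b, c, e, f] \<subseteq> B \<and> poly (Poly [k, a, b, c, e, f]) t \<in> A"
  by (simp add: rel6_def)

text \<open>A run that could always be continued would put all natural numbers into the finite set
  B', which is impossible in characteristic 0. Conversely, the states along a path form a finite
  relation, which \<open>coding\<close> turns into a witness.\<close>

lemma Run_iff_path: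
  fixes n :: "'k::field_char_0"
  shows "Run n t A B x y z \<longleftrightarrow> (\<exists>is. path n t A B is \<and> snd (rn id x y z is (1, 0)) = 0)"
proof
  assume "Run n t A B x y z"
  then obtain t' A' B' where B': "finite B'" and start: "rel3 t' A' B' 0 1 0"
    and step: "\<And>k m s. rel3 t' A' B' k m s ==> (k = n \<and> s = 0) \<or> (\<exists>a b c e f. rel6 t A B k a b c e f \<and>
        rel3 t' A' B' (k + 1) (m * (a * x + b * y + c * z) + e) (s + f * m))" unfolding Run_def by blast
  define ok where "ok = (\<lambda>is. \<forall>j<length is. length (is ! j) = 5 \<and>
     rel6 t A B (of_nat j) (is ! j ! 0) (is ! j ! 1) (is ! j ! 2) (is ! j ! 3) (is ! j ! 4))"
  define st where "st = (\<lambda>is. rn id x y z is (1, 0))"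
  show "\<exists>is. path n t A B is \<and> snd (rn id x y z is (1, 0)) = 0"
  proof (rule ccontr)
    assume no: "\<not> ?thesis"
    \<comment> \<open>Without an accepting path the halting alternative never applies, so runs of
      each length j exist.\<close>
    have "\<exists>is. length is = j \<and> ok is \<and> rel3 t' A' B' (of_nat j) (fst (st is)) (snd (st is))" for j
    proof (induction j)
      case 0
      show ?case by (rule exI[of _ "[]"]) (use start in \<open>simp add: ok_def st_def\<close>)
    next
      case (Suc j)
      then obtain "is" where i: "length is = j" "ok is" "rel3 t' A' B' (of_nat j) (fst (st is)) (snd (st is))" by blast
      have "\<not> (of_nat j = n \<and> snd (st is) = 0)" using no i(1,2) unfolding path_def ok_def st_def by blast
      then obtain a b c e f where abc: "rel6 t A B (of_nat j) a b c e f"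
        "rel3 t' A' B' (of_nat j + 1) (fst (st is) * (a * x + b * y + c * z) + e) (snd (st is) + f * fst (st is))"
        using step[OF i(3)] by blast
      have "ok (is @ [[a, b, c, e, f]])" using i(1,2) abc(1) unfolding ok_def by (auto simp: nth_append less_Suc_eq)
      moreover have "st (is @ [[a, b, c, e, f]]) = (fst (st is) * (a * x + b * y + c * z) + e, snd (st is) + f * fst (st is))"
        unfolding st_def rn_append by (cases "rn id x y z is (1, 0)") simp
      ultimately show ?case using abc(2) i(1) by (intro exI[of _ "is @ [[a, b, c, e, f]]"]) (simp add: add.commute)
    qed
    then have "range (of_nat :: nat => 'k) \<subseteq> B'" unfolding rel3_def by blast
    then have "finite (range (of_nat :: nat => 'k))" using B' finite_subset by blast
    then show False using finite_imageD[OF _ inj_of_nat] by blast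
  qed
next
  assume "\<exists>is. path n t A B is \<and> snd (rn id x y z is (1, 0)) = 0"
  then obtain "is" where i: "path n t A B is" "snd (rn id x y z is (1, 0)) = 0" by blast
  define N where "N = length is"
  define st where "st = (\<lambda>j. rn id x y z (take j is) (1, 0))"
  define R where "R = (\<lambda>j. [of_nat j, fst (st j), snd (st j)]) ` {..N}"
  obtain t' A' B' where *: "finite A'" "finite B'" "\<And>xs. length xs = 3 ==> set xs \<subseteq> B' \<and> poly (Poly xs) t' \<in> A' \<longleftrightarrow> xs \<in> R"
    by (rule coding[of R 3]) (auto simp: R_def)
  have r: "rel3 t' A' B' k m s \<longleftrightarrow> [k, m, s] \<in> R" for k m s unfolding rel3_Poly by (rule *(3)) simp
  have "[0, 1, 0] \<in> R" unfolding R_def st_def by (rule image_eqI[of _ _ 0]) simp_all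
  moreover have "(k = n \<and> s = 0) \<or> (\<exists>a b c e f. rel6 t A B k a b c e f \<and>
        [k + 1, m * (a * x + b * y + c * z) + e, s + f * m] \<in> R)" if kms: "[k, m, s] \<in> R" for k m s
  proof -
    obtain j where j: "j \<le> N" "k = of_nat j" "st j = (m, s)" using kms unfolding R_def by (auto simp: prod_eq_iff)
    show ?thesis
    proof (cases "j = N")
      case True
      then show ?thesis using i j unfolding path_def N_def st_def by simp
    next
      case False
      then have jN: "j < length is" using j(1) N_def by simp
      have "st (Suc j) = (m * (is ! j ! 0 * x + is ! j ! 1 * y + is ! j ! 2 * z) + is ! j ! 3, s + is ! j ! 4 * m)"
        unfolding st_def take_Suc_conv_app_nth[OF jN] rn_append using j(3) unfolding st_def by simp
      then have "[k + 1, m * (is ! j ! 0 * x + is ! j ! 1 * y + is ! j ! 2 * z) + is ! j ! 3, s + is ! j ! 4 * m] \<in> R"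
        unfolding R_def by (intro image_eqI[of _ _ "Suc j"]) (use jN in \<open>simp_all add: j(2) N_def\<close>)
      moreover have "rel6 t A B k (is ! j ! 0) (is ! j ! 1) (is ! j ! 2) (is ! j ! 3) (is ! j ! 4)"
        using i(1) jN unfolding path_def j(2) by blast
      ultimately show ?thesis by blast
    qed
  qed
  ultimately show "Run n t A B x y z" unfolding Run_def r[symmetric] using *(1,2) by blast
qed

text \<open>For v in the set each l \<noteq> 0 is a root of the polynomial of one of finitely many
  paths, so one of these polynomials is zero and all its homogeneous parts vanish at v. For v
  outside, one part not vanishing at v is chosen for each path, and their product is the separating
  form.\<close>

lemma closed_Zc:
  fixes c :: "'k::field_char_0 fin_elem list"
  assumes c: "c \<in> tuples FinS CT"
  shows "zariski_closed (Zc c)"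
proof -
  define x where "x = vec3 (the_Scalar (c ! 0)) (the_Scalar (c ! 1)) (the_Scalar (c ! 2))"
  have xs: "x $ 1 = the_Scalar (c ! 0)" "x $ 2 = the_Scalar (c ! 1)" "x $ 3 = the_Scalar (c ! 2)" by (simp_all add: x_def)
  show ?thesis
  proof (cases "x = 0")
    case False
    have "Zc c = {pt x}"
    proof (rule plane_eqI[OF Zc_sub])
      show "pt v \<in> Zc c \<longleftrightarrow> pt v \<in> {pt x}" if v: "v ~= 0" for v
      proof -
        have "ZL c v \<longleftrightarrow> (\<exists>k. v = k *s x)" unfolding proportional_iff[OF False] ZL_def ZF_def xs[symmetric]
          using v False by (auto simp: vec3_eq_iff)
        then show ?thesis unfolding pt_Zc[OF v] singleton_iff eq_commute[of "pt v"] pt_eq_iff[OF False v] .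
      qed
    qed (use False in simp)
    then show ?thesis using point_VV[OF False] unfolding VV_def irreducible_closed_def by simp
  next
    case True
    define P where "P = {is. path (the_Scalar (c ! 3)) (the_Scalar (c ! 4)) (the_FinSet (c ! 5)) (the_FinSet (c ! 6)) is}"
    have "c ! 6 \<in> carrier FinS Fin_Sort" using c unfolding tuples_iff by (auto dest: spec[of _ 6])
    then have P: "finite P" unfolding P_def by (intro finite_paths) auto
    have Z: "ZL c v \<longleftrightarrow> v ~= 0 \<and> (\<forall>l. l ~= 0 --> (\<exists>is\<in>P. poly (snd (hrn v is (1, 0))) l = 0))" for v
    proof -
      have "poly (snd (hrn v is (1, 0))) l = snd (rn id (l * v $ 1) (l * v $ 2) (l * v $ 3) is (1, 0))" for "is" l
        using poly_hrn[of v "is" 1 0 l] by (simp add: prod_eq_iff)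
      then show ?thesis unfolding ZL_def ZF_def Run_iff_path P_def using True xs by (auto simp: vec3_eq_iff)
    qed
    have F: "is_form d (\<lambda>v :: 'k ^ 3. coeff (snd (hrn v is (1, 0))) d)" for d "is"
    proof (rule hrn_forms[of "\<lambda>v. 1" "\<lambda>v. 0"])
      show "is_form d (\<lambda>v :: 'k ^ 3. coeff 1 d)" for d by (cases "d = 0") (use is_form_const is_form_zero in \<open>simp_all add: coeff_1\<close>)
      show "is_form d (\<lambda>v :: 'k ^ 3. coeff 0 d)" for d using is_form_zero by simp
    qed
    show ?thesis unfolding closed_iff
    proof (intro conjI ballI Zc_sub)
      fix p assume p: "p \<in> proj_plane - Zc c"
      then have "p \<in> proj_plane" by blast
      then obtain v where v: "v ~= 0" "p = pt v" unfolding proj_plane_iff by (elim exE conjE)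
      have nz: "\<not> ZL c v" using p v(2) pt_Zc[OF v(1), of c] by simp
      have "\<exists>d. coeff (snd (hrn v is (1, 0))) d ~= 0" if "is \<in> P" for "is"
      proof (rule ccontr)
        assume "\<not> ?thesis"
        then have "snd (hrn v is (1, 0)) = 0" by (intro poly_eqI) simp
        then show False using nz that v(1) unfolding Z by force
      qed
      then obtain d where d: "\<And>is. is \<in> P ==> coeff (snd (hrn v is (1, 0))) (d is) ~= 0" by metis
      define G where "G = (\<lambda>w :: 'k ^ 3. \<Prod>is\<in>P. coeff (snd (hrn w is (1, 0))) (d is))"
      have G: "is_form (\<Sum>is\<in>P. d is) G" unfolding G_def by (rule is_form_prod) (rule F)
      have "G w = 0" if w: "w ~= 0 \<and> pt w \<in> Zc c" for w
      proof -
        have "poly (\<Prod>is\<in>P. snd (hrn w is (1, 0))) l = 0" if "l ~= 0" for l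
          using w pt_Zc[of w c] that P unfolding Z poly_prod by (intro prod_zero) auto
        then have "(\<Prod>is\<in>P. snd (hrn w is (1, 0))) = 0" by (rule poly_zero_off_point)
        then obtain "is" where "is \<in> P" "snd (hrn w is (1, 0)) = 0" using P by (auto simp: prod_zero_iff)
        then show ?thesis unfolding G_def using P by (intro prod_zero bexI[of _ "is"]) simp_all
      qed
      then have "Zc c \<subseteq> Zset G" using sub_Zset[OF G Zc_sub] by blast
      moreover have "G v ~= 0" unfolding G_def using d P by simp
      then have "p \<notin> Zset G" unfolding v(2) pt_Zset[OF G v(1)] .
      ultimately show "\<exists>d F. is_form d F \<and> Zc c \<subseteq> Zset F \<and> p \<notin> Zset F" using G by blast
    qed
  qed
qed

lemma rn_power:
  "rn id x y z (replicate i [1, 0, 0, 0, 0]) (m, s) = (m * x ^ i, s)"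
  "rn id x y z (replicate i [0, 1, 0, 0, 0]) (m, s) = (m * y ^ i, s)"
  "rn id x y z (replicate i [0, 0, 1, 0, 0]) (m, s) = (m * z ^ i, s)"
  by (induction i arbitrary: m) (simp_all add: mult_ac)

lemma program_for_sum:
  fixes S :: "(nat \<times> nat) set" and g :: "nat => nat => 'k::field"
  assumes "finite S"
  shows "\<exists>is. (\<forall>i\<in>set is. length i = 5) \<and> (\<forall>x y z s. rn id x y z is (1, s) = (1, s + (\<Sum>(i, j)\<in>S. g i j * x ^ i * y ^ j * z ^ (d - i - j))))"
  using assms
proof (induction S rule: finite_induct)
  case empty
  show ?case by (rule exI[of _ "[]"]) simp
next
  case (insert p S)
  obtain i j where p: "p = (i, j)" by (cases p)
  obtain "is" where i: "\<forall>i\<in>set is. length i = 5"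
    "\<And>x y z s. rn id x y z is (1, s) = (1, s + (\<Sum>(i, j)\<in>S. g i j * x ^ i * y ^ j * z ^ (d - i - j)))" using insert.IH by blast
  \<comment> \<open>The monomial is built factor by factor; the last instruction adds g i j times
    the monomial to the sum and resets the monomial to 1.\<close>
  define js where "js = replicate i [1, 0, 0, 0, 0 :: 'k] @ replicate j [0, 1, 0, 0, 0] @ replicate (d - i - j) [0, 0, 1, 0, 0] @ [[0, 0, 0, 1, g i j]]"
  have "rn id x y z js (1, s) = (1, s + g i j * x ^ i * y ^ j * z ^ (d - i - j))" for x y z s
    unfolding js_def rn_append rn_power by (simp add: mult_ac)
  then have "rn id x y z (js @ is) (1, s) = (1, s + (\<Sum>(i, j)\<in>insert p S. g i j * x ^ i * y ^ j * z ^ (d - i - j)))" for x y z s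
    unfolding rn_append using i(2) insert.hyps by (simp add: p add.assoc)
  moreover have "\<forall>i\<in>set (js @ is). length i = 5" using i(1) by (auto simp: js_def)
  ultimately show ?case by blast
qed

text \<open>The instruction relation offers exactly one instruction per line, so the program has a
  single path, and by homogeneity the scalings l do not affect its zeros.\<close>

lemma form_code:
  fixes F :: "'k::field_char_0 ^ 3 => 'k"
  assumes F: "is_form d F"
  obtains c where "c \<in> tuples FinS CT" "Zc c = Zset F"
proof -
  obtain g where g: "F = form_val d g" using F unfolding is_form_def by blast
  obtain "is" where i: "\<forall>i\<in>set is. length i = 5"
    "\<And>x y z s. rn id x y z is (1, s) = (1, s + (\<Sum>(i, j)\<in>{(i, j). i + j \<le> d}. g i j * x ^ i * y ^ j * z ^ (d - i - j)))"
    using program_for_sum[OF finite_deg[of d], of g d] by blast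
  define R where "R = (\<lambda>j. of_nat j # is ! j) ` {..<length is}"
  have i5: "length (is ! j) = 5" if "j < length is" for j using i(1) that by simp
  obtain t A B where *: "finite A" "finite B" "\<And>xs. length xs = 6 ==> set xs \<subseteq> B \<and> poly (Poly xs) t \<in> A \<longleftrightarrow> xs \<in> R"
    by (rule coding[of R 6]) (auto simp: R_def i5)
  have l5: "[i ! 0, i ! 1, i ! 2, i ! 3, i ! 4] = i" if "length i = 5" for i :: "'k list"
    using that by (auto simp: numeral_eq_Suc length_Suc_conv)
  have r: "rel6 t A B k (i ! 0) (i ! 1) (i ! 2) (i ! 3) (i ! 4) \<longleftrightarrow> k # i \<in> R" if "length i = 5" for k i
    unfolding rel6_Poly l5[OF that] by (rule *(3)) (use that in simp)
  have path: "path (of_nat (length is)) t A B js \<longleftrightarrow> js = is" for js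
  proof
    assume p: "path (of_nat (length is)) t A B js"
    then have len: "length js = length is" unfolding path_def by simp
    show "js = is"
    proof (rule nth_equalityI[OF len])
      fix j assume j: "j < length js"
      then have "of_nat j # js ! j \<in> R" using p r unfolding path_def by blast
      then show "js ! j = is ! j" unfolding R_def by auto
    qed
  next
    assume "js = is"
    then show "path (of_nat (length is)) t A B js" unfolding path_def using i5 r unfolding R_def by auto
  qed
  define c where "c = [Scalar 0, Scalar 0, Scalar 0, Scalar (of_nat (length is)), Scalar t, FinSet A, FinSet B]"
  have "ZL c v \<longleftrightarrow> v ~= 0 \<and> (\<forall>l. l ~= 0 --> F (l *s v) = 0)" for v
    unfolding ZL_def ZF_def Run_iff_path c_def by (simp add: path i(2) g form_val_def vec3_eq_iff)
  then have Z: "ZL c v \<longleftrightarrow> F v = 0" if "v ~= 0" for v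
    using that form_homog[OF F] by (auto intro: exI[of _ 1])
  have "Zc c = Zset F"
    by (rule plane_eqI[OF Zc_sub Zset_sub]) (simp add: pt_Zc Z pt_Zset[OF F])
  moreover have "c \<in> tuples FinS CT" using * by (simp add: c_def tuples_def)
  ultimately show ?thesis using that by blast
qed

lemma VV_code:
  fixes Z :: "'k::{alg_closed_field, field_char_0} pset"
  assumes "Z \<in> VV"
  obtains c where "c \<in> tuples FinS CT" "Zc c = Z"
proof (cases "is_pt Z")
  case True
  then obtain x where x: "x ~= 0" "Z = {pt x}" unfolding is_pt_def by (elim exE conjE)
  define c where "c = [Scalar (x $ 1), Scalar (x $ 2), Scalar (x $ 3), Scalar 0, Scalar 0, FinSet {}, FinSet {}]"
  have "Zc c = Z" unfolding x(2)
  proof (rule plane_eqI[OF Zc_sub])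
    show "pt v \<in> Zc c \<longleftrightarrow> pt v \<in> {pt x}" if v: "v ~= 0" for v
    proof -
      have "ZL c v \<longleftrightarrow> (\<exists>k. v = k *s x)" unfolding proportional_iff[OF x(1)] ZL_def ZF_def c_def
        using v x(1) by (auto simp: vec3_eq_iff)
      then show ?thesis unfolding pt_Zc[OF v] singleton_iff eq_commute[of "pt v"] pt_eq_iff[OF x(1) v] .
    qed
  qed (use x(1) in simp)
  moreover have "c \<in> tuples FinS CT" by (simp add: c_def tuples_def)
  ultimately show ?thesis using that by blast
next
  case False
  then show ?thesis using curve_is_Zset[OF assms] form_code that by metis
qed

section \<open>Recognising codes of irreducible sets\<close>

definition good :: "'k::field fin_elem list => bool" where
  "good c \<longleftrightarrow> (\<exists>u\<in>tuples FinS VT. ZL c (vv u)) \<and> (\<exists>u\<in>tuples FinS VT. vv u ~= 0 \<and> \<not> ZL c (vv u)) \<and>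
     (\<forall>c1\<in>tuples FinS CT. \<forall>c2\<in>tuples FinS CT. Zc c \<subseteq> Zc c1 \<union> Zc c2 --> Zc c \<subseteq> Zc c1 \<union> Zc c1 \<or> Zc c \<subseteq> Zc c2 \<union> Zc c2)"

text \<open>Quantifying over codes is at least as strong as quantifying over forms, by
  \<open>form_code\<close>, and at most as strong as quantifying over closed sets, by
  \<open>closed_Zc\<close>; both versions express irreducibility.\<close>

lemma good_iff:
  fixes c :: "'k::{alg_closed_field, field_char_0} fin_elem list"
  assumes c: "c \<in> tuples FinS CT"
  shows "good c \<longleftrightarrow> Zc c \<in> VV"
proof -
  have ne: "(\<exists>v. ZL c v) \<longleftrightarrow> Zc c ~= {}"
    unfolding Zc_def using ZL_nz by blast
  have pl: "(\<exists>v. v ~= 0 \<and> \<not> ZL c v) \<longleftrightarrow> Zc c ~= proj_plane"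
  proof
    assume "\<exists>v. v ~= 0 \<and> \<not> ZL c v"
    then obtain v where v: "v ~= 0" "\<not> ZL c v" by blast
    have "pt v \<notin> Zc c" using v(2) pt_Zc[OF v(1), of c] by simp
    then show "Zc c ~= proj_plane" using pt_in[OF v(1)] by metis
  next
    assume n: "Zc c ~= proj_plane"
    show "\<exists>v. v ~= 0 \<and> \<not> ZL c v"
    proof (rule ccontr)
      assume "\<not> ?thesis"
      then have "Zc c = proj_plane" by (intro plane_eqI[OF Zc_sub order_refl]) (auto simp: pt_Zc)
      then show False using n by simp
    qed
  qed
  have "(\<forall>c1\<in>tuples FinS CT. \<forall>c2\<in>tuples FinS CT. Zc c \<subseteq> Zc c1 \<union> Zc c2 --> Zc c \<subseteq> Zc c1 \<or> Zc c \<subseteq> Zc c2) \<longleftrightarrow>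
    (\<forall>d F d' G. is_form d F \<and> is_form d' G \<and> Zc c \<subseteq> Zset F \<union> Zset G --> Zc c \<subseteq> Zset F \<or> Zc c \<subseteq> Zset G)" if n: "Zc c ~= {}"
  proof
    assume *: "\<forall>c1\<in>tuples FinS CT. \<forall>c2\<in>tuples FinS CT. Zc c \<subseteq> Zc c1 \<union> Zc c2 --> Zc c \<subseteq> Zc c1 \<or> Zc c \<subseteq> Zc c2"
    show "\<forall>d F d' G. is_form d F \<and> is_form d' G \<and> Zc c \<subseteq> Zset F \<union> Zset G --> Zc c \<subseteq> Zset F \<or> Zc c \<subseteq> Zset G"
    proof (intro allI impI, elim conjE)
      fix d d' and F G :: "'k ^ 3 => 'k" assume F: "is_form d F" and G: "is_form d' G" and s: "Zc c \<subseteq> Zset F \<union> Zset G"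
      obtain c1 where c1: "c1 \<in> tuples FinS CT" "Zc c1 = Zset F" by (rule form_code[OF F])
      obtain c2 where c2: "c2 \<in> tuples FinS CT" "Zc c2 = Zset G" by (rule form_code[OF G])
      show "Zc c \<subseteq> Zset F \<or> Zc c \<subseteq> Zset G" using bspec[OF bspec[OF * c1(1)] c2(1)] s unfolding c1(2) c2(2) by blast
    qed
  next
    assume "\<forall>d F d' G. is_form d F \<and> is_form d' G \<and> Zc c \<subseteq> Zset F \<union> Zset G --> Zc c \<subseteq> Zset F \<or> Zc c \<subseteq> Zset G"
    then have irr: "irreducible_closed (Zc c)" unfolding irreducible_iff using closed_Zc[OF c] n by blast
    show "\<forall>c1\<in>tuples FinS CT. \<forall>c2\<in>tuples FinS CT. Zc c \<subseteq> Zc c1 \<union> Zc c2 --> Zc c \<subseteq> Zc c1 \<or> Zc c \<subseteq> Zc c2"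
    proof (intro ballI impI)
      fix c1 c2 :: "'k fin_elem list" assume cc: "c1 \<in> tuples FinS CT" "c2 \<in> tuples FinS CT" and s: "Zc c \<subseteq> Zc c1 \<union> Zc c2"
      have "zariski_closed (Zc c \<inter> Zc c1)" "zariski_closed (Zc c \<inter> Zc c2)" "Zc c = (Zc c \<inter> Zc c1) \<union> (Zc c \<inter> Zc c2)"
        using closed_inter closed_Zc c cc s by blast+
      then have "Zc c \<inter> Zc c1 = Zc c \<or> Zc c \<inter> Zc c2 = Zc c" using irr unfolding irreducible_closed_def by blast
      then show "Zc c \<subseteq> Zc c1 \<or> Zc c \<subseteq> Zc c2" by blast
    qed
  qed
  then show ?thesis
    unfolding good_def ex_vv[of "ZL c"] ex_vv[of "\<lambda>v. v ~= 0 \<and> \<not> ZL c v"] ne pl Un_absorb VV_def mem_Collect_eq irreducible_iff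
    using closed_Zc[OF c] by blast
qed

lemma dfF_good:
  assumes "okp \<Gamma> CT ps"
  shows "dfF \<Gamma> (\<lambda>e. good (map e ps))"
proof -
  have 1: "dfF \<Gamma> (\<lambda>e. \<exists>u\<in>tuples FinS VT. ZL (map e ps) (vv u))"
  proof (rule dfn_block_ex[where Q = "\<lambda>e u. ZL (map e ps) (vv u)"])
    have "dfF (VT @ \<Gamma>) (\<lambda>e. ZL (map e (map ((+) (length VT)) ps)) (vv (map e [0..<length VT])))"
      by (intro dfF_ZL okp_prefix okp_shift assms)
    then show "dfF (VT @ \<Gamma>) (\<lambda>e. ZL (map (\<lambda>n. e (length VT + n)) ps) (vv (map e [0..<length VT])))"
      by (simp only: map_map comp_def)
  qed simp
  have n0: "dfF (VT @ \<Gamma>) (\<lambda>e. vv (map e [0..<length VT]) ~= 0)"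
  proof -
    have "dfF (VT @ \<Gamma>) (\<lambda>e. \<not> (the_Scalar (e 0) = 0 \<and> the_Scalar (e 1) = 0 \<and> the_Scalar (e 2) = 0))"
      by (intro dfn_neg dfn_conj tm_eq tm_var tm_const) simp_all
    then show ?thesis by (rule dfn_cong) (simp add: vv_def vec3_eq_iff eval_nat_numeral)
  qed
  have 2: "dfF \<Gamma> (\<lambda>e. \<exists>u\<in>tuples FinS VT. vv u ~= 0 \<and> \<not> ZL (map e ps) (vv u))"
  proof (rule dfn_block_ex[where Q = "\<lambda>e u. vv u ~= 0 \<and> \<not> ZL (map e ps) (vv u)"])
    have "dfF (VT @ \<Gamma>) (\<lambda>e. vv (map e [0..<length VT]) ~= 0 \<and> \<not> ZL (map e (map ((+) (length VT)) ps)) (vv (map e [0..<length VT])))"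
      by (rule dfn_conj[OF n0 dfn_neg]) (intro dfF_ZL okp_prefix okp_shift assms)
    then show "dfF (VT @ \<Gamma>) (\<lambda>e. vv (map e [0..<length VT]) ~= 0 \<and> \<not> ZL (map (\<lambda>n. e (length VT + n)) ps) (vv (map e [0..<length VT])))"
      by (simp only: map_map comp_def)
  qed simp
  have 3: "dfF \<Gamma> (\<lambda>e. \<forall>c1\<in>tuples FinS CT. \<forall>c2\<in>tuples FinS CT. Zc (map e ps) \<subseteq> Zc c1 \<union> Zc c2 -->
      Zc (map e ps) \<subseteq> Zc c1 \<union> Zc c1 \<or> Zc (map e ps) \<subseteq> Zc c2 \<union> Zc c2)"
  proof (rule dfn_block_all[where Q = "\<lambda>e c1. \<forall>c2\<in>tuples FinS CT. Zc (map e ps) \<subseteq> Zc c1 \<union> Zc c2 -->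
      Zc (map e ps) \<subseteq> Zc c1 \<union> Zc c1 \<or> Zc (map e ps) \<subseteq> Zc c2 \<union> Zc c2"])
    have "dfF (CT @ \<Gamma>) (\<lambda>e. \<forall>c2\<in>tuples FinS CT. Zc (map e qs) \<subseteq> Zc (map e rs) \<union> Zc c2 -->
        Zc (map e qs) \<subseteq> Zc (map e rs) \<union> Zc (map e rs) \<or> Zc (map e qs) \<subseteq> Zc c2 \<union> Zc c2)"
      if qr: "okp (CT @ \<Gamma>) CT qs" "okp (CT @ \<Gamma>) CT rs" for qs rs
    proof (rule dfn_block_all[where Q = "\<lambda>e c2. Zc (map e qs) \<subseteq> Zc (map e rs) \<union> Zc c2 -->
        Zc (map e qs) \<subseteq> Zc (map e rs) \<union> Zc (map e rs) \<or> Zc (map e qs) \<subseteq> Zc c2 \<union> Zc c2"])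
      have "dfF (CT @ CT @ \<Gamma>) (\<lambda>e. Zc (map e (map ((+) (length CT)) qs)) \<subseteq> Zc (map e (map ((+) (length CT)) rs)) \<union> Zc (map e [0..<length CT]) -->
        Zc (map e (map ((+) (length CT)) qs)) \<subseteq> Zc (map e (map ((+) (length CT)) rs)) \<union> Zc (map e (map ((+) (length CT)) rs)) \<or>
        Zc (map e (map ((+) (length CT)) qs)) \<subseteq> Zc (map e [0..<length CT]) \<union> Zc (map e [0..<length CT]))"
        by (intro dfn_imp dfn_disj dfF_Zc_un okp_prefix okp_shift qr)
      then show "dfF (CT @ CT @ \<Gamma>) (\<lambda>e. Zc (map (\<lambda>n. e (length CT + n)) qs) \<subseteq> Zc (map (\<lambda>n. e (length CT + n)) rs) \<union> Zc (map e [0..<length CT]) -->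
        Zc (map (\<lambda>n. e (length CT + n)) qs) \<subseteq> Zc (map (\<lambda>n. e (length CT + n)) rs) \<union> Zc (map (\<lambda>n. e (length CT + n)) rs) \<or>
        Zc (map (\<lambda>n. e (length CT + n)) qs) \<subseteq> Zc (map e [0..<length CT]) \<union> Zc (map e [0..<length CT]))"
        by (simp only: map_map comp_def)
    qed simp
    from this[OF okp_shift[OF assms] okp_prefix]
    show "dfF (CT @ \<Gamma>) (\<lambda>e. \<forall>c2\<in>tuples FinS CT. Zc (map (\<lambda>n. e (length CT + n)) ps) \<subseteq> Zc (map e [0..<length CT]) \<union> Zc c2 -->
        Zc (map (\<lambda>n. e (length CT + n)) ps) \<subseteq> Zc (map e [0..<length CT]) \<union> Zc (map e [0..<length CT]) \<or> Zc (map (\<lambda>n. e (length CT + n)) ps) \<subseteq> Zc c2 \<union> Zc c2)"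
      by (simp only: map_map comp_def)
  qed simp
  show ?thesis unfolding good_def by (intro dfn_conj 1 2 3)
qed

section \<open>The poset interpreted in the field with finite sets\<close>

definition \<tau>V :: "unit => fin_sort list" where "\<tau>V s = CT"
definition XV :: "unit => 'k::field fin_elem list set" where "XV s = {c \<in> tuples FinS CT. Zc c \<in> VV}"
definition \<pi>V :: "unit => 'k::field fin_elem list => 'k pset" where "\<pi>V s c = Zc c"

lemma dfF_XV:
  assumes "okp \<Gamma> CT ps"
  shows "dfF \<Gamma> (\<lambda>e :: nat => 'k::{alg_closed_field, field_char_0} fin_elem. map e ps \<in> XV s)"
  by (rule dfn_cong[OF dfF_good[OF assms]]) (simp add: XV_def okp_tuples[OF assms] good_iff)

lemma two_codes:
  assumes "length c = 7" "length c' = 7"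
  shows "valid \<tau>V XV [s, s'] (c @ c') \<longleftrightarrow> c \<in> XV s \<and> c' \<in> XV s'" "dec \<tau>V \<pi>V [s, s'] (c @ c') = [Zc c, Zc c']"
  using dec_Cons(1)[of c \<tau>V s \<pi>V "[s']" c'] dec_Cons(2)[of c \<tau>V s XV "[s']" c'] dec_single(1)[of c' \<tau>V s' \<pi>V] dec_single(2)[of c' \<tau>V s' XV] assms by (simp_all add: \<tau>V_def \<pi>V_def)

lemma one_code:
  assumes "length c = 7"
  shows "valid \<tau>V XV [s] c \<longleftrightarrow> c \<in> XV s" "dec \<tau>V \<pi>V [s] c = [Zc c]"
  using dec_single(1)[of c \<tau>V s \<pi>V] dec_single(2)[of c \<tau>V s XV] assms by (simp_all add: \<tau>V_def \<pi>V_def)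

lemma pbk_two:
  assumes "\<And>c c'. R [Zc c, Zc c'] \<longleftrightarrow> Q c c'"
    and "dfF (CT @ CT) (\<lambda>e :: nat => 'k::{alg_closed_field, field_char_0} fin_elem. map e [0..<7] \<in> XV s \<and> map e [7..<14] \<in> XV s' \<and> Q (map e [0..<7]) (map e [7..<14]))"
  shows "pbk FinS \<tau>V XV \<pi>V [s, s'] R"
proof -
  have "map e [0..<14] = map e [0..<7] @ map e [7..<14]" for e :: "nat => 'k fin_elem"
    using upt_add_eq_append[of 0 7 7] by simp
  moreover have "tt \<tau>V [s, s'] = CT @ CT" "length (CT @ CT) = 14" by (simp_all add: \<tau>V_def)
  ultimately show ?thesis unfolding pbk_def using assms(2) by (simp only: two_codes length_map length_upt assms(1)) (simp add: two_codes assms(1))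
qed

theorem Var_in_Fin: "cinterp (FinS :: (_, _, _, 'k::{alg_closed_field, field_char_0} fin_elem) fo_structure) VarS \<tau>V XV \<pi>V"
proof (rule cinterp.intro[OF wf_FinS wf_VarS])
  have okp14: "okp (CT @ CT) CT [0..<7]" "okp (CT @ CT) CT [7..<14]" by code_simp+
  have sub: "Zc c \<subseteq> Zc c' \<longleftrightarrow> Zc c \<subseteq> Zc c' \<union> Zc c'" for c c' :: "'k fin_elem list" by simp
  fix s :: unit
  show "set (\<tau>V s) \<subseteq> sorts FinS" by simp
  show "(XV s :: 'k fin_elem list set) \<subseteq> tuples FinS (\<tau>V s)" by (auto simp: XV_def \<tau>V_def)
  have "Z \<in> \<pi>V s ` XV s" if Z: "Z \<in> VV" for Z :: "'k pset"
  proof -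
    obtain c where "c \<in> tuples FinS CT" "Zc c = Z" by (rule VV_code[OF Z])
    then show ?thesis using Z by (auto simp: \<pi>V_def XV_def)
  qed
  then show "\<pi>V s ` (XV s :: 'k fin_elem list set) = carrier VarS s" by (auto simp: \<pi>V_def XV_def)
  show "pbk FinS \<tau>V XV \<pi>V [s] (\<lambda>_ :: 'k pset list. True)"
  proof -
    have eq: "tt \<tau>V [s] = CT" by (simp add: \<tau>V_def)
    have l: "length (map e [0..<length CT]) = 7" for e :: "nat => 'k fin_elem" by simp
    show ?thesis unfolding pbk_def eq
      by (rule dfn_cong[OF dfF_XV[OF okp_self]]) (simp only: one_code(1)[OF l] simp_thms)
  qed
  show "pbk FinS \<tau>V XV \<pi>V [s, s] (\<lambda>xs :: 'k pset list. xs ! 0 = xs ! 1)"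
  proof (rule pbk_two[where Q = "\<lambda>c c'. Zc c \<subseteq> Zc c' \<union> Zc c' \<and> Zc c' \<subseteq> Zc c \<union> Zc c"])
    show "[Zc c, Zc c'] ! 0 = [Zc c, Zc c'] ! 1 \<longleftrightarrow> Zc c \<subseteq> Zc c' \<union> Zc c' \<and> Zc c' \<subseteq> Zc c \<union> Zc c" for c c' :: "'k fin_elem list" by auto
  qed (intro dfn_conj dfF_XV dfF_Zc_un okp14)
  show "pbk FinS \<tau>V XV \<pi>V (rdom VarS r) (\<lambda>xs :: 'k pset list. xs \<in> relI VarS r)" for r
    unfolding VarS_simps
  proof (rule pbk_two[where Q = "\<lambda>c c'. (Zc c \<in> VV \<and> Zc c' \<in> VV) \<and> Zc c \<subseteq> Zc c' \<union> Zc c'"])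
    show "[Zc c, Zc c'] \<in> {[Z, W] | Z W. Z \<in> VV \<and> W \<in> VV \<and> Z \<subseteq> W} \<longleftrightarrow> (Zc c \<in> VV \<and> Zc c' \<in> VV) \<and> Zc c \<subseteq> Zc c' \<union> Zc c'" for c c' :: "'k fin_elem list" by auto
    have "dfF (CT @ CT) (\<lambda>e :: nat => 'k fin_elem. map e [0..<7] \<in> XV () \<and> map e [7..<14] \<in> XV () \<and> Zc (map e [0..<7]) \<subseteq> Zc (map e [7..<14]) \<union> Zc (map e [7..<14]))"
      by (intro dfn_conj dfF_XV dfF_Zc_un okp14)
    then show "dfF (CT @ CT) (\<lambda>e :: nat => 'k fin_elem. map e [0..<7] \<in> XV () \<and> map e [7..<14] \<in> XV () \<and>
       (Zc (map e [0..<7]) \<in> VV \<and> Zc (map e [7..<14]) \<in> VV) \<and> Zc (map e [0..<7]) \<subseteq> Zc (map e [7..<14]) \<union> Zc (map e [7..<14]))"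
      by (rule dfn_cong) (auto simp: XV_def)
  qed
qed simp

section \<open>The composite interpretations\<close>

text \<open>A vector is quantified as three field elements. Membership in the coded set enters as a
  Boolean argument of R, so that R can combine it freely with conditions on the coordinates.\<close>

lemma dfF_all_vec:
  assumes "dfF (VT @ \<Gamma>) (\<lambda>e. R (\<lambda>n. e (3 + n)) (the_Scalar (e 0)) (the_Scalar (e 1)) (the_Scalar (e 2)) (ZL (map e (map ((+) 3) ps)) (vv (map e [0..<3]))))"
  shows "dfF \<Gamma> (\<lambda>e. \<forall>v. R e (v $ 1) (v $ 2) (v $ 3) (ZL (map e ps) v))"
proof -
  have "dfF \<Gamma> (\<lambda>e. \<forall>u\<in>tuples FinS VT. R e (vv u $ 1) (vv u $ 2) (vv u $ 3) (ZL (map e ps) (vv u)))"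
  proof (rule dfn_block_all[where Q = "\<lambda>e u. R e (vv u $ 1) (vv u $ 2) (vv u $ 3) (ZL (map e ps) (vv u))"])
    have l: "length VT = 3" by simp
    have v: "vv (map e [0..<3]) $ 1 = the_Scalar (e 0)" "vv (map e [0..<3]) $ 2 = the_Scalar (e 1)" "vv (map e [0..<3]) $ 3 = the_Scalar (e 2)"
      for e :: "nat => 'a fin_elem" by (simp_all add: vv_def eval_nat_numeral)
    show "dfF (VT @ \<Gamma>) (\<lambda>e. R (\<lambda>n. e (length VT + n)) (vv (map e [0..<length VT]) $ 1) (vv (map e [0..<length VT]) $ 2) (vv (map e [0..<length VT]) $ 3)
        (ZL (map (\<lambda>n. e (length VT + n)) ps) (vv (map e [0..<length VT]))))"
      using assms unfolding l v by (simp only: map_map comp_def)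
  qed simp
  then show ?thesis unfolding all_vv[of "\<lambda>v. R _ (v $ 1) (v $ 2) (v $ 3) (ZL _ v)"] .
qed

lemma Zc_eq_iff:
  assumes "Z \<subseteq> proj_plane"
  shows "Zc c = Z \<longleftrightarrow> (\<forall>v. ZL c v \<longleftrightarrow> v ~= 0 \<and> pt v \<in> Z)"
proof
  assume Z: "Zc c = Z"
  show "\<forall>v. ZL c v \<longleftrightarrow> v ~= 0 \<and> pt v \<in> Z"
  proof
    fix v
    show "ZL c v \<longleftrightarrow> v ~= 0 \<and> pt v \<in> Z" unfolding Z[symmetric] using pt_Zc[of v c] ZL_nz[of c v] by blast
  qed
next
  assume "\<forall>v. ZL c v \<longleftrightarrow> v ~= 0 \<and> pt v \<in> Z"
  then show "Zc c = Z" by (intro plane_eqI[OF Zc_sub assms]) (simp add: pt_Zc)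
qed

text \<open>This and the next two lemmas rephrase conditions on a coded set as statements about all
  vectors, the shape required by \<open>dfF_all_vec\<close>.\<close>

lemma Zc_Sc_iff:
  "Zc c = Sc a \<longleftrightarrow> (\<forall>v. ZL c v \<longleftrightarrow> \<not> (v $ 1 = 0 \<and> v $ 2 = 0 \<and> v $ 3 = 0) \<and> v $ 2 = 0 \<and> v $ 1 = a * v $ 3)"
proof -
  have "v ~= 0 \<and> pt v \<in> Sc a \<longleftrightarrow> \<not> (v $ 1 = 0 \<and> v $ 2 = 0 \<and> v $ 3 = 0) \<and> v $ 2 = 0 \<and> v $ 1 = a * v $ 3" for v
  proof (cases "v = 0")
    case False
    have "pt v \<in> Sc a \<longleftrightarrow> v $ 2 = 0 \<and> v $ 1 = a * v $ 3"
      unfolding singleton_iff eq_commute[of "pt v"] pt_eq_iff[OF nzA False] proportional_iff[OF nzA] by auto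
    then show ?thesis using False by (auto simp: vec3_eq_iff)
  qed (simp add: vec3_eq_iff)
  then show ?thesis using Zc_eq_iff[of "Sc a" c] by simp
qed

lemma isC_Zc_iff:
  fixes c :: "'k::field fin_elem list"
  shows "isC (Zc c) \<longleftrightarrow> \<not> (\<forall>v. \<not> (v $ 1 = 0 \<and> v $ 2 = 0 \<and> v $ 3 = 0) \<and> v $ 2 = 0 --> ZL c v)"
proof -
  have "Mline \<subseteq> Zc c \<longleftrightarrow> (\<forall>v. \<not> (v $ 1 = 0 \<and> v $ 2 = 0 \<and> v $ 3 = 0) \<and> v $ 2 = 0 --> ZL c v)"
  proof
    assume M: "Mline \<subseteq> Zc c"
    show "\<forall>v. \<not> (v $ 1 = 0 \<and> v $ 2 = 0 \<and> v $ 3 = 0) \<and> v $ 2 = 0 --> ZL c v"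
    proof (intro allI impI)
      fix v :: "'k ^ 3" assume v: "\<not> (v $ 1 = 0 \<and> v $ 2 = 0 \<and> v $ 3 = 0) \<and> v $ 2 = 0"
      then have nz: "v ~= 0" by (auto simp: vec3_eq_iff)
      then have "pt v \<in> Mline" using v by (simp add: pt_ln lin_def)
      then show "ZL c v" using M pt_Zc[OF nz, of c] by auto
    qed
  next
    assume *: "\<forall>v. \<not> (v $ 1 = 0 \<and> v $ 2 = 0 \<and> v $ 3 = 0) \<and> v $ 2 = 0 --> ZL c v"
    show "Mline \<subseteq> Zc c"
    proof
      fix p :: "('k ^ 3) set" assume p: "p \<in> Mline"
      then have "p \<in> proj_plane" using ln_sub by blast
      then obtain v where v: "v ~= 0" "p = pt v" unfolding proj_plane_iff by (elim exE conjE)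
      have "v $ 2 = 0" using p unfolding v(2) pt_ln[OF v(1)] by (simp add: lin_def)
      then have "ZL c v" using * v(1) by (auto simp: vec3_eq_iff)
      then show "p \<in> Zc c" unfolding v(2) pt_Zc[OF v(1)] .
    qed
  qed
  then show ?thesis unfolding isC_def by simp
qed

lemma fs_Zc_iff:
  fixes c :: "'k::field fin_elem list"
  shows "fs (Zc c) = X \<longleftrightarrow> (\<forall>v. v $ 2 = 0 \<and> v $ 3 = 1 --> (v $ 1 \<in> X \<longleftrightarrow> ZL c v))"
proof -
  have "fs (Zc c) = X \<longleftrightarrow> (\<forall>a. a \<in> X \<longleftrightarrow> ZL c (vec3 a 0 1))"
    unfolding set_eq_iff fs_mem pt_Zc[OF nzA] by blast
  also have "\<dots> \<longleftrightarrow> (\<forall>v. v $ 2 = 0 \<and> v $ 3 = 1 --> (v $ 1 \<in> X \<longleftrightarrow> ZL c v))"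
  proof
    assume *: "\<forall>a. a \<in> X \<longleftrightarrow> ZL c (vec3 a 0 1)"
    show "\<forall>v. v $ 2 = 0 \<and> v $ 3 = 1 --> (v $ 1 \<in> X \<longleftrightarrow> ZL c v)"
    proof (intro allI impI)
      fix v :: "'k ^ 3" assume "v $ 2 = 0 \<and> v $ 3 = 1"
      then have "v = vec3 (v $ 1) 0 1" by (simp add: vec3_eq_iff)
      then show "v $ 1 \<in> X \<longleftrightarrow> ZL c v" using * by metis
    qed
  next
    assume *: "\<forall>v. v $ 2 = 0 \<and> v $ 3 = 1 --> (v $ 1 \<in> X \<longleftrightarrow> ZL c v)"
    show "\<forall>a. a \<in> X \<longleftrightarrow> ZL c (vec3 a 0 1)"
    proof
      fix a
      show "a \<in> X \<longleftrightarrow> ZL c (vec3 a 0 1)" using spec[OF *, of "vec3 a 0 1"] by simp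
    qed
  qed
  finally show ?thesis .
qed

text \<open>The tail is a code of a member of the poset which should in turn represent the head.
  Whether it does can be read off from the vectors in the coded set, and these are definable from
  the code.\<close>

lemma Fin_composite:
  "dfF (s # tt \<tau>V (\<tau>F s)) (\<lambda>e :: nat => 'k::{alg_closed_field, field_char_0} fin_elem.
     comp_graph \<tau>V XV \<pi>V \<tau>F XF \<pi>F s (map e [0..<length (s # tt \<tau>V (\<tau>F s))]))"
proof -
  have tt: "s # tt \<tau>V (\<tau>F s) = s # CT" "length (s # CT) = 8" by (simp_all add: \<tau>V_def \<tau>F_def)
  have ok: "okp (s # CT) CT [1..<8]" by (cases s) (hypsubst, code_simp)+
  have xs: "map e [0..<8] = e 0 # map e [1..<8]" for e :: "nat => 'k fin_elem"
    by (subst upt_conv_Cons) simp_all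
  have l: "length (map e [1..<8]) = 7" for e :: "nat => 'k fin_elem" by simp
  have cg: "comp_graph \<tau>V XV \<pi>V \<tau>F XF \<pi>F s (map e [0..<8]) \<longleftrightarrow>
      map e [1..<8] \<in> XV () \<and> [Zc (map e [1..<8])] \<in> XF s \<and> \<pi>F s [Zc (map e [1..<8])] = e 0" for e :: "nat => 'k fin_elem"
    unfolding comp_graph_def xs list.sel \<tau>F_def one_code[OF l] ..
  have nz: "dfF (VT @ \<Gamma>) (\<lambda>e :: nat => 'k fin_elem. \<not> (the_Scalar (e 0) = 0 \<and> the_Scalar (e 1) = 0 \<and> the_Scalar (e 2) = 0))" for \<Gamma>
    by (intro dfn_conj dfn_neg tm_eq tm_const tm_var) simp_all
  have l3: "length VT = 3" by simp
  have ZL: "dfF (VT @ s # CT) (\<lambda>e :: nat => 'k fin_elem. ZL (map e (map ((+) 3) [1..<8])) (vv (map e [0..<3])))"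
    using dfF_ZL[OF okp_shift[OF ok, of VT] okp_prefix[of VT "s # CT"]] unfolding l3 .
  show ?thesis unfolding tt cg
  proof (cases s)
    case Field_Sort
    have "dfF (s # CT) (\<lambda>e :: nat => 'k fin_elem. map e [1..<8] \<in> XV () \<and> (\<forall>v. ZL (map e [1..<8]) v \<longleftrightarrow>
        \<not> (v $ 1 = 0 \<and> v $ 2 = 0 \<and> v $ 3 = 0) \<and> v $ 2 = 0 \<and> v $ 1 = the_Scalar (e 0) * v $ 3))"
    proof (rule dfn_conj[OF dfF_XV[OF ok]], rule dfF_all_vec[where R = "\<lambda>e x y z b. b \<longleftrightarrow> \<not> (x = 0 \<and> y = 0 \<and> z = 0) \<and> y = 0 \<and> x = the_Scalar (e 0) * z"])
      show "dfF (VT @ s # CT) (\<lambda>e :: nat => 'k fin_elem. ZL (map e (map ((+) 3) [1..<8])) (vv (map e [0..<3])) \<longleftrightarrow>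
        \<not> (the_Scalar (e 0) = 0 \<and> the_Scalar (e 1) = 0 \<and> the_Scalar (e 2) = 0) \<and> the_Scalar (e 1) = 0 \<and> the_Scalar (e 0) = the_Scalar (e (3 + 0)) * the_Scalar (e 2))"
        by (rule dfn_iff[OF ZL dfn_conj[OF nz]], intro dfn_conj tm_eq tm_const tm_mult tm_var) (simp_all add: Field_Sort)
    qed
    then show "dfF (s # CT) (\<lambda>e :: nat => 'k fin_elem. map e [1..<8] \<in> XV () \<and> [Zc (map e [1..<8])] \<in> XF s \<and> \<pi>F s [Zc (map e [1..<8])] = e 0)"
    proof (rule dfn_cong)
      fix e :: "nat => 'k fin_elem" assume "wt FinS (s # CT) e"
      then obtain a where a: "e 0 = Scalar a" using wt_Field[of "s # CT" e 0] Field_Sort by auto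
      have "isS (Zc c) \<and> \<pi>F Field_Sort [Zc c] = Scalar a \<longleftrightarrow> Zc c = Sc a" for c :: "'k fin_elem list"
      proof
        assume *: "isS (Zc c) \<and> \<pi>F Field_Sort [Zc c] = Scalar a"
        then obtain b where b: "Zc c = Sc b" using isS_iff by blast
        then show "Zc c = Sc a" using * by simp
      qed (auto simp: isS_iff)
      then show "map e [1..<8] \<in> XV () \<and> (\<forall>v. ZL (map e [1..<8]) v \<longleftrightarrow>
          \<not> (v $ 1 = 0 \<and> v $ 2 = 0 \<and> v $ 3 = 0) \<and> v $ 2 = 0 \<and> v $ 1 = the_Scalar (e 0) * v $ 3) \<longleftrightarrow>
        map e [1..<8] \<in> XV () \<and> [Zc (map e [1..<8])] \<in> XF s \<and> \<pi>F s [Zc (map e [1..<8])] = e 0"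
        unfolding Zc_Sc_iff[symmetric] a Field_Sort XF_simps fin_elem.sel by blast
    qed
  next
    case Fin_Sort
    have "dfF (s # CT) (\<lambda>e :: nat => 'k fin_elem. map e [1..<8] \<in> XV () \<and>
        \<not> (\<forall>v. \<not> (v $ 1 = 0 \<and> v $ 2 = 0 \<and> v $ 3 = 0) \<and> v $ 2 = 0 --> ZL (map e [1..<8]) v) \<and>
        (\<forall>v. v $ 2 = 0 \<and> v $ 3 = 1 --> (v $ 1 \<in> the_FinSet (e 0) \<longleftrightarrow> ZL (map e [1..<8]) v)))"
    proof (rule dfn_conj[OF dfF_XV[OF ok]], rule dfn_conj, rule dfn_neg,
        rule dfF_all_vec[where R = "\<lambda>e x y z b. \<not> (x = 0 \<and> y = 0 \<and> z = 0) \<and> y = 0 --> b"])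
      show "dfF (VT @ s # CT) (\<lambda>e :: nat => 'k fin_elem. \<not> (the_Scalar (e 0) = 0 \<and> the_Scalar (e 1) = 0 \<and> the_Scalar (e 2) = 0) \<and> the_Scalar (e 1) = 0 -->
          ZL (map e (map ((+) 3) [1..<8])) (vv (map e [0..<3])))"
        by (rule dfn_imp[OF dfn_conj[OF nz] ZL], intro tm_eq tm_const tm_var) simp_all
      show "dfF (s # CT) (\<lambda>e :: nat => 'k fin_elem. \<forall>v. v $ 2 = 0 \<and> v $ 3 = 1 --> (v $ 1 \<in> the_FinSet (e 0) \<longleftrightarrow> ZL (map e [1..<8]) v))"
      proof (rule dfF_all_vec[where R = "\<lambda>e x y z b. y = 0 \<and> z = 1 --> (x \<in> the_FinSet (e 0) \<longleftrightarrow> b)"])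
        show "dfF (VT @ s # CT) (\<lambda>e :: nat => 'k fin_elem. the_Scalar (e 1) = 0 \<and> the_Scalar (e 2) = 1 --> (the_Scalar (e 0) \<in> the_FinSet (e (3 + 0)) \<longleftrightarrow>
            ZL (map e (map ((+) 3) [1..<8])) (vv (map e [0..<3]))))"
          by (rule dfn_imp[OF _ dfn_iff[OF _ ZL]], intro dfn_conj tm_eq tm_const tm_var, simp_all, intro tm_mem tm_var) (simp_all add: Fin_Sort)
      qed
    qed
    then show "dfF (s # CT) (\<lambda>e :: nat => 'k fin_elem. map e [1..<8] \<in> XV () \<and> [Zc (map e [1..<8])] \<in> XF s \<and> \<pi>F s [Zc (map e [1..<8])] = e 0)"
    proof (rule dfn_cong)
      fix e :: "nat => 'k fin_elem" assume "wt FinS (s # CT) e"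
      then obtain X where X: "e 0 = FinSet X" using wt_Fin[of "s # CT" e 0] Fin_Sort by auto
      show "map e [1..<8] \<in> XV () \<and>
        \<not> (\<forall>v. \<not> (v $ 1 = 0 \<and> v $ 2 = 0 \<and> v $ 3 = 0) \<and> v $ 2 = 0 --> ZL (map e [1..<8]) v) \<and>
        (\<forall>v. v $ 2 = 0 \<and> v $ 3 = 1 --> (v $ 1 \<in> the_FinSet (e 0) \<longleftrightarrow> ZL (map e [1..<8]) v)) \<longleftrightarrow>
        map e [1..<8] \<in> XV () \<and> [Zc (map e [1..<8])] \<in> XF s \<and> \<pi>F s [Zc (map e [1..<8])] = e 0"
        unfolding isC_Zc_iff[symmetric] fs_Zc_iff[symmetric] X Fin_Sort XF_simps fin_elem.sel fin_elem.inject
        by (auto simp: XV_def)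
    qed
  qed
qed

text \<open>\<open>P\<close> has homogeneous coordinates \<open>U, V, W\<close>.\<close>

definition HC :: "'k::field pset => 'k pset => 'k pset => 'k pset => bool" where
  "HC P U V W \<longleftrightarrow> (\<exists>A\<in>VV. \<exists>B\<in>VV. Coord P A B \<and> Mul A W U \<and> Mul B W V \<and> \<not> W = Sc 0) \<or>
     (W = Sc 0 \<and> is_pt P \<and> P \<subseteq> Linf \<and> (\<exists>Z\<in>VV. Coord Z U V \<and> \<not> Z = ptA 0 0 \<and> col (ptA 0 0) Z P))"

lemma dfV_HC:
  assumes "i < length \<Gamma>" "j < length \<Gamma>" "k < length \<Gamma>" "l < length \<Gamma>"
  shows "dfV \<Gamma> (\<lambda>e :: nat => 'k::field_char_0 pset. HC (e i) (e j) (e k) (e l))"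
  unfolding HC_def
  by (intro dfn_disj dfn_conj dfn_neg dfV_ex dfV_Coord dfV_Mul dfV_const dfV_is_pt dfV_sub_const dfV_col_const ptA_VV Linf_VV) (use assms in simp_all)

lemma HC_iff:
  fixes P :: "'k::{alg_closed_field, field_char_0} pset"
  shows "HC P U V W \<longleftrightarrow> (\<exists>u v w. U = Sc u \<and> V = Sc v \<and> W = Sc w \<and> vec3 u v w ~= 0 \<and> P = {pt (vec3 u v w)})"
proof
  assume "HC P U V W"
  then consider A B where "Coord P A B" "Mul A W U" "Mul B W V" "W ~= Sc 0"
    | Z where "W = Sc 0" "is_pt P" "P \<subseteq> Linf" "Coord Z U V" "Z ~= ptA 0 0" "col (ptA 0 0) Z P" unfolding HC_def by (elim disjE bexE conjE) auto
  then show "\<exists>u v w. U = Sc u \<and> V = Sc v \<and> W = Sc w \<and> vec3 u v w ~= 0 \<and> P = {pt (vec3 u v w)}"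
  proof cases
    case 1
    obtain a b where P: "P = ptA a b" "A = Sc a" "B = Sc b" using 1(1) unfolding Coord_iff by (elim exE conjE)
    obtain w where W: "W = Sc w" "U = Sc (a * w)" using 1(2) unfolding Mul_iff P(2) by auto
    have V: "V = Sc (b * w)" using 1(3) unfolding Mul_iff P(3) W(1) by auto
    have w: "w ~= 0" using 1(4) W(1) by auto
    have nz: "vec3 (a * w) (b * w) w ~= (0 :: 'k ^ 3)" using w by (simp add: vec3_eq_iff)
    have "vec3 (a * w) (b * w) w = w *s vec3 a b 1" by (simp add: vec3_eq_iff mult.commute)
    then have "P = {pt (vec3 (a * w) (b * w) w)}" unfolding P(1) using pt_eq_iff[OF nzA nz] by auto
    then show ?thesis using W V nz by blast
  next
    case 2
    obtain p where p: "p ~= 0" "P = {pt p}" using 2(2) unfolding is_pt_def by (elim exE conjE)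
    obtain u v where Z: "Z = ptA u v" "U = Sc u" "V = Sc v" using 2(4) unfolding Coord_iff by (elim exE conjE)
    have p3: "p $ 3 = 0" using 2(3) pt_Linf[OF p(1)] unfolding p(2) by simp
    have nz: "vec3 u v 0 ~= (0 :: 'k ^ 3)" using 2(5) unfolding Z nzI by auto
    have "u * p $ 2 = v * p $ 1" using 2(6) unfolding Z(1) p(2) col_origin[OF nzA p(1)] by simp
    then have "pt (vec3 u v 0) = pt p" unfolding pt_eq_iff[OF nz p(1)] proportional_iff[OF nz] using p3 by simp
    then show ?thesis using Z 2(1) nz p(2) by (intro exI[of _ u] exI[of _ v] exI[of _ 0]) simp
  qed
next
  assume "\<exists>u v w. U = Sc u \<and> V = Sc v \<and> W = Sc w \<and> vec3 u v w ~= 0 \<and> P = {pt (vec3 u v w)}"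
  then obtain u v w where *: "U = Sc u" "V = Sc v" "W = Sc w" "vec3 u v w ~= 0" "P = {pt (vec3 u v w)}" by (elim exE conjE)
  show "HC P U V W"
  proof (cases "w = 0")
    case False
    have "vec3 u v w = w *s vec3 (u / w) (v / w) 1" using False by (simp add: vec3_eq_iff)
    then have "pt (vec3 (u / w) (v / w) 1) = pt (vec3 u v w)" unfolding pt_eq_iff[OF nzA *(4)] by blast
    then have "Coord P (Sc (u / w)) (Sc (v / w))" unfolding Coord_iff *(5) by auto
    moreover have "Mul (Sc (u / w)) W U" "Mul (Sc (v / w)) W V" unfolding Mul_iff *(1-3) using False by (auto intro!: exI[of _ w])
    moreover have "W ~= Sc 0" using False *(3) by simp
    ultimately show ?thesis unfolding HC_def using ptA_VV by blast
  next
    case True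
    have nz: "u ~= 0 \<or> v ~= 0" using *(4) True by (simp add: nzI)
    have "is_pt P" "P \<subseteq> Linf" unfolding *(5) using is_pt_I[OF *(4)] pt_Linf[OF *(4)] True by simp_all
    moreover have "Coord (ptA u v) U V" unfolding Coord_iff using * by blast
    moreover have "ptA u v ~= ptA 0 0" using nz by auto
    moreover have "col (ptA 0 0) (ptA u v) P" unfolding *(5) col_origin[OF nzA *(4)] by simp
    ultimately show ?thesis unfolding HC_def using True *(3) ptA_VV by blast
  qed
qed

text \<open>The pullback of \<open>ZL\<close> to the poset: the seven entries of a code and the
  three of a vector are all given by members of the poset.\<close>

definition PZ :: "'k::field pset list => bool" where
  "PZ ys \<longleftrightarrow> valid \<tau>F XF (CT @ VT) ys \<and> ZL (take 7 (dec \<tau>F \<pi>F (CT @ VT) ys)) (vv (drop 7 (dec \<tau>F \<pi>F (CT @ VT) ys)))"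

lemma okp_unit: "okp \<Gamma> (tt \<tau>F ss) is \<longleftrightarrow> (\<forall>i\<in>set is. i < length \<Gamma>) \<and> length is = length ss"
proof -
  have "map ((!) \<Gamma>) is = replicate (length ss) () \<longleftrightarrow> length is = length ss"
    by (metis length_map length_replicate map_replicate_const replicate_eqI unit_eq list.set_map)
  then show ?thesis unfolding okp_def tt_\<tau>F by blast
qed

lemma dfV_PZ:
  assumes "\<forall>i\<in>set is. i < length \<Gamma>" "length is = 10"
  shows "dfV \<Gamma> (\<lambda>e :: nat => 'k::{alg_closed_field, field_char_0} pset. PZ (map e is))"
proof -
  have "pbk VarS \<tau>F XF \<pi>F (CT @ VT) (\<lambda>xs :: 'k fin_elem list. ZL (take 7 xs) (vv (drop 7 xs)))"
    by (rule cinterp.pull[OF Fin_in_Var dfF_ZL_base]) simp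
  moreover have "okp \<Gamma> (tt \<tau>F (CT @ VT)) is" unfolding okp_unit using assms by simp
  ultimately show ?thesis unfolding PZ_def by (rule pbk_at)
qed

lemma dfV_PZ10:
  assumes "i0 < length \<Gamma>" "i1 < length \<Gamma>" "i2 < length \<Gamma>" "i3 < length \<Gamma>" "i4 < length \<Gamma>" "i5 < length \<Gamma>" "i6 < length \<Gamma>"
    "i7 < length \<Gamma>" "i8 < length \<Gamma>" "i9 < length \<Gamma>"
  shows "dfV \<Gamma> (\<lambda>e :: nat => 'k::{alg_closed_field, field_char_0} pset. PZ [e i0, e i1, e i2, e i3, e i4, e i5, e i6, e i7, e i8, e i9])"
  using dfV_PZ[of "[i0, i1, i2, i3, i4, i5, i6, i7, i8, i9]" \<Gamma>] assms by simp

lemma PZ_iff: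
  assumes "length ys = 7" "valid \<tau>F XF CT ys"
  shows "PZ (ys @ [Sc u, Sc v, Sc w]) \<longleftrightarrow> ZL (dec \<tau>F \<pi>F CT ys) (vec3 u v w)"
proof -
  have l: "length ys = length (tt \<tau>F CT)" unfolding tt_\<tau>F using assms(1) by simp
  have "dec \<tau>F \<pi>F VT [Sc u, Sc v, Sc w] = [Scalar u, Scalar v, Scalar w]" by simp
  moreover have "valid \<tau>F XF VT [Sc u, Sc v, Sc w]" by (auto simp: isS_iff)
  moreover have "length (dec \<tau>F \<pi>F CT ys) = 7" by simp
  ultimately show ?thesis unfolding PZ_def dec_append(1)[OF l] dec_append(2)[OF l] using assms(2)
    by (simp del: F_Cons length_dec add: vv_def)
qed

text \<open>The head equals the decoded set if both have the same points, and a point is tested by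
  running the code, as represented in the poset, on homogeneous coordinates carried by the
  axis.\<close>

lemma Var_composite:
  "dfV (s # tt \<tau>F (\<tau>V s)) (\<lambda>e :: nat => 'k::{alg_closed_field, field_char_0} pset.
     comp_graph \<tau>F XF \<pi>F \<tau>V XV \<pi>V s (map e [0..<length (s # tt \<tau>F (\<tau>V s))]))"
proof -
  define \<Gamma> where "\<Gamma> = s # tt \<tau>F (\<tau>V s)"
  have \<Gamma>: "length \<Gamma> = 8" unfolding \<Gamma>_def tt_\<tau>F by (simp add: tt_\<tau>F \<tau>V_def)
  define C where "C = (\<lambda>e :: nat => 'k pset. [e 1, e 2, e 3, e 4, e 5, e 6, e 7])"
  have xs: "map e [0..<8] = e 0 # C e" for e :: "nat => 'k pset" unfolding C_def by (simp add: upt_rec eval_nat_numeral)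
  have "pbk VarS \<tau>F XF \<pi>F CT (\<lambda>c :: 'k fin_elem list. c \<in> XV s)"
    by (rule cinterp.pull[OF Fin_in_Var dfF_XV[OF okp_self]]) simp
  moreover have "okp \<Gamma> (tt \<tau>F CT) [1, 2, 3, 4, 5, 6, 7]" unfolding okp_unit by (simp add: \<Gamma>)
  ultimately have "dfV \<Gamma> (\<lambda>e. valid \<tau>F XF CT (map e [1, 2, 3, 4, 5, 6, 7]) \<and> dec \<tau>F \<pi>F CT (map e [1, 2, 3, 4, 5, 6, 7]) \<in> (XV s :: 'k fin_elem list set))"
    by (rule pbk_at)
  then have 1: "dfV \<Gamma> (\<lambda>e. valid \<tau>F XF CT (C e) \<and> dec \<tau>F \<pi>F CT (C e) \<in> XV s)" unfolding C_def list.map .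
  have 2: "dfV \<Gamma> (\<lambda>e :: nat => 'k pset. \<forall>P\<in>VV. is_pt P --> (P \<subseteq> e 0 \<longleftrightarrow> (\<exists>U\<in>VV. \<exists>V\<in>VV. \<exists>W\<in>VV. HC P U V W \<and>
      PZ [e 1, e 2, e 3, e 4, e 5, e 6, e 7, U, V, W])))"
    by (intro dfV_all dfV_ex dfn_imp dfn_iff dfn_conj dfV_is_pt dfV_sub dfV_HC dfV_PZ10) (simp_all add: \<Gamma>)
  show ?thesis unfolding \<Gamma>_def[symmetric] \<Gamma>
  proof (rule dfn_cong[OF dfn_conj[OF 1 2]])
    fix e :: "nat => 'k pset" assume e: "wt VarS \<Gamma> e"
    have Z: "e 0 \<in> VV" by (rule wt_VarS[OF e]) (simp add: \<Gamma>)
    define c where "c = dec \<tau>F \<pi>F CT (C e)"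
    have key: "(\<forall>P\<in>VV. is_pt P --> (P \<subseteq> e 0 \<longleftrightarrow> (\<exists>U\<in>VV. \<exists>V\<in>VV. \<exists>W\<in>VV. HC P U V W \<and> PZ (C e @ [U, V, W])))) \<longleftrightarrow> Zc c = e 0"
      if v: "valid \<tau>F XF CT (C e)"
    proof -
      have lc: "length (C e) = 7" by (simp add: C_def)
      \<comment> \<open>The coordinates found may differ from p by a factor; membership in
        \<open>Zc c\<close> does not see it.\<close>
      have ex: "(\<exists>U\<in>VV. \<exists>V\<in>VV. \<exists>W\<in>VV. HC {pt p} U V W \<and> PZ (C e @ [U, V, W])) \<longleftrightarrow> ZL c p" if p: "p ~= 0" for p
      proof
        assume "\<exists>U\<in>VV. \<exists>V\<in>VV. \<exists>W\<in>VV. HC {pt p} U V W \<and> PZ (C e @ [U, V, W])"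
        then obtain U V W where *: "HC {pt p} U V W" "PZ (C e @ [U, V, W])" by (elim bexE conjE)
        obtain u v w where q: "U = Sc u" "V = Sc v" "W = Sc w" "vec3 u v w ~= 0" "{pt p} = {pt (vec3 u v w)}" using *(1) unfolding HC_iff by (elim exE conjE)
        have "ZL c (vec3 u v w)" using *(2) unfolding q(1-3) PZ_iff[OF lc v] c_def .
        then have "pt (vec3 u v w) \<in> Zc c" unfolding pt_Zc[OF q(4)] .
        then have "pt p \<in> Zc c" using q(5) by simp
        then show "ZL c p" unfolding pt_Zc[OF p] .
      next
        assume z: "ZL c p"
        have pp: "vec3 (p $ 1) (p $ 2) (p $ 3) = p" by (simp add: vec3_eq_iff)
        have "HC {pt p} (Sc (p $ 1)) (Sc (p $ 2)) (Sc (p $ 3))"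
          unfolding HC_iff by (rule exI[of _ "p $ 1"], rule exI[of _ "p $ 2"], rule exI[of _ "p $ 3"]) (unfold pp, use p in blast)
        moreover have "PZ (C e @ [Sc (p $ 1), Sc (p $ 2), Sc (p $ 3)])" unfolding PZ_iff[OF lc v] pp using z unfolding c_def .
        ultimately show "\<exists>U\<in>VV. \<exists>V\<in>VV. \<exists>W\<in>VV. HC {pt p} U V W \<and> PZ (C e @ [U, V, W])" using ptA_VV by blast
      qed
      have "(\<forall>P\<in>VV. is_pt P --> (P \<subseteq> e 0 \<longleftrightarrow> (\<exists>U\<in>VV. \<exists>V\<in>VV. \<exists>W\<in>VV. HC P U V W \<and> PZ (C e @ [U, V, W])))) \<longleftrightarrow>
        (\<forall>p. p ~= 0 --> (pt p \<in> e 0 \<longleftrightarrow> ZL c p))"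
      proof
        assume *: "\<forall>P\<in>VV. is_pt P --> (P \<subseteq> e 0 \<longleftrightarrow> (\<exists>U\<in>VV. \<exists>V\<in>VV. \<exists>W\<in>VV. HC P U V W \<and> PZ (C e @ [U, V, W])))"
        show "\<forall>p. p ~= 0 --> (pt p \<in> e 0 \<longleftrightarrow> ZL c p)"
        proof (intro allI impI)
          fix p :: "'k ^ 3" assume p: "p ~= 0"
          show "pt p \<in> e 0 \<longleftrightarrow> ZL c p" using bspec[OF * point_VV[OF p]] is_pt_I[OF p] unfolding ex[OF p] by simp
        qed
      next
        assume *: "\<forall>p. p ~= 0 --> (pt p \<in> e 0 \<longleftrightarrow> ZL c p)"
        show "\<forall>P\<in>VV. is_pt P --> (P \<subseteq> e 0 \<longleftrightarrow> (\<exists>U\<in>VV. \<exists>V\<in>VV. \<exists>W\<in>VV. HC P U V W \<and> PZ (C e @ [U, V, W])))"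
        proof (intro ballI impI)
          fix P :: "'k pset" assume "is_pt P"
          then obtain p where p: "p ~= 0" "P = {pt p}" unfolding is_pt_def by (elim exE conjE)
          show "P \<subseteq> e 0 \<longleftrightarrow> (\<exists>U\<in>VV. \<exists>V\<in>VV. \<exists>W\<in>VV. HC P U V W \<and> PZ (C e @ [U, V, W]))" unfolding p(2) ex[OF p(1)] using * p(1) by simp
        qed
      qed
      also have "\<dots> \<longleftrightarrow> Zc c = e 0" unfolding Zc_eq_iff[OF VV_sub[OF Z]]
      proof (rule iff_allI)
        fix v
        have "ZL c v ==> v ~= 0" by (rule ZL_nz)
        then show "(v ~= 0 --> (pt v \<in> e 0 \<longleftrightarrow> ZL c v)) \<longleftrightarrow> (ZL c v \<longleftrightarrow> v ~= 0 \<and> pt v \<in> e 0)" by argo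
      qed
      finally show ?thesis .
    qed
    have "comp_graph \<tau>F XF \<pi>F \<tau>V XV \<pi>V s (map e [0..<8]) \<longleftrightarrow> valid \<tau>F XF CT (C e) \<and> c \<in> XV s \<and> Zc c = e 0"
      unfolding comp_graph_def xs list.sel \<tau>V_def \<pi>V_def c_def ..
    note cg = this
    have CU: "C e @ [U, V, W] = [e 1, e 2, e 3, e 4, e 5, e 6, e 7, U, V, W]" for U V W by (simp add: C_def)
    show "(valid \<tau>F XF CT (C e) \<and> dec \<tau>F \<pi>F CT (C e) \<in> XV s) \<and>
      (\<forall>P\<in>VV. is_pt P --> (P \<subseteq> e 0 \<longleftrightarrow> (\<exists>U\<in>VV. \<exists>V\<in>VV. \<exists>W\<in>VV. HC P U V W \<and> PZ [e 1, e 2, e 3, e 4, e 5, e 6, e 7, U, V, W]))) \<longleftrightarrow>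
      comp_graph \<tau>F XF \<pi>F \<tau>V XV \<pi>V s (map e [0..<8])"
    proof (cases "valid \<tau>F XF CT (C e)")
      case True
      show ?thesis unfolding cg c_def[symmetric] key[unfolded CU, OF True] conj_assoc ..
    next
      case False
      show ?thesis unfolding cg using False by (simp only: simp_thms)
    qed
  qed
qed

theorem theorem13p4:
  shows "bi_interpretable (Fin_structure TYPE('k::{alg_closed_field, field_char_0})) (Var_structure TYPE('k))"
  by (rule bi_interpretableI[OF Var_in_Fin Fin_in_Var Fin_composite Var_composite])

end
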